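(* Let $x^\sharp\in\mathbb{C}^n$ be a fixed nonzero vector and let $a_1,\dots,a_m\in\mathbb{C}^n$ be i.i.d. standard complex Gaussian random vectors. Let $(z_k)_{k\ge 0}$ be the iterates of the minimal-norm Gauss-Newton method with spectral initialization (defined in the context) applied to the data $y_j=|a_j^*x^\sharp|^2$, $j=1,\dots,m$. There are universal constants $0<\delta\le 0.01$, $C_1>0$ and a large constant $C_0>0$ such that for any sufficiently small constant $\epsilon_0>0$, if $m\ge C_0\,\epsilon_0^{-4}\,n\log^3 n$, then with probability at least $1-O(m^{-8})-O(me^{-1.5n})$ the initial estimate obeys $$\operatorname{dist}(z_0,x^\sharp)\le \delta\|x^\sharp\|_2,$$ and for all $k\ge 0$ the iterates obey $$\operatorname{dist}(z_{k+1},x^\sharp)\le \frac{2}{\|x^\sharp\|_2}\operatorname{dist}^2(z_k,x^\sharp)+\epsilon_0\operatorname{dist}(z_k,x^\sharp),$$ $$\max_{1\le j\le m}\left|a_j^*\left(z_k-x^\sharp e^{i\phi(z_k)}\right)\right|\le C_1\sqrt{\log m}\,\|x^\sharp\|_2 .$$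
   Context: A standard complex Gaussian vector in $\mathbb{C}^n$ is $a\sim \frac{1}{\sqrt2}\mathcal N(0,I_n)+\frac{i}{\sqrt2}\mathcal N(0,I_n)$ with independent real and imaginary parts. $O(\cdot)$ hides universal constants. Distance and phase: $\operatorname{dist}(z,x)=\min_{\phi\in\mathbb{R}}\|z-xe^{i\phi}\|_2$, and $\phi(z)=\operatorname{argmin}_{\phi\in\mathbb{R}}\|z-x^\sharp e^{i\phi}\|_2$. For $z\in\mathbb{C}^n$, $A(z)\in\mathbb{C}^{m\times 2n}$ is the matrix whose $j$-th row is $\frac{1}{\sqrt m}\left[\,z^*a_ja_j^*,\ z^{\top}\bar a_ja_j^{\top}\right]$, and $F(z)=\frac{1}{\sqrt m}\left(|a_1^*z|^2-y_1,\dots,|a_m^*z|^2-y_m\right)^{\top}$. $A^\dagger$ denotes the Moore-Penrose pseudoinverse, and for $v\in\mathbb{C}^{2n}$, $v(1:n)$ is the vector of its first $n$ entries. Algorithm. Spectral initialization: let $\lambda_1(Y)$ and $\tilde z_0$ (with $\|\tilde z_0\|_2=1$) be the leading eigenvalue and a leading eigenvector of $Y=\frac1m\sum_{j=1}^m y_ja_ja_j^*$, and set $z_0=\sqrt{\lambda_1(Y)/2}\;\tilde z_0$. Gauss-Newton updates: for $k=0,1,2,\dots$, $z_{k+1}=z_k-\left(A(z_k)^\dagger F(z_k)\right)(1:n)$. *)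

theory Defs
  imports
    "HOL-Probability.Probability"
    "Jordan_Normal_Form.Spectral_Radius"
    "Jordan_Normal_Form.Schur_Decomposition"
begin

unbundle no vec_syntax
hide_const (open) Finite_Cartesian_Product.vec

text \<open>
  The dimension \<open>n\<close> and the sample size \<open>m\<close> are quantified inside the statement, after the
  universal constants, so vectors and matrices are those of \<open>Jordan_Normal_Form\<close>, whose
  dimensions are numbers. Indices start at 0. Since \<open>v \<bullet>c w\<close> conjugates its second
  argument, the scalar \<open>a\<^sup>* z\<close> is written \<open>z \<bullet>c a\<close>.
\<close>

definition l2norm :: "complex vec \<Rightarrow> real" where
  "l2norm v = L2_set (\<lambda>i. cmod (v $ i)) {..<dim_vec v}"


section \<open>Gaussian samples\<close>

text \<open>
  The law of \<open>u / sqrt 2 + i v / sqrt 2\<close> for independent standard real normal variables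
  \<open>u\<close> and \<open>v\<close>.
\<close>

definition std_complex_normal :: "complex measure" where
  "std_complex_normal =
     distr (density lborel std_normal_density \<Otimes>\<^sub>M density lborel std_normal_density) borel
       (\<lambda>(u, v). Complex (u / sqrt 2) (v / sqrt 2))"

definition std_complex_gaussian :: "nat \<Rightarrow> (nat \<Rightarrow> complex) measure" where
  "std_complex_gaussian n = (\<Pi>\<^sub>M i\<in>{..<n}. std_complex_normal)"

text \<open>
  The joint law of \<open>m\<close> independent standard complex Gaussian vectors in dimension \<open>n\<close>. The
  theorem is stated on this canonical space rather than for random vectors on an arbitrary space
  over a type \<open>'w\<close>: the constants then cannot depend on \<open>'w\<close>. Lemma \<open>distr_iid_gaussian\<close>
  shows that nothing is lost.
\<close>

definition gaussian_sample :: "nat \<Rightarrow> nat \<Rightarrow> (nat \<Rightarrow> nat \<Rightarrow> complex) measure" where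
  "gaussian_sample n m = (\<Pi>\<^sub>M j\<in>{..<m}. std_complex_gaussian n)"

definition sample_vec :: "nat \<Rightarrow> (nat \<Rightarrow> nat \<Rightarrow> complex) \<Rightarrow> nat \<Rightarrow> complex vec" where
  "sample_vec n \<omega> j = vec n (\<omega> j)"

lemma distr_iid_gaussian:
  fixes M :: "'w measure" and a :: "nat \<Rightarrow> 'w \<Rightarrow> nat \<Rightarrow> complex"
  assumes "prob_space M" and "m \<ge> 1"
    and indep: "prob_space.indep_vars M (\<lambda>_. std_complex_gaussian n) a {..<m}"
    and law: "\<And>j. j < m \<Longrightarrow> distr M (std_complex_gaussian n) (a j) = std_complex_gaussian n"
  shows "distr M (gaussian_sample n m) (\<lambda>w. \<lambda>j\<in>{..<m}. a j w) = gaussian_sample n m"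
proof -
  interpret prob_space M by fact
  have "a j \<in> measurable M (std_complex_gaussian n)" if "j < m" for j
    using indep that unfolding indep_vars_def by auto
  then have "distr M (\<Pi>\<^sub>M j\<in>{..<m}. std_complex_gaussian n) (\<lambda>w. \<lambda>j\<in>{..<m}. a j w)
      = (\<Pi>\<^sub>M j\<in>{..<m}. distr M (std_complex_gaussian n) (a j))"
    using indep assms(2) by (subst indep_vars_iff_distr_eq_PiM'[symmetric]) (auto simp: lessThan_empty_iff)
  also have "\<dots> = gaussian_sample n m"
    unfolding gaussian_sample_def by (rule PiM_cong) (auto simp: law)
  finally show ?thesis unfolding gaussian_sample_def .
qed


section \<open>Distance up to a global phase\<close>

text \<open>The infimum is attained, by continuity and periodicity in \<open>\<phi>\<close>.\<close>

definition phase_dist :: "complex vec \<Rightarrow> complex vec \<Rightarrow> real" where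
  "phase_dist z x = (INF \<phi>::real. l2norm (z - cis \<phi> \<cdot>\<^sub>v x))"

text \<open>
  The minimising phase is unique only modulo \<open>2 * pi\<close>, and not even so when \<open>z\<close> is
  orthogonal to \<open>x\<close>; we therefore speak of all minimisers.
\<close>

definition is_aligning_phase :: "complex vec \<Rightarrow> complex vec \<Rightarrow> real \<Rightarrow> bool" where
  "is_aligning_phase x z \<phi> \<longleftrightarrow> is_arg_min (\<lambda>\<phi>. l2norm (z - cis \<phi> \<cdot>\<^sub>v x)) (\<lambda>_. True) \<phi>"


section \<open>The Moore-Penrose pseudoinverse\<close>

definition is_pseudoinverse :: "complex mat \<Rightarrow> complex mat \<Rightarrow> bool" where
  "is_pseudoinverse A B \<longleftrightarrow>
     B \<in> carrier_mat (dim_col A) (dim_row A) \<and>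
     A * B * A = A \<and> B * A * B = B \<and>
     mat_adjoint (A * B) = A * B \<and> mat_adjoint (B * A) = B * A"

definition pseudoinverse :: "complex mat \<Rightarrow> complex mat" where
  "pseudoinverse A = (THE B. is_pseudoinverse A B)"


section \<open>Minimal-norm Gauss-Newton method with spectral initialization\<close>

definition spectral_mat :: "nat \<Rightarrow> nat \<Rightarrow> (nat \<Rightarrow> complex vec) \<Rightarrow> (nat \<Rightarrow> real) \<Rightarrow> complex mat" where
  "spectral_mat n m a y =
     mat n n (\<lambda>(i, k). 1 / of_nat m * (\<Sum>j<m. of_real (y j) * (a j $ i * cnj (a j $ k))))"

text \<open>Used for Hermitian matrices only, all of whose eigenvalues are real.\<close>

definition leading_eigenvalue :: "complex mat \<Rightarrow> real" where
  "leading_eigenvalue Y = Max {\<mu>. eigenvalue Y (complex_of_real \<mu>)}"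

definition spectral_init :: "complex mat \<Rightarrow> complex vec \<Rightarrow> bool" where
  "spectral_init Y z0 \<longleftrightarrow>
     (\<exists>v. eigenvector Y v (complex_of_real (leading_eigenvalue Y)) \<and> l2norm v = 1 \<and>
          z0 = complex_of_real (sqrt (leading_eigenvalue Y / 2)) \<cdot>\<^sub>v v)"

definition gn_mat :: "nat \<Rightarrow> nat \<Rightarrow> (nat \<Rightarrow> complex vec) \<Rightarrow> complex vec \<Rightarrow> complex mat" where
  "gn_mat n m a z =
     mat\<^sub>r m (2 * n) (\<lambda>j. complex_of_real (1 / sqrt (real m)) \<cdot>\<^sub>v
       (((a j \<bullet>c z) \<cdot>\<^sub>v conjugate (a j)) @\<^sub>v ((z \<bullet>c a j) \<cdot>\<^sub>v a j)))"

definition gn_residual ::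
    "nat \<Rightarrow> (nat \<Rightarrow> complex vec) \<Rightarrow> (nat \<Rightarrow> real) \<Rightarrow> complex vec \<Rightarrow> complex vec" where
  "gn_residual m a y z =
     complex_of_real (1 / sqrt (real m)) \<cdot>\<^sub>v
       vec m (\<lambda>j. complex_of_real ((cmod (z \<bullet>c a j))\<^sup>2 - y j))"

text \<open>
  A predicate rather than a function because the leading unit eigenvector is determined at best
  up to a phase: \<open>z\<close> is a run of the method for some choice of it.
\<close>

definition gauss_newton_run ::
    "nat \<Rightarrow> nat \<Rightarrow> (nat \<Rightarrow> complex vec) \<Rightarrow> (nat \<Rightarrow> real) \<Rightarrow> (nat \<Rightarrow> complex vec) \<Rightarrow> bool" where
  "gauss_newton_run n m a y z \<longleftrightarrow>
     spectral_init (spectral_mat n m a y) (z 0) \<and>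
     (\<forall>k. z (Suc k) =
        z k - vec_first (pseudoinverse (gn_mat n m a (z k)) *\<^sub>v gn_residual m a y (z k)) n)"

end

theory Submission
  imports Defs
begin

text \<open>
  Scale the signal \<open>x\<close> to norm \<open>1\<close> and multiply every vector by the phase that makes its inner
  product with \<open>x\<close> real and nonnegative. In this frame the distance of an iterate \<open>x + h\<close> to the orbit
  of \<open>x\<close> is the norm of \<open>h\<close>, and the next distance is at most the norm of \<open>g\<close>, where \<open>x + g\<close> is the
  Gauss-Newton update. This \<open>g\<close> solves the real least squares problem
  \<open>2 Re (conj (a\<^sub>j\<^sup>* (x + h)) (a\<^sub>j\<^sup>* g)) = |a\<^sub>j\<^sup>* h|\<^sup>2\<close> for all \<open>j\<close>, with \<open>Im (g\<^sup>* (x + h)) = 0\<close>.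
  The mean square of the left hand side is at least about \<open>2 * norm g ^ 2\<close>, and the right hand side
  is quadratic in \<open>h\<close>: this is the quadratic convergence.

  Both sides involve averages of fourth powers of Gaussian variables. The lower bound concentrates well,
  because nonnegative variables with a second moment have Gaussian lower tails. The upper bound does
  not: it is proved for variables cut off at a level \<open>B\<close> of order \<open>sqrt (ln m)\<close>, and the excess
  over \<open>B\<close> is controlled only if \<open>h\<close> is incoherent, that is, if \<open>|a\<^sub>j\<^sup>* h| \<le> B\<close> for all \<open>j\<close>. The
  excess then contributes the term linear in \<open>h\<close>. Everything required of the sample is collected
  in the locale \<open>regular_sample\<close>.

  Incoherence is the main difficulty, as \<open>h\<close> depends on all the vectors \<open>a\<^sub>j\<close>. It is obtained by leaving
  one sample out: for every \<open>l\<close> there is a path, built from the other samples, that starts near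
  the spectral initialisation and approximately satisfies the same normal equations. Being independent
  of \<open>a\<^sub>l\<close>, the path is incoherent with \<open>a\<^sub>l\<close>; and its distance to the true run stays a small
  multiple of \<open>B / R\<close>, where \<open>R\<close> bounds \<open>norm a\<^sub>l\<close>, as the step is a contraction there (\<open>spectral_leave_one_out\<close>,
  \<open>gn_step_leave_one_out\<close>). Hence the run itself is incoherent with \<open>a\<^sub>l\<close>. The simultaneous
  induction is \<open>iterates_converge\<close>; it follows the paths for \<open>n\<close> steps, after which
  \<open>norm h \<le> 2 ^ (- n)\<close> makes incoherence trivial.

  The paths take their values in a countable dense set and satisfy the equations of the method up to a
  tolerance \<open>1 / m\<close>. There are thus countably many of them, and the first admissible one in an
  enumeration is a measurable function of the other samples (\<open>select_independent\<close>). This is how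
  independence is used; it takes the place of a measurable choice of eigenvectors and of updates.

  A random sample is regular by exponential inequalities on the points of a fine lattice in the unit
  ball, of which there are at most \<open>exp (10 n ln m)\<close> (\<open>regular_sample_from_net\<close>,
  \<open>good_event\<close>). The choice of all parameters is made in the locale \<open>large_sample\<close>; where its
  assumptions fail although those of the theorem hold, the probability bound claimed is not positive.
\<close>

section \<open>Finitely supported complex sequences\<close>

lemma mult_cnj_self: "z * cnj z = complex_of_real ((cmod z)\<^sup>2)"
  by (rule complex_norm_square[symmetric])

text \<open>
  Vectors of all dimensions live in one real inner product space, so that the library of analysis
  applies while the dimension remains a number: \<open>fspace n\<close> below is the copy of complex \<open>n\<close>-space.
\<close>

typedef fvec = "{f :: nat \<Rightarrow> complex. finite {i. f i \<noteq> 0}}"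
  morphisms fv Abs_fvec
  by (rule exI[of _ "\<lambda>_. 0"]) simp

setup_lifting type_definition_fvec

lemma finite_fv: "finite {i. fv u i \<noteq> 0}"
  using fv by simp

lemma fvec_eq_iff: "u = v \<longleftrightarrow> (\<forall>i. fv u i = fv v i)"
  by (metis ext fv_inject)

text \<open>
  The complex inner product, linear in its first argument; \<open>a\<^sup>* z\<close> is \<open>cip z a\<close>. Its real part is the
  inner product of the real vector space.
\<close>

definition cip :: "fvec \<Rightarrow> fvec \<Rightarrow> complex" where
  "cip u v = (\<Sum>i | fv u i \<noteq> 0. fv u i * cnj (fv v i))"

lemma cip_eq_sum:
  assumes "finite A" "{i. fv u i \<noteq> 0} \<subseteq> A \<or> {i. fv v i \<noteq> 0} \<subseteq> A"
  shows "cip u v = (\<Sum>i\<in>A. fv u i * cnj (fv v i))"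
proof -
  have "cip u v = (\<Sum>i\<in>{i. fv u i \<noteq> 0} \<inter> {i. fv v i \<noteq> 0}. fv u i * cnj (fv v i))"
    unfolding cip_def by (rule sum.mono_neutral_right) (auto simp: finite_fv)
  also have "\<dots> = (\<Sum>i\<in>A. fv u i * cnj (fv v i))"
    using assms by (intro sum.mono_neutral_left) (auto simp: finite_fv)
  finally show ?thesis .
qed

lemma cip_right: "cip u v = (\<Sum>i | fv v i \<noteq> 0. fv u i * cnj (fv v i))"
  by (rule cip_eq_sum) (simp_all add: finite_fv)

instantiation fvec :: real_inner
begin

lift_definition zero_fvec :: fvec is "\<lambda>_. 0" by simp

lift_definition plus_fvec :: "fvec \<Rightarrow> fvec \<Rightarrow> fvec" is "\<lambda>f g i. f i + g i"
proof -
  fix f g :: "nat \<Rightarrow> complex"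
  assume "finite {i. f i \<noteq> 0}" "finite {i. g i \<noteq> 0}"
  then show "finite {i. f i + g i \<noteq> 0}"
    by (rule finite_subset[OF _ finite_UnI, rotated]) auto
qed

lift_definition uminus_fvec :: "fvec \<Rightarrow> fvec" is "\<lambda>f i. - f i" by simp

lift_definition minus_fvec :: "fvec \<Rightarrow> fvec \<Rightarrow> fvec" is "\<lambda>f g i. f i - g i"
proof -
  fix f g :: "nat \<Rightarrow> complex"
  assume "finite {i. f i \<noteq> 0}" "finite {i. g i \<noteq> 0}"
  then show "finite {i. f i - g i \<noteq> 0}"
    by (rule finite_subset[OF _ finite_UnI, rotated]) auto
qed

lift_definition scaleR_fvec :: "real \<Rightarrow> fvec \<Rightarrow> fvec" is "\<lambda>c f i. c *\<^sub>R f i"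
  by (erule finite_subset[rotated]) auto

definition inner_fvec :: "fvec \<Rightarrow> fvec \<Rightarrow> real" where
  "inner_fvec u v = Re (cip u v)"

definition norm_fvec :: "fvec \<Rightarrow> real" where
  "norm_fvec u = sqrt (inner u u)"

definition dist_fvec :: "fvec \<Rightarrow> fvec \<Rightarrow> real" where
  "dist_fvec u v = norm (u - v)"

definition sgn_fvec :: "fvec \<Rightarrow> fvec" where
  "sgn_fvec u = inverse (norm u) *\<^sub>R u"

definition uniformity_fvec :: "(fvec \<times> fvec) filter" where
  "uniformity_fvec = (INF e\<in>{0 <..}. principal {(x, y). dist x y < e})"

definition open_fvec :: "fvec set \<Rightarrow> bool" where
  "open_fvec U = (\<forall>x\<in>U. eventually (\<lambda>(x', y). x' = x \<longrightarrow> y \<in> U) uniformity)"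

lemma cip_self: "cip u u = of_real (\<Sum>i | fv u i \<noteq> 0. (cmod (fv u i))\<^sup>2)"
  unfolding cip_def by (simp add: mult_cnj_self)

instance
proof
  show "a + b + c = a + (b + c)" "a + b = b + a" "0 + a = a" "- a + a = 0" "a - b = a + - b"
    for a b c :: fvec
    by (transfer; simp add: add_ac)+
  show "r *\<^sub>R (a + b) = r *\<^sub>R a + r *\<^sub>R b" "(r + s) *\<^sub>R a = r *\<^sub>R a + s *\<^sub>R a"
    "r *\<^sub>R s *\<^sub>R a = (r * s) *\<^sub>R a" "1 *\<^sub>R a = a" for r s :: real and a b :: fvec
    by (transfer; simp add: algebra_simps)+
  show "dist a b = norm (a - b)" for a b :: fvec by (fact dist_fvec_def)
  show "sgn a = inverse (norm a) *\<^sub>R a" for a :: fvec by (fact sgn_fvec_def)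
  show "(uniformity :: (fvec \<times> fvec) filter) = (INF e\<in>{0 <..}. principal {(x, y). dist x y < e})"
    by (fact uniformity_fvec_def)
  show "open U = (\<forall>x\<in>U. \<forall>\<^sub>F (x', y) in uniformity. x' = x \<longrightarrow> y \<in> U)" for U :: "fvec set"
    by (fact open_fvec_def)
  show "norm a = sqrt (inner a a)" for a :: fvec by (fact norm_fvec_def)
  show "inner a b = inner b a" for a b :: fvec
    unfolding inner_fvec_def cip_def[of a b] cip_right[of b a]
    by (simp add: mult.commute)
  show "inner (a + b) c = inner a c + inner b c" for a b c :: fvec
    unfolding inner_fvec_def cip_right
    by (simp add: plus_fvec.rep_eq algebra_simps sum.distrib)
  show "inner (r *\<^sub>R a) b = r * inner a b" for r :: real and a b :: fvec
    unfolding inner_fvec_def cip_right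
    by (simp add: scaleR_fvec.rep_eq sum_distrib_left algebra_simps)
  show "0 \<le> inner a a" for a :: fvec
    unfolding inner_fvec_def cip_self by (simp add: sum_nonneg)
  show "(inner a a = 0) = (a = 0)" for a :: fvec
    unfolding inner_fvec_def cip_self Re_complex_of_real
    by (subst sum_nonneg_eq_0_iff) (auto simp: finite_fv fvec_eq_iff zero_fvec.rep_eq)
qed

end

lift_definition cmul :: "complex \<Rightarrow> fvec \<Rightarrow> fvec" is "\<lambda>c f i. c * f i"
  by (erule finite_subset[rotated]) auto

lemmas fv_simps [simp] = zero_fvec.rep_eq plus_fvec.rep_eq uminus_fvec.rep_eq minus_fvec.rep_eq
  scaleR_fvec.rep_eq cmul.rep_eq

lemma cip_commute: "cip v u = cnj (cip u v)"
  unfolding cip_def[of u v] cip_right[of v u]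
  by (simp add: mult.commute)

lemma cip_add_left: "cip (a + b) c = cip a c + cip b c"
  unfolding cip_right
  by (simp add: algebra_simps sum.distrib)

lemma cip_cmul_left: "cip (cmul r a) b = r * cip a b"
  unfolding cip_right
  by (simp add: sum_distrib_left algebra_simps)

lemma scaleR_eq_cmul: "r *\<^sub>R u = cmul (of_real r) u"
  by (simp add: fvec_eq_iff scaleR_conv_of_real)

lemma cip_scaleR_left: "cip (r *\<^sub>R a) b = of_real r * cip a b"
  by (simp add: scaleR_eq_cmul cip_cmul_left)

lemma cip_add_right: "cip c (a + b) = cip c a + cip c b"
  by (metis cip_add_left cip_commute complex_cnj_add)

lemma cip_cmul_right: "cip b (cmul r a) = cnj r * cip b a"
  by (metis cip_cmul_left cip_commute complex_cnj_mult)

lemma cip_scaleR_right: "cip a (r *\<^sub>R b) = of_real r * cip a b"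
  by (simp add: scaleR_eq_cmul cip_cmul_right)

lemma uminus_eq_cmul: "- u = cmul (-1) u"
  by (simp add: fvec_eq_iff)

lemma cip_minus_left: "cip (- a) b = - cip a b"
  by (simp add: uminus_eq_cmul cip_cmul_left)

lemma cip_minus_right: "cip a (- b) = - cip a b"
  by (simp add: uminus_eq_cmul cip_cmul_right)

lemma cip_diff_left: "cip (a - b) c = cip a c - cip b c"
  using cip_add_left[of a "- b" c] by (simp add: cip_minus_left)

lemma cip_diff_right: "cip c (a - b) = cip c a - cip c b"
  using cip_add_right[of c a "- b"] by (simp add: cip_minus_right)

lemma cip_zero_left [simp]: "cip 0 u = 0" and cip_zero_right [simp]: "cip u 0 = 0"
  by (simp_all add: cip_def)

lemmas cip_linear = cip_add_left cip_add_right cip_diff_left cip_diff_right cip_cmul_left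
  cip_cmul_right cip_scaleR_left cip_scaleR_right cip_minus_left cip_minus_right

lemma cip_sum_left: "cip (sum f A) v = (\<Sum>i\<in>A. cip (f i) v)"
  by (induction A rule: infinite_finite_induct) (simp_all add: cip_add_left)

lemma cip_sum_right: "cip v (sum f A) = (\<Sum>i\<in>A. cip v (f i))"
  by (induction A rule: infinite_finite_induct) (simp_all add: cip_add_right)

lemma cip_self_norm: "cip u u = of_real ((norm u)\<^sup>2)"
proof -
  have "Im (cip u u) = 0" by (simp add: cip_self)
  moreover have "Re (cip u u) = (norm u)\<^sup>2"
    by (simp add: power2_norm_eq_inner inner_fvec_def)
  ultimately show ?thesis by (simp add: complex_eq_iff)
qed

lemma norm_cmul [simp]: "norm (cmul c u) = cmod c * norm u"
proof -
  have "cip (cmul c u) (cmul c u) = (c * cnj c) * cip u u"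
    by (simp add: cip_cmul_left cip_cmul_right)
  then have "of_real ((norm (cmul c u))\<^sup>2) = complex_of_real ((cmod c * norm u)\<^sup>2)"
    unfolding cip_self_norm mult_cnj_self by (simp only: of_real_mult power_mult_distrib)
  then have "(norm (cmul c u))\<^sup>2 = (cmod c * norm u)\<^sup>2"
    using of_real_eq_iff by blast
  then show ?thesis by (simp add: power2_eq_iff_nonneg)
qed

lemma cmod_cip_le: "cmod (cip u v) \<le> norm u * norm v"
proof (cases "cip u v = 0")
  case False
  define c where "c = cnj (cip u v) / cmod (cip u v)"
  have c: "cmod c = 1" using False by (simp add: c_def norm_divide)
  have "cip (cmul c u) v = cmod (cip u v)"
    using False mult_cnj_self[of "cip u v"]
    by (simp add: cip_linear c_def power2_eq_square mult_ac)
  then have "cmod (cip u v) = inner (cmul c u) v" by (simp add: inner_fvec_def)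
  also have "\<dots> \<le> norm (cmul c u) * norm v" by (rule norm_cauchy_schwarz)
  finally show ?thesis using c by simp
qed simp

lemma cmul_simps:
  "cmul a (cmul b u) = cmul (a * b) u" "cmul 1 u = u" "cmul 0 u = 0" "cmul a 0 = 0"
  "cmul a (u + v) = cmul a u + cmul a v" "cmul a (u - v) = cmul a u - cmul a v"
  "cmul a (- u) = - cmul a u"
  "cmul (a + b) u = cmul a u + cmul b u" "cmul (a - b) u = cmul a u - cmul b u"
  by (simp_all add: fvec_eq_iff algebra_simps)

lemma cmul_sum: "cmul a (sum f A) = (\<Sum>i\<in>A. cmul a (f i))"
  by (induction A rule: infinite_finite_induct) (simp_all add: cmul_simps)

lemma fv_sum: "fv (sum f A) i = (\<Sum>j\<in>A. fv (f j) i)"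
  by (induction A rule: infinite_finite_induct) auto

definition fspace :: "nat \<Rightarrow> fvec set" where
  "fspace n = {u. \<forall>i\<ge>n. fv u i = 0}"

lemma fspace_closed [simp, intro]:
  "0 \<in> fspace n"
  "u \<in> fspace n \<Longrightarrow> v \<in> fspace n \<Longrightarrow> u + v \<in> fspace n"
  "u \<in> fspace n \<Longrightarrow> v \<in> fspace n \<Longrightarrow> u - v \<in> fspace n"
  "u \<in> fspace n \<Longrightarrow> - u \<in> fspace n"
  "u \<in> fspace n \<Longrightarrow> cmul c u \<in> fspace n"
  "u \<in> fspace n \<Longrightarrow> r *\<^sub>R u \<in> fspace n"
  by (auto simp: fspace_def)

lemma fspace_sum [simp, intro]:
  "(\<And>i. i \<in> A \<Longrightarrow> f i \<in> fspace n) \<Longrightarrow> sum f A \<in> fspace n"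
  by (induction A rule: infinite_finite_induct) auto

lemma cip_fspace:
  "u \<in> fspace n \<or> v \<in> fspace n \<Longrightarrow> cip u v = (\<Sum>i<n. fv u i * cnj (fv v i))"
  by (rule cip_eq_sum) (auto simp: fspace_def not_le[symmetric])

lemma norm_fspace: "u \<in> fspace n \<Longrightarrow> (norm u)\<^sup>2 = (\<Sum>i<n. (cmod (fv u i))\<^sup>2)"
proof -
  assume "u \<in> fspace n"
  then have "complex_of_real ((norm u)\<^sup>2) = complex_of_real (\<Sum>i<n. (cmod (fv u i))\<^sup>2)"
    unfolding cip_self_norm[symmetric] by (simp add: cip_fspace mult_cnj_self)
  then show ?thesis using of_real_eq_iff by blast
qed

lift_definition mk_fv :: "nat \<Rightarrow> (nat \<Rightarrow> complex) \<Rightarrow> fvec" is "\<lambda>n f i. if i < n then f i else 0"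
  by simp

lemma fv_mk_fv [simp]: "fv (mk_fv n f) i = (if i < n then f i else 0)"
  by (simp add: mk_fv.rep_eq)

lemma mk_fv_fspace [simp, intro]: "mk_fv n f \<in> fspace n"
  by (simp add: fspace_def)

section \<open>Aligning the phase with a unit vector\<close>

text \<open>
  The phase of \<open>0\<close> is set to \<open>1\<close> so that \<open>ph\<close> is unimodular everywhere.
\<close>

definition ph :: "complex \<Rightarrow> complex" where
  "ph p = (if p = 0 then 1 else sgn p)"

lemma cmod_ph [simp]: "cmod (ph p) = 1"
  by (simp add: ph_def norm_sgn)

lemma ph_cnj_mult: "cnj (ph p) * p = of_real (cmod p)"
  using mult_cnj_self[of p]
  by (auto simp: ph_def sgn_div_norm scaleR_conv_of_real field_simps power2_eq_square)

lemma ph_mult: "cmod c = 1 \<Longrightarrow> p \<noteq> 0 \<Longrightarrow> ph (c * p) = c * ph p"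
  by (auto simp: ph_def sgn_mult) (simp add: sgn_div_norm)

lemma ph_diff_le: "p \<noteq> 0 \<Longrightarrow> q \<noteq> 0 \<Longrightarrow> cmod (ph p - ph q) \<le> 2 * cmod (p - q) / cmod p"
proof -
  assume "p \<noteq> 0" "q \<noteq> 0"
  have 1: "ph p = p / cmod p" "ph q = q / cmod q"
    using \<open>p \<noteq> 0\<close> \<open>q \<noteq> 0\<close> by (simp_all add: ph_def sgn_div_norm scaleR_conv_of_real field_simps)
  have "ph p - ph q = ((p - q) + ph q * (of_real (cmod q) - of_real (cmod p))) / cmod p"
    unfolding 1 using \<open>p \<noteq> 0\<close> \<open>q \<noteq> 0\<close> by (simp add: field_simps)
  then have "cmod (ph p - ph q) = cmod ((p - q) + ph q * (of_real (cmod q) - of_real (cmod p))) / cmod p"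
    by (simp add: norm_divide)
  also have "\<dots> \<le> (cmod (p - q) + cmod (ph q * of_real (cmod q - cmod p))) / cmod p"
    by (intro divide_right_mono order_trans[OF norm_triangle_ineq]) auto
  also have "\<dots> \<le> (cmod (p - q) + cmod (p - q)) / cmod p"
    unfolding norm_mult cmod_ph norm_of_real
    by (intro divide_right_mono add_left_mono) (auto simp: abs_le_iff norm_triangle_ineq2 norm_minus_commute
        intro: order_trans[OF norm_triangle_ineq2])
  finally show ?thesis by simp
qed

definition align :: "fvec \<Rightarrow> fvec \<Rightarrow> fvec" where
  "align x z = cmul (cnj (ph (cip z x))) z"

lemma align_fspace [simp, intro]: "z \<in> fspace n \<Longrightarrow> align x z \<in> fspace n"
  by (simp add: align_def)

lemma norm_align [simp]: "norm (align x z) = norm z"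
  by (simp add: align_def)

lemma cip_align: "cip (align x z) x = of_real (cmod (cip z x))"
  by (simp add: align_def cip_linear ph_cnj_mult)

lemma unalign: "cmul (ph (cip z x)) (align x z) = z"
  using mult_cnj_self[of "ph (cip z x)"] by (simp add: align_def cmul_simps)

lemma align_cmul:
  assumes "cmod c = 1" "cip z x \<noteq> 0" shows "align x (cmul c z) = align x z"
proof -
  have "align x (cmul c z) = cmul ((c * cnj c) * cnj (ph (cip z x))) z"
    using ph_mult[OF assms] by (simp add: align_def cip_linear cmul_simps mult_ac)
  then show ?thesis using assms mult_cnj_self[of c] by (simp add: align_def)
qed

text \<open>
  Aligned vectors minimise the distance to \<open>x\<close> among all phases: expanding the square, only
  \<open>Re (cnj c * cip z x)\<close> depends on the phase \<open>c\<close>, and it is at most \<open>cmod (cip z x)\<close>.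
\<close>

lemma norm_align_diff_sq:
  assumes "norm x = 1"
  shows "(norm (align x z - x))\<^sup>2 = (norm z)\<^sup>2 + 1 - 2 * cmod (cip z x)"
proof -
  have "inner (align x z) x = cmod (cip z x)" by (simp add: inner_fvec_def cip_align)
  then show ?thesis
    using assms by (simp add: power2_norm_eq_inner inner_diff_left inner_diff_right inner_commute
        norm_eq_1[symmetric]) (simp add: power2_norm_eq_inner[symmetric] norm_align)
qed

lemma norm_diff_cmul_sq:
  assumes "norm x = 1" "cmod c = 1"
  shows "(norm (z - cmul c x))\<^sup>2 = (norm z)\<^sup>2 + 1 - 2 * Re (cnj c * cip z x)"
proof -
  have "inner z (cmul c x) = Re (cnj c * cip z x)" by (simp add: inner_fvec_def cip_linear)
  moreover have "inner (cmul c x) (cmul c x) = 1"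
    using assms by (simp add: power2_norm_eq_inner[symmetric])
  ultimately show ?thesis
    by (simp add: power2_norm_eq_inner inner_diff_left inner_diff_right inner_commute)
qed

lemma norm_align_diff_le:
  assumes "norm x = 1" "cmod c = 1"
  shows "norm (align x z - x) \<le> norm (z - cmul c x)"
proof -
  have "Re (cnj c * cip z x) \<le> cmod (cip z x)"
    using complex_Re_le_cmod[of "cnj c * cip z x"] assms by (simp add: norm_mult)
  then have "(norm (align x z - x))\<^sup>2 \<le> (norm (z - cmul c x))\<^sup>2"
    using norm_align_diff_sq[OF assms(1), of z] norm_diff_cmul_sq[OF assms, of z] by simp
  then show ?thesis by (simp add: power2_le_iff_abs_le)
qed

lemma norm_align_diff_le_self:
  "norm x = 1 \<Longrightarrow> norm (align x z - x) \<le> norm (z - x)"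
  using norm_align_diff_le[of x 1 z] by (simp add: cmul_simps)

lemma align_lipschitz:
  assumes x: "norm x = 1" and z: "norm (z - x) \<le> 1/100" "norm (w - x) \<le> 1/100"
  shows "norm (align x z - align x w) \<le> 4 * norm (z - w)"
proof -
  have *: "cmod (cip v x) \<ge> 99/100" if "norm (v - x) \<le> 1/100" for v
  proof -
    have "cip v x = cip (v - x) x + 1" using x by (simp add: cip_linear cip_self_norm)
    moreover have "cmod (cip (v - x) x) \<le> 1/100" using cmod_cip_le[of "v - x" x] that x by simp
    ultimately show ?thesis using norm_diff_ineq[of 1 "cip (v - x) x"] by (simp add: add.commute)
  qed
  let ?p = "cip z x" and ?q = "cip w x"
  have pq: "cmod ?p \<ge> 99/100" "cmod ?q \<ge> 99/100" using * z by auto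
  have "cmod (ph ?p - ph ?q) \<le> 2 * cmod (?p - ?q) / cmod ?p"
    using pq by (intro ph_diff_le) auto
  also have "\<dots> \<le> 2 * norm (z - w) / (99/100)"
    using pq cmod_cip_le[of "z - w" x] x by (intro frac_le) (auto simp: cip_linear)
  finally have 1: "cmod (ph ?p - ph ?q) \<le> 200/99 * norm (z - w)" by simp
  have nw: "norm w \<le> 101/100" using z x norm_triangle_ineq[of "w - x" x] by simp
  have "align x z - align x w = cmul (cnj (ph ?p)) (z - w) + cmul (cnj (ph ?p - ph ?q)) w"
    by (simp add: align_def cmul_simps)
  then have "norm (align x z - align x w) \<le> norm (z - w) + cmod (ph ?p - ph ?q) * norm w"
    using norm_triangle_ineq[of "cmul (cnj (ph ?p)) (z - w)" "cmul (cnj (ph ?p - ph ?q)) w"]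
    by (simp del: complex_cnj_diff)
  also have "\<dots> \<le> norm (z - w) + (200/99 * norm (z - w)) * (101/100)"
    using 1 nw by (intro add_left_mono mult_mono) auto
  finally show ?thesis using norm_ge_zero[of "z - w"] by argo
qed


section \<open>Averages over the sample\<close>

text \<open>
  Half the gradient at \<open>g\<close> of the least squares functional
  \<open>1/2 * (\<Sum>j\<in>J. (2 * Re (cnj (cip (x + h) (a j)) * cip g (a j)) - (cmod (cip h (a j)))\<^sup>2)\<^sup>2)\<close>;
  its zeros are the Gauss-Newton updates \<open>x + g\<close> of \<open>x + h\<close>.
\<close>

definition gn_form :: "(nat \<Rightarrow> fvec) \<Rightarrow> nat set \<Rightarrow> fvec \<Rightarrow> fvec \<Rightarrow> fvec \<Rightarrow> fvec" where
  "gn_form a J x h g = (\<Sum>j\<in>J. cmul (of_real (2 * Re (cnj (cip (x + h) (a j)) * cip g (a j))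
      - (cmod (cip h (a j)))\<^sup>2) * cip (x + h) (a j)) (a j))"

text \<open>
  The operator of the spectral initialisation, up to the factor \<open>1 / m\<close>.
\<close>

definition weighted_cov :: "(nat \<Rightarrow> fvec) \<Rightarrow> nat set \<Rightarrow> fvec \<Rightarrow> fvec \<Rightarrow> fvec" where
  "weighted_cov a J x v = (\<Sum>j\<in>J. cmul (of_real ((cmod (cip x (a j)))\<^sup>2) * cip v (a j)) (a j))"

lemma gn_form_fspace [simp, intro]: "(\<And>j. j \<in> J \<Longrightarrow> a j \<in> fspace n) \<Longrightarrow> gn_form a J x h g \<in> fspace n"
  by (auto simp: gn_form_def)

lemma weighted_cov_fspace [simp, intro]: "(\<And>j. j \<in> J \<Longrightarrow> a j \<in> fspace n) \<Longrightarrow> weighted_cov a J x v \<in> fspace n"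
  by (auto simp: weighted_cov_def)

lemma weighted_cov_linear:
  "weighted_cov a J x (u - v) = weighted_cov a J x u - weighted_cov a J x v"
  "weighted_cov a J x (cmul c u) = cmul c (weighted_cov a J x u)"
  by (simp_all add: weighted_cov_def cip_linear cmul_simps algebra_simps sum_subtractf cmul_sum)

lemma weighted_cov_add: "weighted_cov a J x (u + v) = weighted_cov a J x u + weighted_cov a J x v"
  by (simp add: weighted_cov_def cip_linear cmul_simps algebra_simps sum.distrib)

lemma inner_gn_form:
  "inner (gn_form a J x h g) e = (\<Sum>j\<in>J. (2 * Re (cnj (cip (x + h) (a j)) * cip g (a j))
      - (cmod (cip h (a j)))\<^sup>2) * Re (cnj (cip (x + h) (a j)) * cip e (a j)))"
proof -
  have "Re (cip (cmul (of_real s * p) b) e) = s * Re (cnj p * cip e b)" for s p b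
    by (simp add: cip_linear cip_commute[of b e] algebra_simps)
  then show ?thesis unfolding inner_fvec_def gn_form_def cip_sum_left Re_sum by (simp only:)
qed

lemma inner_weighted_cov:
  "inner (weighted_cov a J x v) v = (\<Sum>j\<in>J. (cmod (cip x (a j)) * cmod (cip v (a j)))\<^sup>2)"
proof -
  have "Re (cip (cmul (of_real s * p) b) v) = s * (cmod p)\<^sup>2" if "p = cip v b" for s p b
    using mult_cnj_self[of p] that by (simp add: cip_linear cip_commute[of b v] mult.assoc del: of_real_power)
  then show ?thesis unfolding inner_fvec_def weighted_cov_def cip_sum_left Re_sum power_mult_distrib
    by (intro sum.cong refl) (simp only:)
qed

text \<open>
  The root mean square of the products \<open>(a\<^sub>j\<^sup>* u) (a\<^sub>j\<^sup>* v)\<close>; it bounds the four-fold averages that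
  appear below by Cauchy-Schwarz.
\<close>

definition pair_avg :: "nat \<Rightarrow> (nat \<Rightarrow> fvec) \<Rightarrow> fvec \<Rightarrow> fvec \<Rightarrow> real" where
  "pair_avg m a u v = L2_set (\<lambda>j. cmod (cip u (a j)) * cmod (cip v (a j))) {..<m} / sqrt m"

lemma pair_avg_nonneg: "pair_avg m a u v \<ge> 0"
  by (simp add: pair_avg_def)

lemma pair_avg_scaleR:
  "pair_avg m a (r *\<^sub>R u) (s *\<^sub>R v) = \<bar>r\<bar> * \<bar>s\<bar> * pair_avg m a u v"
proof -
  have "L2_set (\<lambda>j. cmod (cip (r *\<^sub>R u) (a j)) * cmod (cip (s *\<^sub>R v) (a j))) {..<m}
      = L2_set (\<lambda>j. (\<bar>r\<bar> * \<bar>s\<bar>) * (cmod (cip u (a j)) * cmod (cip v (a j)))) {..<m}"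
    by (simp add: cip_linear norm_mult mult_ac)
  then show ?thesis by (simp add: pair_avg_def L2_set_right_distrib[symmetric])
qed

lemma pair_avg_sq: "(pair_avg m a u v)\<^sup>2 = (\<Sum>j<m. (cmod (cip u (a j)) * cmod (cip v (a j)))\<^sup>2) / m"
  by (simp add: pair_avg_def power_divide L2_set_def sum_nonneg)

lemma pair_avg_cauchy_schwarz:
  "(\<Sum>j<m. (cmod (cip u (a j)) * cmod (cip v (a j))) * (cmod (cip p (a j)) * cmod (cip q (a j)))) / m
    \<le> pair_avg m a u v * pair_avg m a p q"
proof -
  let ?f = "\<lambda>j. cmod (cip u (a j)) * cmod (cip v (a j))" and ?g = "\<lambda>j. cmod (cip p (a j)) * cmod (cip q (a j))"
  have "(\<Sum>j<m. ?f j * ?g j) \<le> L2_set ?f {..<m} * L2_set ?g {..<m}"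
    using L2_set_mult_ineq[of ?f ?g "{..<m}"] by simp
  then have "(\<Sum>j<m. ?f j * ?g j) / m \<le> L2_set ?f {..<m} * L2_set ?g {..<m} / m"
    by (rule divide_right_mono) simp
  also have "\<dots> = pair_avg m a u v * pair_avg m a p q"
    by (simp add: pair_avg_def)
  finally show ?thesis .
qed

definition re_avg :: "nat \<Rightarrow> (nat \<Rightarrow> fvec) \<Rightarrow> fvec \<Rightarrow> fvec \<Rightarrow> real" where
  "re_avg m a u v = (\<Sum>j<m. (Re (cnj (cip u (a j)) * cip v (a j)))\<^sup>2) / m"

lemma re_avg_scaleR: "re_avg m a (r *\<^sub>R u) (s *\<^sub>R v) = r\<^sup>2 * s\<^sup>2 * re_avg m a u v"
proof -
  have "(Re (cnj (cip (r *\<^sub>R u) b) * cip (s *\<^sub>R v) b))\<^sup>2 = r\<^sup>2 * s\<^sup>2 * (Re (cnj (cip u b) * cip v b))\<^sup>2" for b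
  proof -
    have "Re (cnj (cip (r *\<^sub>R u) b) * cip (s *\<^sub>R v) b) = r * s * Re (cnj (cip u b) * cip v b)"
      by (simp add: cip_linear algebra_simps)
    then show ?thesis by (simp add: power_mult_distrib)
  qed
  then show ?thesis unfolding re_avg_def by (simp add: sum_distrib_left mult_ac)
qed

section \<open>Samples on which the method is analysed\<close>

text \<open>
  The parameters are as follows: \<open>R\<close> bounds the sample vectors, \<open>B\<close> is the level at which products are cut off
  and the bound for incoherent vectors, \<open>\<rho>\<close> measures the total excess over \<open>B\<close> uniformly over the unit
  ball, and \<open>\<tau>\<close> is the error of the averages. The main terms of \<open>re_lower\<close> and \<open>trunc_upper\<close> are
  the exact Gaussian expectations. The two averages are treated differently because sums of nonnegative
  variables concentrate from below without any cut-off.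
\<close>

locale regular_sample =
  fixes n m :: nat and a :: "nat \<Rightarrow> fvec" and x :: fvec and R B \<rho> \<tau> :: real
  assumes m_pos: "m > 0"
    and a_fspace [simp, intro]: "a j \<in> fspace n"
    and x_fspace [simp, intro]: "x \<in> fspace n" and norm_x [simp]: "norm x = 1"
    and B_nonneg: "B \<ge> 0" and rho_nonneg: "\<rho> \<ge> 0" and tau_pos: "0 < \<tau>" and tau_small: "\<tau> \<le> 1/10^8"
    and B_rho: "2 * B * \<rho> \<le> \<tau>" and B_R: "B \<le> 2 * R"
    and norm_a: "j < m \<Longrightarrow> norm (a j) \<le> R"
    and x_incoherent: "j < m \<Longrightarrow> cmod (cip x (a j)) \<le> B"
    and excess: "u \<in> fspace n \<Longrightarrow> norm u \<le> 1 \<Longrightarrow>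
        (\<Sum>j<m. (max 0 (cmod (cip u (a j)) - B))\<^sup>2) \<le> \<rho>\<^sup>2 * m"
    and re_lower: "u \<in> fspace n \<Longrightarrow> v \<in> fspace n \<Longrightarrow> norm u = 1 \<Longrightarrow> norm v = 1 \<Longrightarrow>
        re_avg m a u v \<ge> (1 + 3 * (Re (cip u v))\<^sup>2 - (Im (cip u v))\<^sup>2) / 2 - \<tau>"
    and trunc_upper: "u \<in> fspace n \<Longrightarrow> v \<in> fspace n \<Longrightarrow> norm u = 1 \<Longrightarrow> norm v = 1 \<Longrightarrow>
        (\<Sum>j<m. (min (cmod (cip u (a j))) B * min (cmod (cip v (a j))) B)\<^sup>2) / m \<le> 1 + (cmod (cip u v))\<^sup>2 + \<tau>"
begin

lemma R_nonneg: "R \<ge> 0"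
  using norm_a[OF m_pos] norm_ge_zero order_trans by blast

text \<open>
  If \<open>v\<close> is incoherent, the excess of \<open>u\<close> is multiplied by factors of size at most \<open>b\<close>, and that of \<open>v\<close> by factors cut
  off at \<open>B\<close>; both are small in mean square. What remains is the truncated average.
\<close>

lemma pair_avg_unit:
  assumes uv: "u \<in> fspace n" "v \<in> fspace n" "norm u = 1" "norm v = 1"
    and b: "\<And>j. j < m \<Longrightarrow> cmod (cip v (a j)) \<le> b"
  shows "pair_avg m a u v \<le> sqrt (1 + (cmod (cip u v))\<^sup>2 + \<tau>) + (B + b) * \<rho>"
proof -
  define p q where "p j = cmod (cip u (a j))" and "q j = cmod (cip v (a j))" for j
  have pq: "p j \<ge> 0" "q j \<ge> 0" for j by (simp_all add: p_def q_def)
  have qb: "q j \<le> b" if "j < m" for j using b that by (simp add: q_def)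
  have b0: "b \<ge> 0" using qb[OF m_pos] pq(2)[of 0] by linarith
  have split: "p j * q j \<le> min (p j) B * min (q j) B + B * max 0 (q j - B) + b * max 0 (p j - B)" if "j < m" for j
  proof -
    have 1: "p j = min (p j) B + max 0 (p j - B)" "q j = min (q j) B + max 0 (q j - B)" by auto
    have "p j * q j = min (p j) B * q j + max 0 (p j - B) * q j" by (subst 1(1)) (rule distrib_right)
    also have "min (p j) B * q j = min (p j) B * min (q j) B + min (p j) B * max 0 (q j - B)"
      by (subst (1) 1(2)) (rule distrib_left)
    also have "min (p j) B * max 0 (q j - B) \<le> B * max 0 (q j - B)" by (intro mult_right_mono) auto
    also have "max 0 (p j - B) * q j \<le> b * max 0 (p j - B)"
      using qb[OF that] by (subst mult.commute) (intro mult_right_mono, auto)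
    finally show ?thesis by linarith
  qed
  have "L2_set (\<lambda>j. p j * q j) {..<m}
      \<le> L2_set (\<lambda>j. min (p j) B * min (q j) B + B * max 0 (q j - B) + b * max 0 (p j - B)) {..<m}"
    using split pq by (intro L2_set_mono) auto
  also have "\<dots> \<le> L2_set (\<lambda>j. min (p j) B * min (q j) B) {..<m}
       + L2_set (\<lambda>j. B * max 0 (q j - B)) {..<m} + L2_set (\<lambda>j. b * max 0 (p j - B)) {..<m}"
    by (intro order_trans[OF L2_set_triangle_ineq] add_right_mono L2_set_triangle_ineq)
  also have "L2_set (\<lambda>j. min (p j) B * min (q j) B) {..<m} \<le> sqrt ((1 + (cmod (cip u v))\<^sup>2 + \<tau>) * m)"
    unfolding L2_set_def p_def q_def using trunc_upper[OF uv] m_pos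
    by (intro real_sqrt_le_mono) (simp add: field_simps)
  also have "L2_set (\<lambda>j. B * max 0 (q j - B)) {..<m} \<le> B * (\<rho> * sqrt m)"
  proof -
    have "L2_set (\<lambda>j. max 0 (q j - B)) {..<m} \<le> sqrt (\<rho>\<^sup>2 * m)"
      unfolding L2_set_def q_def using excess[of v] uv by (intro real_sqrt_le_mono) simp
    then show ?thesis using B_nonneg rho_nonneg
      by (simp add: L2_set_right_distrib[symmetric] real_sqrt_mult mult_left_mono)
  qed
  also have "L2_set (\<lambda>j. b * max 0 (p j - B)) {..<m} \<le> b * (\<rho> * sqrt m)"
  proof -
    have "L2_set (\<lambda>j. max 0 (p j - B)) {..<m} \<le> sqrt (\<rho>\<^sup>2 * m)"
      unfolding L2_set_def p_def using excess[of u] uv by (intro real_sqrt_le_mono) simp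
    then show ?thesis using b0 rho_nonneg
      by (simp add: L2_set_right_distrib[symmetric] real_sqrt_mult mult_left_mono)
  qed
  finally have "L2_set (\<lambda>j. p j * q j) {..<m} \<le> (sqrt (1 + (cmod (cip u v))\<^sup>2 + \<tau>) + (B + b) * \<rho>) * sqrt m"
    unfolding real_sqrt_mult by (simp add: algebra_simps)
  then show ?thesis using m_pos by (simp add: pair_avg_def p_def q_def field_simps)
qed

text \<open>
  The constant \<open>1.42\<close> is slightly more than \<open>sqrt 2\<close>, the value for parallel \<open>u\<close> and \<open>v\<close>.
\<close>

lemma pair_avg_le:
  assumes uv: "u \<in> fspace n" "v \<in> fspace n"
    and b: "\<And>j. j < m \<Longrightarrow> cmod (cip v (a j)) \<le> b"
  shows "pair_avg m a u v \<le> norm u * (1.42 * norm v + (B * norm v + b) * \<rho>)"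
proof (cases "u = 0 \<or> v = 0")
  case True
  moreover have "b \<ge> 0" using b[OF m_pos] norm_ge_zero order_trans by blast
  ultimately show ?thesis using rho_nonneg by (auto simp: pair_avg_def L2_set_def)
next
  case False
  define u' v' where "u' = (1 / norm u) *\<^sub>R u" and "v' = (1 / norm v) *\<^sub>R v"
  have n1: "norm u' = 1" "norm v' = 1" using False by (simp_all add: u'_def v'_def)
  have e: "u = norm u *\<^sub>R u'" "v = norm v *\<^sub>R v'" using False by (simp_all add: u'_def v'_def)
  have "cmod (cip v' (a j)) \<le> b / norm v" if "j < m" for j
    using b[OF that] False by (simp add: v'_def cip_linear norm_divide divide_right_mono)
  then have "pair_avg m a u' v' \<le> sqrt (1 + (cmod (cip u' v'))\<^sup>2 + \<tau>) + (B + b / norm v) * \<rho>"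
    using uv n1 by (intro pair_avg_unit) (auto simp: u'_def v'_def)
  also have "sqrt (1 + (cmod (cip u' v'))\<^sup>2 + \<tau>) \<le> 1.42"
  proof (rule real_le_lsqrt)
    have "(cmod (cip u' v'))\<^sup>2 \<le> 1" using cmod_cip_le[of u' v'] n1 by (simp add: power_le_one)
    then show "1 + (cmod (cip u' v'))\<^sup>2 + \<tau> \<le> 1.42\<^sup>2" using tau_small by (simp add: power2_eq_square)
  qed simp
  finally have "norm u * norm v * pair_avg m a u' v' \<le> norm u * norm v * (1.42 + (B + b / norm v) * \<rho>)"
    by (intro mult_left_mono) auto
  also have "\<dots> = norm u * (1.42 * norm v + (B * norm v + b) * \<rho>)"
    using False by (simp add: field_simps)
  also have "norm u * norm v * pair_avg m a u' v' = pair_avg m a u v"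
    using pair_avg_scaleR[of m a "norm u" u' "norm v" v'] e by simp
  finally show ?thesis .
qed

text \<open>
  The average can vanish only when \<open>v\<close> is a real multiple of \<open>\<i> * u\<close>, the direction of the phase symmetry; the
  subtracted term accounts for this direction.
\<close>

lemma re_avg_ge:
  assumes uv: "u \<in> fspace n" "v \<in> fspace n"
  shows "re_avg m a u v \<ge> (1/2 - \<tau>) * (norm u * norm v)\<^sup>2 - (Im (cip v u))\<^sup>2 / 2"
proof (cases "u = 0 \<or> v = 0")
  case True
  then show ?thesis by (auto simp: re_avg_def)
next
  case False
  define u' v' where "u' = (1 / norm u) *\<^sub>R u" and "v' = (1 / norm v) *\<^sub>R v"
  have n1: "norm u' = 1" "norm v' = 1" using False by (simp_all add: u'_def v'_def)
  have e: "u = norm u *\<^sub>R u'" "v = norm v *\<^sub>R v'" using False by (simp_all add: u'_def v'_def)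
  have "re_avg m a u' v' \<ge> (1 + 3 * (Re (cip u' v'))\<^sup>2 - (Im (cip u' v'))\<^sup>2) / 2 - \<tau>"
    using uv n1 by (intro re_lower) (auto simp: u'_def v'_def)
  then have "re_avg m a u' v' \<ge> 1/2 - \<tau> - (Im (cip u' v'))\<^sup>2 / 2"
    using zero_le_power2[of "Re (cip u' v')"] by argo
  then have "(norm u)\<^sup>2 * (norm v)\<^sup>2 * re_avg m a u' v' \<ge> (norm u)\<^sup>2 * (norm v)\<^sup>2 * (1/2 - \<tau> - (Im (cip u' v'))\<^sup>2 / 2)"
    by (intro mult_left_mono) auto
  moreover have "(norm u)\<^sup>2 * (norm v)\<^sup>2 * re_avg m a u' v' = re_avg m a u v"
    using re_avg_scaleR[of m a "norm u" u' "norm v" v'] e by simp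
  moreover have "(norm u)\<^sup>2 * (norm v)\<^sup>2 * (Im (cip u' v'))\<^sup>2 = (Im (cip v u))\<^sup>2"
    using False cip_commute[of v u] by (simp add: u'_def v'_def cip_linear power_mult_distrib power_divide)
  ultimately show ?thesis by (simp add: algebra_simps power_mult_distrib)
qed

end

section \<open>One step of the method\<close>

context regular_sample
begin

lemma norm_x_plus:
  assumes "norm h \<le> 2/1000" shows "norm (x + h) \<le> 1.002" "norm (x + h) \<ge> 0.998"
  using norm_triangle_ineq[of x h] norm_triangle_ineq2[of x "- h"] assms by auto

lemma re_avg_ge_near:
  assumes "h \<in> fspace n" "g \<in> fspace n" "norm h \<le> 2/1000"
  shows "re_avg m a (x + h) g \<ge> 49/100 * (norm g)\<^sup>2 - (Im (cip g (x + h)))\<^sup>2 / 2"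
proof -
  have "49/100 \<le> (1/2 - \<tau>) * (0.998 * 0.998)" using tau_small by simp
  also have "\<dots> \<le> (1/2 - \<tau>) * (norm (x + h))\<^sup>2"
    unfolding power2_eq_square using tau_small norm_x_plus[OF assms(3)] by (intro mult_mono mult_left_mono) auto
  finally have "49/100 * (norm g)\<^sup>2 \<le> (1/2 - \<tau>) * (norm (x + h))\<^sup>2 * (norm g)\<^sup>2"
    by (rule mult_right_mono) simp
  then show ?thesis using re_avg_ge[of "x + h" g] assms by (simp add: power_mult_distrib mult.assoc)
qed

text \<open>
  Pairing the normal equations with \<open>g\<close> itself gives
  \<open>2 * (\<Sum>j<m. (r j)\<^sup>2) = (\<Sum>j<m. (cmod (cip h (a j)))\<^sup>2 * r j)\<close> for
  \<open>r j = Re (cnj (cip (x + h) (a j)) * cip g (a j))\<close>. By Cauchy-Schwarz the root mean square of \<open>r\<close> is at most half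
  \<open>pair_avg m a h h\<close>, and it is bounded below by \<open>re_avg_ge\<close>.
\<close>

lemma gn_step_contracts:
  assumes hg: "h \<in> fspace n" "g \<in> fspace n" and h: "norm h \<le> 2/1000"
    and inc: "\<And>j. j < m \<Longrightarrow> cmod (cip h (a j)) \<le> b"
    and eq: "gn_form a {..<m} x h g = 0" and gauge: "Im (cip g (x + h)) = 0"
  shows "norm g \<le> norm h * (1.42 * norm h + (B * norm h + b) * \<rho>)"
proof -
  define r where "r j = Re (cnj (cip (x + h) (a j)) * cip g (a j))" for j
  define c where "c j = cmod (cip h (a j)) * cmod (cip h (a j))" for j
  define T where "T = re_avg m a (x + h) g"
  have T: "T = (\<Sum>j<m. (r j)\<^sup>2) / m" by (simp add: T_def re_avg_def r_def)
  have T0: "T \<ge> 0" unfolding T by (simp add: sum_nonneg)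
  have "(\<Sum>j<m. (2 * r j - c j) * r j) = 0"
    using inner_gn_form[of a "{..<m}" x h g g] eq by (simp add: r_def c_def power2_eq_square)
  then have "2 * (\<Sum>j<m. (r j)\<^sup>2) = (\<Sum>j<m. c j * r j)"
    by (simp add: algebra_simps power2_eq_square sum_subtractf sum_distrib_left)
  also have "\<dots> \<le> L2_set c {..<m} * L2_set r {..<m}"
    by (rule order_trans[OF sum_mono L2_set_mult_ineq]) (simp add: abs_mult[symmetric])
  also have "L2_set c {..<m} = pair_avg m a h h * sqrt m" using m_pos by (simp add: pair_avg_def c_def[abs_def])
  also have "L2_set r {..<m} = sqrt T * sqrt m"
    using m_pos by (simp add: L2_set_def T real_sqrt_mult[symmetric])
  also have "pair_avg m a h h * sqrt m * (sqrt T * sqrt m) = pair_avg m a h h * sqrt T * (sqrt m * sqrt m)"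
    by (simp only: mult_ac)
  also have "sqrt m * sqrt m = m" by simp
  also have "(\<Sum>j<m. (r j)\<^sup>2) = T * m" using m_pos by (simp add: T)
  finally have "2 * (T * m) \<le> pair_avg m a h h * sqrt T * m" .
  then have "2 * T \<le> pair_avg m a h h * sqrt T" using m_pos by simp
  then have "2 * sqrt T * sqrt T \<le> pair_avg m a h h * sqrt T"
    using T0 by (metis mult.assoc real_sqrt_mult_self abs_of_nonneg)
  then have 1: "2 * sqrt T \<le> pair_avg m a h h"
    using T0 pair_avg_nonneg[of m a h h] by (cases "T = 0") (auto simp: mult_le_cancel_right)
  have "49/100 * (norm g)\<^sup>2 \<le> T"
    using re_avg_ge_near[OF hg h] gauge by (simp add: T_def)
  moreover have "(norm g / 2)\<^sup>2 = (norm g)\<^sup>2 / 4" by (simp add: power_divide)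
  ultimately have "(norm g / 2)\<^sup>2 \<le> T" using zero_le_power2[of "norm g"] by linarith
  then have "norm g / 2 \<le> sqrt T" by (rule real_le_rsqrt)
  with 1 have "norm g \<le> pair_avg m a h h" by simp
  also have "\<dots> \<le> norm h * (1.42 * norm h + (B * norm h + b) * \<rho>)"
    by (rule pair_avg_le[OF hg(1) hg(1) inc])
  finally show ?thesis .
qed

text \<open>
  The influence of a single sample on an average over all of them.
\<close>

definition sample_err :: real where
  "sample_err = 40 * B ^ 3 * R / m"

lemma sample_err_nonneg: "sample_err \<ge> 0"
  using B_nonneg R_nonneg by (simp add: sample_err_def)

text \<open>
  The step is a contraction with respect to its base point. Pair both normal equations with the
  difference \<open>e = g - g'\<close> and subtract: the quadratic form at \<open>x + h'\<close> applied to \<open>e\<close> equals a sum of terms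
  that are linear in \<open>h - h'\<close> and have a further small factor \<open>h\<close>, \<open>h'\<close> or \<open>g\<close>, plus the term of
  the sample \<open>l\<close>, plus the defect of the approximate equations. Here \<open>bg\<close> is any bound for the incoherence of \<open>g\<close>; it
  enters multiplied by \<open>\<rho>\<close>, so that \<open>iterates_converge\<close> can absorb it afterwards.
\<close>

lemma gn_step_leave_one_out:
  fixes \<eta> bg :: real
  assumes V: "h \<in> fspace n" "h' \<in> fspace n" "g \<in> fspace n" "g' \<in> fspace n"
    and small: "norm h \<le> 1/1000" "norm h' \<le> 2/1000" "norm g \<le> 1/1000"
    and eq: "gn_form a {..<m} x h g = 0" and gauge: "Im (cip g (x + h)) = 0"
    and l: "l < m"
    and eq': "norm (gn_form a ({..<m} - {l}) x h' g') \<le> \<eta> * m"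
    and gauge': "\<bar>Im (cip g' (x + h'))\<bar> \<le> \<eta>"
    and g'_l: "cmod (cip g' (a l)) \<le> B * norm g'"
    and inc: "\<And>j. j < m \<Longrightarrow> cmod (cip h (a j)) \<le> 3 * B"
      "\<And>j. j < m \<Longrightarrow> cmod (cip h' (a j)) \<le> 3 * B"
      "\<And>j. j < m \<Longrightarrow> cmod (cip g (a j)) \<le> bg"
    and err: "sample_err \<le> 1/100"
  shows "norm (g - g') \<le> 24 * (3/1000 + bg * \<rho> + 3 * B * \<rho>) * norm (h - h') + 4 * \<eta> + 2 * sample_err"
proof -
  define z z' d e where "z = x + h" and "z' = x + h'" and "d = h - h'" and "e = g - g'"
  have V': "z \<in> fspace n" "z' \<in> fspace n" "d \<in> fspace n" "e \<in> fspace n"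
    using V by (simp_all add: z_def z'_def d_def e_def)
  have zd: "z' = z - d" by (simp add: z_def z'_def d_def)
  define s s' st r r' where
    "s j = 2 * Re (cnj (cip z (a j)) * cip g (a j)) - (cmod (cip h (a j)))\<^sup>2" and
    "s' j = 2 * Re (cnj (cip z' (a j)) * cip g (a j)) - (cmod (cip h' (a j)))\<^sup>2" and
    "st j = 2 * Re (cnj (cip z' (a j)) * cip g' (a j)) - (cmod (cip h' (a j)))\<^sup>2" and
    "r j = Re (cnj (cip z (a j)) * cip e (a j))" and
    "r' j = Re (cnj (cip z' (a j)) * cip e (a j))" for j
  have eta0: "\<eta> \<ge> 0" using gauge' abs_ge_zero order_trans by blast
  have B\<rho>: "B * \<rho> \<le> 1/1000" using B_rho tau_small by simp
  have bg0: "bg \<ge> 0" using inc(3)[OF m_pos] norm_ge_zero order_trans by blast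
  have bgr: "bg * \<rho> \<ge> 0" "B * \<rho> \<ge> 0" using bg0 rho_nonneg B_nonneg by auto
  define \<omega> where "\<omega> = 3/1000 + bg * \<rho> + 3 * B * \<rho>"
  have \<omega>0: "\<omega> \<ge> 0" using bgr by (simp add: \<omega>_def)
  have F1: "(\<Sum>j<m. s j * r j) = 0"
    using inner_gn_form[of a "{..<m}" x h g e] eq by (simp add: s_def r_def z_def)
  have F2: "(\<Sum>j\<in>{..<m}-{l}. st j * r' j) = inner (gn_form a ({..<m} - {l}) x h' g') e"
    using inner_gn_form[of a "{..<m}-{l}" x h' g' e] by (simp add: st_def r'_def z'_def)
  have F2': "\<bar>\<Sum>j\<in>{..<m}-{l}. st j * r' j\<bar> \<le> \<eta> * m * norm e"
    unfolding F2 using mult_right_mono[OF eq', of "norm e"]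
    by (intro order_trans[OF Cauchy_Schwarz_ineq2]) auto
  have F3: "st j = s' j - 2 * r' j" for j
    by (simp add: st_def s'_def r'_def e_def cip_linear algebra_simps)
  have F4: "(\<Sum>j<m. st j * r' j) = (\<Sum>j\<in>{..<m}-{l}. st j * r' j) + st l * r' l"
    using l by (subst sum.remove[of _ l]) auto
  have "2 * (\<Sum>j<m. (r' j)\<^sup>2) = (\<Sum>j<m. s' j * r' j) - (\<Sum>j<m. st j * r' j)"
    unfolding F3 by (simp add: algebra_simps power2_eq_square sum_subtractf sum_distrib_left)
  also have "\<dots> = (\<Sum>j<m. s' j * r' j - s j * r j) - ((\<Sum>j\<in>{..<m}-{l}. st j * r' j) + st l * r' l)"
    unfolding F4 sum_subtractf F1 by simp
  finally have main: "2 * (\<Sum>j<m. (r' j)\<^sup>2) \<le> (\<Sum>j<m. \<bar>s' j * r' j - s j * r j\<bar>) + \<eta> * m * norm e + \<bar>st l * r' l\<bar>"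
    using F2' sum_abs[of "\<lambda>j. s' j * r' j - s j * r j" "{..<m}"] by linarith
  \<comment> \<open>\<open>W\<close> collects the products, each with one factor \<open>d\<close> and one factor \<open>e\<close>, which arise from
    replacing \<open>h\<close> by \<open>h'\<close> in one place at a time.\<close>
  let ?c = "\<lambda>v j. cmod (cip v (a j))"
  define W where "W j = 2 * (?c e j * ?c z' j * (?c d j * ?c g j)) + ?c e j * ?c z' j * (?c d j * ?c h j)
     + ?c e j * ?c z' j * (?c d j * ?c h' j) + 2 * (?c e j * ?c z j * (?c d j * ?c g j))
     + ?c e j * ?c h j * (?c d j * ?c h j)" for j
  have W: "\<bar>s' j * r' j - s j * r j\<bar> \<le> W j" for j
  proof -
    have re: "\<bar>Re (cnj p * q)\<bar> \<le> cmod p * cmod q" for p q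
      using abs_Re_le_cmod[of "cnj p * q"] by (simp add: norm_mult)
    have "s' j - s j = - 2 * Re (cnj (cip d (a j)) * cip g (a j)) + ((?c h j)\<^sup>2 - (?c h' j)\<^sup>2)"
      by (simp add: s'_def s_def zd cip_linear algebra_simps)
    moreover have "(?c h j)\<^sup>2 - (?c h' j)\<^sup>2 = (?c h j - ?c h' j) * (?c h j + ?c h' j)"
      by (simp add: power2_eq_square algebra_simps)
    moreover have "\<bar>?c h j - ?c h' j\<bar> \<le> ?c d j"
      using norm_triangle_ineq3[of "cip h (a j)" "cip h' (a j)"] by (simp add: d_def cip_linear)
    then have "\<bar>(?c h j - ?c h' j) * (?c h j + ?c h' j)\<bar> \<le> ?c d j * (?c h j + ?c h' j)"
      by (simp add: abs_mult mult_right_mono)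
    ultimately have 1: "\<bar>s' j - s j\<bar> \<le> ?c d j * (2 * ?c g j + ?c h j + ?c h' j)"
      using re[of "cip d (a j)" "cip g (a j)"] by (simp add: algebra_simps)
    have 2: "\<bar>r' j\<bar> \<le> ?c z' j * ?c e j" unfolding r'_def by (rule re)
    have "\<bar>s j\<bar> \<le> 2 * (?c z j * ?c g j) + (?c h j)\<^sup>2"
      using re[of "cip z (a j)" "cip g (a j)"] zero_le_power2[of "?c h j"] unfolding s_def by linarith
    moreover have "r' j - r j = - Re (cnj (cip d (a j)) * cip e (a j))"
      by (simp add: r'_def r_def zd cip_linear algebra_simps)
    then have "\<bar>r' j - r j\<bar> \<le> ?c d j * ?c e j" using re[of "cip d (a j)" "cip e (a j)"] by simp
    ultimately have 3: "\<bar>s j\<bar> * \<bar>r' j - r j\<bar> \<le> (2 * (?c z j * ?c g j) + (?c h j)\<^sup>2) * (?c d j * ?c e j)"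
      by (intro mult_mono) auto
    have "s' j * r' j - s j * r j = (s' j - s j) * r' j + s j * (r' j - r j)" by (simp add: algebra_simps)
    then have "\<bar>s' j * r' j - s j * r j\<bar> \<le> \<bar>s' j - s j\<bar> * \<bar>r' j\<bar> + \<bar>s j\<bar> * \<bar>r' j - r j\<bar>"
      by (metis abs_mult abs_triangle_ineq)
    also have "\<dots> \<le> ?c d j * (2 * ?c g j + ?c h j + ?c h' j) * (?c z' j * ?c e j)
        + (2 * (?c z j * ?c g j) + (?c h j)\<^sup>2) * (?c d j * ?c e j)"
      by (rule add_mono[OF mult_mono[OF 1 2] 3]) auto
    also have "\<dots> = W j" by (simp add: W_def power2_eq_square algebra_simps)
    finally show ?thesis .
  qed
  have az: "?c v j \<le> 4 * B" if "j < m" "v = z \<or> v = z'" for j v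
  proof -
    have "?c (x + u) j \<le> ?c x j + ?c u j" for u by (simp add: cip_linear norm_triangle_ineq)
    from this[of h] this[of h'] show ?thesis
      using that inc(1,2)[OF that(1)] x_incoherent[OF that(1)] by (auto simp: z_def z'_def)
  qed
  have Qz: "pair_avg m a e v \<le> 1.6 * norm e" if v: "v = z \<or> v = z'" for v
  proof -
    have nv: "norm v \<le> 1.002" using v norm_x_plus(1) small by (auto simp: z_def z'_def)
    have "pair_avg m a e v \<le> norm e * (1.42 * norm v + (B * norm v + 4 * B) * \<rho>)"
      using v V' az by (intro pair_avg_le) auto
    also have "\<dots> \<le> norm e * (1.42 * 1.002 + (B * 1.002 + 4 * B) * \<rho>)"
      using nv B_nonneg rho_nonneg by (intro mult_left_mono add_mono mult_right_mono) auto
    also have "\<dots> \<le> norm e * 1.6" using B\<rho> by (intro mult_left_mono) (auto simp: algebra_simps)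
    finally show ?thesis by simp
  qed
  have Qh: "pair_avg m a u v \<le> norm u * \<omega>" if v: "v = h \<or> v = h' \<or> v = g" and u: "u \<in> fspace n" for u v
  proof -
    have nv: "norm v \<le> 2/1000" using v small by auto
    define b where "b = (if v = g then bg else 3 * B)"
    have b: "b * \<rho> \<le> bg * \<rho> + 3 * (B * \<rho>)" using bgr by (auto simp: b_def)
    have "pair_avg m a u v \<le> norm u * (1.42 * norm v + (B * norm v + b) * \<rho>)"
      using u v V inc by (intro pair_avg_le) (auto simp: b_def)
    also have "\<dots> \<le> norm u * (1.42 * (2/1000) + (B * (2/1000) + b) * \<rho>)"
      using nv B_nonneg rho_nonneg by (intro mult_left_mono add_mono mult_right_mono) auto
    also have "\<dots> \<le> norm u * \<omega>" unfolding \<omega>_def using B\<rho> b by (intro mult_left_mono) (auto simp: algebra_simps)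
    finally show ?thesis .
  qed
  have \<omega>1: "pair_avg m a e h \<le> norm e"
  proof -
    have "pair_avg m a e h \<le> norm e * (1.42 * norm h + (B * norm h + 3 * B) * \<rho>)"
      using V V' inc by (intro pair_avg_le) auto
    also have "\<dots> \<le> norm e * (1.42 * (2/1000) + (B * (2/1000) + 3 * B) * \<rho>)"
      using small B_nonneg rho_nonneg by (intro mult_left_mono add_mono mult_right_mono) auto
    also have "\<dots> \<le> norm e * 1" using B\<rho> by (intro mult_left_mono) (auto simp: algebra_simps)
    finally show ?thesis by simp
  qed
  define P where "P u v p q = (\<Sum>j<m. (?c u j * ?c v j) * (?c p j * ?c q j)) / m" for u v p q
  have P: "P e v d q \<le> 1.6 * norm e * (norm d * \<omega>)" if "v = z \<or> v = z'" "q = h \<or> q = h' \<or> q = g" for v q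
    unfolding P_def using that Qz Qh V' pair_avg_nonneg[of m a]
    by (intro order_trans[OF pair_avg_cauchy_schwarz] mult_mono) auto
  have Ph: "P e h d h \<le> norm e * (norm d * \<omega>)"
    unfolding P_def using \<omega>1 Qh V' pair_avg_nonneg[of m a]
    by (intro order_trans[OF pair_avg_cauchy_schwarz] mult_mono) auto
  have "(\<Sum>j<m. \<bar>s' j * r' j - s j * r j\<bar>) / m \<le> (\<Sum>j<m. W j) / m"
    using W by (intro divide_right_mono sum_mono) auto
  also have "\<dots> = 2 * P e z' d g + P e z' d h + P e z' d h' + 2 * P e z d g + P e h d h"
    by (simp add: W_def P_def sum.distrib sum_distrib_left[symmetric] add_divide_distrib)
  also have "\<dots> \<le> 11 * \<omega> * norm e * norm d"
  proof -
    have "0 \<le> norm e * (norm d * \<omega>)" using \<omega>0 by simp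
    then show ?thesis using P[of z' g] P[of z' h] P[of z' h'] P[of z g] Ph by (simp add: mult_ac)
  qed
  finally have bil: "(\<Sum>j<m. \<bar>s' j * r' j - s j * r j\<bar>) \<le> 11 * \<omega> * norm e * norm d * m"
    using m_pos by (simp add: field_simps)
  \<comment> \<open>The sample left out occurs once, and \<open>g'\<close> and \<open>h'\<close> are incoherent with it.\<close>
  have sl: "\<bar>st l * r' l\<bar> \<le> sample_err * m * (norm e + (norm e)\<^sup>2)"
  proof -
    have g': "norm g' \<le> 1/1000 + norm e" using small(3) norm_triangle_ineq4[of g e] by (simp add: e_def)
    have re: "\<bar>Re (cnj p * q)\<bar> \<le> cmod p * cmod q" for p q
      using abs_Re_le_cmod[of "cnj p * q"] by (simp add: norm_mult)
    have "\<bar>Re (cnj (cip z' (a l)) * cip g' (a l))\<bar> \<le> (4 * B) * (B * norm g')"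
      using az[OF l] g'_l B_nonneg by (intro order_trans[OF re] mult_mono) auto
    moreover have "(?c h' l)\<^sup>2 \<le> (3 * B)\<^sup>2" using inc(2)[OF l] by (intro power_mono) auto
    ultimately have "\<bar>st l\<bar> \<le> 2 * ((4 * B) * (B * norm g')) + (3 * B)\<^sup>2"
      using zero_le_power2[of "?c h' l"] unfolding st_def by linarith
    also have "\<dots> \<le> 2 * ((4 * B) * (B * (1/1000 + norm e))) + (3 * B)\<^sup>2"
      using g' B_nonneg by (intro add_right_mono mult_left_mono) auto
    also have "\<dots> \<le> B\<^sup>2 * (10 * (1 + norm e))"
      using B_nonneg by (simp add: power2_eq_square algebra_simps)
    finally have 1: "\<bar>st l\<bar> \<le> B\<^sup>2 * (10 * (1 + norm e))" .
    have "?c e l \<le> norm e * R" using cmod_cip_le[of e "a l"] norm_a[OF l] mult_left_mono[of "norm (a l)" R "norm e"] by simp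
    then have "\<bar>r' l\<bar> \<le> (4 * B) * (norm e * R)"
      unfolding r'_def using az[OF l] B_nonneg by (intro order_trans[OF re] mult_mono) auto
    with 1 have "\<bar>st l * r' l\<bar> \<le> (B\<^sup>2 * (10 * (1 + norm e))) * ((4 * B) * (norm e * R))"
      unfolding abs_mult by (intro mult_mono) auto
    also have "\<dots> = sample_err * m * (norm e + (norm e)\<^sup>2)"
      using m_pos by (simp add: sample_err_def power2_eq_square power3_eq_cube algebra_simps)
    finally show ?thesis .
  qed
  have "2 * re_avg m a z' e * m = 2 * (\<Sum>j<m. (r' j)\<^sup>2)"
    using m_pos by (simp add: re_avg_def r'_def)
  also have "\<dots> \<le> 11 * \<omega> * norm e * norm d * m + \<eta> * m * norm e + sample_err * m * (norm e + (norm e)\<^sup>2)"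
    using main bil sl by linarith
  also have "\<dots> = (11 * \<omega> * norm e * norm d + \<eta> * norm e + sample_err * (norm e + (norm e)\<^sup>2)) * m"
    by (simp add: algebra_simps)
  finally have up: "2 * re_avg m a z' e \<le> 11 * \<omega> * norm e * norm d + \<eta> * norm e + sample_err * (norm e + (norm e)\<^sup>2)"
    using m_pos by simp
  have im: "\<bar>Im (cip e z')\<bar> \<le> norm d / 1000 + \<eta>"
  proof -
    have "Im (cip e z') = - Im (cip g d) - Im (cip g' z')"
      using gauge by (simp add: e_def zd cip_linear z_def)
    moreover have "\<bar>Im (cip g d)\<bar> \<le> 1/1000 * norm d"
      using abs_Im_le_cmod[of "cip g d"] cmod_cip_le[of g d] mult_right_mono[OF small(3) norm_ge_zero[of d]] by linarith
    ultimately show ?thesis using gauge' by (simp add: z'_def)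
  qed
  \<comment> \<open>It remains to solve a quadratic inequality for \<open>norm e\<close>.\<close>
  define q where "q = norm d / 1000 + \<eta>"
  have "(Im (cip e z'))\<^sup>2 \<le> q\<^sup>2" using im by (intro power2_le_iff_abs_le[THEN iffD2]) (auto simp: q_def eta0)
  moreover have "49/100 * (norm e)\<^sup>2 - (Im (cip e z'))\<^sup>2 / 2 \<le> re_avg m a z' e"
    unfolding z'_def using V V' small by (intro re_avg_ge_near) auto
  moreover have "sample_err * (norm e)\<^sup>2 \<le> 1/100 * (norm e)\<^sup>2" using err by (intro mult_right_mono) auto
  ultimately have quad: "97/100 * (norm e)\<^sup>2 \<le> (11 * \<omega> * norm d + \<eta> + sample_err) * norm e + q\<^sup>2"
    using up by (simp add: algebra_simps)
  define p where "p = 11 * \<omega> * norm d + \<eta> + sample_err"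
  have p0: "p \<ge> 0" "q \<ge> 0" using \<omega>0 eta0 sample_err_nonneg by (simp_all add: p_def q_def)
  have "norm e \<le> 2 * p + 2 * q"
  proof (rule ccontr)
    assume "\<not> ?thesis"
    then have lt: "norm e > 2 * p + 2 * q" by simp
    then have e0: "norm e > 0" using p0 by linarith
    have "p * norm e \<le> (norm e / 2 - q) * norm e" using lt e0 by (intro mult_right_mono) auto
    moreover have "q * q \<le> q * (norm e / 2)" using lt p0 by (intro mult_left_mono) auto
    moreover have "q * norm e \<ge> 0" using p0 by simp
    ultimately have "p * norm e + q\<^sup>2 \<le> (norm e)\<^sup>2 / 2" by (simp add: power2_eq_square algebra_simps)
    then have "97/100 * (norm e)\<^sup>2 \<le> (norm e)\<^sup>2 / 2" using quad unfolding p_def by linarith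
    then show False using zero_less_power[OF e0, of 2] by linarith
  qed
  also have "\<dots> \<le> 24 * \<omega> * norm d + 4 * \<eta> + 2 * sample_err"
  proof -
    have "3/1000 * norm d \<le> \<omega> * norm d" using bgr by (intro mult_right_mono) (auto simp: \<omega>_def)
    then have "norm d / 1000 \<le> \<omega> * norm d" using norm_ge_zero[of d] by linarith
    then show ?thesis by (simp add: p_def q_def)
  qed
  finally show ?thesis by (simp add: e_def d_def \<omega>_def)
qed

end

context regular_sample
begin

section \<open>The spectral initialisation\<close>

lemma weighted_cov_upper:
  assumes v: "v \<in> fspace n" and J: "J \<subseteq> {..<m}"
  shows "inner (weighted_cov a J x v) v \<le> ((1 + 5 * \<tau>) * (norm v)\<^sup>2 + (cmod (cip v x))\<^sup>2) * m"
proof (cases "v = 0")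
  case True
  then show ?thesis by simp
next
  case False
  define u where "u = (1 / norm v) *\<^sub>R v"
  have u: "u \<in> fspace n" "norm u = 1" "v = norm v *\<^sub>R u" using v False by (simp_all add: u_def)
  let ?c = "cmod (cip u x)"
  have "pair_avg m a u x \<le> sqrt (1 + ?c\<^sup>2 + \<tau>) + (B + B) * \<rho>"
    using u x_incoherent by (intro pair_avg_unit) auto
  also have "\<dots> \<le> sqrt (1 + ?c\<^sup>2 + \<tau>) + \<tau>" using B_rho by simp
  finally have "(pair_avg m a u x)\<^sup>2 \<le> (sqrt (1 + ?c\<^sup>2 + \<tau>) + \<tau>)\<^sup>2"
    by (intro power_mono pair_avg_nonneg)
  also have "\<dots> = 1 + ?c\<^sup>2 + \<tau> + 2 * \<tau> * sqrt (1 + ?c\<^sup>2 + \<tau>) + \<tau>\<^sup>2"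
    using tau_pos by (simp add: power2_sum add_nonneg_nonneg)
  also have "\<dots> \<le> 1 + ?c\<^sup>2 + \<tau> + 2 * \<tau> * (3/2) + \<tau>\<^sup>2"
  proof -
    have "?c\<^sup>2 \<le> 1" using cmod_cip_le[of u x] u by (simp add: power_le_one)
    then have "sqrt (1 + ?c\<^sup>2 + \<tau>) \<le> 3/2" using tau_small by (intro real_le_lsqrt) (auto simp: power2_eq_square)
    then show ?thesis using tau_pos by (intro add_right_mono add_left_mono mult_left_mono) auto
  qed
  also have "\<tau>\<^sup>2 \<le> \<tau>" using tau_pos tau_small by (simp add: power2_eq_square mult_le_cancel_left1)
  finally have "(pair_avg m a u x)\<^sup>2 \<le> 1 + 5 * \<tau> + ?c\<^sup>2" by simp
  moreover have "pair_avg m a v x = norm v * pair_avg m a u x"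
    using pair_avg_scaleR[of m a "norm v" u 1 x] u(3) by simp
  ultimately have "(pair_avg m a v x)\<^sup>2 \<le> (norm v)\<^sup>2 * (1 + 5 * \<tau> + ?c\<^sup>2)"
    by (simp add: power_mult_distrib mult_left_mono)
  also have "(norm v)\<^sup>2 * (1 + 5 * \<tau> + ?c\<^sup>2) = (1 + 5 * \<tau>) * (norm v)\<^sup>2 + (cmod (cip v x))\<^sup>2"
  proof -
    have "cip v x = norm v * cip u x" by (subst u(3)) (simp add: cip_linear)
    then show ?thesis by (simp add: norm_mult power_mult_distrib algebra_simps)
  qed
  finally have *: "(pair_avg m a v x)\<^sup>2 * m \<le> ((1 + 5 * \<tau>) * (norm v)\<^sup>2 + (cmod (cip v x))\<^sup>2) * m"
    by (rule mult_right_mono) simp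
  have "inner (weighted_cov a J x v) v \<le> (\<Sum>j<m. (cmod (cip x (a j)) * cmod (cip v (a j)))\<^sup>2)"
    unfolding inner_weighted_cov using J by (intro sum_mono2) auto
  also have "\<dots> = (pair_avg m a v x)\<^sup>2 * m" using m_pos by (simp add: pair_avg_sq mult.commute)
  finally show ?thesis using * by simp
qed

lemma weighted_cov_lower:
  "inner (weighted_cov a {..<m} x x) x \<ge> (2 - \<tau>) * m"
proof -
  have "re_avg m a x x \<ge> 2 - \<tau>" using re_lower[of x x] by (simp add: cip_self_norm)
  moreover have "re_avg m a x x = inner (weighted_cov a {..<m} x x) x / m"
  proof -
    have "Re (cnj p * p) = cmod p * cmod p" for p
      using arg_cong[OF mult_cnj_self[of p], of Re] by (simp only: mult.commute[of "cnj p"] Re_complex_of_real power2_eq_square)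
    then show ?thesis unfolding re_avg_def inner_weighted_cov by simp
  qed
  ultimately show ?thesis using m_pos by (simp add: field_simps)
qed

text \<open>
  The expectation of the weighted covariance, divided by \<open>m\<close>, is \<open>1 + x x\<^sup>*\<close>. If its quadratic form at \<open>z\<close> is nearly the top
  value \<open>2\<close>, then \<open>z\<close> must be nearly parallel to \<open>x\<close>. The lemma serves the full sample as well as the samples with
  one vector left out, because only upper bounds over \<open>J\<close> enter.
\<close>

lemma spectral_close:
  assumes z: "z \<in> fspace n" and J: "J \<subseteq> {..<m}"
    and eig: "weighted_cov a J x z = (2 * real m * (norm z)\<^sup>2) *\<^sub>R z"
    and top: "2 * (norm z)\<^sup>2 \<ge> 2 - 2 * \<tau>"
  shows "norm (align x z - x) \<le> 1/1000"
proof -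
  define \<nu> p where "\<nu> = norm z" and "p = cmod (cip z x)"
  have \<nu>2: "\<nu>\<^sup>2 \<ge> 1 - \<tau>" using top by (simp add: \<nu>_def)
  then have "\<nu> \<noteq> 0" using tau_small by auto
  then have \<nu>0: "\<nu> > 0" by (simp add: \<nu>_def)
  have p: "0 \<le> p" "p \<le> \<nu>" using cmod_cip_le[of z x] by (simp_all add: p_def \<nu>_def)
  have "2 * real m * \<nu>\<^sup>2 * \<nu>\<^sup>2 \<le> ((1 + 5 * \<tau>) * \<nu>\<^sup>2 + p\<^sup>2) * m"
    using weighted_cov_upper[OF z J] unfolding eig by (simp add: \<nu>_def p_def power2_norm_eq_inner)
  then have "m * (2 * \<nu>\<^sup>2 * \<nu>\<^sup>2) \<le> m * ((1 + 5 * \<tau>) * \<nu>\<^sup>2 + p\<^sup>2)" by (simp add: mult_ac)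
  then have main: "2 * \<nu>\<^sup>2 * \<nu>\<^sup>2 \<le> (1 + 5 * \<tau>) * \<nu>\<^sup>2 + p\<^sup>2"
    using m_pos by (simp only: mult_le_cancel_left_pos of_nat_0_less_iff)
  have "p\<^sup>2 \<le> \<nu>\<^sup>2" using p by (intro power_mono)
  with main have "\<nu>\<^sup>2 * (2 * \<nu>\<^sup>2) \<le> \<nu>\<^sup>2 * (2 + 5 * \<tau>)" by (simp add: algebra_simps)
  then have up: "2 * \<nu>\<^sup>2 \<le> 2 + 5 * \<tau>" using \<nu>0 by simp
  have "(\<nu> * (1 - 7 * \<tau>))\<^sup>2 \<le> p\<^sup>2"
  proof -
    have "(1 - 7 * \<tau>) * (1 - 7 * \<tau>) \<le> 1 - 7 * \<tau>" using tau_pos tau_small by (intro mult_left_le) auto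
    then have "\<nu>\<^sup>2 * ((1 - 7 * \<tau>) * (1 - 7 * \<tau>)) \<le> \<nu>\<^sup>2 * (2 * \<nu>\<^sup>2 - 1 - 5 * \<tau>)"
      using \<nu>2 by (intro mult_left_mono) auto
    also have "\<dots> \<le> p\<^sup>2" using main by (simp add: algebra_simps)
    finally show ?thesis by (simp add: power_mult_distrib power2_eq_square mult_ac)
  qed
  then have p_ge: "\<nu> * (1 - 7 * \<tau>) \<le> p" using p(1) by (rule power2_le_imp_le)
  have \<nu>1: "\<bar>\<nu> - 1\<bar> \<le> 5/2 * \<tau>"
  proof -
    have "\<bar>\<nu> - 1\<bar> * 1 \<le> \<bar>\<nu> - 1\<bar> * (\<nu> + 1)" using \<nu>0 by (intro mult_left_mono) auto
    also have "\<dots> = \<bar>(\<nu> - 1) * (\<nu> + 1)\<bar>" using \<nu>0 by (simp add: abs_mult)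
    also have "(\<nu> - 1) * (\<nu> + 1) = \<nu>\<^sup>2 - 1" by (simp add: power2_eq_square algebra_simps)
    also have "\<bar>\<nu>\<^sup>2 - 1\<bar> \<le> 5/2 * \<tau>" using \<nu>2 up tau_pos by linarith
    finally show ?thesis by simp
  qed
  have "(norm (align x z - x))\<^sup>2 = \<nu>\<^sup>2 + 1 - 2 * p"
    unfolding \<nu>_def p_def by (rule norm_align_diff_sq) simp
  also have "\<dots> \<le> \<nu>\<^sup>2 + 1 - 2 * (\<nu> * (1 - 7 * \<tau>))" using p_ge by simp
  also have "\<dots> = (\<nu> - 1)\<^sup>2 + 14 * \<tau> * \<nu>" by (simp add: power2_eq_square algebra_simps)
  also have "\<dots> \<le> (5/2 * \<tau>)\<^sup>2 + 14 * \<tau> * 2"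
  proof (rule add_mono)
    show "(\<nu> - 1)\<^sup>2 \<le> (5/2 * \<tau>)\<^sup>2" using power_mono[OF \<nu>1 abs_ge_zero, of 2] by (simp only: power2_abs)
    show "14 * \<tau> * \<nu> \<le> 14 * \<tau> * 2" proof (rule mult_left_mono)
      show "\<nu> \<le> 2" using \<nu>1 tau_small abs_ge_self[of "\<nu> - 1"] by simp
    qed (use tau_pos in simp)
  qed
  also have "\<dots> \<le> 40 * \<tau>" using tau_pos tau_small by (simp add: power2_eq_square)
  also have "\<dots> \<le> (1/1000)\<^sup>2" using tau_small by (simp add: power2_eq_square)
  finally show ?thesis by (rule power2_le_imp_le) simp
qed

text \<open>
  With \<open>w = x + h'\<close> and \<open>d = h - h'\<close>, the difference of the two eigenvalue equations paired with \<open>d\<close> reads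
  \<open>2 m (norm z ^ 2 norm d ^ 2 + (2 y + norm d ^ 2) y) = d\<^sup>* C d + error\<close> for \<open>y = inner w d\<close>. By
  \<open>weighted_cov_upper\<close> the right hand side is at most about \<open>m (norm d ^ 2 + s ^ 2)\<close> with \<open>s = cmod (cip d x)\<close>, and
  \<open>y\<close> is close to \<open>s\<close> up to the sign, since \<open>d\<close> is real along \<open>x\<close>. So the left hand side
  exceeds this by at least about \<open>m norm d ^ 2\<close>.
\<close>

lemma spectral_leave_one_out:
  fixes \<eta> :: real
  assumes V: "h \<in> fspace n" "h' \<in> fspace n" and small: "norm h \<le> 1/1000" "norm h' \<le> 2/1000"
    and real: "Im (cip h x) = 0" "Im (cip h' x) = 0"
    and eq: "weighted_cov a {..<m} x (x + h) = (2 * real m * (norm (x + h))\<^sup>2) *\<^sub>R (x + h)"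
    and l: "l < m"
    and eq': "norm (weighted_cov a ({..<m} - {l}) x (x + h') - (2 * real m * (norm (x + h'))\<^sup>2) *\<^sub>R (x + h')) \<le> \<eta> * m"
    and h'_l: "cmod (cip h' (a l)) \<le> B * norm h'"
  shows "norm (h - h') \<le> 2 * \<eta> + sample_err"
proof -
  define z w d where "z = x + h" and "w = x + h'" and "d = h - h'"
  have V': "z \<in> fspace n" "w \<in> fspace n" "d \<in> fspace n" using V by (simp_all add: z_def w_def d_def)
  have zd: "z = w + d" by (simp add: z_def w_def d_def)
  define e where "e = weighted_cov a {..<m} x w - (2 * real m * (norm w)\<^sup>2) *\<^sub>R w"
  have e: "norm e \<le> (\<eta> + sample_err / 10) * m"
  proof -
    define t where "t = cmul (of_real ((cmod (cip x (a l)))\<^sup>2) * cip w (a l)) (a l)"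
    have "weighted_cov a {..<m} x w = weighted_cov a ({..<m} - {l}) x w + t"
      using l by (simp add: weighted_cov_def t_def sum.remove[of "{..<m}" l])
    then have "e = (weighted_cov a ({..<m} - {l}) x w - (2 * real m * (norm w)\<^sup>2) *\<^sub>R w) + t" by (simp add: e_def)
    then have "norm e \<le> \<eta> * m + norm t"
      using eq' unfolding w_def by (simp only:) (rule order_trans[OF norm_triangle_ineq], rule add_right_mono)
    moreover have "norm t \<le> (B\<^sup>2 * (B + B)) * R"
    proof -
      have "cmod (cip w (a l)) \<le> B + B * 1"
        using x_incoherent[OF l] h'_l small B_nonneg norm_triangle_ineq[of "cip x (a l)" "cip h' (a l)"]
          mult_left_mono[of "norm h'" 1 B] by (simp add: w_def cip_linear)
      moreover have "(cmod (cip x (a l)))\<^sup>2 \<le> B\<^sup>2" using x_incoherent[OF l] by (intro power_mono) auto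
      ultimately have "(cmod (cip x (a l)))\<^sup>2 * cmod (cip w (a l)) \<le> B\<^sup>2 * (B + B)" by (intro mult_mono) auto
      then show ?thesis unfolding t_def norm_cmul norm_mult
        using norm_a[OF l] B_nonneg by - (rule mult_mono, auto simp: norm_power)
    qed
    moreover have "(B\<^sup>2 * (B + B)) * R \<le> sample_err / 10 * m"
      using m_pos B_nonneg R_nonneg by (simp add: sample_err_def power2_eq_square power3_eq_cube)
    ultimately show ?thesis by (simp add: algebra_simps)
  qed
  define y s where "y = inner w d" and "s = cmod (cip d x)"
  have y_s: "\<bar>y\<bar> \<le> 1.002 * norm d" using Cauchy_Schwarz_ineq2[of w d] norm_x_plus(1)[OF small(2)]
      mult_right_mono[of "norm w" "1.002" "norm d"] by (simp add: y_def w_def)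
  have s: "s \<le> norm d" "s \<ge> 0" using cmod_cip_le[of d x] by (auto simp: s_def)
  have "cip d x = of_real (inner x d)"
    using real by (simp add: complex_eq_iff d_def cip_linear inner_fvec_def cip_commute[of x])
  then have sx: "s = \<bar>inner x d\<bar>" by (simp add: s_def)
  define \<theta> where "\<theta> = inner h' d"
  have \<theta>: "\<bar>\<theta>\<bar> \<le> 2/1000 * norm d"
    using Cauchy_Schwarz_ineq2[of h' d] mult_right_mono[OF small(2), of "norm d"] by (simp add: \<theta>_def)
  have yx: "y = inner x d + \<theta>" by (simp add: y_def w_def inner_add_left \<theta>_def)
  have y2: "y\<^sup>2 \<ge> s\<^sup>2 - 4/1000 * (norm d)\<^sup>2"
  proof -
    have "y\<^sup>2 = s\<^sup>2 + 2 * (inner x d * \<theta>) + \<theta>\<^sup>2" unfolding yx sx by (simp add: power2_eq_square algebra_simps)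
    moreover have "\<bar>inner x d * \<theta>\<bar> \<le> norm d * (2/1000 * norm d)"
      unfolding abs_mult using \<theta> s sx by (intro mult_mono) auto
    then have "\<bar>inner x d * \<theta>\<bar> \<le> 2/1000 * (norm d)\<^sup>2" by (simp add: power2_eq_square)
    ultimately show ?thesis using zero_le_power2[of \<theta>] by linarith
  qed
  have wd: "weighted_cov a {..<m} x d = (2 * real m * (norm z)\<^sup>2) *\<^sub>R z - (2 * real m * (norm w)\<^sup>2) *\<^sub>R w - e"
  proof -
    have "d = z - w" by (simp add: zd)
    then show ?thesis using eq by (simp add: weighted_cov_linear e_def z_def)
  qed
  have nz: "(norm z)\<^sup>2 = (norm w)\<^sup>2 + 2 * y + (norm d)\<^sup>2"
    by (simp add: zd y_def power2_norm_eq_inner inner_add_left inner_add_right inner_commute)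
  have "inner z d = y + (norm d)\<^sup>2" by (simp add: zd y_def inner_add_left power2_norm_eq_inner)
  moreover have "2 * real m * (norm z)\<^sup>2 * y - 2 * real m * (norm w)\<^sup>2 * y = 2 * real m * ((2 * y + (norm d)\<^sup>2) * y)"
    unfolding nz by (simp add: algebra_simps)
  ultimately have inner_wd: "inner (weighted_cov a {..<m} x d) d
      = 2 * real m * ((norm z)\<^sup>2 * (norm d)\<^sup>2 + (2 * y + (norm d)\<^sup>2) * y) - inner e d"
    unfolding wd inner_diff_left inner_scaleR_left y_def[symmetric] by (simp add: algebra_simps)
  have "inner e d \<le> (\<eta> + sample_err / 10) * m * norm d"
    using norm_cauchy_schwarz[of e d] mult_right_mono[OF e, of "norm d"] by simp
  with inner_wd weighted_cov_upper[OF V'(3) subset_refl]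
  have "2 * real m * ((norm z)\<^sup>2 * (norm d)\<^sup>2 + (2 * y + (norm d)\<^sup>2) * y)
     \<le> ((1 + 5 * \<tau>) * (norm d)\<^sup>2 + s\<^sup>2) * m + (\<eta> + sample_err / 10) * m * norm d" by (simp add: s_def)
  then have "m * (2 * ((norm z)\<^sup>2 * (norm d)\<^sup>2 + (2 * y + (norm d)\<^sup>2) * y))
     \<le> m * (((1 + 5 * \<tau>) * (norm d)\<^sup>2 + s\<^sup>2) + (\<eta> + sample_err / 10) * norm d)" by (simp add: algebra_simps)
  then have key: "2 * ((norm z)\<^sup>2 * (norm d)\<^sup>2) + 4 * y\<^sup>2 + 2 * ((norm d)\<^sup>2 * y)
     \<le> (1 + 5 * \<tau>) * (norm d)\<^sup>2 + s\<^sup>2 + (\<eta> + sample_err / 10) * norm d"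
    using m_pos unfolding mult_le_cancel_left_pos[OF m_pos[folded of_nat_0_less_iff[where 'a=real]]]
    by (simp add: algebra_simps power2_eq_square)
  have "99/100 * (norm d)\<^sup>2 \<le> (norm z)\<^sup>2 * (norm d)\<^sup>2"
  proof (rule mult_right_mono)
    have "99/100 \<le> 0.998 * (0.998 :: real)" by simp
    also have "\<dots> \<le> (norm z)\<^sup>2"
      unfolding power2_eq_square using norm_x_plus(2)[of h] small by (intro mult_mono) (auto simp: z_def)
    finally show "99/100 \<le> (norm z)\<^sup>2" .
  qed simp
  moreover have "\<bar>(norm d)\<^sup>2 * y\<bar> \<le> (norm d)\<^sup>2 * (4/1000)"
  proof -
    have "norm d \<le> 3/1000" using small norm_triangle_ineq4[of h h'] by (simp add: d_def)
    then have "\<bar>y\<bar> \<le> 4/1000" using y_s by simp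
    from mult_left_mono[OF this zero_le_power2[of "norm d"]] show ?thesis by (simp add: abs_mult)
  qed
  moreover have "\<tau> * (norm d)\<^sup>2 \<le> 1/1000 * (norm d)\<^sup>2" using tau_small by (intro mult_right_mono) auto
  moreover have "0 \<le> (norm d)\<^sup>2" "0 \<le> y\<^sup>2" by auto
  moreover have "2 * ((norm z)\<^sup>2 * (norm d)\<^sup>2) + 4 * y\<^sup>2 + 2 * ((norm d)\<^sup>2 * y)
     \<le> (norm d)\<^sup>2 + 5 * (\<tau> * (norm d)\<^sup>2) + s\<^sup>2 + (\<eta> + sample_err / 10) * norm d"
    using key by (simp add: algebra_simps)
  ultimately have "(norm d)\<^sup>2 / 2 \<le> (\<eta> + sample_err / 10) * norm d"
    using y2 by (simp only: abs_le_iff) linarith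
  then have "norm d * (norm d / 2) \<le> norm d * (\<eta> + sample_err / 10)" by (simp add: power2_eq_square mult_ac)
  moreover have "0 \<le> \<eta> * m" using order_trans[OF norm_ge_zero eq'] .
  then have "0 \<le> \<eta>" using m_pos by (simp add: zero_le_mult_iff)
  ultimately have "norm d / 2 \<le> \<eta> + sample_err / 10"
    using sample_err_nonneg by (cases "norm d = 0") auto
  then show ?thesis using sample_err_nonneg by (simp add: d_def)
qed

text \<open>
  This makes the kernel of the Gauss-Newton matrix one-dimensional.
\<close>

lemma kernel_trivial:
  assumes "z \<in> fspace n" "z \<noteq> 0" "u \<in> fspace n"
    and ker: "\<And>j. j < m \<Longrightarrow> Re (cnj (cip z (a j)) * cip u (a j)) = 0"
  shows "\<exists>t. u = cmul (\<i> * of_real t) z"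
proof -
  define t where "t = Im (cip u z) / (norm z)\<^sup>2"
  define v where "v = u - cmul (\<i> * of_real t) z"
  have "v \<in> fspace n" using assms by (simp add: v_def)
  have "Re (cnj (cip z (a j)) * cip v (a j)) = 0" if "j < m" for j
    using ker[OF that] by (simp add: v_def cip_linear algebra_simps)
  then have "re_avg m a z v = 0" by (simp add: re_avg_def)
  moreover have "Im (cip v z) = 0"
    using assms(2) by (simp add: v_def cip_linear cip_self_norm t_def)
  ultimately have "(1/2 - \<tau>) * (norm z * norm v)\<^sup>2 \<le> 0"
    using re_avg_ge[OF assms(1) \<open>v \<in> fspace n\<close>] by simp
  then have "v = 0" using tau_small assms(2) by (auto simp: mult_le_0_iff)
  then show ?thesis by (auto simp: v_def)
qed


end

section \<open>The iterates in an aligned frame\<close>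

text \<open>
  The update from \<open>z\<close> to \<open>z'\<close>, before alignment: the normal equations for \<open>z - z'\<close>, of which the minimal-norm solution
  is the one orthogonal to the direction \<open>\<i> * z\<close>.
\<close>

definition gn_relation :: "nat \<Rightarrow> (nat \<Rightarrow> fvec) \<Rightarrow> fvec \<Rightarrow> fvec \<Rightarrow> fvec \<Rightarrow> bool" where
  "gn_relation m a x z z' \<longleftrightarrow>
     (\<Sum>j<m. cmul (of_real (2 * Re (cnj (cip z (a j)) * cip (z - z') (a j))
        - ((cmod (cip z (a j)))\<^sup>2 - (cmod (cip x (a j)))\<^sup>2)) * cip z (a j)) (a j)) = 0 \<and>
     Im (cip (z - z') z) = 0"

text \<open>
  Let \<open>p = a\<^sup>* z\<close> and \<open>q = a\<^sup>* x\<close>. As \<open>|q|\<^sup>2 = |p|\<^sup>2 + 2 Re (cnj p (q - p)) + |q - p|\<^sup>2\<close> exactly, the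
  residual \<open>|p|\<^sup>2 - |q|\<^sup>2\<close> of the equation for \<open>z - z'\<close> turns into the quadratic error \<open>|q - p|\<^sup>2\<close> when the update
  is measured from \<open>x\<close> instead of \<open>z\<close>.
\<close>

lemma gn_relation_aligned:
  assumes norm_x [simp]: "norm x = 1" and rel: "gn_relation m a x z z'"
  defines "c \<equiv> cnj (ph (cip z x))"
  shows "gn_form a {..<m} x (align x z - x) (cmul c z' - x) = 0"
    and "Im (cip (cmul c z' - x) (x + (align x z - x))) = 0"
proof -
  have cc: "c * cnj c = 1" using mult_cnj_self[of c] by (simp add: c_def)
  then have cc': "cnj c * c = 1" by (simp add: mult.commute)
  have al: "align x z = cmul c z" by (simp add: align_def c_def)
  define Z Z' X where "Z j = cip z (a j)" and "Z' j = cip z' (a j)" and "X j = cip x (a j)" for j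
  have scal: "2 * Re (cnj (c * p) * (c * p' - q)) - (cmod (c * p - q))\<^sup>2
      = - (2 * Re (cnj p * (p - p')) - ((cmod p)\<^sup>2 - (cmod q)\<^sup>2))" for p p' q :: complex
  proof -
    have "cnj (c * p) * (c * p' - q) = (cnj c * c) * (cnj p * p') - cnj (c * p) * q"
      by (simp add: algebra_simps)
    then have 1: "Re (cnj (c * p) * (c * p' - q)) = Re (cnj p * p') - Re (cnj (c * p) * q)"
      by (simp only: cc') simp
    have 2: "(cmod (u - q))\<^sup>2 = (cmod u)\<^sup>2 + (cmod q)\<^sup>2 - 2 * Re (cnj u * q)" for u
      by (simp add: cmod_power2) (simp add: power2_eq_square algebra_simps)
    have 3: "cmod (c * p) = cmod p" by (simp add: norm_mult c_def)
    have "Re (cnj p * p) = (cmod p)\<^sup>2"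
      using arg_cong[OF mult_cnj_self[of p], of Re] by (simp only: mult.commute[of "cnj p"] Re_complex_of_real)
    then show ?thesis unfolding 1 2 3 by (simp add: algebra_simps)
  qed
  have "gn_form a {..<m} x (align x z - x) (cmul c z' - x)
    = (\<Sum>j<m. cmul (- c) (cmul (of_real (2 * Re (cnj (Z j) * (Z j - Z' j))
        - ((cmod (Z j))\<^sup>2 - (cmod (X j))\<^sup>2)) * Z j) (a j)))"
    unfolding gn_form_def
  proof (rule sum.cong)
    fix j
    have E: "2 * Re (cnj (cip (x + (align x z - x)) (a j)) * cip (cmul c z' - x) (a j)) - (cmod (cip (align x z - x) (a j)))\<^sup>2
        = - (2 * Re (cnj (Z j) * (Z j - Z' j)) - ((cmod (Z j))\<^sup>2 - (cmod (X j))\<^sup>2))"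
      using scal[of "Z j" "Z' j" "X j"] by (simp add: al cip_linear Z_def Z'_def X_def)
    have w: "cip (x + (align x z - x)) (a j) = c * Z j" by (simp add: al cip_linear Z_def)
    have gen: "cmul (of_real (- M) * (c * q)) b = cmul (- c) (cmul (of_real M * q) b)" for M q b
      by (simp add: cmul_simps mult_ac)
    show "cmul (of_real (2 * Re (cnj (cip (x + (align x z - x)) (a j)) * cip (cmul c z' - x) (a j))
          - (cmod (cip (align x z - x) (a j)))\<^sup>2) * cip (x + (align x z - x)) (a j)) (a j)
        = cmul (- c) (cmul (of_real (2 * Re (cnj (Z j) * (Z j - Z' j))
          - ((cmod (Z j))\<^sup>2 - (cmod (X j))\<^sup>2)) * Z j) (a j))"
      by (subst E, subst w, rule gen)
  qed simp
  also have "\<dots> = 0"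
    using rel unfolding cmul_sum[symmetric] gn_relation_def cip_diff_left Z_def Z'_def X_def
    by (simp only: cmul_simps)
  finally show "gn_form a {..<m} x (align x z - x) (cmul c z' - x) = 0" .
  have "Im (cip z' z) = 0" using rel by (simp add: gn_relation_def cip_linear cip_self_norm)
  moreover have "cip (cmul c z') (cmul c z) = cip z' z"
    using cc cc' by (simp add: cip_linear mult.assoc[symmetric])
  moreover have "Im (cip x (align x z)) = 0"
    using cip_commute[of x "align x z"] by (simp add: cip_align)
  ultimately show "Im (cip (cmul c z' - x) (x + (align x z - x))) = 0"
    by (simp add: cip_diff_left al)
qed

definition displ :: "fvec \<Rightarrow> fvec \<Rightarrow> fvec" where
  "displ x t = align x (x + t) - x"

text \<open>
  A path for the method without the sample \<open>l\<close>: from the aligned displacement of \<open>t k\<close>, the point \<open>t (k + 1)\<close> solves the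
  normal equations up to the tolerance \<open>\<eta>\<close>; it is aligned in turn before the next step.
\<close>

definition loo_path :: "nat \<Rightarrow> nat \<Rightarrow> (nat \<Rightarrow> fvec) \<Rightarrow> fvec \<Rightarrow> nat \<Rightarrow> nat \<Rightarrow> real \<Rightarrow> (nat \<Rightarrow> fvec) \<Rightarrow> bool" where
  "loo_path n m a x l K \<eta> t \<longleftrightarrow> (\<forall>k. t k \<in> fspace n) \<and>
     norm (weighted_cov a ({..<m} - {l}) x (x + displ x (t 0))
        - (2 * real m * (norm (x + displ x (t 0)))\<^sup>2) *\<^sub>R (x + displ x (t 0))) \<le> \<eta> * real m \<and>
     norm (displ x (t 0)) \<le> 2/1000 \<and>
     (\<forall>k<K. norm (gn_form a ({..<m} - {l}) x (displ x (t k)) (t (Suc k))) \<le> \<eta> * real m \<and>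
        \<bar>Im (cip (t (Suc k)) (x + displ x (t k)))\<bar> \<le> \<eta>)"

definition incoherent_along :: "fvec \<Rightarrow> fvec \<Rightarrow> real \<Rightarrow> nat \<Rightarrow> (nat \<Rightarrow> fvec) \<Rightarrow> bool" where
  "incoherent_along x b B K t \<longleftrightarrow> (\<forall>k\<le>K. cmod (cip (t k) b) \<le> B * norm (t k) \<and>
     cmod (cip (displ x (t k)) b) \<le> B * norm (displ x (t k)))"

lemma displ_fspace [simp, intro]: "t \<in> fspace n \<Longrightarrow> x \<in> fspace n \<Longrightarrow> displ x t \<in> fspace n"
  by (auto simp: displ_def)

lemma Im_cip_displ [simp]: "norm x = 1 \<Longrightarrow> Im (cip (displ x t) x) = 0"
  by (simp add: displ_def cip_diff_left cip_align cip_self_norm)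

context regular_sample
begin

text \<open>
  The induction hypothesis \<open>close k\<close> consists of the decay of the error, of its incoherence with all samples, and
  of the bound \<open>B / (2000 R)\<close> for its distance to the \<open>K\<close>-step paths. In a step, the incoherence of \<open>H k\<close>
  gives the contraction of the run. For the distance to the paths, the incoherence of the update \<open>g\<close> is required,
  which is not yet known; its smallest bound \<open>bg\<close> is attained at some sample \<open>l\<close>, and the path for this very \<open>l\<close> shows
  that \<open>bg \<le> B\<close>. The step is required to satisfy \<open>gn_relation\<close> only if the kernel of the matrix is the trivial one.
\<close>

lemma iterates_converge:
  fixes \<epsilon> \<eta> :: real
  assumes zV: "\<And>k. z k \<in> fspace n"
    and eig: "weighted_cov a {..<m} x (z 0) = (2 * real m * (norm (z 0))\<^sup>2) *\<^sub>R z 0"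
    and top: "2 * real m * (norm (z 0))\<^sup>2 \<ge> inner (weighted_cov a {..<m} x x) x"
    and step: "\<And>k. (\<And>u. u \<in> fspace n \<Longrightarrow> (\<And>j. j < m \<Longrightarrow> Re (cnj (cip (z k) (a j)) * cip u (a j)) = 0)
        \<Longrightarrow> \<exists>t. u = cmul (\<i> * of_real t) (z k)) \<Longrightarrow> gn_relation m a x (z k) (z (Suc k))"
    and loo: "\<And>l. l < m \<Longrightarrow> \<exists>t. loo_path n m a x l K \<eta> t \<and> incoherent_along x (a l) B K t"
    and R_pos: "R > 0" and K: "R / 2 ^ K \<le> B"
    and err: "sample_err \<le> 1/100" and small: "R * (4 * \<eta> + 2 * sample_err) \<le> B / 10^5"
    and eps: "4 * B * \<rho> \<le> \<epsilon>"
  defines "H \<equiv> \<lambda>k. align x (z k) - x"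
  shows "norm (H k) \<le> 1/1000"
    and "norm (H (Suc k)) \<le> 2 * (norm (H k))\<^sup>2 + \<epsilon> * norm (H k)"
    and "j < m \<Longrightarrow> cmod (cip (H k) (a j)) \<le> B"
proof -
  have B\<rho>: "B * \<rho> \<le> 1/10^8" "0 \<le> B * \<rho>" using B_rho tau_small rho_nonneg B_nonneg by simp_all
  have HV [simp, intro]: "H k \<in> fspace n" for k using zV by (simp add: H_def)
  have ImH: "Im (cip (H k) x) = 0" for k by (simp add: H_def cip_diff_left cip_align cip_self_norm)
  obtain t where t: "\<And>l. l < m \<Longrightarrow> loo_path n m a x l K \<eta> (t l)"
    and t_inc: "\<And>l k. l < m \<Longrightarrow> k \<le> K \<Longrightarrow> cmod (cip (t l k) (a l)) \<le> B * norm (t l k)"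
    and H'_inc: "\<And>l k. l < m \<Longrightarrow> k \<le> K \<Longrightarrow> cmod (cip (displ x (t l k)) (a l)) \<le> B * norm (displ x (t l k))"
    using loo unfolding incoherent_along_def by metis
  define H' where "H' l k = displ x (t l k)" for l k
  have tV [simp, intro]: "l < m \<Longrightarrow> t l k \<in> fspace n" for l k using t by (simp add: loo_path_def)
  have H'V [simp, intro]: "l < m \<Longrightarrow> H' l k \<in> fspace n" for l k by (simp add: H'_def)
  define G where "G k = cmul (cnj (ph (cip (z k) x))) (z (Suc k)) - x" for k
  have GV [simp, intro]: "G k \<in> fspace n" for k using zV by (simp add: G_def)
  have av: "cmod (cip v (a j)) \<le> R * norm v" if "j < m" for v j
    using cmod_cip_le[of v "a j"] mult_left_mono[OF norm_a[OF that], of "norm v"] by (simp add: mult.commute)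

  \<comment> \<open>One step of the original run, under the incoherence bound.\<close>
  have run_step: "gn_form a {..<m} x (H k) (G k) = 0" "Im (cip (G k) (x + H k)) = 0"
    "norm (G k) \<le> norm (H k) * (1.42 * norm (H k) + (B * norm (H k) + B) * \<rho>)"
    "norm (G k) \<le> norm (H k) / 2" "H (Suc k) = displ x (G k)" "norm (H (Suc k)) \<le> norm (G k)"
    if H: "norm (H k) \<le> 1/1000" and inc: "\<And>j. j < m \<Longrightarrow> cmod (cip (H k) (a j)) \<le> B" for k
  proof -
    have "z k \<noteq> 0"
    proof
      assume "z k = 0"
      then have "norm (H k) = 1" by (simp add: H_def align_def cmul_simps)
      then show False using H by simp
    qed
    then have rel: "gn_relation m a x (z k) (z (Suc k))" using zV by (intro step kernel_trivial)
    show 1: "gn_form a {..<m} x (H k) (G k) = 0" "Im (cip (G k) (x + H k)) = 0"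
      using gn_relation_aligned[OF norm_x rel] by (simp_all add: H_def G_def)
    show 2: "norm (G k) \<le> norm (H k) * (1.42 * norm (H k) + (B * norm (H k) + B) * \<rho>)"
      using H inc 1 by (intro gn_step_contracts) auto
    also have "\<dots> \<le> norm (H k) * (1/2)"
    proof (rule mult_left_mono)
      have "B * \<rho> * norm (H k) \<le> B * \<rho> * 1" using H B\<rho> by (intro mult_left_mono) auto
      then show "1.42 * norm (H k) + (B * norm (H k) + B) * \<rho> \<le> 1/2"
        using H B\<rho> by (simp add: algebra_simps)
    qed simp
    finally show 3: "norm (G k) \<le> norm (H k) / 2" by simp
    have "cip (G k) x = cnj (ph (cip (z k) x)) * cip (z (Suc k)) x - 1"
      by (simp add: G_def cip_linear cip_self_norm)
    moreover have "cmod (cip (G k) x) < 1" using cmod_cip_le[of "G k" x] 3 H by simp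
    ultimately have "cip (z (Suc k)) x \<noteq> 0" by auto
    then show "H (Suc k) = displ x (G k)"
      by (simp add: H_def displ_def G_def align_cmul)
    then show "norm (H (Suc k)) \<le> norm (G k)"
      using norm_align_diff_le_self[OF norm_x, of "x + G k"] by (simp add: displ_def)
  qed

  define close where "close k \<longleftrightarrow> norm (H k) \<le> 1/1000 * (1/2) ^ k \<and> (\<forall>j<m. cmod (cip (H k) (a j)) \<le> B) \<and>
      (k \<le> K \<longrightarrow> (\<forall>l<m. R * norm (H k - H' l k) \<le> B / 2000))" for k
  have H_small: "norm (H k) \<le> 1/1000" if "close k" for k
  proof -
    have "norm (H k) \<le> 1/1000 * (1/2) ^ k" using that by (simp add: close_def)
    also have "\<dots> \<le> 1/1000 * 1" by (intro mult_left_mono power_le_one) auto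
    finally show ?thesis by simp
  qed
  have scaled: "norm v \<le> 1/1000" if "R * norm v \<le> B / 2000" for v
  proof -
    have "R * norm v \<le> R * (1/1000)" using that B_R by simp
    then show ?thesis using R_pos by simp
  qed
  have H'_small: "norm (H' l k) \<le> 2/1000" if "close k" "l < m" "k \<le> K" for l k
  proof -
    have "norm (H k - H' l k) \<le> 1/1000" using that by (intro scaled) (auto simp: close_def)
    then show ?thesis using norm_triangle_ineq4[of "H k" "H k - H' l k"] H_small[OF that(1)] by simp
  qed
  have H'_l: "cmod (cip (H' l k) (a l)) \<le> B * (2/1000)" if "l < m" "k \<le> K" "norm (H' l k) \<le> 2/1000" for l k
    using H'_inc[OF that(1,2)] mult_left_mono[OF that(3) B_nonneg] by (simp add: H'_def)
  have inc_from_loo: "cmod (cip (H k) (a l)) \<le> B" if "l < m" "k \<le> K" "R * norm (H k - H' l k) \<le> B / 2000"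
    "norm (H k) \<le> 1/1000" for l k
  proof -
    have "norm (H k - H' l k) \<le> 1/1000" using that by (intro scaled) auto
    then have "norm (H' l k) \<le> 2/1000" using norm_triangle_ineq4[of "H k" "H k - H' l k"] that(4) by simp
    then have "cmod (cip (H' l k) (a l)) \<le> B * (2/1000)" using that by (intro H'_l)
    moreover have "cmod (cip (H k - H' l k) (a l)) \<le> B / 2000" using av[OF that(1)] that(3) by (rule order_trans)
    ultimately show ?thesis
      using norm_triangle_ineq[of "cip (H' l k) (a l)" "cip (H k - H' l k) (a l)"] B_nonneg
      by (simp add: cip_linear)
  qed

  have close0: "close 0"
  proof -
    have "2 * real m * (norm (z 0))\<^sup>2 \<ge> (2 - \<tau>) * m" using top weighted_cov_lower by (rule order_trans[rotated])
    then have "m * (2 - \<tau>) \<le> m * (2 * (norm (z 0))\<^sup>2)" by (simp add: mult_ac)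
    then have "2 - \<tau> \<le> 2 * (norm (z 0))\<^sup>2" using m_pos by (simp only: mult_le_cancel_left_pos of_nat_0_less_iff)
    then have H0: "norm (H 0) \<le> 1/1000" unfolding H_def
      using zV eig tau_pos by (intro spectral_close[of "z 0" "{..<m}"]) auto
    have xH: "x + H 0 = cmul (cnj (ph (cip (z 0) x))) (z 0)" by (simp add: H_def align_def)
    have eigH: "weighted_cov a {..<m} x (x + H 0) = (2 * real m * (norm (x + H 0))\<^sup>2) *\<^sub>R (x + H 0)"
      unfolding xH weighted_cov_linear eig by (simp add: scaleR_eq_cmul cmul_simps mult_ac)
    have d: "R * norm (H 0 - H' l 0) \<le> B / 2000" if l: "l < m" for l
    proof -
      have n': "norm (H' l 0) \<le> 2/1000" using t[OF l] by (simp add: loo_path_def H'_def)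
      have "norm (H 0 - H' l 0) \<le> 2 * \<eta> + sample_err"
      proof (rule spectral_leave_one_out[OF _ _ H0 n' ImH _ eigH l])
        show "Im (cip (H' l 0) x) = 0" by (simp add: H'_def Im_cip_displ)
        show "cmod (cip (H' l 0) (a l)) \<le> B * norm (H' l 0)" using H'_inc[OF l, of 0] by (simp add: H'_def)
        show "norm (weighted_cov a ({..<m} - {l}) x (x + H' l 0)
            - (2 * real m * (norm (x + H' l 0))\<^sup>2) *\<^sub>R (x + H' l 0)) \<le> \<eta> * m"
          using t[OF l] by (simp add: loo_path_def H'_def)
      qed (use l in auto)
      then have "R * norm (H 0 - H' l 0) \<le> R * (2 * \<eta> + sample_err)" using R_pos by simp
      then show ?thesis using small B_nonneg by (simp add: algebra_simps)
    qed
    show ?thesis unfolding close_def using H0 d inc_from_loo by auto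
  qed
  have close_Suc: "close (Suc k)" if c: "close k" for k
  proof -
    note H_k = H_small[OF c]
    have inc: "\<And>j. j < m \<Longrightarrow> cmod (cip (H k) (a j)) \<le> B" using c by (simp add: close_def)
    have "norm (H (Suc k)) \<le> norm (H k) / 2" using run_step(4,6)[OF H_k inc] by linarith
    also have "norm (H k) \<le> 1/1000 * (1/2) ^ k" using c by (simp add: close_def)
    finally have decay: "norm (H (Suc k)) \<le> 1/1000 * (1/2) ^ Suc k" by simp
    have H_Suc: "norm (H (Suc k)) \<le> 1/1000"
      using run_step(4,6)[OF H_k inc] H_k norm_ge_zero[of "H k"] by linarith
    show ?thesis
    proof (cases "Suc k \<le> K")
      case False
      \<comment> \<open>After \<open>K\<close> steps the error is so small that incoherence follows from Cauchy-Schwarz.\<close>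
      then have "K \<le> Suc k" by simp
      have "cmod (cip (H (Suc k)) (a j)) \<le> B" if "j < m" for j
      proof -
        have "cmod (cip (H (Suc k)) (a j)) \<le> R * (1/1000 * (1/2) ^ Suc k)"
          using av[OF that] decay R_pos by (meson mult_left_mono order_trans less_imp_le)
        also have "\<dots> \<le> R * (1 * (1/2) ^ K)"
          using R_pos \<open>K \<le> Suc k\<close> by (intro mult_left_mono mult_mono power_decreasing) auto
        also have "\<dots> \<le> B" using K by (simp add: power_divide)
        finally show ?thesis .
      qed
      then show ?thesis using decay False by (simp add: close_def)
    next
      case True
      define g where "g = G k"
      have g_small: "norm g \<le> 1/2000" using run_step(4)[OF H_k inc] H_k by (simp add: g_def)
      define bg where "bg = Max ((\<lambda>j. cmod (cip g (a j))) ` {..<m})"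
      have bg: "cmod (cip g (a j)) \<le> bg" if "j < m" for j
        unfolding bg_def using that by (intro Max_ge) auto
      have ex: "\<exists>j<m. cmod (cip g (a j)) = bg"
        using Max_in[of "(\<lambda>j. cmod (cip g (a j))) ` {..<m}"] m_pos unfolding bg_def by fastforce
      have bg0: "bg \<ge> 0" using bg[OF m_pos] norm_ge_zero order_trans by blast
      define e where "e l = R * norm (g - t l (Suc k))" for l
      have Bg: "B * norm g \<le> B / 2000" using mult_left_mono[OF g_small B_nonneg] by simp
      have e_le: "e l \<le> B / 20000 + bg / 10^8" if l: "l < m" for l
      proof -
        have d: "R * norm (H k - H' l k) \<le> B / 2000" using c True l by (simp add: close_def)
        have n': "norm (H' l k) \<le> 2/1000" using H'_small[OF c l] True by simp
        have "norm (g - t l (Suc k)) \<le> 24 * (3/1000 + bg * \<rho> + 3 * B * \<rho>) * norm (H k - H' l k) + 4 * \<eta> + 2 * sample_err"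
        proof (rule gn_step_leave_one_out)
          show "cmod (cip (H' l k) (a j)) \<le> 3 * B" if j: "j < m" for j
          proof -
            have "cmod (cip (H k - H' l k) (a j)) \<le> B / 2000" using av[OF j] d by (rule order_trans)
            then show ?thesis using inc[OF j] B_nonneg
                norm_triangle_ineq4[of "cip (H k) (a j)" "cip (H k - H' l k) (a j)"] by (simp add: cip_linear)
          qed
          show "cmod (cip (H k) (a j)) \<le> 3 * B" if j: "j < m" for j using inc[OF j] B_nonneg by simp
          show "norm (gn_form a ({..<m} - {l}) x (H' l k) (t l (Suc k))) \<le> \<eta> * m"
            "\<bar>Im (cip (t l (Suc k)) (x + H' l k))\<bar> \<le> \<eta>"
            using t[OF l] True by (simp_all add: loo_path_def H'_def)
          show "cmod (cip (t l (Suc k)) (a l)) \<le> B * norm (t l (Suc k))" using t_inc[OF l True] .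
        qed (use l H_k n' g_small bg err run_step(1,2)[OF H_k inc] in \<open>auto simp: g_def\<close>)
        then have "e l \<le> R * (24 * (3/1000 + bg * \<rho> + 3 * B * \<rho>) * norm (H k - H' l k) + 4 * \<eta> + 2 * sample_err)"
          unfolding e_def using R_pos by (intro mult_left_mono) auto
        also have "\<dots> = 24 * (3/1000 + bg * \<rho> + 3 * B * \<rho>) * (R * norm (H k - H' l k)) + R * (4 * \<eta> + 2 * sample_err)"
          by (simp add: algebra_simps)
        also have "\<dots> \<le> 24 * (3/1000 + bg * \<rho> + 3 * B * \<rho>) * (B / 2000) + B / 10^5"
          using bg0 rho_nonneg B_nonneg by (intro add_mono mult_left_mono d small) auto
        also have "\<dots> \<le> B / 20000 + bg / 10^8"
        proof -
          have "bg * (B * \<rho>) \<le> bg * (1/10^8)" "B * (B * \<rho>) \<le> B * (1/10^8)"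
            using bg0 B_nonneg B\<rho> by (intro mult_left_mono; simp)+
          then show ?thesis using B_nonneg bg0 by (simp add: algebra_simps)
        qed
        finally show ?thesis .
      qed
      \<comment> \<open>The bound for \<open>e l\<close> contains \<open>bg\<close> with a small coefficient and can be solved for it.\<close>
      have bg_B: "bg \<le> B"
      proof -
        obtain l where l: "l < m" "cmod (cip g (a l)) = bg" using ex by blast
        define g' where "g' = t l (Suc k)"
        have "bg \<le> cmod (cip g' (a l)) + cmod (cip (g - g') (a l))"
          using norm_triangle_ineq[of "cip g' (a l)" "cip (g - g') (a l)"] l by (simp add: cip_linear)
        also have "cmod (cip (g - g') (a l)) \<le> e l" using av[OF l(1)] by (simp add: e_def g'_def)
        also have "cmod (cip g' (a l)) \<le> B * norm g'" using t_inc[OF l(1) True] by (simp add: g'_def)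
        also have "B * norm g' \<le> B * (norm g + norm (g - g'))"
          using B_nonneg norm_triangle_ineq4[of g "g - g'"] by (intro mult_left_mono) auto
        also have "\<dots> \<le> B / 2000 + 2 * e l"
        proof -
          have "B * norm (g - g') \<le> 2 * R * norm (g - g')" using B_R by (intro mult_right_mono) auto
          then show ?thesis using Bg by (simp add: algebra_simps e_def g'_def)
        qed
        finally have "bg \<le> B / 2000 + 3 * e l" by simp
        then show ?thesis using e_le[OF l(1)] B_nonneg bg0 by simp
      qed
      have d: "R * norm (H (Suc k) - H' l (Suc k)) \<le> B / 2000" if l: "l < m" for l
      proof -
        have el: "e l \<le> B / 19000" using e_le[OF l] bg_B B_nonneg by simp
        then have "norm (g - t l (Suc k)) \<le> 1/1000" using B_nonneg by (intro scaled) (simp add: e_def)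
        then have "norm (t l (Suc k)) \<le> 1/100"
          using norm_triangle_ineq4[of g "g - t l (Suc k)"] g_small by simp
        then have "norm (align x (x + g) - align x (x + t l (Suc k))) \<le> 4 * norm ((x + g) - (x + t l (Suc k)))"
          using g_small by (intro align_lipschitz) auto
        then have "norm (H (Suc k) - H' l (Suc k)) \<le> 4 * norm (g - t l (Suc k))"
          using run_step(5)[OF H_k inc] by (simp add: H'_def displ_def g_def)
        then have "R * norm (H (Suc k) - H' l (Suc k)) \<le> R * (4 * norm (g - t l (Suc k)))"
          using R_pos by (intro mult_left_mono) auto
        then show ?thesis using el B_nonneg by (simp add: e_def mult.left_commute)
      qed
      show ?thesis unfolding close_def using decay d inc_from_loo[OF _ True d H_Suc] by auto
    qed
  qed
  have close: "close k" for k by (induction k) (use close0 close_Suc in auto)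
  show "norm (H k) \<le> 1/1000" using H_small close by blast
  show inc: "j < m \<Longrightarrow> cmod (cip (H k) (a j)) \<le> B" for j using close[of k] by (simp add: close_def)
  note rs = run_step[OF H_small[OF close[of k]] inc]
  have "norm (H (Suc k)) \<le> norm (H k) * (1.42 * norm (H k) + (B * norm (H k) + B) * \<rho>)"
    using rs(3,6) by linarith
  also have "\<dots> \<le> norm (H k) * (2 * norm (H k) + \<epsilon>)"
  proof (rule mult_left_mono)
    have "B * \<rho> * norm (H k) \<le> B * \<rho> * 1" using H_small[OF close[of k]] B\<rho> by (intro mult_left_mono) auto
    moreover have "(B * norm (H k) + B) * \<rho> = B * \<rho> * norm (H k) + B * \<rho>" by (simp add: algebra_simps)
    moreover have "1.42 * norm (H k) \<le> 2 * norm (H k)" by simp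
    moreover have "4 * (B * \<rho>) \<le> \<epsilon>" using eps by simp
    ultimately show "1.42 * norm (H k) + (B * norm (H k) + B) * \<rho> \<le> 2 * norm (H k) + \<epsilon>"
      using B\<rho> by linarith
  qed simp
  finally show "norm (H (Suc k)) \<le> 2 * (norm (H k))\<^sup>2 + \<epsilon> * norm (H k)"
    by (simp add: power2_eq_square algebra_simps)
qed

end

section \<open>Continuity, leading eigenvectors and approximate normal equations\<close>

lemma bounded_linear_cip: "bounded_linear (\<lambda>u. cip u v)"
  by (rule bounded_linear_intro[of _ "norm v"]) (auto simp: cip_linear scaleR_conv_of_real cmod_cip_le)

lemma bounded_linear_cmul: "bounded_linear (\<lambda>c. cmul c v)"
  by (rule bounded_linear_intro[of _ "norm v"]) (auto simp: cmul_simps scaleR_eq_cmul scaleR_conv_of_real)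

lemmas continuous_cip [continuous_intros] = bounded_linear.continuous[OF bounded_linear_cip]
lemmas continuous_cmul [continuous_intros] = bounded_linear.continuous[OF bounded_linear_cmul]

lemma isCont_weighted_cov [continuous_intros]:
  "isCont f v \<Longrightarrow> isCont (\<lambda>u. weighted_cov a J x (f u)) v"
  unfolding weighted_cov_def by (intro continuous_intros)

lemma isCont_gn_form: "isCont (\<lambda>g. gn_form a J x h g) v"
  unfolding gn_form_def
  by (intro continuous_intros bounded_linear.continuous[OF bounded_linear_Re])

lemma inner_weighted_cov_commute:
  "inner (weighted_cov a J x u) v = inner u (weighted_cov a J x v)"
proof -
  have "Re (cip (cmul (of_real s * cip u b) b) v) = Re (cip u (cmul (of_real s * cip v b) b))" for s b
    by (simp add: cip_linear cip_commute[of b v] cip_commute[of b u])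
  then show ?thesis
    unfolding inner_fvec_def weighted_cov_def cip_sum_left cip_sum_right Re_sum by (simp only:)
qed

text \<open>
  Compactness in the product topology, by Tychonoff's theorem.
\<close>

lemma compact_unit_sphere_coords:
  "compact {f :: nat \<Rightarrow> complex. (\<forall>i\<ge>n. f i = 0) \<and> (\<Sum>i<n. (cmod (f i))\<^sup>2) = 1}" (is "compact ?S")
proof -
  have "compactin (product_topology (\<lambda>_::nat. euclidean) UNIV)
      (PiE UNIV (\<lambda>i. if i < n then cball (0::complex) 1 else {0}))"
    unfolding compactin_PiE by auto
  then have K: "compact (PiE UNIV (\<lambda>i. if i < n then cball (0::complex) 1 else {0}))"
    by (simp add: euclidean_product_topology)
  have "continuous_on UNIV (\<lambda>f. \<Sum>i<n. (cmod (f i))\<^sup>2)"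
    by (intro continuous_intros continuous_on_product_coordinates)
  then have C: "closed {f :: nat \<Rightarrow> complex. (\<Sum>i<n. (cmod (f i))\<^sup>2) = 1}"
    by (rule closed_Collect_eq) (rule continuous_on_const)
  have "?S = PiE UNIV (\<lambda>i. if i < n then cball (0::complex) 1 else {0}) \<inter> {f. (\<Sum>i<n. (cmod (f i))\<^sup>2) = 1}"
  proof (intro equalityI subsetI)
    fix f assume f: "f \<in> ?S"
    have "cmod (f i) \<le> 1" if "i < n" for i
    proof -
      have "(cmod (f i))\<^sup>2 \<le> (\<Sum>i<n. (cmod (f i))\<^sup>2)" using that by (intro member_le_sum) auto
      then show ?thesis using f by (simp add: power_le_one_iff abs_square_le_1)
    qed
    then show "f \<in> PiE UNIV (\<lambda>i. if i < n then cball 0 1 else {0}) \<inter> {f. (\<Sum>i<n. (cmod (f i))\<^sup>2) = 1}"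
      using f by (auto simp: PiE_iff)
  next
    fix f :: "nat \<Rightarrow> complex"
    assume f: "f \<in> PiE UNIV (\<lambda>i. if i < n then cball 0 1 else {0}) \<inter> {f. (\<Sum>i<n. (cmod (f i))\<^sup>2) = 1}"
    then have "f i \<in> (if i < n then cball 0 1 else {0})" for i by (auto simp: PiE_iff)
    then have "f i = 0" if "i \<ge> n" for i using that by (metis not_le singletonD)
    with f show "f \<in> ?S" by simp
  qed
  then show ?thesis using compact_Int_closed[OF K C] by simp
qed

lemma leading_eigenvector_exists:
  assumes fin: "finite J" and a: "\<And>j. j \<in> J \<Longrightarrow> a j \<in> fspace n"
    and ne: "u \<in> fspace n" "norm u = 1"
  obtains v \<mu> where "v \<in> fspace n" "norm v = 1" "weighted_cov a J x v = \<mu> *\<^sub>R v" "\<mu> \<ge> 0"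
    "\<And>w. w \<in> fspace n \<Longrightarrow> inner (weighted_cov a J x w) w \<le> \<mu> * (norm w)\<^sup>2"
proof -
  let ?S = "{f :: nat \<Rightarrow> complex. (\<forall>i\<ge>n. f i = 0) \<and> (\<Sum>i<n. (cmod (f i))\<^sup>2) = 1}"
  define q where "q v = inner (weighted_cov a J x v) v" for v
  have q_mk: "q (mk_fv n f) = (\<Sum>j\<in>J. (cmod (cip x (a j)) * cmod (\<Sum>i<n. f i * cnj (fv (a j) i)))\<^sup>2)" for f
  proof -
    have "cip (mk_fv n f) (a j) = (\<Sum>i<n. f i * cnj (fv (a j) i))" for j
      by (subst cip_fspace[of _ n]) auto
    then show ?thesis by (simp add: q_def inner_weighted_cov)
  qed
  have "continuous_on ?S (\<lambda>f. q (mk_fv n f))"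
    unfolding q_mk by (intro continuous_intros continuous_on_subset[OF continuous_on_product_coordinates]) auto
  moreover have S_of: "fv w \<in> ?S \<and> mk_fv n (fv w) = w" if "w \<in> fspace n" "norm w = 1" for w
    using that norm_fspace[of w n] by (auto simp: fspace_def fvec_eq_iff)
  then have "?S \<noteq> {}" using ne by blast
  ultimately obtain f where f: "f \<in> ?S" "\<And>g. g \<in> ?S \<Longrightarrow> q (mk_fv n g) \<le> q (mk_fv n f)"
    using continuous_attains_sup[OF compact_unit_sphere_coords, of n "\<lambda>f. q (mk_fv n f)"] by blast
  define v where "v = mk_fv n f"
  have vV: "v \<in> fspace n" by (simp add: v_def)
  have "(norm v)\<^sup>2 = 1" using norm_fspace[OF vV] f(1) by (simp add: v_def)
  then have nv: "norm v = 1" by (simp add: power2_eq_1_iff) (metis norm_ge_zero not_one_le_zero neg_0_le_iff_le)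
  have max1: "q w \<le> q v" if "w \<in> fspace n" "norm w = 1" for w
    using f(2)[of "fv w"] S_of[OF that] by (simp add: v_def)
  have scale: "q (r *\<^sub>R w) = r\<^sup>2 * q w" for r w
    by (simp add: q_def scaleR_eq_cmul[of r] weighted_cov_linear)
      (simp add: scaleR_eq_cmul[symmetric] power2_eq_square)
  have max: "q w \<le> q v * (norm w)\<^sup>2" if "w \<in> fspace n" for w
  proof (cases "w = 0")
    case True
    then show ?thesis by (simp add: q_def)
  next
    case False
    have "q w = (norm w)\<^sup>2 * q ((1 / norm w) *\<^sub>R w)" using False by (simp add: scale power_divide)
    also have "\<dots> \<le> (norm w)\<^sup>2 * q v" using that False by (intro mult_left_mono max1) auto
    finally show ?thesis by (simp add: mult.commute)
  qed
  define e where "e = weighted_cov a J x v - q v *\<^sub>R v"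
  have eV: "e \<in> fspace n" using vV a by (auto simp: e_def)
  \<comment> \<open>At the maximiser the derivative in the direction of the residual \<open>e\<close> vanishes; this derivative is
    \<open>2 * (norm e)\<^sup>2\<close>.\<close>
  have "e = 0"
  proof (rule ccontr)
    assume e0: "e \<noteq> 0"
    define c where "c = q e - q v * (norm e)\<^sup>2"
    have c: "c \<le> 0" using max[OF eV] by (simp add: c_def)
    have key: "2 * r * (norm e)\<^sup>2 + r\<^sup>2 * c \<le> 0" for r
    proof -
      have "weighted_cov a J x (v + r *\<^sub>R e) = weighted_cov a J x v + r *\<^sub>R weighted_cov a J x e"
        by (simp add: weighted_cov_add weighted_cov_linear(2) scaleR_eq_cmul)
      then have "q (v + r *\<^sub>R e) = q v + 2 * r * inner (weighted_cov a J x v) e + r\<^sup>2 * q e"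
        using inner_weighted_cov_commute[of a J x e v]
        by (simp add: q_def inner_add_left inner_add_right inner_commute power2_eq_square algebra_simps)
      moreover have "(norm (v + r *\<^sub>R e))\<^sup>2 = (norm v)\<^sup>2 + 2 * r * inner v e + r\<^sup>2 * (norm e)\<^sup>2"
        unfolding power2_norm_eq_inner inner_add_left inner_add_right inner_scaleR_left inner_scaleR_right
        by (simp only: inner_commute[of e v] power2_eq_square) (simp add: algebra_simps)
      moreover have "inner (weighted_cov a J x v) e = q v * inner v e + (norm e)\<^sup>2"
        by (simp add: e_def power2_norm_eq_inner algebra_simps inner_diff_left inner_diff_right)
      moreover have "v + r *\<^sub>R e \<in> fspace n" using vV eV by auto
      ultimately show ?thesis using max[of "v + r *\<^sub>R e"] nv by (simp add: c_def algebra_simps)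
    qed
    define r where "r = (norm e)\<^sup>2 / (1 - c)"
    have "r > 0" using e0 c by (simp add: r_def)
    have "r * (2 * (norm e)\<^sup>2 + r * c) \<le> 0" using key[of r] by (simp add: power2_eq_square algebra_simps)
    then have "2 * (norm e)\<^sup>2 + r * c \<le> 0" using \<open>r > 0\<close> by (simp add: mult_le_0_iff)
    moreover have "r * c \<ge> - (norm e)\<^sup>2"
    proof -
      have "r * (1 - c) = (norm e)\<^sup>2" using c by (simp add: r_def)
      then have "r * c = r - (norm e)\<^sup>2" by (simp add: algebra_simps)
      then show ?thesis using \<open>r > 0\<close> by linarith
    qed
    moreover have "(norm e)\<^sup>2 > 0" using e0 by simp
    ultimately show False by linarith
  qed
  then have "weighted_cov a J x v = q v *\<^sub>R v" by (simp add: e_def)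
  moreover have "q v \<ge> 0" unfolding q_def inner_weighted_cov by (simp add: sum_nonneg)
  ultimately show thesis using that[OF vV nv] max by (simp add: q_def)
qed

text \<open>
  A step of length proportional to the gradient decreases the functional by a multiple of the squared gradient. So
  the gradient is small at every point where the functional is close to its infimum.
\<close>

lemma normal_equations_approx:
  assumes fin: "finite J" and a: "\<And>j. j \<in> J \<Longrightarrow> a j \<in> fspace n" and V: "h \<in> fspace n" "x \<in> fspace n"
    and \<xi>: "\<xi> > 0"
  obtains g where "g \<in> fspace n" "norm (gn_form a J x h g) \<le> \<xi>" "Im (cip g (x + h)) = 0"
proof -
  define w where "w = x + h"
  define f c where "f j u = Re (cnj (cip w (a j)) * cip u (a j))" and "c j = (cmod (cip h (a j)))\<^sup>2" for j u
  define \<Phi> where "\<Phi> g = (\<Sum>j\<in>J. (2 * f j g - c j)\<^sup>2)" for g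
  \<comment> \<open>\<open>M\<close> bounds the quadratic form, so that a step of length \<open>1 / (2 * M)\<close> along the gradient decreases \<open>\<Phi>\<close>.\<close>
  define M where "M = 1 + (\<Sum>j\<in>J. (cmod (cip w (a j)) * norm (a j))\<^sup>2)"
  have M: "M \<ge> 1" by (simp add: M_def sum_nonneg)
  have f_lin: "f j (u + v) = f j u + f j v" "f j (r *\<^sub>R u) = r * f j u" for j u v r
    by (simp_all add: f_def cip_linear algebra_simps)
  have f2: "(\<Sum>j\<in>J. (f j u)\<^sup>2) \<le> M * (norm u)\<^sup>2" for u
  proof -
    have "(\<Sum>j\<in>J. (f j u)\<^sup>2) \<le> (\<Sum>j\<in>J. (cmod (cip w (a j)) * norm (a j))\<^sup>2 * (norm u)\<^sup>2)"
    proof (rule sum_mono)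
      fix j
      have "\<bar>f j u\<bar> \<le> cmod (cip w (a j)) * cmod (cip u (a j))"
        using abs_Re_le_cmod[of "cnj (cip w (a j)) * cip u (a j)"] by (simp add: f_def norm_mult)
      also have "\<dots> \<le> cmod (cip w (a j)) * (norm u * norm (a j))" by (intro mult_left_mono cmod_cip_le) auto
      finally have "\<bar>f j u\<bar>\<^sup>2 \<le> (cmod (cip w (a j)) * (norm u * norm (a j)))\<^sup>2" by (intro power_mono) auto
      then show "(f j u)\<^sup>2 \<le> (cmod (cip w (a j)) * norm (a j))\<^sup>2 * (norm u)\<^sup>2"
        by (simp add: power_mult_distrib mult_ac)
    qed
    also have "\<dots> \<le> M * (norm u)\<^sup>2" unfolding sum_distrib_right[symmetric] M_def by (intro mult_right_mono) auto
    finally show ?thesis .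
  qed
  define S where "S = Inf (\<Phi> ` fspace n)"
  have \<Phi>0: "\<Phi> g \<ge> 0" for g by (simp add: \<Phi>_def sum_nonneg)
  have bdd: "bdd_below (\<Phi> ` fspace n)" using \<Phi>0 by (intro bdd_belowI[of _ 0]) auto
  have "S < S + \<xi>\<^sup>2 / M" using \<xi> M by simp
  then have "\<exists>y\<in>\<Phi> ` fspace n. y < S + \<xi>\<^sup>2 / M"
    unfolding S_def by (subst cInf_less_iff[symmetric, OF _ bdd]) auto
  then obtain g where g: "g \<in> fspace n" "\<Phi> g < S + \<xi>\<^sup>2 / M" by auto
  define N where "N = gn_form a J x h g"
  have NV: "N \<in> fspace n" using a by (auto simp: N_def)
  have inner_N: "inner N u = (\<Sum>j\<in>J. (2 * f j g - c j) * f j u)" for u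
    unfolding N_def inner_gn_form by (simp add: f_def c_def w_def)
  have "\<Phi> (g + r *\<^sub>R N) = \<Phi> g + 4 * r * (norm N)\<^sup>2 + 4 * r\<^sup>2 * (\<Sum>j\<in>J. (f j N)\<^sup>2)" for r
  proof -
    have "(2 * f j (g + r *\<^sub>R N) - c j)\<^sup>2 = (2 * f j g - c j)\<^sup>2 + 4 * r * ((2 * f j g - c j) * f j N) + 4 * r\<^sup>2 * (f j N)\<^sup>2" for j
      by (simp add: f_lin power2_eq_square algebra_simps)
    then show ?thesis unfolding \<Phi>_def power2_norm_eq_inner inner_N
      by (simp add: sum.distrib sum_distrib_left)
  qed
  from this[of "- (1 / (2 * M))"]
  have "\<Phi> (g + (- (1 / (2 * M))) *\<^sub>R N) = \<Phi> g - 2 / M * (norm N)\<^sup>2 + (\<Sum>j\<in>J. (f j N)\<^sup>2) / M\<^sup>2"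
    using M by (simp add: power_divide)
  also have "(\<Sum>j\<in>J. (f j N)\<^sup>2) / M\<^sup>2 \<le> (M * (norm N)\<^sup>2) / M\<^sup>2" using f2 by (intro divide_right_mono) auto
  also have "(M * (norm N)\<^sup>2) / M\<^sup>2 = (norm N)\<^sup>2 / M" using M by (simp add: power2_eq_square)
  finally have "\<Phi> (g + (- (1 / (2 * M))) *\<^sub>R N) \<le> \<Phi> g - (norm N)\<^sup>2 / M" by simp
  moreover have "S \<le> \<Phi> (g + (- (1 / (2 * M))) *\<^sub>R N)"
    unfolding S_def using g NV by (intro cInf_lower bdd imageI fspace_closed)
  ultimately have "(norm N)\<^sup>2 / M \<le> \<xi>\<^sup>2 / M" using g(2) by linarith
  then have "(norm N)\<^sup>2 \<le> \<xi>\<^sup>2" using M by (simp add: divide_le_cancel)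
  then have N\<xi>: "norm N \<le> \<xi>" using \<xi> by (simp add: power2_le_iff_abs_le)
  \<comment> \<open>Adding a real multiple of \<open>\<i> * w\<close> leaves the equations unchanged.\<close>
  define s where "s = Im (cip g w) / (norm w)\<^sup>2"
  define g' where "g' = g - cmul (\<i> * of_real s) w"
  have "Re (cnj (cip w (a j)) * cip g' (a j)) = Re (cnj (cip w (a j)) * cip g (a j))" for j
    by (simp add: g'_def cip_linear algebra_simps)
  then have "gn_form a J x h g' = N" unfolding N_def gn_form_def w_def by simp
  moreover have "Im (cip g' w) = 0"
    by (cases "w = 0") (simp_all add: g'_def cip_linear cip_self_norm s_def)
  moreover have "g' \<in> fspace n" using g V by (auto simp: g'_def w_def)
  ultimately show thesis using that N\<xi> by (simp add: w_def)
qed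

lemma isCont_less: "isCont f v \<Longrightarrow> f v < (c::real) \<Longrightarrow> \<forall>\<^sub>F u in nhds v. f u < c"
  unfolding isCont_def tendsto_at_iff_tendsto_nhds by (rule order_tendstoD(2))

lemma dense_approx:
  assumes dense: "\<And>v e. v \<in> fspace n \<Longrightarrow> e > 0 \<Longrightarrow> \<exists>d\<in>D. norm (v - d) < e"
    and ev: "eventually P (nhds v)" and v: "v \<in> fspace n"
  shows "\<exists>d\<in>D. P d"
proof -
  obtain e where "e > 0" "\<And>d. dist d v < e \<Longrightarrow> P d" using ev unfolding eventually_nhds_metric by blast
  then show ?thesis using dense[OF v \<open>e > 0\<close>] by (metis dist_norm dist_commute)
qed

context regular_sample
begin

text \<open>
  All conditions on a path hold with strict inequalities for an exact leading eigenvector of the reduced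
  sample and for nearly exact updates. By continuity they hold on open sets, which meet the dense set.
\<close>

lemma loo_path_exists:
  assumes dense: "\<And>v e. v \<in> fspace n \<Longrightarrow> e > 0 \<Longrightarrow> \<exists>d\<in>D. norm (v - d) < e" and D: "D \<subseteq> fspace n"
    and l: "l < m" and \<eta>: "\<eta> > 0" and B4: "B ^ 4 \<le> \<tau> * m"
  shows "\<exists>t. (\<forall>k. t k \<in> D) \<and> loo_path n m a x l K \<eta> t"
proof -
  let ?J = "{..<m} - {l}"
  let ?C = "weighted_cov a ?J x"
  define init where "init t \<longleftrightarrow> norm (?C (x + displ x t) - (2 * real m * (norm (x + displ x t))\<^sup>2) *\<^sub>R (x + displ x t)) \<le> \<eta> * real m
     \<and> norm (displ x t) \<le> 2/1000" for t
  define nxt where "nxt t t' \<longleftrightarrow> norm (gn_form a ?J x (displ x t) t') \<le> \<eta> * real m \<and>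
        \<bar>Im (cip t' (x + displ x t))\<bar> \<le> \<eta>" for t t'
  have init: "\<exists>t\<in>D. init t"
  proof -
    obtain v \<mu> where v: "v \<in> fspace n" "norm v = 1" "?C v = \<mu> *\<^sub>R v" "\<mu> \<ge> 0"
      "\<And>w. w \<in> fspace n \<Longrightarrow> inner (?C w) w \<le> \<mu> * (norm w)\<^sup>2"
      using leading_eigenvector_exists[of ?J a n x x] by auto
    have \<mu>: "\<mu> \<ge> (2 - 2 * \<tau>) * m"
    proof -
      have "(cmod (cip x (a l)) * cmod (cip x (a l)))\<^sup>2 \<le> (B * B)\<^sup>2"
        using x_incoherent[OF l] B_nonneg by (intro power_mono mult_mono) auto
      also have "\<dots> = B ^ 4" by (simp add: power2_eq_square power4_eq_xxxx mult_ac)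
      finally have "(cmod (cip x (a l)) * cmod (cip x (a l)))\<^sup>2 \<le> \<tau> * m" using B4 by linarith
      moreover have "inner (weighted_cov a {..<m} x x) x
          = inner (?C x) x + (cmod (cip x (a l)) * cmod (cip x (a l)))\<^sup>2"
        unfolding inner_weighted_cov using l by (subst sum.remove[of _ l]) auto
      ultimately show ?thesis using weighted_cov_lower v(5)[of x] by (simp add: algebra_simps)
    qed
    define w where "w = sqrt (\<mu> / (2 * m)) *\<^sub>R v"
    have wV: "w \<in> fspace n" using v by (simp add: w_def)
    have nw: "2 * real m * (norm w)\<^sup>2 = \<mu>"
      using v m_pos by (simp add: w_def power_mult_distrib)
    have Cw: "?C w = (2 * real m * (norm w)\<^sup>2) *\<^sub>R w"
      unfolding nw unfolding w_def scaleR_eq_cmul weighted_cov_linear v(3)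
      by (simp add: scaleR_eq_cmul cmul_simps mult.commute)
    have "m * (2 - 2 * \<tau>) \<le> m * (2 * (norm w)\<^sup>2)" using \<mu> nw by (simp add: mult_ac)
    then have "2 - 2 * \<tau> \<le> 2 * (norm w)\<^sup>2"
      unfolding mult_le_cancel_left_pos[OF m_pos[folded of_nat_0_less_iff[where 'a=real]]] .
    then have close: "norm (align x w - x) \<le> 1/1000"
      using wV Cw by (intro spectral_close[of w ?J]) auto
    define h where "h = align x w - x"
    have hV: "h \<in> fspace n" using wV by (auto simp: h_def)
    have xh: "x + h = align x w" by (simp add: h_def)
    have cip_xh: "cip (x + h) x = of_real (cmod (cip w x))" by (simp add: xh cip_align)
    have ph1: "ph (of_real r) = 1" if "r \<ge> 0" for r using that by (auto simp: ph_def sgn_of_real)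
    have displ_h: "displ x h = h" unfolding displ_def align_def cip_xh by (simp add: ph1 cmul_simps)
    have Ch: "?C (x + h) = (2 * real m * (norm (x + h))\<^sup>2) *\<^sub>R (x + h)"
      unfolding xh norm_align unfolding align_def weighted_cov_linear Cw
      by (simp add: scaleR_eq_cmul cmul_simps mult_ac)
    have cont: "isCont (displ x) h"
      unfolding isCont_def
    proof (rule LIM_I)
      fix r :: real assume r: "r > 0"
      have "norm (displ x t - displ x h) < r" if "norm (t - h) < min (1/1000) (r / 4)" for t
      proof -
        have "norm t \<le> 1/100"
          using that close norm_triangle_ineq[of h "t - h"] unfolding h_def[symmetric] by simp
        then have "norm (align x (x + t) - align x (x + h)) \<le> 4 * norm ((x + t) - (x + h))"
          using close unfolding h_def[symmetric] by (intro align_lipschitz) auto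
        then show ?thesis using that by (simp add: displ_def)
      qed
      then show "\<exists>s>0. \<forall>t. t \<noteq> h \<and> norm (t - h) < s \<longrightarrow> norm (displ x t - displ x h) < r"
        using r by (intro exI[of _ "min (1/1000) (r/4)"]) auto
    qed
    have "isCont (\<lambda>t. norm (?C (x + displ x t) - (2 * real m * (norm (x + displ x t))\<^sup>2) *\<^sub>R (x + displ x t))) h"
      by (intro continuous_intros cont)
    then have 1: "\<forall>\<^sub>F t in nhds h. norm (?C (x + displ x t) - (2 * real m * (norm (x + displ x t))\<^sup>2) *\<^sub>R (x + displ x t)) < \<eta> * real m"
      by (rule isCont_less) (use \<eta> m_pos in \<open>simp add: displ_h Ch\<close>)
    have "isCont (\<lambda>t. norm (displ x t)) h" by (intro continuous_intros cont)
    then have 2: "\<forall>\<^sub>F t in nhds h. norm (displ x t) < 2/1000"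
      by (rule isCont_less) (use close in \<open>simp add: displ_h h_def[symmetric]\<close>)
    have "\<forall>\<^sub>F t in nhds h. init t" using 1 2 unfolding init_def by eventually_elim auto
    then show ?thesis using dense_approx[OF dense _ hV] by blast
  qed
  have nxt: "\<exists>t'\<in>D. nxt t t'" if t: "t \<in> D" for t
  proof -
    have V: "displ x t \<in> fspace n" using t D by auto
    have "\<eta> * real m / 2 > 0" using \<eta> m_pos by simp
    then obtain g where g: "g \<in> fspace n" "norm (gn_form a ?J x (displ x t) g) \<le> \<eta> * real m / 2" "Im (cip g (x + displ x t)) = 0"
      using normal_equations_approx[of ?J a n "displ x t" x "\<eta> * real m / 2"] V by auto
    have "isCont (\<lambda>g. norm (gn_form a ?J x (displ x t) g)) g" by (intro continuous_intros isCont_gn_form)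
    then have 1: "\<forall>\<^sub>F g in nhds g. norm (gn_form a ?J x (displ x t) g) < \<eta> * real m"
      by (rule isCont_less) (use order_le_less_trans[OF g(2), of "\<eta> * real m"] \<eta> m_pos in simp)
    have "isCont (\<lambda>g. \<bar>Im (cip g (x + displ x t))\<bar>) g"
      by (intro continuous_intros bounded_linear.continuous[OF bounded_linear_Im])
    then have 2: "\<forall>\<^sub>F g in nhds g. \<bar>Im (cip g (x + displ x t))\<bar> < \<eta>"
      by (rule isCont_less) (use g(3) \<eta> in simp)
    have "\<forall>\<^sub>F g in nhds g. nxt t g" using 1 2 unfolding nxt_def by eventually_elim auto
    then show ?thesis using dense_approx[OF dense _ g(1)] by blast
  qed
  have "\<exists>t. \<forall>k. (t k \<in> D \<and> (k = 0 \<longrightarrow> init (t k))) \<and> nxt (t k) (t (Suc k))"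
    by (rule dependent_nat_choice) (use init nxt in auto)
  then obtain t where "\<And>k. t k \<in> D" "init (t 0)" "\<And>k. nxt (t k) (t (Suc k))" by blast
  then show ?thesis using D unfolding loo_path_def init_def nxt_def by (intro exI[of _ t]) blast
qed

end

section \<open>The pseudoinverse of a matrix with a known kernel\<close>

lemma dim_mat_adjoint [simp]: "dim_row (mat_adjoint A) = dim_col A" "dim_col (mat_adjoint A) = dim_row A"
  by (simp_all add: mat_adjoint_def)

lemma mat_adjoint_index [simp]:
  "i < dim_col A \<Longrightarrow> j < dim_row A \<Longrightarrow> mat_adjoint A $$ (i, j) = conjugate (A $$ (j, i))"
  by (simp add: mat_adjoint_def mat_of_rows_index)

lemma mat_adjoint_carrier [simp, intro]: "A \<in> carrier_mat m k \<Longrightarrow> mat_adjoint A \<in> carrier_mat k m"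
  by (intro carrier_matI) auto

lemma mat_adjoint_adjoint [simp]: "mat_adjoint (mat_adjoint A) = A"
  by (intro eq_matI) auto

lemma mat_adjoint_mult:
  fixes A B :: "complex mat"
  assumes "A \<in> carrier_mat m k" "B \<in> carrier_mat k p"
  shows "mat_adjoint (A * B) = mat_adjoint B * mat_adjoint A"
  using assms by (intro eq_matI) (auto simp: scalar_prod_def mult.commute)

lemma mat_adjoint_one [simp]: "mat_adjoint (1\<^sub>m k :: complex mat) = 1\<^sub>m k"
  by (intro eq_matI) auto

lemma mat_adjoint_add:
  fixes A B :: "complex mat"
  assumes "A \<in> carrier_mat m k" "B \<in> carrier_mat m k"
  shows "mat_adjoint (A + B) = mat_adjoint A + mat_adjoint B"
  using assms by (intro eq_matI) auto

lemma mat_adjoint_minus: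
  fixes A B :: "complex mat"
  assumes "A \<in> carrier_mat m k" "B \<in> carrier_mat m k"
  shows "mat_adjoint (A - B) = mat_adjoint A - mat_adjoint B"
  using assms by (intro eq_matI) auto

lemma mat_adjoint_cscalar:
  fixes A :: "complex mat"
  assumes "A \<in> carrier_mat m k" "u \<in> carrier_vec m" "v \<in> carrier_vec k"
  shows "(mat_adjoint A *\<^sub>v u) \<bullet>c v = u \<bullet>c (A *\<^sub>v v)"
proof -
  have dims: "dim_row A = m" "dim_col A = k" "dim_vec u = m" "dim_vec v = k" using assms by auto
  have 1: "(mat_adjoint A *\<^sub>v u) $ i = (\<Sum>j<m. cnj (A $$ (j, i)) * u $ j)" if "i < k" for i
    using that by (simp add: dims scalar_prod_def atLeast0LessThan)
  have 2: "(A *\<^sub>v v) $ j = (\<Sum>i<k. A $$ (j, i) * v $ i)" if "j < m" for j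
    using that by (simp add: dims scalar_prod_def atLeast0LessThan)
  have "(mat_adjoint A *\<^sub>v u) \<bullet>c v = (\<Sum>i<k. (mat_adjoint A *\<^sub>v u) $ i * cnj (v $ i))"
    by (simp add: dims scalar_prod_def atLeast0LessThan del: index_mult_mat_vec)
  also have "\<dots> = (\<Sum>i<k. \<Sum>j<m. cnj (A $$ (j, i)) * u $ j * cnj (v $ i))"
    by (intro sum.cong refl) (simp add: 1 sum_distrib_right del: index_mult_mat_vec)
  also have "\<dots> = (\<Sum>j<m. \<Sum>i<k. cnj (A $$ (j, i)) * u $ j * cnj (v $ i))" by (rule sum.swap)
  also have "\<dots> = (\<Sum>j<m. u $ j * cnj ((A *\<^sub>v v) $ j))"
    by (intro sum.cong refl) (simp add: 2 sum_distrib_left mult_ac del: index_mult_mat_vec)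
  also have "\<dots> = u \<bullet>c (A *\<^sub>v v)"
    by (simp add: dims scalar_prod_def atLeast0LessThan del: index_mult_mat_vec)
  finally show ?thesis .
qed

lemma pseudoinverse_unique:
  assumes B: "is_pseudoinverse A B" and C: "is_pseudoinverse A C"
  shows "B = C"
proof -
  define m k where "m = dim_row A" and "k = dim_col A"
  have cA: "A \<in> carrier_mat m k" unfolding m_def k_def by (rule carrier_matI) (rule refl)+
  have cB: "B \<in> carrier_mat k m" and cC: "C \<in> carrier_mat k m"
    using B C unfolding is_pseudoinverse_def m_def k_def by blast+
  note c = cA cB cC
  have AB: "A * B = A * C"
  proof -
    have "A * B = (A * C * A) * B" using C by (simp add: is_pseudoinverse_def)
    also have "\<dots> = (A * C) * (A * B)" by (rule assoc_mult_mat[of _ m m _ k _ m]) (use c in auto)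
    also have "\<dots> = mat_adjoint (A * C) * mat_adjoint (A * B)" using B C by (simp add: is_pseudoinverse_def)
    also have "\<dots> = mat_adjoint ((A * B) * (A * C))"
      using c by (intro mat_adjoint_mult[symmetric, of _ m m _ m]) auto
    also have "(A * B) * (A * C) = (A * B * A) * C"
      by (rule assoc_mult_mat[symmetric, of _ m m _ k _ m]) (use c in auto)
    also have "\<dots> = A * C" using B by (simp add: is_pseudoinverse_def)
    also have "mat_adjoint (A * C) = A * C" using C by (simp add: is_pseudoinverse_def)
    finally show ?thesis .
  qed
  have BA: "B * A = C * A"
  proof -
    have "B * A = B * (A * C * A)" using C by (simp add: is_pseudoinverse_def)
    also have "A * C * A = A * (C * A)" by (rule assoc_mult_mat[OF cA cC cA])
    also have "B * (A * (C * A)) = (B * A) * (C * A)"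
      by (rule assoc_mult_mat[symmetric, of _ k m _ k _ k]) (use c in auto)
    also have "\<dots> = mat_adjoint (B * A) * mat_adjoint (C * A)" using B C by (simp add: is_pseudoinverse_def)
    also have "\<dots> = mat_adjoint ((C * A) * (B * A))"
      using c by (intro mat_adjoint_mult[symmetric, of _ k k _ k]) auto
    also have "(C * A) * (B * A) = C * (A * (B * A))"
      by (rule assoc_mult_mat[of _ k m _ k _ k]) (use c in auto)
    also have "A * (B * A) = A * B * A" by (rule assoc_mult_mat[OF cA cB cA, symmetric])
    also have "C * (A * B * A) = C * A" using B by (simp add: is_pseudoinverse_def)
    also have "mat_adjoint (C * A) = C * A" using C by (simp add: is_pseudoinverse_def)
    finally show ?thesis .
  qed
  have "B = B * A * B" using B by (simp add: is_pseudoinverse_def)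
  also have "\<dots> = C * A * B" by (simp add: BA)
  also have "\<dots> = C * (A * B)" using c by (intro assoc_mult_mat)
  also have "\<dots> = C * (A * C)" by (simp add: AB)
  also have "\<dots> = C * A * C" using c by (intro assoc_mult_mat[symmetric])
  also have "\<dots> = C" using C by (simp add: is_pseudoinverse_def)
  finally show ?thesis .
qed

lemma pseudoinverse_eqI: "is_pseudoinverse A B \<Longrightarrow> pseudoinverse A = B"
  unfolding pseudoinverse_def using pseudoinverse_unique by blast

lemma cscalar_self_norm: "v \<bullet>c v = of_real ((l2norm v)\<^sup>2)"
proof -
  have "v \<bullet>c v = (\<Sum>i<dim_vec v. of_real ((cmod (v $ i))\<^sup>2))"
    by (simp add: scalar_prod_def atLeast0LessThan mult_cnj_self)
  then show ?thesis by (simp add: l2norm_def L2_set_def sum_nonneg)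
qed

lemma l2norm_eq_0: "v \<in> carrier_vec k \<Longrightarrow> l2norm v = 0 \<Longrightarrow> v = 0\<^sub>v k"
  by (auto simp: l2norm_def L2_set_eq_0_iff intro!: eq_vecI)

text \<open>
  If the kernel of \<open>A\<close> is spanned by \<open>k\<close>, then \<open>A\<^sup>* A + k k\<^sup>*\<close> is invertible and
  \<open>(A\<^sup>* A + k k\<^sup>*)\<^sup>-\<^sup>1 A\<^sup>*\<close> satisfies the Penrose equations. The conclusions say that \<open>w\<close> is the least squares solution
  orthogonal to the kernel.
\<close>

lemma pseudoinverse_rank_one_kernel:
  fixes A :: "complex mat"
  assumes A: "A \<in> carrier_mat m N" and k: "k \<in> carrier_vec N" and Ak: "A *\<^sub>v k = 0\<^sub>v m"
    and ker: "\<And>v. v \<in> carrier_vec N \<Longrightarrow> A *\<^sub>v v = 0\<^sub>v m \<Longrightarrow> v \<bullet>c k = 0 \<Longrightarrow> v = 0\<^sub>v N"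
    and F: "F \<in> carrier_vec m"
  defines "w \<equiv> pseudoinverse A *\<^sub>v F"
  shows "w \<in> carrier_vec N" "mat_adjoint A *\<^sub>v (A *\<^sub>v w) = mat_adjoint A *\<^sub>v F" "w \<bullet>c k = 0"
proof -
  define A' where "A' = mat_adjoint A"
  have A': "A' \<in> carrier_mat N m" using A by (simp add: A'_def)
  define K where "K = mat N N (\<lambda>(i, j). k $ i * cnj (k $ j))"
  have K: "K \<in> carrier_mat N N" by (simp add: K_def)
  have Kv: "K *\<^sub>v v = (v \<bullet>c k) \<cdot>\<^sub>v k" if "v \<in> carrier_vec N" for v
    using that k by (intro eq_vecI) (auto simp: K_def scalar_prod_def sum_distrib_right sum_distrib_left mult_ac)
  have adjK: "mat_adjoint K = K" by (intro eq_matI) (auto simp: K_def mult.commute)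
  have AK: "A * K = 0\<^sub>m m N"
  proof (rule eq_matI)
    fix i j assume ij: "i < dim_row (0\<^sub>m m N :: complex mat)" "j < dim_col (0\<^sub>m m N :: complex mat)"
    have "(A * K) $$ (i, j) = (A *\<^sub>v k) $ i * cnj (k $ j)"
      using ij A k by (simp add: K_def scalar_prod_def sum_distrib_right sum_distrib_left mult_ac)
    then show "(A * K) $$ (i, j) = 0\<^sub>m m N $$ (i, j)" using ij by (simp add: Ak)
  qed (use A K in auto)
  have KA': "K * A' = 0\<^sub>m N m"
  proof -
    have "K * A' = mat_adjoint (A * K)" unfolding A'_def
      using mat_adjoint_mult[OF A K] adjK by simp
    also have "\<dots> = 0\<^sub>m N m" unfolding AK by (intro eq_matI) auto
    finally show ?thesis .
  qed
  define M where "M = A' * A + K"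
  have AA: "A' * A \<in> carrier_mat N N" using A A' by simp
  have M: "M \<in> carrier_mat N N" using AA K by (simp add: M_def)
  have adjM: "mat_adjoint M = M"
    unfolding M_def using mat_adjoint_add[OF AA K] mat_adjoint_mult[OF A' A] by (simp add: A'_def adjK)
  have Mv: "M *\<^sub>v v = A' *\<^sub>v (A *\<^sub>v v) + (v \<bullet>c k) \<cdot>\<^sub>v k" if v: "v \<in> carrier_vec N" for v
    unfolding M_def using v AA K A A' by (simp add: add_mult_distrib_mat_vec[of _ N N] assoc_mult_mat_vec[of _ N m] Kv)
  have inj: "v = 0\<^sub>v N" if v: "v \<in> carrier_vec N" "M *\<^sub>v v = 0\<^sub>v N" for v
  proof -
    have Av: "A *\<^sub>v v \<in> carrier_vec m" using A v by simp
    have "0 = (A' *\<^sub>v (A *\<^sub>v v) + (v \<bullet>c k) \<cdot>\<^sub>v k) \<bullet>c v" using v Mv[OF v(1)] by simp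
    also have "\<dots> = (A' *\<^sub>v (A *\<^sub>v v)) \<bullet>c v + (v \<bullet>c k) * (k \<bullet>c v)"
      using v k A A' by (subst add_scalar_prod_distrib[of _ N]) auto
    also have "(A' *\<^sub>v (A *\<^sub>v v)) \<bullet>c v = of_real ((l2norm (A *\<^sub>v v))\<^sup>2)"
      unfolding A'_def using mat_adjoint_cscalar[OF A Av v(1)] by (simp only: cscalar_self_norm)
    also have "k \<bullet>c v = cnj (v \<bullet>c k)"
      using v k by (simp add: scalar_prod_def mult.commute)
    finally have "complex_of_real ((l2norm (A *\<^sub>v v))\<^sup>2 + (cmod (v \<bullet>c k))\<^sup>2) = 0"
      by (simp only: mult_cnj_self of_real_add)
    then have "(l2norm (A *\<^sub>v v))\<^sup>2 + (cmod (v \<bullet>c k))\<^sup>2 = 0" using of_real_eq_0_iff by blast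
    then have "l2norm (A *\<^sub>v v) = 0" "v \<bullet>c k = 0" by (auto simp: add_nonneg_eq_0_iff)
    then show ?thesis using l2norm_eq_0[OF Av] ker v by blast
  qed
  then have "det M \<noteq> 0" using det_0_iff_vec_prod_zero_field[OF M] by blast
  then obtain W where W: "W \<in> carrier_mat N N" "W * M = 1\<^sub>m N" "M * W = 1\<^sub>m N"
    using det_non_zero_imp_unit[OF M, of "()"] unfolding Units_def ring_mat_def by auto
  have adjW: "mat_adjoint W = W"
  proof -
    have W': "mat_adjoint W \<in> carrier_mat N N" using W by simp
    have "mat_adjoint W * M = 1\<^sub>m N"
      using mat_adjoint_mult[OF M W(1)] adjM W(3) by simp
    then have "mat_adjoint W * M * W = W" using W by simp
    then show ?thesis using assoc_mult_mat[OF W' M W(1)] W(3) right_mult_one_mat[OF W'] by simp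
  qed
  have KM: "K * M = K * K"
  proof -
    have "K * (A' * A) = (K * A') * A" using K A A' by (simp add: assoc_mult_mat[of _ N N _ m _ N])
    then show ?thesis unfolding M_def using K A A' AA
      by (simp add: mult_add_distrib_mat[of _ N N _ N] KA')
  qed
  have MK: "M * K = K * K"
  proof -
    have "A' * A * K = A' * (A * K)" using K A A' by (simp add: assoc_mult_mat[of _ N m _ N _ N])
    then show ?thesis unfolding M_def using K A A' AA
      by (simp add: add_mult_distrib_mat[of _ N N _ _ N] AK)
  qed
  have WK: "W * K = K * W"
  proof -
    have "W * K = W * K * (M * W)" using W K by simp
    also have "\<dots> = W * (K * M) * W" using W K M by (simp add: assoc_mult_mat[of _ N N _ N _ N])
    also have "\<dots> = W * (M * K) * W" by (simp add: KM MK)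
    also have "\<dots> = (W * M) * K * W" using W(1) K M by (simp add: assoc_mult_mat[of _ N N _ N _ N])
    finally show ?thesis using W K by simp
  qed
  define P where "P = W * A'"
  have P: "P \<in> carrier_mat N m" using W A' by (simp add: P_def)
  have PA: "P * A = 1\<^sub>m N - W * K"
  proof -
    have "P * A = W * (A' * A)" using W A A' by (simp add: P_def assoc_mult_mat[of _ N N _ m _ N])
    also have "A' * A = M - K" using AA K by (intro eq_matI) (auto simp: M_def)
    also have "W * (M - K) = W * M - W * K" using W M K by (intro mult_minus_distrib_mat)
    finally show ?thesis by (simp add: W)
  qed
  have WKc: "W * K \<in> carrier_mat N N" using W K by simp
  have adjWK: "mat_adjoint (W * K) = W * K"
    using mat_adjoint_mult[OF W(1) K] adjW adjK WK by simp
  have AWK: "A * (W * K) = 0\<^sub>m m N"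
  proof -
    have "A * (W * K) = (A * K) * W" unfolding WK using A K W by (simp add: assoc_mult_mat[of _ m N _ N _ N])
    then show ?thesis using W by (simp add: AK)
  qed
  have WKP: "(W * K) * P = 0\<^sub>m N m"
  proof -
    have "(W * K) * P = (W * (K * W)) * A'" unfolding P_def using W K A' by (simp add: assoc_mult_mat[of _ N N _ N _ m] assoc_mult_mat[of _ N N _ N _ N])
    also have "\<dots> = (W * W) * (K * A')" unfolding WK[symmetric] using W K A' by (simp add: assoc_mult_mat[of _ N N _ N _ m] assoc_mult_mat[of _ N N _ N _ N])
    finally show ?thesis using W by (simp add: KA')
  qed
  have "is_pseudoinverse A P"
    unfolding is_pseudoinverse_def
  proof (intro conjI)
    show "P \<in> carrier_mat (dim_col A) (dim_row A)" using P A by auto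
    have "A * P * A = A * (1\<^sub>m N - W * K)" using A P by (simp add: PA[symmetric] assoc_mult_mat[of _ m N _ m _ N])
    also have "\<dots> = A * 1\<^sub>m N - A * (W * K)" using A WKc by (intro mult_minus_distrib_mat) auto
    also have "\<dots> = A" using A unfolding AWK by (intro eq_matI) auto
    finally show "A * P * A = A" .
    have "P * A * P = 1\<^sub>m N * P - (W * K) * P" unfolding PA using P WKc by (intro minus_mult_distrib_mat) auto
    also have "\<dots> = P" using P unfolding WKP by (intro eq_matI) auto
    finally show "P * A * P = P" .
    have "mat_adjoint (A * P) = mat_adjoint P * A'" unfolding A'_def by (rule mat_adjoint_mult[OF A P])
    also have "mat_adjoint P = A * W" unfolding P_def using mat_adjoint_mult[OF W(1) A'] by (simp add: adjW A'_def)
    also have "A * W * A' = A * P" using A W A' by (simp add: P_def assoc_mult_mat[of _ m N _ N _ m])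
    finally show "mat_adjoint (A * P) = A * P" .
    show "mat_adjoint (P * A) = P * A"
      unfolding PA using mat_adjoint_minus[of "1\<^sub>m N" N N "W * K"] WKc by (simp add: adjWK)
  qed
  then have w: "w = P *\<^sub>v F" by (simp add: w_def pseudoinverse_eqI)
  show wc: "w \<in> carrier_vec N" using P F by (simp add: w)
  have Kw: "K *\<^sub>v w = 0\<^sub>v N"
  proof -
    have "K *\<^sub>v w = (K * P) *\<^sub>v F" using K P F by (simp add: w assoc_mult_mat_vec[of _ N N])
    also have "K * P = (W * K) * A'" unfolding P_def WK using W K A' by (simp add: assoc_mult_mat[of _ N N _ N _ m])
    also have "\<dots> = 0\<^sub>m N m" using W K A' by (simp add: assoc_mult_mat[of _ N N _ N _ m] KA')
    also have "0\<^sub>m N m *\<^sub>v F = 0\<^sub>v N" using F by (intro eq_vecI) (auto simp: scalar_prod_def)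
    finally show ?thesis .
  qed
  have "M *\<^sub>v w = (M * P) *\<^sub>v F" using M P F by (simp add: w assoc_mult_mat_vec[of _ N N])
  also have "M * P = A'"
    unfolding P_def using M W A' assoc_mult_mat[OF M W(1) A'] by simp
  finally have "A' *\<^sub>v (A *\<^sub>v w) + K *\<^sub>v w = A' *\<^sub>v F" using Mv[OF wc] Kv[OF wc] by simp
  moreover have "A' *\<^sub>v (A *\<^sub>v w) \<in> carrier_vec N" using A A' wc by simp
  ultimately show "mat_adjoint A *\<^sub>v (A *\<^sub>v w) = mat_adjoint A *\<^sub>v F" by (simp add: Kw A'_def)
  show "w \<bullet>c k = 0"
  proof (cases "k = 0\<^sub>v N")
    case True
    then show ?thesis using wc by simp
  next
    case False
    then obtain i where i: "i < N" "k $ i \<noteq> 0" using k by (metis carrier_vecD eq_vecI index_zero_vec)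
    have "((w \<bullet>c k) \<cdot>\<^sub>v k) $ i = 0" using Kw Kv[OF wc] i by simp
    then show ?thesis using i k by simp
  qed
qed


section \<open>Runs of the method in terms of sequences\<close>

definition to_fv :: "complex vec \<Rightarrow> fvec" where
  "to_fv v = mk_fv (dim_vec v) (\<lambda>i. v $ i)"

lemma to_fv_fspace [simp, intro]: "v \<in> carrier_vec n \<Longrightarrow> to_fv v \<in> fspace n"
  by (auto simp: to_fv_def fspace_def)

lemma fv_to_fv: "v \<in> carrier_vec n \<Longrightarrow> fv (to_fv v) i = (if i < n then v $ i else 0)"
  by (simp add: to_fv_def)

lemma cip_to_fv:
  assumes "v \<in> carrier_vec n" "w \<in> carrier_vec n"
  shows "cip (to_fv v) (to_fv w) = v \<bullet>c w"
  using assms by (subst cip_fspace[of _ n]) (auto simp: fv_to_fv scalar_prod_def atLeast0LessThan)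

lemma norm_to_fv: "norm (to_fv v) = l2norm v"
proof -
  have "(norm (to_fv v))\<^sup>2 = (l2norm v)\<^sup>2"
    by (subst norm_fspace[of _ "dim_vec v"])
      (auto simp: fv_to_fv l2norm_def L2_set_def sum_nonneg to_fv_def fspace_def)
  then show ?thesis by (simp add: l2norm_def power2_eq_iff_nonneg)
qed

lemma to_fv_simps:
  "v \<in> carrier_vec n \<Longrightarrow> w \<in> carrier_vec n \<Longrightarrow> to_fv (v + w) = to_fv v + to_fv w"
  "v \<in> carrier_vec n \<Longrightarrow> w \<in> carrier_vec n \<Longrightarrow> to_fv (v - w) = to_fv v - to_fv w"
  "to_fv (c \<cdot>\<^sub>v v) = cmul c (to_fv v)"
  by (auto simp: fvec_eq_iff to_fv_def)

lemma to_fv_inject: "v \<in> carrier_vec n \<Longrightarrow> w \<in> carrier_vec n \<Longrightarrow> to_fv v = to_fv w \<Longrightarrow> v = w"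
  by (rule eq_vecI) (auto simp: fvec_eq_iff to_fv_def split: if_splits dest: spec)

lemma to_fv_surj:
  assumes "u \<in> fspace n" obtains v where "v \<in> carrier_vec n" "to_fv v = u"
proof
  show "Matrix.vec n (fv u) \<in> carrier_vec n" by simp
  show "to_fv (Matrix.vec n (fv u)) = u" using assms by (auto simp: fvec_eq_iff to_fv_def fspace_def)
qed

lemma to_fv_sample_vec: "to_fv (sample_vec n \<omega> j) = mk_fv n (\<omega> j)"
  by (auto simp: fvec_eq_iff to_fv_def sample_vec_def)

lemma to_fv_spectral_mat:
  assumes a: "\<And>j. j < m \<Longrightarrow> a j \<in> carrier_vec n" and v: "v \<in> carrier_vec n" and x: "x \<in> carrier_vec n"
  shows "to_fv (spectral_mat n m a (\<lambda>j. (cmod (x \<bullet>c a j))\<^sup>2) *\<^sub>v v)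
    = (1 / m) *\<^sub>R weighted_cov (\<lambda>j. to_fv (a j)) {..<m} (to_fv x) (to_fv v)"
proof -
  let ?y = "\<lambda>j. complex_of_real ((cmod (x \<bullet>c a j))\<^sup>2)"
  have "(\<Sum>k<n. 1 / of_nat m * (\<Sum>j<m. ?y j * (a j $ i * cnj (a j $ k))) * v $ k)
      = 1 / of_nat m * (\<Sum>j<m. ?y j * (v \<bullet>c a j) * a j $ i)" if i: "i < n" for i
  proof -
    have "(\<Sum>k<n. 1 / of_nat m * (\<Sum>j<m. ?y j * (a j $ i * cnj (a j $ k))) * v $ k)
       = 1 / of_nat m * (\<Sum>k<n. \<Sum>j<m. ?y j * (a j $ i * cnj (a j $ k)) * v $ k)"
      by (simp only: sum_distrib_left sum_distrib_right mult.assoc)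
    also have "(\<Sum>k<n. \<Sum>j<m. ?y j * (a j $ i * cnj (a j $ k)) * v $ k)
       = (\<Sum>j<m. \<Sum>k<n. ?y j * (a j $ i * cnj (a j $ k)) * v $ k)" by (rule sum.swap)
    also have "\<dots> = (\<Sum>j<m. ?y j * (v \<bullet>c a j) * a j $ i)"
    proof (intro sum.cong refl)
      fix j assume "j \<in> {..<m}"
      then have "v \<bullet>c a j = (\<Sum>k<n. v $ k * cnj (a j $ k))"
        using a[of j] v by (simp add: scalar_prod_def atLeast0LessThan)
      then show "(\<Sum>k<n. ?y j * (a j $ i * cnj (a j $ k)) * v $ k) = ?y j * (v \<bullet>c a j) * a j $ i"
        by (simp add: sum_distrib_left sum_distrib_right mult_ac)
    qed
    finally show ?thesis .
  qed
  then have *: "(spectral_mat n m a (\<lambda>j. (cmod (x \<bullet>c a j))\<^sup>2) *\<^sub>v v) $ i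
      = 1 / of_nat m * (\<Sum>j<m. ?y j * (v \<bullet>c a j) * a j $ i)" if "i < n" for i
    using that v by (simp add: spectral_mat_def scalar_prod_def atLeast0LessThan)
  have dim: "spectral_mat n m a (\<lambda>j. (cmod (x \<bullet>c a j))\<^sup>2) *\<^sub>v v \<in> carrier_vec n"
    by (simp add: spectral_mat_def carrier_vecI)
  show ?thesis
    unfolding fvec_eq_iff
  proof
    fix i
    show "fv (to_fv (spectral_mat n m a (\<lambda>j. (cmod (x \<bullet>c a j))\<^sup>2) *\<^sub>v v)) i
      = fv ((1 / m) *\<^sub>R weighted_cov (\<lambda>j. to_fv (a j)) {..<m} (to_fv x) (to_fv v)) i"
    proof (cases "i < n")
      case True
      have "(\<Sum>j<m. ?y j * (v \<bullet>c a j) * a j $ i)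
        = (\<Sum>j<m. fv (cmul (of_real ((cmod (cip (to_fv x) (to_fv (a j))))\<^sup>2) * cip (to_fv v) (to_fv (a j))) (to_fv (a j))) i)"
        using True by (intro sum.cong refl) (simp add: cip_to_fv[OF x a] cip_to_fv[OF v a] fv_to_fv[OF a])
      then show ?thesis using True
        unfolding fv_to_fv[OF dim] *[OF True] weighted_cov_def
        by (simp add: fv_sum scaleR_conv_of_real del: of_real_power fv_simps(6))
    next
      case False
      have "weighted_cov (\<lambda>j. to_fv (a j)) {..<m} (to_fv x) (to_fv v) \<in> fspace n"
        unfolding weighted_cov_def using a by (intro fspace_sum fspace_closed to_fv_fspace) auto
      then show ?thesis using False unfolding fv_to_fv[OF dim] by (simp add: fspace_def)
    qed
  qed
qed

text \<open>
  The scaling of the initialisation turns its eigenvalue into \<open>2 (norm z0) ^ 2\<close>, which removes the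
  eigenvalue from the statement. Being the largest one, it is at least the Rayleigh quotient at \<open>x\<close>.
\<close>

lemma spectral_init_eigen:
  fixes x :: "complex vec"
  assumes a: "\<And>j. a j \<in> carrier_vec n" and x: "x \<in> carrier_vec n" "x \<noteq> 0\<^sub>v n" and m: "m > 0"
    and init: "spectral_init (spectral_mat n m a (\<lambda>j. (cmod (x \<bullet>c a j))\<^sup>2)) z0"
  defines "C \<equiv> weighted_cov (\<lambda>j. to_fv (a j)) {..<m} (to_fv x)"
  shows "z0 \<in> carrier_vec n"
    and "C (to_fv z0) = (2 * real m * (norm (to_fv z0))\<^sup>2) *\<^sub>R to_fv z0"
    and "inner (C (to_fv x)) (to_fv x) \<le> 2 * real m * (norm (to_fv z0))\<^sup>2 * (norm (to_fv x))\<^sup>2"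
proof -
  define Y where "Y = spectral_mat n m a (\<lambda>j. (cmod (x \<bullet>c a j))\<^sup>2)"
  have Y: "Y \<in> carrier_mat n n" by (simp add: Y_def spectral_mat_def)
  have YC: "to_fv (Y *\<^sub>v v) = (1 / m) *\<^sub>R C (to_fv v)" if "v \<in> carrier_vec n" for v
    unfolding Y_def C_def using a that x(1) by (intro to_fv_spectral_mat)
  define lam where "lam = leading_eigenvalue Y"
  obtain v where v: "eigenvector Y v (of_real lam)" "l2norm v = 1" "z0 = of_real (sqrt (lam / 2)) \<cdot>\<^sub>v v"
    using init unfolding spectral_init_def Y_def[symmetric] lam_def[symmetric] by blast
  have vV: "v \<in> carrier_vec n" "Y *\<^sub>v v = of_real lam \<cdot>\<^sub>v v" using v(1) Y by (auto simp: eigenvector_def)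
  show z0V: "z0 \<in> carrier_vec n" using v(3) vV by simp
  have xn: "norm (to_fv x) \<noteq> 0" using l2norm_eq_0[OF x(1)] x(2) by (auto simp: norm_to_fv)
  obtain u \<mu> where u: "u \<in> fspace n" "norm u = 1" "C u = \<mu> *\<^sub>R u" "\<mu> \<ge> 0"
      "\<And>w. w \<in> fspace n \<Longrightarrow> inner (C w) w \<le> \<mu> * (norm w)\<^sup>2"
    using leading_eigenvector_exists[of "{..<m}" "\<lambda>j. to_fv (a j)" n "(1 / norm (to_fv x)) *\<^sub>R to_fv x" "to_fv x"]
      a x(1) xn unfolding C_def by (auto simp: to_fv_fspace)
  obtain u' where u': "u' \<in> carrier_vec n" "to_fv u' = u" using to_fv_surj[OF u(1)] .
  have "to_fv (Y *\<^sub>v u') = to_fv (of_real (\<mu> / m) \<cdot>\<^sub>v u')"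
    using YC[OF u'(1)] u by (simp add: u' to_fv_simps scaleR_eq_cmul cmul_simps)
  then have "Y *\<^sub>v u' = of_real (\<mu> / m) \<cdot>\<^sub>v u'"
    using Y u'(1) by (intro to_fv_inject[of _ n]) (auto intro: mult_mat_vec_carrier)
  moreover have "u' \<noteq> 0\<^sub>v n"
  proof
    assume "u' = 0\<^sub>v n"
    then have "norm u = 0" by (simp add: u'(2)[symmetric] norm_to_fv l2norm_def L2_set_def)
    then show False using u(2) by simp
  qed
  ultimately have "eigenvalue Y (complex_of_real (\<mu> / m))"
    using Y u'(1) unfolding eigenvalue_def eigenvector_def by auto
  moreover have "finite {r. eigenvalue Y (complex_of_real r)}"
  proof -
    have "finite (complex_of_real -` spectrum Y)"
      by (intro finite_vimageI card_finite_spectrum(1)[OF Y]) (auto simp: inj_def)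
    then show ?thesis by (simp add: vimage_def spectrum_def)
  qed
  ultimately have le: "\<mu> / m \<le> lam" unfolding lam_def leading_eigenvalue_def by (intro Max_ge) auto
  have "0 \<le> \<mu> / m" using u(4) by simp
  with le have lam0: "lam \<ge> 0" by linarith
  have fz0: "to_fv z0 = sqrt (lam / 2) *\<^sub>R to_fv v" by (simp add: v(3) to_fv_simps scaleR_eq_cmul)
  have nz: "2 * (norm (to_fv z0))\<^sup>2 = lam" using lam0 v(2) by (simp add: fz0 norm_to_fv power_mult_distrib)
  have "m *\<^sub>R to_fv (Y *\<^sub>v v) = C (to_fv v)" using YC[OF vV(1)] m by simp
  then have Cv: "C (to_fv v) = (m * lam) *\<^sub>R to_fv v" by (simp add: vV(2) to_fv_simps scaleR_eq_cmul cmul_simps)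
  have "C (to_fv z0) = (m * lam) *\<^sub>R to_fv z0"
    using Cv unfolding fz0 C_def scaleR_eq_cmul[of "sqrt (lam / 2)"] weighted_cov_linear(2)
    by (simp add: scaleR_eq_cmul cmul_simps mult_ac)
  moreover have "2 * real m * (norm (to_fv z0))\<^sup>2 = m * lam" using nz by (simp add: mult_ac)
  ultimately show "C (to_fv z0) = (2 * real m * (norm (to_fv z0))\<^sup>2) *\<^sub>R to_fv z0" by (simp only:)
  have "inner (C (to_fv x)) (to_fv x) \<le> \<mu> * (norm (to_fv x))\<^sup>2" using x(1) by (intro u(5)) auto
  also have "\<mu> \<le> m * lam" using le m by (simp add: field_simps)
  also have "m * lam = 2 * real m * (norm (to_fv z0))\<^sup>2" using nz by (simp add: mult_ac)
  finally show "inner (C (to_fv x)) (to_fv x) \<le> 2 * real m * (norm (to_fv z0))\<^sup>2 * (norm (to_fv x))\<^sup>2"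
    by (simp add: mult_right_mono)
qed

text \<open>
  The method works with vectors of length \<open>2 n\<close>, which split as \<open>(u + \<i> v, conj (u - \<i> v))\<close>. The matrix acts on \<open>u\<close> and
  on \<open>v\<close> by the same real linear map, giving the real and the imaginary part of the image. As the residual is real, the
  solution of minimal norm has \<open>v = 0\<close>, and \<open>u\<close> solves the real least squares problem. The kernel is spanned by the vector with
  \<open>u = \<i> z\<close> and \<open>v = 0\<close>; orthogonality to it is the second conclusion.
\<close>

lemma gn_update_normal_equations:
  fixes x z :: "complex vec"
  assumes a: "\<And>j. a j \<in> carrier_vec n" and x: "x \<in> carrier_vec n" and z: "z \<in> carrier_vec n" "z \<noteq> 0\<^sub>v n" and m: "m > 0"
    and ker: "\<And>u. u \<in> fspace n \<Longrightarrow> (\<And>j. j < m \<Longrightarrow> Re (cnj (cip (to_fv z) (to_fv (a j))) * cip u (to_fv (a j))) = 0)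
        \<Longrightarrow> \<exists>t. u = cmul (\<i> * of_real t) (to_fv z)"
  defines "G \<equiv> to_fv (vec_first (pseudoinverse (gn_mat n m a z) *\<^sub>v gn_residual m a (\<lambda>j. (cmod (x \<bullet>c a j))\<^sup>2) z) n)"
  shows "(\<Sum>j<m. cmul (of_real (2 * Re (cnj (cip (to_fv z) (to_fv (a j))) * cip G (to_fv (a j)))
        - ((cmod (cip (to_fv z) (to_fv (a j))))\<^sup>2 - (cmod (cip (to_fv x) (to_fv (a j))))\<^sup>2)) * cip (to_fv z) (to_fv (a j))) (to_fv (a j))) = 0"
    and "Im (cip G (to_fv z)) = 0"
proof -
  define A where "A = gn_mat n m a z"
  define F where "F = gn_residual m a (\<lambda>j. (cmod (x \<bullet>c a j))\<^sup>2) z"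
  define s where "s = 1 / sqrt (real m)"
  have s0: "s > 0" using m by (simp add: s_def)
  define Z b where "Z = to_fv z" and "b j = to_fv (a j)" for j
  define \<alpha> where "\<alpha> j = cip Z (b j)" for j
  have \<alpha>: "\<alpha> j = z \<bullet>c a j" for j by (simp add: \<alpha>_def Z_def b_def cip_to_fv[OF z(1) a])
  have \<alpha>': "cnj (\<alpha> j) = a j \<bullet>c z" for j
    using cip_commute[of "b j" Z] by (simp add: \<alpha>_def) (simp add: Z_def b_def cip_to_fv[OF a z(1)])
  define f where "f j = (cmod (\<alpha> j))\<^sup>2 - (cmod (x \<bullet>c a j))\<^sup>2" for j
  have A: "A \<in> carrier_mat m (2 * n)" by (simp add: A_def gn_mat_def)
  have F: "F \<in> carrier_vec m" and Fi: "j < m \<Longrightarrow> F $ j = of_real (s * f j)" for j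
    by (simp_all add: F_def gn_residual_def f_def \<alpha> s_def)
  have Aidx: "A $$ (j, i) = of_real s * (if i < n then cnj (\<alpha> j) * cnj (a j $ i) else \<alpha> j * a j $ (i - n))"
    if "j < m" "i < 2 * n" for i j
    using that a[of j] unfolding A_def gn_mat_def \<alpha> \<alpha>' s_def[symmetric]
    by (auto simp: carrier_vecD[OF a] \<alpha>'[symmetric] \<alpha>)
  \<comment> \<open>The components \<open>u\<close> and \<open>v\<close> of the decomposition above.\<close>
  define U where "U w = cmul (1/2) (mk_fv n (\<lambda>i. w $ i) + mk_fv n (\<lambda>i. cnj (w $ (n + i))))" for w :: "complex vec"
  define V where "V w = cmul (1/(2*\<i>)) (mk_fv n (\<lambda>i. w $ i) - mk_fv n (\<lambda>i. cnj (w $ (n + i))))" for w :: "complex vec"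
  have UV [simp]: "U w \<in> fspace n" "V w \<in> fspace n" for w by (simp_all add: U_def V_def)
  have P: "mk_fv n (\<lambda>i. w $ i) = U w + cmul \<i> (V w)" and Q: "mk_fv n (\<lambda>i. cnj (w $ (n + i))) = U w - cmul \<i> (V w)" for w
    by (simp_all add: U_def V_def fvec_eq_iff field_simps)
  have split_sum: "(\<Sum>i<2*n. h i) = (\<Sum>i<n. h i) + (\<Sum>i<n. h (n + i))" for h :: "nat \<Rightarrow> complex"
  proof -
    have "{..<2*n} = {..<n} \<union> {n..<n+n}" by auto
    then have "(\<Sum>i<2*n. h i) = (\<Sum>i<n. h i) + (\<Sum>i\<in>{n..<n+n}. h i)"
      by (simp add: sum.union_disjoint ivl_disj_int)
    also have "(\<Sum>i\<in>{n..<n+n}. h i) = (\<Sum>i<n. h (n + i))"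
      using sum.shift_bounds_nat_ivl[of h 0 n n] by (simp add: atLeast0LessThan add.commute)
    finally show ?thesis .
  qed
  have cip_b: "cip (mk_fv n h) (b j) = (\<Sum>i<n. h i * cnj (a j $ i))" for h j
    by (subst cip_fspace[of _ n]) (auto simp: b_def fv_to_fv[OF a])
  have Aw: "(A *\<^sub>v w) $ j = of_real (s * (2 * Re (cnj (\<alpha> j) * cip (U w) (b j)))) + \<i> * of_real (s * (2 * Re (cnj (\<alpha> j) * cip (V w) (b j))))"
    if w: "w \<in> carrier_vec (2 * n)" and j: "j < m" for w j
  proof -
    have "(A *\<^sub>v w) $ j = (\<Sum>i<2*n. A $$ (j, i) * w $ i)"
      using A w j by (simp add: scalar_prod_def atLeast0LessThan)
    also have "\<dots> = (\<Sum>i<n. A $$ (j, i) * w $ i) + (\<Sum>i<n. A $$ (j, n + i) * w $ (n + i))" by (rule split_sum)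
    also have "(\<Sum>i<n. A $$ (j, i) * w $ i) = of_real s * (cnj (\<alpha> j) * cip (mk_fv n (\<lambda>i. w $ i)) (b j))"
      unfolding cip_b sum_distrib_left by (intro sum.cong refl) (simp add: Aidx j mult_ac)
    also have "(\<Sum>i<n. A $$ (j, n + i) * w $ (n + i)) = of_real s * (\<alpha> j * cnj (cip (mk_fv n (\<lambda>i. cnj (w $ (n + i)))) (b j)))"
      unfolding cip_b sum_distrib_left cnj_sum by (intro sum.cong refl) (simp add: Aidx j mult_ac)
    finally have "(A *\<^sub>v w) $ j = of_real s * (cnj (\<alpha> j) * cip (U w + cmul \<i> (V w)) (b j)
        + \<alpha> j * cnj (cip (U w - cmul \<i> (V w)) (b j)))" unfolding P Q by (simp add: distrib_left)
    then show ?thesis by (simp add: complex_eq_iff cip_linear algebra_simps)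
  qed
  define k where "k = Matrix.vec (2 * n) (\<lambda>i. if i < n then \<i> * z $ i else cnj (\<i> * z $ (i - n)))"
  have k: "k \<in> carrier_vec (2 * n)" by (simp add: k_def)
  have Uk: "U k = cmul \<i> Z" "V k = 0"
    by (auto simp: U_def V_def k_def Z_def fvec_eq_iff fv_to_fv[OF z(1)])
  have wk: "w \<bullet>c k = of_real (2 * Re (cip (U w) (cmul \<i> Z))) + \<i> * of_real (2 * Re (cip (V w) (cmul \<i> Z)))"
    if w: "w \<in> carrier_vec (2 * n)" for w
  proof -
    have "w \<bullet>c k = (\<Sum>i<2*n. w $ i * cnj (k $ i))" using w k by (simp add: scalar_prod_def atLeast0LessThan)
    also have "\<dots> = (\<Sum>i<n. w $ i * cnj (k $ i)) + (\<Sum>i<n. w $ (n + i) * cnj (k $ (n + i)))" by (rule split_sum)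
    also have "(\<Sum>i<n. w $ i * cnj (k $ i)) = cip (mk_fv n (\<lambda>i. w $ i)) (cmul \<i> Z)"
      by (subst cip_fspace[of _ n]) (auto simp: k_def Z_def fv_to_fv[OF z(1)])
    also have "(\<Sum>i<n. w $ (n + i) * cnj (k $ (n + i))) = cnj (cip (mk_fv n (\<lambda>i. cnj (w $ (n + i)))) (cmul \<i> Z))"
      by (subst cip_fspace[of _ n]) (auto simp: k_def Z_def fv_to_fv[OF z(1)] intro!: sum.cong)
    finally show ?thesis unfolding P Q by (simp add: complex_eq_iff cip_linear algebra_simps)
  qed
  have Z0: "norm Z \<noteq> 0" using l2norm_eq_0[OF z(1)] z(2) by (auto simp: Z_def norm_to_fv)
  have ker': "u = 0" if u: "u \<in> fspace n" "\<And>j. j < m \<Longrightarrow> Re (cnj (\<alpha> j) * cip u (b j)) = 0" "Re (cip u (cmul \<i> Z)) = 0" for u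
  proof -
    obtain t where t: "u = cmul (\<i> * of_real t) Z"
      using ker[of u] u(1,2) unfolding \<alpha>_def Z_def b_def by blast
    have "Re (cip u (cmul \<i> Z)) = t * (norm Z)\<^sup>2" unfolding t by (simp add: cip_linear cip_self_norm)
    then have "t = 0" using u(3) Z0 by simp
    then show ?thesis by (simp add: t cmul_simps)
  qed
  have UV0: "w = 0\<^sub>v (2 * n)" if w: "w \<in> carrier_vec (2 * n)" "U w = 0" "V w = 0" for w
  proof (rule eq_vecI)
    fix i assume i: "i < dim_vec (0\<^sub>v (2 * n) :: complex vec)"
    have "fv (mk_fv n (\<lambda>i. w $ i)) i = 0" "fv (mk_fv n (\<lambda>i. cnj (w $ (n + i)))) (i - n) = 0"
      unfolding P Q w by (simp_all add: cmul_simps)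
    then show "w $ i = 0\<^sub>v (2 * n) $ i" using i by (cases "i < n") (auto simp: split: if_splits)
  qed (use w in simp)
  define w where "w = pseudoinverse A *\<^sub>v F"
  have Ak: "A *\<^sub>v k = 0\<^sub>v m"
  proof (rule eq_vecI)
    fix j assume "j < dim_vec (0\<^sub>v m :: complex vec)"
    then have j: "j < m" by simp
    have "Re (cnj (\<alpha> j) * cip (cmul \<i> Z) (b j)) = 0" by (simp add: cip_linear \<alpha>_def algebra_simps)
    then show "(A *\<^sub>v k) $ j = 0\<^sub>v m $ j" using j unfolding Aw[OF k j] Uk by simp
  qed (use A in simp)
  have kerA: "v = 0\<^sub>v (2 * n)" if v: "v \<in> carrier_vec (2 * n)" "A *\<^sub>v v = 0\<^sub>v m" "v \<bullet>c k = 0" for v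
  proof (rule UV0[OF v(1)])
    have 1: "Re (cnj (\<alpha> j) * cip (U v) (b j)) = 0" "Re (cnj (\<alpha> j) * cip (V v) (b j)) = 0" if j: "j < m" for j
      using Aw[OF v(1) j] v(2) j s0 by (auto simp: complex_eq_iff)
    have 2: "Re (cip (U v) (cmul \<i> Z)) = 0" "Re (cip (V v) (cmul \<i> Z)) = 0"
      using wk[OF v(1)] v(3) by (auto simp: complex_eq_iff)
    show "U v = 0" "V v = 0" using 1 2 by (auto intro!: ker')
  qed
  note pinv = pseudoinverse_rank_one_kernel[OF A k Ak kerA F, folded w_def]
  have wc: "w \<in> carrier_vec (2 * n)" and norm_eq: "mat_adjoint A *\<^sub>v (A *\<^sub>v w) = mat_adjoint A *\<^sub>v F"
    and gauge: "w \<bullet>c k = 0" using pinv by blast+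
  have g2: "Re (cip (U w) (cmul \<i> Z)) = 0" "Re (cip (V w) (cmul \<i> Z)) = 0"
    using wk[OF wc] gauge by (auto simp: complex_eq_iff)
  define \<rho> \<sigma> where "\<rho> j = 2 * Re (cnj (\<alpha> j) * cip (U w) (b j)) - f j" and "\<sigma> j = 2 * Re (cnj (\<alpha> j) * cip (V w) (b j))" for j
  have AwF: "(A *\<^sub>v w) $ j = F $ j + of_real s * (of_real (\<rho> j) + \<i> * of_real (\<sigma> j))" if j: "j < m" for j
    unfolding Aw[OF wc j] Fi[OF j] by (simp add: \<rho>_def \<sigma>_def complex_eq_iff algebra_simps)
  have adj: "(\<Sum>j<m. cnj (A $$ (j, i)) * (of_real (\<rho> j) + \<i> * of_real (\<sigma> j))) = 0" if i: "i < 2 * n" for i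
  proof -
    have adj_i: "(mat_adjoint A *\<^sub>v y) $ i = (\<Sum>j<m. cnj (A $$ (j, i)) * y $ j)" if "y \<in> carrier_vec m" for y
      using that i A by (simp add: scalar_prod_def atLeast0LessThan)
    have "(\<Sum>j<m. cnj (A $$ (j, i)) * (A *\<^sub>v w) $ j) = (\<Sum>j<m. cnj (A $$ (j, i)) * F $ j)"
      using arg_cong[OF norm_eq, of "\<lambda>y. y $ i"] A wc F by (subst (asm) (1 2) adj_i) auto
    moreover have "(\<Sum>j<m. cnj (A $$ (j, i)) * (A *\<^sub>v w) $ j) = (\<Sum>j<m. cnj (A $$ (j, i)) * F $ j)
       + of_real s * (\<Sum>j<m. cnj (A $$ (j, i)) * (of_real (\<rho> j) + \<i> * of_real (\<sigma> j)))"
      unfolding sum_distrib_left sum.distrib[symmetric]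
      by (intro sum.cong refl) (simp only: lessThan_iff AwF, simp add: algebra_simps)
    ultimately show ?thesis using s0 by simp
  qed
  have gen: "X = 0 \<and> Y = 0" if "X + \<i> * Y = 0" "X - \<i> * Y = 0" for X Y :: complex
    using that by (simp add: complex_eq_iff)
  have two: "(\<Sum>j<m. \<alpha> j * a j $ i * of_real (\<rho> j)) = 0" "(\<Sum>j<m. \<alpha> j * a j $ i * of_real (\<sigma> j)) = 0" if i: "i < n" for i
  proof -
    have "(\<Sum>j<m. cnj (A $$ (j, i)) * (of_real (\<rho> j) + \<i> * of_real (\<sigma> j)))
        = of_real s * (\<Sum>j<m. \<alpha> j * a j $ i * (of_real (\<rho> j) + \<i> * of_real (\<sigma> j)))"
      unfolding sum_distrib_left by (intro sum.cong refl) (use i in \<open>simp add: Aidx mult_ac\<close>)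
    then have "of_real s * (\<Sum>j<m. \<alpha> j * a j $ i * (of_real (\<rho> j) + \<i> * of_real (\<sigma> j))) = 0"
      using adj[of i] i by simp
    then have "(\<Sum>j<m. \<alpha> j * a j $ i * (of_real (\<rho> j) + \<i> * of_real (\<sigma> j))) = 0"
      using s0 by simp
    then have 1: "(\<Sum>j<m. \<alpha> j * a j $ i * of_real (\<rho> j)) + \<i> * (\<Sum>j<m. \<alpha> j * a j $ i * of_real (\<sigma> j)) = 0"
      by (simp add: sum.distrib sum_distrib_left distrib_left mult_ac)
    have "(\<Sum>j<m. cnj (A $$ (j, n + i)) * (of_real (\<rho> j) + \<i> * of_real (\<sigma> j)))
        = of_real s * (\<Sum>j<m. cnj (\<alpha> j * a j $ i) * (of_real (\<rho> j) + \<i> * of_real (\<sigma> j)))"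
      unfolding sum_distrib_left by (intro sum.cong refl) (use i in \<open>simp add: Aidx mult_ac\<close>)
    then have "of_real s * (\<Sum>j<m. cnj (\<alpha> j * a j $ i) * (of_real (\<rho> j) + \<i> * of_real (\<sigma> j))) = 0"
      using adj[of "n + i"] i by simp
    then have "(\<Sum>j<m. cnj (\<alpha> j * a j $ i) * (of_real (\<rho> j) + \<i> * of_real (\<sigma> j))) = 0"
      using s0 by simp
    then have "cnj (\<Sum>j<m. cnj (\<alpha> j * a j $ i) * (of_real (\<rho> j) + \<i> * of_real (\<sigma> j))) = 0" by simp
    then have 2: "(\<Sum>j<m. \<alpha> j * a j $ i * of_real (\<rho> j)) - \<i> * (\<Sum>j<m. \<alpha> j * a j $ i * of_real (\<sigma> j)) = 0"
      by (simp add: sum_distrib_left algebra_simps sum.distrib sum_negf)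
    show "(\<Sum>j<m. \<alpha> j * a j $ i * of_real (\<rho> j)) = 0" "(\<Sum>j<m. \<alpha> j * a j $ i * of_real (\<sigma> j)) = 0"
      using gen[OF 1 2] by blast+
  qed
  have vec0: "(\<Sum>j<m. cmul (of_real (c j) * \<alpha> j) (b j)) = 0" if "\<And>i. i < n \<Longrightarrow> (\<Sum>j<m. \<alpha> j * a j $ i * of_real (c j)) = 0" for c
    unfolding fvec_eq_iff
  proof
    fix i
    show "fv (\<Sum>j<m. cmul (of_real (c j) * \<alpha> j) (b j)) i = fv 0 i"
      using that[of i] unfolding fv_sum by (cases "i < n") (simp_all add: b_def fv_to_fv[OF a] mult_ac)
  qed
  have "V w = 0"
  proof (rule ker')
    have "0 = Re (cip (\<Sum>j<m. cmul (of_real (\<sigma> j) * \<alpha> j) (b j)) (V w))" using vec0[OF two(2)] by simp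
    also have "\<dots> = (\<Sum>j<m. (\<sigma> j)\<^sup>2 / 2)"
      unfolding cip_sum_left Re_sum
    proof (intro sum.cong refl)
      fix j
      have "cip (b j) (V w) = cnj (cip (V w) (b j))" by (rule cip_commute)
      then show "Re (cip (cmul (of_real (\<sigma> j) * \<alpha> j) (b j)) (V w)) = (\<sigma> j)\<^sup>2 / 2"
        by (simp add: cip_linear \<sigma>_def power2_eq_square algebra_simps)
    qed
    finally have "(\<Sum>j<m. (\<sigma> j)\<^sup>2 / 2) = 0" by simp
    then have "\<sigma> j = 0" if "j < m" for j using that by (subst (asm) sum_nonneg_eq_0_iff) auto
    then show "Re (cnj (\<alpha> j) * cip (V w) (b j)) = 0" if "j < m" for j
      using \<open>\<And>j. j < m \<Longrightarrow> \<sigma> j = 0\<close>[OF that] unfolding \<sigma>_def by simp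
  qed (use g2 in auto)
  moreover have "G = mk_fv n (\<lambda>i. w $ i)"
    unfolding G_def A_def[symmetric] F_def[symmetric] w_def[symmetric]
    by (auto simp: vec_first_def to_fv_def fvec_eq_iff)
  ultimately have G: "G = U w" using P[of w] by (simp add: cmul_simps)
  have fj: "f j = (cmod (cip Z (b j)))\<^sup>2 - (cmod (cip (to_fv x) (b j)))\<^sup>2" for j
    by (simp add: f_def \<alpha>_def b_def cip_to_fv[OF x a])
  show "(\<Sum>j<m. cmul (of_real (2 * Re (cnj (cip (to_fv z) (to_fv (a j))) * cip G (to_fv (a j)))
        - ((cmod (cip (to_fv z) (to_fv (a j))))\<^sup>2 - (cmod (cip (to_fv x) (to_fv (a j))))\<^sup>2)) * cip (to_fv z) (to_fv (a j))) (to_fv (a j))) = 0"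
    using vec0[OF two(1)] unfolding \<rho>_def fj \<alpha>_def G Z_def b_def .
  show "Im (cip G (to_fv z)) = 0" using g2(1) by (simp add: G Z_def cip_linear)
qed

section \<open>The law of one coordinate of a Gaussian vector\<close>

lemma measurable_Complex_pair [measurable]:
  "(\<lambda>(u, v). Complex (u / sqrt 2) (v / sqrt 2)) \<in> borel_measurable (borel \<Otimes>\<^sub>M borel)"
  unfolding Complex_eq split_def by measurable

lemma sets_std_complex_normal [measurable_cong, simp]: "sets std_complex_normal = sets borel"
  by (simp add: std_complex_normal_def)

lemma space_std_complex_normal [simp]: "space std_complex_normal = UNIV"
  by (simp add: std_complex_normal_def)

lemma sets_std_normal_pair [measurable_cong]:
  "sets (std_normal_distribution \<Otimes>\<^sub>M std_normal_distribution) = sets (borel \<Otimes>\<^sub>M borel)"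
  by (intro sets_pair_measure_cong) auto

lemma prob_space_std_complex_normal: "prob_space std_complex_normal"
  unfolding std_complex_normal_def
proof (rule prob_space.prob_space_distr)
  interpret N: prob_space std_normal_distribution using prob_space_normal_density by simp
  interpret pair_prob_space std_normal_distribution std_normal_distribution ..
  show "prob_space (std_normal_distribution \<Otimes>\<^sub>M std_normal_distribution)" by unfold_locales
qed measurable

interpretation scn: prob_space std_complex_normal
  by (rule prob_space_std_complex_normal)

interpretation scn_prod: product_prob_space "\<lambda>_::nat. std_complex_normal" UNIV
  by standard

lemma prob_space_std_complex_gaussian: "prob_space (std_complex_gaussian n)"
  unfolding std_complex_gaussian_def by (rule prob_space_PiM) (rule prob_space_std_complex_normal)

lemma sets_std_complex_gaussian [measurable_cong]:
  "sets (std_complex_gaussian n) = sets (\<Pi>\<^sub>M i\<in>{..<n}. borel)"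
  unfolding std_complex_gaussian_def by (intro sets_PiM_cong) auto

lemma measurable_cnj [measurable]: "cnj \<in> borel_measurable borel"
  by (intro borel_measurable_continuous_onI continuous_intros)

lemma cip_mk_fv: "cip u (mk_fv n g) = (\<Sum>i<n. fv u i * cnj (g i))"
  by (subst cip_fspace[of _ n]) auto

lemma measurable_cip_mk_fv [measurable]:
  "(\<lambda>g. cip u (mk_fv n g)) \<in> borel_measurable (std_complex_gaussian n)"
  unfolding cip_mk_fv by measurable

lemma char_std_complex_normal:
  "(CLINT g|std_complex_normal. iexp (t * Re (u * cnj g))) = of_real (exp (- ((t * cmod u)\<^sup>2 / 4)))"
proof -
  let ?N = std_normal_distribution
  interpret N: prob_space ?N using prob_space_normal_density by simp
  interpret P: pair_prob_space ?N ?N ..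
  define r s where "r = t * Re u / sqrt 2" and "s = t * Im u / sqrt 2"
  have int: "integrable (?N \<Otimes>\<^sub>M ?N) (\<lambda>(p, q). iexp (r * p) * iexp (s * q))"
    by (rule P.P.integrable_const_bound[where B = 1]) (auto simp: norm_mult split_def)
  have "(CLINT g|std_complex_normal. iexp (t * Re (u * cnj g)))
     = (CLINT z|?N \<Otimes>\<^sub>M ?N. (case z of (p, q) \<Rightarrow> iexp (r * p) * iexp (s * q)))"
    unfolding std_complex_normal_def
    by (subst integral_distr) (auto simp: split_def r_def s_def field_simps exp_add[symmetric] intro!: Bochner_Integration.integral_cong)
  also have "\<dots> = (CLINT p|?N. (CLINT q|?N. iexp (r * p) * iexp (s * q)))"
    using P.integral_fst'[OF int] by simp
  also have "\<dots> = char ?N r * char ?N s" by (simp add: char_def)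
  also have "\<dots> = of_real (exp (- (r\<^sup>2 / 2)) * exp (- (s\<^sup>2 / 2)))"
    by (simp add: char_std_normal_distribution)
  also have "exp (- (r\<^sup>2 / 2)) * exp (- (s\<^sup>2 / 2)) = exp (- ((t * cmod u)\<^sup>2 / 4))"
    unfolding exp_add[symmetric] by (simp add: r_def s_def power_mult_distrib power_divide cmod_power2 field_simps)
  finally show ?thesis .
qed

text \<open>
  By rotation invariance, in the form of equality of characteristic functions.
\<close>

lemma law_Re_cip:
  assumes u: "u \<in> fspace n"
  shows "distr (std_complex_gaussian n) borel (\<lambda>g. Re (cip u (mk_fv n g)))
    = distr std_normal_distribution borel (\<lambda>y. norm u / sqrt 2 * y)" (is "?L = ?R")
proof (rule Levy_uniqueness)
  interpret G: prob_space "std_complex_gaussian n" by (rule prob_space_std_complex_gaussian)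
  interpret N: prob_space std_normal_distribution using prob_space_normal_density by simp
  show "real_distribution ?L" by (intro G.real_distribution_distr) measurable
  show "real_distribution ?R" by (intro N.real_distribution_distr) simp
  show "char ?L = char ?R"
  proof
    fix t
    have "char ?L t = (CLINT g|std_complex_gaussian n. iexp (t * Re (cip u (mk_fv n g))))"
      unfolding char_def by (subst integral_distr) auto
    also have "\<dots> = (CLINT g|std_complex_gaussian n. (\<Prod>i<n. iexp (t * Re (fv u i * cnj (g i)))))"
    proof -
      have "iexp (t * (\<Sum>i<n. c i)) = (\<Prod>i<n. iexp (t * c i))" for c
        by (simp add: exp_sum sum_distrib_left)
      then show ?thesis unfolding cip_mk_fv Re_sum by (simp only:)
    qed
    also have "\<dots> = (\<Prod>i<n. CLINT g|std_complex_normal. iexp (t * Re (fv u i * cnj g)))"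
      unfolding std_complex_gaussian_def
      by (rule scn_prod.product_integral_prod) (auto intro!: scn.integrable_const_bound[where B = 1])
    also have "\<dots> = of_real (exp (- ((t * norm u)\<^sup>2 / 4)))"
      unfolding char_std_complex_normal of_real_prod[symmetric] power_mult_distrib norm_fspace[OF u]
      by (simp add: exp_sum[symmetric] sum_negf sum_distrib_left sum_divide_distrib)
    also have "\<dots> = char std_normal_distribution (t * norm u / sqrt 2)"
      by (simp add: char_std_normal_distribution power_divide)
    also have "\<dots> = char ?R t"
      unfolding char_def by (subst integral_distr) (auto simp: mult_ac)
    finally show "char ?L t = char ?R t" .
  qed
qed

lemma Re_cip_moment4:
  assumes u: "u \<in> fspace n"
  shows "integrable (std_complex_gaussian n) (\<lambda>g. (Re (cip u (mk_fv n g))) ^ 4)"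
    and "(\<integral>g. (Re (cip u (mk_fv n g))) ^ 4 \<partial>std_complex_gaussian n) = 3/4 * norm u ^ 4"
proof -
  let ?N = std_normal_distribution and ?\<sigma> = "norm u / sqrt 2"
  have i: "integrable ?N (\<lambda>y. (?\<sigma> * y) ^ 4)"
    unfolding power_mult_distrib
    by (rule integrable_mult_right) (use std_normal_distribution_even_moments(2)[of 2] in simp)
  then have "integrable (distr ?N borel (\<lambda>y. ?\<sigma> * y)) (\<lambda>y. y ^ 4)" by (subst integrable_distr_eq) auto
  then show "integrable (std_complex_gaussian n) (\<lambda>g. (Re (cip u (mk_fv n g))) ^ 4)"
    unfolding law_Re_cip[OF u, symmetric] by (subst (asm) integrable_distr_eq) auto
  have "(\<integral>g. (Re (cip u (mk_fv n g))) ^ 4 \<partial>std_complex_gaussian n)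
      = (\<integral>y. y ^ 4 \<partial>distr (std_complex_gaussian n) borel (\<lambda>g. Re (cip u (mk_fv n g))))"
    by (subst integral_distr) auto
  also have "\<dots> = (\<integral>y. (?\<sigma> * y) ^ 4 \<partial>?N)" unfolding law_Re_cip[OF u] by (subst integral_distr) auto
  also have "\<dots> = ?\<sigma> ^ 4 * (\<integral>y. y ^ 4 \<partial>?N)"
    unfolding power_mult_distrib by (rule integral_mult_right_zero)
  also have "(\<integral>y. y ^ 4 \<partial>?N) = 3"
    using std_normal_distribution_even_moments(1)[of 2] by (simp add: fact_numeral)
  also have "?\<sigma> ^ 4 * 3 = 3/4 * norm u ^ 4" by (simp add: power_divide power4_eq_xxxx)
  finally show "(\<integral>g. (Re (cip u (mk_fv n g))) ^ 4 \<partial>std_complex_gaussian n) = 3/4 * norm u ^ 4" .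
qed

lemma exp_sq_std_normal: "(\<integral>\<^sup>+ y. ennreal (exp (y\<^sup>2 / 4)) \<partial>std_normal_distribution) = ennreal (sqrt 2)"
proof -
  have "(\<integral>\<^sup>+ y. ennreal (exp (y\<^sup>2 / 4)) \<partial>std_normal_distribution)
     = (\<integral>\<^sup>+ y. ennreal (std_normal_density y) * ennreal (exp (y\<^sup>2 / 4)) \<partial>lborel)"
    by (rule nn_integral_density) auto
  also have "\<dots> = (\<integral>\<^sup>+ y. ennreal (sqrt 2) * ennreal (normal_density 0 (sqrt 2) y) \<partial>lborel)"
  proof (rule nn_integral_cong)
    fix y :: real
    have "std_normal_density y * exp (y\<^sup>2 / 4) = sqrt 2 * normal_density 0 (sqrt 2) y"
    proof -
      have "exp (- y\<^sup>2 / 2) * exp (y\<^sup>2 / 4) = exp (- y\<^sup>2 / 4)" by (simp add: exp_add[symmetric])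
      then show ?thesis by (simp add: normal_density_def real_sqrt_mult field_simps)
    qed
    then show "ennreal (std_normal_density y) * ennreal (exp (y\<^sup>2 / 4)) = ennreal (sqrt 2) * ennreal (normal_density 0 (sqrt 2) y)"
      by (simp add: ennreal_mult'[symmetric])
  qed
  also have "\<dots> = ennreal (sqrt 2) * (\<integral>\<^sup>+ y. ennreal (normal_density 0 (sqrt 2) y) \<partial>lborel)"
    by (rule nn_integral_cmult) auto
  also have "(\<integral>\<^sup>+ y. ennreal (normal_density 0 (sqrt 2) y) \<partial>lborel) = 1"
    by (subst nn_integral_eq_integral) (auto simp: normal_density_nonneg)
  finally show ?thesis by simp
qed

lemma exp_Re_cip:
  assumes u: "u \<in> fspace n" and nu: "norm u \<le> 1"
  shows "(\<integral>\<^sup>+ g. ennreal (exp ((Re (cip u (mk_fv n g)))\<^sup>2 / 2)) \<partial>std_complex_gaussian n) \<le> ennreal (sqrt 2)"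
proof -
  let ?N = std_normal_distribution and ?\<sigma> = "norm u / sqrt 2"
  have "(\<integral>\<^sup>+ g. ennreal (exp ((Re (cip u (mk_fv n g)))\<^sup>2 / 2)) \<partial>std_complex_gaussian n)
     = (\<integral>\<^sup>+ y. ennreal (exp (y\<^sup>2 / 2)) \<partial>distr (std_complex_gaussian n) borel (\<lambda>g. Re (cip u (mk_fv n g))))"
    by (subst nn_integral_distr) auto
  also have "\<dots> = (\<integral>\<^sup>+ y. ennreal (exp ((?\<sigma> * y)\<^sup>2 / 2)) \<partial>?N)"
    unfolding law_Re_cip[OF u] by (subst nn_integral_distr) auto
  also have "\<dots> \<le> (\<integral>\<^sup>+ y. ennreal (exp (y\<^sup>2 / 4)) \<partial>?N)"
  proof (intro nn_integral_mono ennreal_leI)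
    fix y :: real
    have "(norm u)\<^sup>2 * y\<^sup>2 \<le> 1 * y\<^sup>2" using nu by (intro mult_right_mono) (auto simp: power_le_one)
    then show "exp ((?\<sigma> * y)\<^sup>2 / 2) \<le> exp (y\<^sup>2 / 4)" by (simp add: power_mult_distrib power_divide)
  qed
  finally show ?thesis by (simp add: exp_sq_std_normal)
qed

text \<open>
  The inequality \<open>2 s t \<le> s ^ 2 + t ^ 2\<close> separates the real and the imaginary part, and both have the law determined
  above.
\<close>

lemma exp_cip:
  assumes u: "u \<in> fspace n" and nu: "norm u \<le> 1"
  shows "(\<integral>\<^sup>+ g. ennreal (exp ((cmod (cip u (mk_fv n g)))\<^sup>2 / 4)) \<partial>std_complex_gaussian n) \<le> ennreal (sqrt 2)"
proof -
  define v where "v = cmul (- \<i>) u"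
  have v: "v \<in> fspace n" "norm v \<le> 1" using u nu by (auto simp: v_def)
  have Im: "Im (cip u w) = Re (cip v w)" for w by (simp add: v_def cip_linear)
  have le: "exp ((cmod (cip u w))\<^sup>2 / 4) \<le> exp ((Re (cip u w))\<^sup>2 / 2) / 2 + exp ((Re (cip v w))\<^sup>2 / 2) / 2" for w
  proof -
    have "exp ((cmod (cip u w))\<^sup>2 / 4) = exp ((Re (cip u w))\<^sup>2 / 4) * exp ((Re (cip v w))\<^sup>2 / 4)"
      by (simp add: cmod_power2 Im exp_add[symmetric] add_divide_distrib)
    also have "\<dots> \<le> ((exp ((Re (cip u w))\<^sup>2 / 4))\<^sup>2 + (exp ((Re (cip v w))\<^sup>2 / 4))\<^sup>2) / 2"
      using sum_squares_bound[of "exp ((Re (cip u w))\<^sup>2 / 4)" "exp ((Re (cip v w))\<^sup>2 / 4)"] by simp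
    also have "\<dots> = exp ((Re (cip u w))\<^sup>2 / 2) / 2 + exp ((Re (cip v w))\<^sup>2 / 2) / 2"
      by (simp add: exp_double[symmetric] add_divide_distrib)
    finally show ?thesis .
  qed
  define c :: real where "c = 1/2"
  have c: "c \<ge> 0" by (simp add: c_def)
  have le': "exp ((cmod (cip u w))\<^sup>2 / 4) \<le> c * exp ((Re (cip u w))\<^sup>2 / 2) + c * exp ((Re (cip v w))\<^sup>2 / 2)" for w
    using le[of w] by (simp add: c_def)
  have "(\<integral>\<^sup>+ g. ennreal (exp ((cmod (cip u (mk_fv n g)))\<^sup>2 / 4)) \<partial>std_complex_gaussian n)
     \<le> (\<integral>\<^sup>+ g. ennreal c * ennreal (exp ((Re (cip u (mk_fv n g)))\<^sup>2 / 2))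
          + ennreal c * ennreal (exp ((Re (cip v (mk_fv n g)))\<^sup>2 / 2)) \<partial>std_complex_gaussian n)"
    using le' c by (intro nn_integral_mono) (simp add: ennreal_mult'[symmetric] ennreal_plus[symmetric] del: ennreal_plus)
  also have "\<dots> = ennreal c * (\<integral>\<^sup>+ g. ennreal (exp ((Re (cip u (mk_fv n g)))\<^sup>2 / 2)) \<partial>std_complex_gaussian n)
      + ennreal c * (\<integral>\<^sup>+ g. ennreal (exp ((Re (cip v (mk_fv n g)))\<^sup>2 / 2)) \<partial>std_complex_gaussian n)"
    by (subst nn_integral_add) (auto simp: nn_integral_cmult)
  also have "\<dots> \<le> ennreal c * ennreal (sqrt 2) + ennreal c * ennreal (sqrt 2)"
    using exp_Re_cip[OF u nu] exp_Re_cip[OF v] by (intro add_mono mult_left_mono) auto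
  also have "\<dots> = ennreal (sqrt 2)"
    using c by (simp add: ennreal_mult'[symmetric] ennreal_plus[symmetric] del: ennreal_plus) (simp add: c_def)
  finally show ?thesis .
qed

text \<open>
  The fourth power of the modulus is a linear combination of fourth powers of real parts of four rotated
  variables, whose laws are known.
\<close>

lemma cip_moment4:
  assumes u: "u \<in> fspace n"
  shows "integrable (std_complex_gaussian n) (\<lambda>g. cmod (cip u (mk_fv n g)) ^ 4)"
    and "(\<integral>g. cmod (cip u (mk_fv n g)) ^ 4 \<partial>std_complex_gaussian n) = 2 * norm u ^ 4"
proof -
  define w where "w c = cmul c u" for c
  have w: "w c \<in> fspace n" "norm (w c) = cmod c * norm u" for c using u by (auto simp: w_def)
  let ?e = "(1 + \<i>) / sqrt 2" and ?f = "(1 - \<i>) / sqrt 2"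
  \<comment> \<open>The average of \<open>cos ^ 4\<close> over four equally spaced directions is \<open>3/8\<close>.\<close>
  have id: "cmod p ^ 4 = 2/3 * ((Re (1 * p)) ^ 4 + (Re (\<i> * p)) ^ 4 + (Re (?e * p)) ^ 4 + (Re (?f * p)) ^ 4)" for p
  proof -
    have e: "Re (?e * p) = (Re p - Im p) / sqrt 2" "Re (?f * p) = (Re p + Im p) / sqrt 2"
      by (simp_all add: field_simps)
    have s: "sqrt 2 ^ 4 = (4::real)" by (simp add: power4_eq_xxxx)
    have "cmod p ^ 4 = ((Re p)\<^sup>2 + (Im p)\<^sup>2)\<^sup>2" by (simp add: cmod_power2[symmetric])
    then show ?thesis unfolding e power_divide s by (simp add: power4_eq_xxxx power2_eq_square field_simps)
  qed
  have id': "cmod (cip u v) ^ 4 = 2/3 * ((Re (cip (w 1) v)) ^ 4 + (Re (cip (w \<i>) v)) ^ 4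
      + (Re (cip (w ?e) v)) ^ 4 + (Re (cip (w ?f) v)) ^ 4)" for v
    unfolding w_def cip_cmul_left by (rule id)
  have n: "cmod ?e = 1" "cmod ?f = 1" by (simp_all add: norm_divide cmod_def power_divide)
  show "integrable (std_complex_gaussian n) (\<lambda>g. cmod (cip u (mk_fv n g)) ^ 4)"
    unfolding id' by (intro Bochner_Integration.integrable_add integrable_mult_right Re_cip_moment4(1) w(1))
  show "(\<integral>g. cmod (cip u (mk_fv n g)) ^ 4 \<partial>std_complex_gaussian n) = 2 * norm u ^ 4"
    unfolding id' by (simp add: Re_cip_moment4 w n del: of_real_divide)
qed

text \<open>
  Eighth moments bound the second moments of the products of two squares, to which the concentration
  inequalities are applied.
\<close>

lemma integrable_cip_power8:
  assumes u: "u \<in> fspace n" and nu: "norm u \<le> 1"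
  shows "integrable (std_complex_gaussian n) (\<lambda>g. cmod (cip u (mk_fv n g)) ^ 8)"
    and "(\<integral>g. cmod (cip u (mk_fv n g)) ^ 8 \<partial>std_complex_gaussian n) \<le> 10^5"
proof -
  have le: "y ^ 8 \<le> 65536 * exp (y\<^sup>2 / 4)" for y :: real
  proof -
    have "(y\<^sup>2 / 16) ^ 4 \<le> exp (y\<^sup>2 / 16) ^ 4"
    proof (rule power_mono)
      show "y\<^sup>2 / 16 \<le> exp (y\<^sup>2 / 16)" using exp_ge_add_one_self[of "y\<^sup>2 / 16"] by linarith
    qed simp
    also have "exp (y\<^sup>2 / 16) ^ 4 = exp (y\<^sup>2 / 4)" by (simp add: exp_of_nat_mult[symmetric])
    finally show ?thesis by (simp add: power_divide power_mult[symmetric])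
  qed
  define c :: real where "c = 65536"
  have c: "c \<ge> 0" by (simp add: c_def)
  have le': "y ^ 8 \<le> c * exp (y\<^sup>2 / 4)" for y :: real using le[of y] by (simp add: c_def)
  have "(\<integral>\<^sup>+ g. ennreal (cmod (cip u (mk_fv n g)) ^ 8) \<partial>std_complex_gaussian n)
      \<le> (\<integral>\<^sup>+ g. ennreal c * ennreal (exp ((cmod (cip u (mk_fv n g)))\<^sup>2 / 4)) \<partial>std_complex_gaussian n)"
    using le' c by (intro nn_integral_mono) (simp add: ennreal_mult'[symmetric])
  also have "\<dots> = ennreal c * (\<integral>\<^sup>+ g. ennreal (exp ((cmod (cip u (mk_fv n g)))\<^sup>2 / 4)) \<partial>std_complex_gaussian n)"
    by (rule nn_integral_cmult) measurable
  also have "\<dots> \<le> ennreal c * ennreal (sqrt 2)" by (intro mult_left_mono exp_cip u nu) auto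
  also have "\<dots> \<le> ennreal (10^5)"
  proof -
    have "sqrt 2 \<le> (3/2::real)" by (rule real_le_lsqrt) (auto simp: power2_eq_square)
    then have "c * sqrt 2 \<le> 10^5" by (simp add: c_def)
    then show ?thesis using c by (simp only: ennreal_mult'[symmetric] ennreal_leI)
  qed
  finally have *: "(\<integral>\<^sup>+ g. ennreal (cmod (cip u (mk_fv n g)) ^ 8) \<partial>std_complex_gaussian n) \<le> ennreal (10^5)" .
  show i: "integrable (std_complex_gaussian n) (\<lambda>g. cmod (cip u (mk_fv n g)) ^ 8)"
    using * by (intro integrableI_bounded) (auto simp: less_top[symmetric] top_unique)
  show "(\<integral>g. cmod (cip u (mk_fv n g)) ^ 8 \<partial>std_complex_gaussian n) \<le> 10^5"
    using *[unfolded nn_integral_eq_integral[OF i AE_I2[OF zero_le_power[OF norm_ge_zero]]]]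
    by (subst (asm) ennreal_le_iff) simp_all
qed

section \<open>Mixed moments by polarisation\<close>

text \<open>
  Mixed fourth moments are thus determined by the fourth moments of the linear combinations \<open>p \<plusminus> q\<close> and
  \<open>p \<plusminus> \<i> q\<close>.
\<close>

lemma polarize_abs:
  "(cmod p)\<^sup>2 * (cmod q)\<^sup>2 = (cmod (p + q) ^ 4 + cmod (p - q) ^ 4 + cmod (p + \<i> * q) ^ 4 + cmod (p - \<i> * q) ^ 4
     - 4 * cmod p ^ 4 - 4 * cmod q ^ 4) / 16"
proof -
  have 4: "cmod z ^ 4 = ((Re z)\<^sup>2 + (Im z)\<^sup>2)\<^sup>2" for z by (simp add: cmod_power2[symmetric])
  show ?thesis unfolding 4 cmod_power2 by (simp add: power2_eq_square field_simps)
qed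

lemma polarize_Re:
  "(Re (cnj p * q))\<^sup>2 = (cmod (p + q) ^ 4 + cmod (p - q) ^ 4 - 2 * cmod p ^ 4 - 2 * cmod q ^ 4 - 4 * ((cmod p)\<^sup>2 * (cmod q)\<^sup>2)) / 8"
proof -
  have 4: "cmod z ^ 4 = ((Re z)\<^sup>2 + (Im z)\<^sup>2)\<^sup>2" for z by (simp add: cmod_power2[symmetric])
  show ?thesis unfolding 4 cmod_power2 by (simp add: power2_eq_square field_simps)
qed

lemma cip_mixed_moments:
  assumes u: "u \<in> fspace n" and v: "v \<in> fspace n"
  shows "integrable (std_complex_gaussian n) (\<lambda>g. (cmod (cip u (mk_fv n g)))\<^sup>2 * (cmod (cip v (mk_fv n g)))\<^sup>2)" (is ?A)
    and "(\<integral>g. (cmod (cip u (mk_fv n g)))\<^sup>2 * (cmod (cip v (mk_fv n g)))\<^sup>2 \<partial>std_complex_gaussian n)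
      = (norm u)\<^sup>2 * (norm v)\<^sup>2 + (cmod (cip u v))\<^sup>2" (is ?B)
    and "integrable (std_complex_gaussian n) (\<lambda>g. (Re (cnj (cip u (mk_fv n g)) * cip v (mk_fv n g)))\<^sup>2)" (is ?C)
    and "(\<integral>g. (Re (cnj (cip u (mk_fv n g)) * cip v (mk_fv n g)))\<^sup>2 \<partial>std_complex_gaussian n)
      = ((norm u)\<^sup>2 * (norm v)\<^sup>2 + 3 * (Re (cip u v))\<^sup>2 - (Im (cip u v))\<^sup>2) / 2" (is ?D)
proof -
  define w where "w c = u + cmul c v" for c
  have w: "w c \<in> fspace n" for c using u v by (auto simp: w_def)
  have cw: "cip (w c) b = cip u b + c * cip v b" for c b by (simp add: w_def cip_linear)
  have nw: "(norm (w c))\<^sup>2 = (norm u)\<^sup>2 + (norm v)\<^sup>2 + 2 * Re (cnj c * cip u v)" if "cmod c = 1" for c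
  proof -
    have "(norm (w c))\<^sup>2 = (norm u)\<^sup>2 + (norm (cmul c v))\<^sup>2 + 2 * inner u (cmul c v)"
      unfolding w_def power2_norm_eq_inner inner_add_left inner_add_right by (simp add: inner_commute)
    then show ?thesis using that by (simp add: inner_fvec_def cip_linear)
  qed
  have n4: "norm (w c) ^ 4 = ((norm (w c))\<^sup>2)\<^sup>2" for c by simp
  have abs: "(cmod (cip u b))\<^sup>2 * (cmod (cip v b))\<^sup>2 = (cmod (cip (w 1) b) ^ 4 + cmod (cip (w (-1)) b) ^ 4
     + cmod (cip (w \<i>) b) ^ 4 + cmod (cip (w (-\<i>)) b) ^ 4 - 4 * cmod (cip u b) ^ 4 - 4 * cmod (cip v b) ^ 4) / 16" for b
    unfolding cw polarize_abs[of "cip u b"] by simp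
  have re: "(Re (cnj (cip u b) * cip v b))\<^sup>2 = (cmod (cip (w 1) b) ^ 4 + cmod (cip (w (-1)) b) ^ 4
     - 2 * cmod (cip u b) ^ 4 - 2 * cmod (cip v b) ^ 4 - 4 * ((cmod (cip u b))\<^sup>2 * (cmod (cip v b))\<^sup>2)) / 8" for b
    unfolding cw polarize_Re[of "cip u b"] by simp
  note I = cip_moment4(1)[OF w] cip_moment4(1)[OF u] cip_moment4(1)[OF v]
  show A: ?A unfolding abs
    by (intro integrable_divide Bochner_Integration.integrable_diff Bochner_Integration.integrable_add integrable_mult_right I)
  have "(\<integral>g. (cmod (cip u (mk_fv n g)))\<^sup>2 * (cmod (cip v (mk_fv n g)))\<^sup>2 \<partial>std_complex_gaussian n)
     = (2 * norm (w 1) ^ 4 + 2 * norm (w (-1)) ^ 4 + 2 * norm (w \<i>) ^ 4 + 2 * norm (w (-\<i>)) ^ 4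
        - 4 * (2 * norm u ^ 4) - 4 * (2 * norm v ^ 4)) / 16"
    unfolding abs by (simp add: I cip_moment4(2) w u v)
  also have "\<dots> = (norm u)\<^sup>2 * (norm v)\<^sup>2 + (cmod (cip u v))\<^sup>2"
  proof -
    have "norm u ^ 4 = ((norm u)\<^sup>2)\<^sup>2" "norm v ^ 4 = ((norm v)\<^sup>2)\<^sup>2" by simp_all
    then show ?thesis unfolding n4 by (simp add: nw cmod_power2) (simp add: power2_eq_square power4_eq_xxxx field_simps)
  qed
  finally show B: ?B .
  show ?C unfolding re
    by (intro integrable_divide Bochner_Integration.integrable_diff Bochner_Integration.integrable_add integrable_mult_right I A)
  have "(\<integral>g. (Re (cnj (cip u (mk_fv n g)) * cip v (mk_fv n g)))\<^sup>2 \<partial>std_complex_gaussian n)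
     = (2 * norm (w 1) ^ 4 + 2 * norm (w (-1)) ^ 4 - 2 * (2 * norm u ^ 4) - 2 * (2 * norm v ^ 4)
        - 4 * ((norm u)\<^sup>2 * (norm v)\<^sup>2 + (cmod (cip u v))\<^sup>2)) / 8"
    unfolding re B[symmetric] using A by (simp add: I cip_moment4(2) w u v)
  also have "\<dots> = ((norm u)\<^sup>2 * (norm v)\<^sup>2 + 3 * (Re (cip u v))\<^sup>2 - (Im (cip u v))\<^sup>2) / 2"
  proof -
    have "norm u ^ 4 = ((norm u)\<^sup>2)\<^sup>2" "norm v ^ 4 = ((norm v)\<^sup>2)\<^sup>2" by simp_all
    then show ?thesis unfolding n4 by (simp add: nw cmod_power2) (simp add: power2_eq_square power4_eq_xxxx field_simps)
  qed
  finally show ?D .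
qed

lemma cip_mixed_moment8:
  assumes u: "u \<in> fspace n" "norm u \<le> 1" and v: "v \<in> fspace n" "norm v \<le> 1"
    and [measurable]: "f \<in> borel_measurable (std_complex_gaussian n)"
    and f: "\<And>g. \<bar>f g\<bar> \<le> (cmod (cip u (mk_fv n g)))\<^sup>2 * (cmod (cip v (mk_fv n g)))\<^sup>2"
  shows "integrable (std_complex_gaussian n) (\<lambda>g. (f g)\<^sup>2)"
    and "(\<integral>g. (f g)\<^sup>2 \<partial>std_complex_gaussian n) \<le> 10^5"
proof -
  let ?U = "\<lambda>g. cmod (cip u (mk_fv n g))" and ?V = "\<lambda>g. cmod (cip v (mk_fv n g))"
  have le: "(f g)\<^sup>2 \<le> (?U g ^ 8 + ?V g ^ 8) / 2" for g
  proof -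
    have "(f g)\<^sup>2 = \<bar>f g\<bar>\<^sup>2" by simp
    also have "\<dots> \<le> ((?U g)\<^sup>2 * (?V g)\<^sup>2)\<^sup>2" by (intro power_mono f) auto
    also have "\<dots> = ?U g ^ 4 * ?V g ^ 4" by (simp add: power_mult_distrib power_mult[symmetric])
    also have "\<dots> \<le> ((?U g ^ 4)\<^sup>2 + (?V g ^ 4)\<^sup>2) / 2" using sum_squares_bound[of "?U g ^ 4" "?V g ^ 4"] by simp
    finally show ?thesis by (simp add: power_mult[symmetric])
  qed
  have i: "integrable (std_complex_gaussian n) (\<lambda>g. (?U g ^ 8 + ?V g ^ 8) / 2)"
    using u v by (intro integrable_divide Bochner_Integration.integrable_add integrable_cip_power8(1))
  show *: "integrable (std_complex_gaussian n) (\<lambda>g. (f g)\<^sup>2)"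
  proof (rule Bochner_Integration.integrable_bound[OF i])
    have "norm ((f g)\<^sup>2) \<le> norm ((?U g ^ 8 + ?V g ^ 8) / 2)" for g
      using order_trans[OF le[of g] abs_ge_self] by (simp only: real_norm_def abs_power2)
    then show "AE g in std_complex_gaussian n. norm ((f g)\<^sup>2) \<le> norm ((?U g ^ 8 + ?V g ^ 8) / 2)"
      by (rule AE_I2)
  qed measurable
  have "(\<integral>g. (f g)\<^sup>2 \<partial>std_complex_gaussian n) \<le> (\<integral>g. (?U g ^ 8 + ?V g ^ 8) / 2 \<partial>std_complex_gaussian n)"
    by (rule integral_mono[OF * i le])
  also have "\<dots> = ((\<integral>g. ?U g ^ 8 \<partial>std_complex_gaussian n) + (\<integral>g. ?V g ^ 8 \<partial>std_complex_gaussian n)) / 2"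
    using integrable_cip_power8(1)[OF u] integrable_cip_power8(1)[OF v] by simp
  also have "\<dots> \<le> 10^5" using integrable_cip_power8(2)[OF u] integrable_cip_power8(2)[OF v] by simp
  finally show "(\<integral>g. (f g)\<^sup>2 \<partial>std_complex_gaussian n) \<le> 10^5" .
qed


section \<open>Exponential concentration for sums over the sample\<close>

interpretation scg: prob_space "std_complex_gaussian n" for n
  by (rule prob_space_std_complex_gaussian)

interpretation scg_prod: product_prob_space "\<lambda>_::nat. std_complex_gaussian n" UNIV for n
  by standard

interpretation sample: prob_space "gaussian_sample n m" for n m
  unfolding gaussian_sample_def by (rule prob_space_PiM) (rule prob_space_std_complex_gaussian)

lemma measurable_sample_component [measurable]:
  "j < m \<Longrightarrow> (\<lambda>\<omega>. \<omega> j) \<in> measurable (gaussian_sample n m) (std_complex_gaussian n)"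
  unfolding gaussian_sample_def by measurable

lemma exp_markov:
  assumes M: "prob_space M" and f [measurable]: "f \<in> borel_measurable M"
    and c0: "c \<ge> 0" and c: "(\<integral>\<^sup>+ g. ennreal (exp (f g)) \<partial>M) \<le> ennreal c"
  shows "measure M {g \<in> space M. t \<le> f g} \<le> c * exp (- t)"
proof -
  interpret prob_space M by fact
  let ?A = "{g \<in> space M. t \<le> f g}"
  have "emeasure M ?A = (\<integral>\<^sup>+ g. indicator ?A g \<partial>M)" by simp
  also have "\<dots> \<le> (\<integral>\<^sup>+ g. ennreal (exp (- t)) * ennreal (exp (f g)) \<partial>M)"
    by (intro nn_integral_mono) (auto simp: indicator_def ennreal_mult'[symmetric] exp_add[symmetric])
  also have "\<dots> = ennreal (exp (- t)) * (\<integral>\<^sup>+ g. ennreal (exp (f g)) \<partial>M)"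
    by (intro nn_integral_cmult) measurable
  also have "\<dots> \<le> ennreal (exp (- t)) * ennreal c" using c by (rule mult_left_mono) simp
  also have "\<dots> = ennreal (c * exp (- t))" using c0 by (simp add: ennreal_mult'[symmetric] mult.commute)
  finally show ?thesis using c0 by (simp add: emeasure_eq_measure)
qed

lemma chernoff_sample:
  assumes [measurable]: "f \<in> borel_measurable (std_complex_gaussian n)" and c0: "c \<ge> 0"
    and c: "(\<integral>\<^sup>+ g. ennreal (exp (f g)) \<partial>std_complex_gaussian n) \<le> ennreal c"
  shows "measure (gaussian_sample n m) {\<omega> \<in> space (gaussian_sample n m). t \<le> (\<Sum>j<m. f (\<omega> j))} \<le> c ^ m * exp (- t)"
proof -
  let ?P = "gaussian_sample n m"
  have meas: "(\<lambda>\<omega>. f (\<omega> j)) \<in> borel_measurable ?P" if "j \<in> {..<m}" for j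
    using measurable_compose[OF measurable_sample_component assms(1)] that by simp
  have "(\<integral>\<^sup>+ \<omega>. ennreal (exp (\<Sum>j<m. f (\<omega> j))) \<partial>?P) = (\<integral>\<^sup>+ \<omega>. (\<Prod>j<m. ennreal (exp (f (\<omega> j)))) \<partial>?P)"
    by (simp add: exp_sum prod_ennreal)
  also have "\<dots> = (\<Prod>j<m. \<integral>\<^sup>+ g. ennreal (exp (f g)) \<partial>std_complex_gaussian n)"
    unfolding gaussian_sample_def by (rule scg_prod.product_nn_integral_prod) auto
  also have "\<dots> \<le> (\<Prod>j<m. ennreal c)" by (intro prod_mono_ennreal c)
  also have "\<dots> = ennreal (c ^ m)" using c0 by (simp add: ennreal_power)
  finally show ?thesis
    using c0 meas by (intro exp_markov sample.prob_space_axioms borel_measurable_sum) simp_all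
qed

text \<open>
  Bernstein's argument with \<open>exp y \<le> 1 + y + y\<^sup>2\<close>, valid for \<open>y \<le> 1\<close>; this is where the cut-off enters.
\<close>

lemma upper_deviation:
  assumes [measurable]: "\<xi> \<in> borel_measurable (std_complex_gaussian n)"
    and \<xi>: "\<And>g. 0 \<le> \<xi> g" "\<And>g. \<xi> g \<le> M" and s: "0 < s" "s * M \<le> 1"
    and \<mu>: "(\<integral>g. \<xi> g \<partial>std_complex_gaussian n) \<le> \<mu>" and V: "(\<integral>g. (\<xi> g)\<^sup>2 \<partial>std_complex_gaussian n) \<le> V"
  shows "measure (gaussian_sample n m) {\<omega> \<in> space (gaussian_sample n m). m * (\<mu> + \<tau>) \<le> (\<Sum>j<m. \<xi> (\<omega> j))}
      \<le> exp (- (m * (s * \<tau> - s\<^sup>2 * V)))"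
proof -
  let ?G = "std_complex_gaussian n"
  have i1: "integrable ?G \<xi>" using \<xi> by (intro scg.integrable_const_bound[where B = M]) auto
  have "(\<xi> g)\<^sup>2 \<le> M\<^sup>2" for g using \<xi> by (intro power_mono)
  then have i2: "integrable ?G (\<lambda>g. (\<xi> g)\<^sup>2)" by (intro scg.integrable_const_bound[where B = "M\<^sup>2"]) auto
  have "exp (s * \<xi> g) \<le> 1 + s * \<xi> g + (s * \<xi> g)\<^sup>2" for g
  proof (rule exp_bound)
    show "0 \<le> s * \<xi> g" using s \<xi> by simp
    show "s * \<xi> g \<le> 1" using s \<xi>(2)[of g] mult_left_mono[of "\<xi> g" M s] by linarith
  qed
  then have "(\<integral>\<^sup>+ g. ennreal (exp (s * \<xi> g)) \<partial>?G) \<le> (\<integral>\<^sup>+ g. ennreal (1 + s * \<xi> g + s\<^sup>2 * (\<xi> g)\<^sup>2) \<partial>?G)"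
    by (intro nn_integral_mono ennreal_leI) (simp add: power_mult_distrib)
  also have "\<dots> = ennreal (\<integral>g. 1 + s * \<xi> g + s\<^sup>2 * (\<xi> g)\<^sup>2 \<partial>?G)"
    using i1 i2 \<xi> s by (intro nn_integral_eq_integral) (auto intro!: AE_I2 add_nonneg_nonneg)
  also have "(\<integral>g. 1 + s * \<xi> g + s\<^sup>2 * (\<xi> g)\<^sup>2 \<partial>?G) = 1 + s * (\<integral>g. \<xi> g \<partial>?G) + s\<^sup>2 * (\<integral>g. (\<xi> g)\<^sup>2 \<partial>?G)"
    using i1 i2 by (simp add: scg.prob_space)
  also have "ennreal \<dots> \<le> ennreal (exp (s * \<mu> + s\<^sup>2 * V))"
  proof (rule ennreal_leI)
    have "s * (\<integral>g. \<xi> g \<partial>?G) \<le> s * \<mu>" "s\<^sup>2 * (\<integral>g. (\<xi> g)\<^sup>2 \<partial>?G) \<le> s\<^sup>2 * V"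
      using s \<mu> V by (intro mult_left_mono; simp)+
    then show "1 + s * (\<integral>g. \<xi> g \<partial>?G) + s\<^sup>2 * (\<integral>g. (\<xi> g)\<^sup>2 \<partial>?G) \<le> exp (s * \<mu> + s\<^sup>2 * V)"
      using exp_ge_add_one_self[of "s * \<mu> + s\<^sup>2 * V"] by linarith
  qed
  finally have "measure (gaussian_sample n m) {\<omega> \<in> space (gaussian_sample n m). s * (m * (\<mu> + \<tau>)) \<le> (\<Sum>j<m. s * \<xi> (\<omega> j))}
      \<le> exp (s * \<mu> + s\<^sup>2 * V) ^ m * exp (- (s * (m * (\<mu> + \<tau>))))"
    by (intro chernoff_sample) auto
  also have "exp (s * \<mu> + s\<^sup>2 * V) ^ m * exp (- (s * (m * (\<mu> + \<tau>)))) = exp (- (m * (s * \<tau> - s\<^sup>2 * V)))"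
    by (simp add: exp_of_nat_mult[symmetric] exp_add[symmetric] algebra_simps)
  finally show ?thesis using s by (simp add: sum_distrib_left[symmetric])
qed

lemma exp_minus_le: "exp (- y) \<le> 1 - y + y\<^sup>2" if "y \<ge> 0" for y :: real
proof -
  have "1 \<le> (1 - y + y\<^sup>2) * (1 + y)" using that by (simp add: algebra_simps power2_eq_square)
  also have "\<dots> \<le> (1 - y + y\<^sup>2) * exp y"
  proof (rule mult_left_mono)
    have "1 - y + y\<^sup>2 = (y - 1/2)\<^sup>2 + 3/4" by (simp add: power2_eq_square algebra_simps)
    then show "0 \<le> 1 - y + y\<^sup>2" by simp
  qed simp
  finally show ?thesis by (simp add: exp_minus field_simps)
qed

text \<open>
  Here \<open>exp (- y) \<le> 1 - y + y\<^sup>2\<close> holds for all \<open>y \<ge> 0\<close>, so a second moment of \<open>\<xi>\<close> takes the place of an upper bound.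
\<close>

lemma lower_deviation:
  assumes [measurable]: "\<xi> \<in> borel_measurable (std_complex_gaussian n)"
    and \<xi>: "\<And>g. 0 \<le> \<xi> g" and s: "0 < s"
    and i1: "integrable (std_complex_gaussian n) \<xi>" and i2: "integrable (std_complex_gaussian n) (\<lambda>g. (\<xi> g)\<^sup>2)"
    and \<mu>: "(\<integral>g. \<xi> g \<partial>std_complex_gaussian n) \<ge> \<mu>" and V: "(\<integral>g. (\<xi> g)\<^sup>2 \<partial>std_complex_gaussian n) \<le> V"
  shows "measure (gaussian_sample n m) {\<omega> \<in> space (gaussian_sample n m). (\<Sum>j<m. \<xi> (\<omega> j)) \<le> m * (\<mu> - \<tau>)}
      \<le> exp (- (m * (s * \<tau> - s\<^sup>2 * V)))"
proof -
  let ?G = "std_complex_gaussian n"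
  have q0: "0 \<le> 1 - s * \<xi> g + s\<^sup>2 * (\<xi> g)\<^sup>2" for g
  proof -
    have "1 - s * \<xi> g + s\<^sup>2 * (\<xi> g)\<^sup>2 = (s * \<xi> g - 1/2)\<^sup>2 + 3/4" by (simp add: power2_eq_square algebra_simps)
    then show ?thesis by simp
  qed
  have "exp (- (s * \<xi> g)) \<le> 1 - s * \<xi> g + (s * \<xi> g)\<^sup>2" for g using s \<xi> by (intro exp_minus_le) simp
  then have "(\<integral>\<^sup>+ g. ennreal (exp (- (s * \<xi> g))) \<partial>?G) \<le> (\<integral>\<^sup>+ g. ennreal (1 - s * \<xi> g + s\<^sup>2 * (\<xi> g)\<^sup>2) \<partial>?G)"
    by (intro nn_integral_mono ennreal_leI) (simp add: power_mult_distrib)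
  also have "\<dots> = ennreal (\<integral>g. 1 - s * \<xi> g + s\<^sup>2 * (\<xi> g)\<^sup>2 \<partial>?G)"
    using i1 i2 q0 by (intro nn_integral_eq_integral) auto
  also have "(\<integral>g. 1 - s * \<xi> g + s\<^sup>2 * (\<xi> g)\<^sup>2 \<partial>?G) = 1 - s * (\<integral>g. \<xi> g \<partial>?G) + s\<^sup>2 * (\<integral>g. (\<xi> g)\<^sup>2 \<partial>?G)"
    using i1 i2 by (simp add: scg.prob_space)
  also have "ennreal \<dots> \<le> ennreal (exp (- (s * \<mu>) + s\<^sup>2 * V))"
  proof (rule ennreal_leI)
    have "s * (\<integral>g. \<xi> g \<partial>?G) \<ge> s * \<mu>" "s\<^sup>2 * (\<integral>g. (\<xi> g)\<^sup>2 \<partial>?G) \<le> s\<^sup>2 * V"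
      using s \<mu> V by (intro mult_left_mono; simp)+
    then show "1 - s * (\<integral>g. \<xi> g \<partial>?G) + s\<^sup>2 * (\<integral>g. (\<xi> g)\<^sup>2 \<partial>?G) \<le> exp (- (s * \<mu>) + s\<^sup>2 * V)"
      using exp_ge_add_one_self[of "- (s * \<mu>) + s\<^sup>2 * V"] by linarith
  qed
  finally have "measure (gaussian_sample n m) {\<omega> \<in> space (gaussian_sample n m). - (s * (m * (\<mu> - \<tau>))) \<le> (\<Sum>j<m. - (s * \<xi> (\<omega> j)))}
      \<le> exp (- (s * \<mu>) + s\<^sup>2 * V) ^ m * exp (- (- (s * (m * (\<mu> - \<tau>)))))"
    by (intro chernoff_sample) auto
  also have "exp (- (s * \<mu>) + s\<^sup>2 * V) ^ m * exp (- (- (s * (m * (\<mu> - \<tau>))))) = exp (- (m * (s * \<tau> - s\<^sup>2 * V)))"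
    by (simp add: exp_of_nat_mult[symmetric] exp_add[symmetric] algebra_simps)
  finally show ?thesis using s by (simp add: sum_negf sum_distrib_left[symmetric])
qed

section \<open>Independence of one sample from the others\<close>

text \<open>
  Here \<open>S i\<close> is the event that the candidate \<open>i\<close> is admissible, which depends on the samples other than \<open>l\<close> only, and \<open>T i\<close> is
  the set of values of the sample \<open>l\<close> that are bad for the candidate \<open>i\<close>. The first admissible candidate is independent
  of the sample \<open>l\<close>, hence bad with probability at most \<open>\<epsilon>\<close>, however many candidates there are. A union bound over
  the candidates would be useless.
\<close>

lemma select_independent:
  fixes S :: "nat \<Rightarrow> (nat \<Rightarrow> nat \<Rightarrow> complex) set" and T :: "nat \<Rightarrow> (nat \<Rightarrow> complex) set"
  assumes l: "l < m" and S: "\<And>i. S i \<in> sets (gaussian_sample n m)" and T: "\<And>i. T i \<in> sets (std_complex_gaussian n)"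
    and inv: "\<And>i \<omega> g. \<omega> \<in> space (gaussian_sample n m) \<Longrightarrow> g \<in> space (std_complex_gaussian n) \<Longrightarrow> (fun_upd \<omega> l g) \<in> S i \<longleftrightarrow> \<omega> \<in> S i"
    and small: "\<And>i. measure (std_complex_gaussian n) (T i) \<le> \<epsilon>"
  obtains N where "N \<in> sets (gaussian_sample n m)" "measure (gaussian_sample n m) N \<le> \<epsilon>"
    "\<And>\<omega> i. \<omega> \<in> space (gaussian_sample n m) - N \<Longrightarrow> \<omega> \<in> S i \<Longrightarrow> \<exists>k. \<omega> \<in> S k \<and> \<omega> l \<notin> T k"
proof -
  let ?P = "gaussian_sample n m" and ?G = "std_complex_gaussian n"
  \<comment> \<open>\<open>S' i\<close> is the event that \<open>i\<close> is the first admissible candidate.\<close>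
  define S' where "S' = disjointed S"
  have S': "S' i \<in> sets ?P" for i using sets.range_disjointed_sets[of S ?P] S unfolding S'_def by auto
  note [measurable] = S' T measurable_sample_component[OF l]
  have inv': "(fun_upd \<omega> l g) \<in> S' i \<longleftrightarrow> \<omega> \<in> S' i" if "\<omega> \<in> space ?P" "g \<in> space ?G" for \<omega> g i
    using inv[OF that] by (auto simp: S'_def disjointed_def)
  define Q where "Q i = {\<omega> \<in> space ?P. \<omega> \<in> S' i \<and> \<omega> l \<in> T i}" for i
  have Q [measurable]: "Q i \<in> sets ?P" for i unfolding Q_def by measurable
  have e0: "\<epsilon> \<ge> 0" using small[of 0] measure_nonneg order_trans by blast
  have Qm: "emeasure ?P (Q i) \<le> ennreal \<epsilon> * emeasure ?P (S' i)" for i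
  proof -
    define I where "I = {..<m} - {l}"
    have I: "finite I" "l \<notin> I" "insert l I = {..<m}" using l by (auto simp: I_def)
    have P: "?P = PiM (insert l I) (\<lambda>_. ?G)" by (simp add: gaussian_sample_def I)
    have upd: "(fun_upd \<omega> l g) \<in> space ?P" if "\<omega> \<in> space (PiM I (\<lambda>_. ?G))" "g \<in> space ?G" for \<omega> g
      unfolding P using that by (auto simp: space_PiM PiE_iff extensional_def)
    obtain g0 where g0: "g0 \<in> space ?G" using scg.not_empty by blast
    have [measurable]: "(\<lambda>\<omega>. indicator (Q i) \<omega> :: ennreal) \<in> borel_measurable (PiM (insert l I) (\<lambda>_. ?G))"
      "(\<lambda>\<omega>. indicator (S' i) \<omega> :: ennreal) \<in> borel_measurable (PiM (insert l I) (\<lambda>_. ?G))"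
      unfolding P[symmetric] by measurable
    have eqS: "indicator (S' i) ((fun_upd \<omega> l g)) = (indicator (S' i) ((fun_upd \<omega> l g0)) :: ennreal)"
      if "\<omega> \<in> space (PiM I (\<lambda>_. ?G))" "g \<in> space ?G" for \<omega> g
      using inv'[OF upd[OF that(1) g0] that(2), of i] by (simp add: indicator_def)
    have eqQ: "indicator (Q i) ((fun_upd \<omega> l g)) = indicator (S' i) ((fun_upd \<omega> l g0)) * (indicator (T i) g :: ennreal)"
      if "\<omega> \<in> space (PiM I (\<lambda>_. ?G))" "g \<in> space ?G" for \<omega> g
      using inv'[OF upd[OF that(1) g0] that(2), of i] upd[OF that] by (auto simp: indicator_def Q_def)
    have "emeasure ?P (Q i) = (\<integral>\<^sup>+ \<omega>. indicator (Q i) \<omega> \<partial>?P)" by simp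
    also have "\<dots> = (\<integral>\<^sup>+ \<omega>. (\<integral>\<^sup>+ g. indicator (Q i) ((fun_upd \<omega> l g)) \<partial>?G) \<partial>PiM I (\<lambda>_. ?G))"
      unfolding P by (rule scg_prod.product_nn_integral_insert[OF I(1,2)]) measurable
    also have "\<dots> = (\<integral>\<^sup>+ \<omega>. indicator (S' i) ((fun_upd \<omega> l g0)) * emeasure ?G (T i) \<partial>PiM I (\<lambda>_. ?G))"
    proof (rule nn_integral_cong)
      fix \<omega> assume \<omega>: "\<omega> \<in> space (PiM I (\<lambda>_. ?G))"
      have "(\<integral>\<^sup>+ g. indicator (Q i) ((fun_upd \<omega> l g)) \<partial>?G) = (\<integral>\<^sup>+ g. indicator (S' i) ((fun_upd \<omega> l g0)) * indicator (T i) g \<partial>?G)"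
        by (intro nn_integral_cong eqQ[OF \<omega>])
      then show "(\<integral>\<^sup>+ g. indicator (Q i) ((fun_upd \<omega> l g)) \<partial>?G) = indicator (S' i) ((fun_upd \<omega> l g0)) * emeasure ?G (T i)"
        by (simp add: nn_integral_cmult)
    qed
    also have "\<dots> \<le> (\<integral>\<^sup>+ \<omega>. indicator (S' i) ((fun_upd \<omega> l g0)) * ennreal \<epsilon> \<partial>PiM I (\<lambda>_. ?G))"
      using small[of i] by (intro nn_integral_mono mult_left_mono) (auto simp: scg.emeasure_eq_measure ennreal_leI)
    also have "\<dots> = (\<integral>\<^sup>+ \<omega>. (\<integral>\<^sup>+ g. ennreal \<epsilon> * indicator (S' i) ((fun_upd \<omega> l g)) \<partial>?G) \<partial>PiM I (\<lambda>_. ?G))"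
    proof (rule nn_integral_cong)
      fix \<omega> assume \<omega>: "\<omega> \<in> space (PiM I (\<lambda>_. ?G))"
      have "(\<integral>\<^sup>+ g. ennreal \<epsilon> * indicator (S' i) ((fun_upd \<omega> l g)) \<partial>?G) = (\<integral>\<^sup>+ g. ennreal \<epsilon> * indicator (S' i) ((fun_upd \<omega> l g0)) \<partial>?G)"
        by (intro nn_integral_cong) (simp only: eqS[OF \<omega>])
      then show "indicator (S' i) ((fun_upd \<omega> l g0)) * ennreal \<epsilon> = (\<integral>\<^sup>+ g. ennreal \<epsilon> * indicator (S' i) ((fun_upd \<omega> l g)) \<partial>?G)"
        by (simp add: scg.emeasure_space_1 mult.commute)
    qed
    also have "\<dots> = (\<integral>\<^sup>+ \<omega>. ennreal \<epsilon> * indicator (S' i) \<omega> \<partial>?P)"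
      unfolding P by (rule scg_prod.product_nn_integral_insert[OF I(1,2), symmetric]) measurable
    also have "\<dots> = ennreal \<epsilon> * emeasure ?P (S' i)" by (simp add: nn_integral_cmult)
    finally show ?thesis .
  qed
  show thesis
  proof
    show "(\<Union>i. Q i) \<in> sets ?P" by measurable
    have "emeasure ?P (\<Union>i. Q i) \<le> (\<Sum>i. emeasure ?P (Q i))"
      by (rule emeasure_subadditive_countably) auto
    also have "\<dots> \<le> (\<Sum>i. ennreal \<epsilon> * emeasure ?P (S' i))" by (intro suminf_le Qm) auto
    also have "\<dots> = ennreal \<epsilon> * (\<Sum>i. emeasure ?P (S' i))" by simp
    also have "(\<Sum>i. emeasure ?P (S' i)) = emeasure ?P (\<Union>i. S' i)"
      by (rule suminf_emeasure) (auto simp: S'_def disjoint_family_disjointed S'[unfolded S'_def])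
    also have "\<dots> \<le> 1" by (rule sample.emeasure_le_1)
    finally have "emeasure ?P (\<Union>i. Q i) \<le> ennreal \<epsilon> * 1" by (simp add: mult_left_mono)
    then show "measure ?P (\<Union>i. Q i) \<le> \<epsilon>" using e0 by (simp add: sample.emeasure_eq_measure)
  next
    fix \<omega> i assume \<omega>: "\<omega> \<in> space ?P - (\<Union>i. Q i)" "\<omega> \<in> S i"
    then have "\<omega> \<in> (\<Union>i. S' i)" unfolding S'_def UN_disjointed_eq by blast
    then obtain k where k: "\<omega> \<in> S' k" by blast
    then have "\<omega> \<in> S k" using disjointed_subset[of S k] by (auto simp: S'_def)
    moreover have "\<omega> l \<notin> T k" using \<omega>(1) k by (auto simp: Q_def)
    ultimately show "\<exists>k. \<omega> \<in> S k \<and> \<omega> l \<notin> T k" by blast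
  qed
qed

section \<open>Lattice points\<close>

text \<open>
  Rounding towards zero keeps the lattice points in the unit ball.
\<close>

definition rnd :: "nat \<Rightarrow> real \<Rightarrow> int" where
  "rnd N t = (if t \<ge> 0 then \<lfloor>N * t\<rfloor> else \<lceil>N * t\<rceil>)"

lemma rnd_bounds:
  assumes "N > 0"
  shows "\<bar>of_int (rnd N t) / N\<bar> \<le> \<bar>t\<bar>" "\<bar>t - of_int (rnd N t) / N\<bar> \<le> 1 / N"
proof -
  have N: "real N > 0" using assms by simp
  have pos: "0 \<le> f \<Longrightarrow> f \<le> r * t \<Longrightarrow> 0 \<le> t \<Longrightarrow> \<bar>f\<bar> \<le> r * \<bar>t\<bar>"
    and neg: "f \<le> 0 \<Longrightarrow> r * t \<le> f \<Longrightarrow> t \<le> 0 \<Longrightarrow> \<bar>f\<bar> \<le> r * \<bar>t\<bar>" for f r :: real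
    by simp_all
  have 1: "\<bar>of_int (rnd N t)\<bar> \<le> N * \<bar>t\<bar>"
  proof (cases "t \<ge> 0")
    case True
    then have "0 \<le> N * t" by simp
    then have "0 \<le> real_of_int \<lfloor>N * t\<rfloor>" by (simp only: of_int_0_le_iff zero_le_floor)
    then show ?thesis unfolding rnd_def if_P[OF True] using of_int_floor_le True by (rule pos)
  next
    case False
    then have "N * t \<le> 0" by (simp add: mult_nonneg_nonpos)
    then have "real_of_int \<lceil>N * t\<rceil> \<le> 0" by (simp only: of_int_le_0_iff ceiling_le_zero)
    then show ?thesis unfolding rnd_def if_not_P[OF False] using le_of_int_ceiling False by (intro neg) simp_all
  qed
  then show "\<bar>of_int (rnd N t) / N\<bar> \<le> \<bar>t\<bar>" using N by (simp add: field_simps)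
  have gen: "f \<le> y \<Longrightarrow> y \<le> f + 1 \<Longrightarrow> \<bar>y - f\<bar> \<le> 1" "y \<le> f \<Longrightarrow> f - 1 \<le> y \<Longrightarrow> \<bar>y - f\<bar> \<le> 1"
    for f y :: real by simp_all
  have "\<bar>N * t - of_int (rnd N t)\<bar> \<le> 1"
    unfolding rnd_def
    by (cases "t \<ge> 0") (simp_all only: if_True if_False gen of_int_floor_le real_of_int_floor_add_one_ge
        le_of_int_ceiling of_int_ceiling_diff_one_le)
  then have "\<bar>N * t - of_int (rnd N t)\<bar> / N \<le> 1 / N" using N by (intro divide_right_mono) auto
  moreover have "t - of_int (rnd N t) / N = (N * t - of_int (rnd N t)) / N"
    using N by (simp add: field_simps)
  then have "\<bar>N * t - of_int (rnd N t)\<bar> / N = \<bar>t - of_int (rnd N t) / N\<bar>"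
    by (simp add: abs_divide)
  ultimately show "\<bar>t - of_int (rnd N t) / N\<bar> \<le> 1 / N" by simp
qed

definition lattice_pt :: "nat \<Rightarrow> nat \<Rightarrow> int list \<Rightarrow> int list \<Rightarrow> fvec" where
  "lattice_pt n N ks ls = mk_fv n (\<lambda>i. Complex (of_int (ks ! i) / N) (of_int (ls ! i) / N))"

lemma lattice_pt_fspace [simp, intro]: "lattice_pt n N ks ls \<in> fspace n"
  by (simp add: lattice_pt_def)

lemma lattice_approx:
  assumes v: "v \<in> fspace n" and N: "N > 0"
  defines "p \<equiv> lattice_pt n N (map (\<lambda>i. rnd N (Re (fv v i))) [0..<n]) (map (\<lambda>i. rnd N (Im (fv v i))) [0..<n])"
  shows "norm p \<le> norm v" "norm (v - p) \<le> sqrt (2 * n) / N"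
proof -
  have p: "fv p i = Complex (of_int (rnd N (Re (fv v i))) / N) (of_int (rnd N (Im (fv v i))) / N)" if "i < n" for i
    using that by (simp add: p_def lattice_pt_def)
  have pV: "p \<in> fspace n" by (simp add: p_def)
  have "(norm p)\<^sup>2 \<le> (norm v)\<^sup>2"
    unfolding norm_fspace[OF pV] norm_fspace[OF v]
  proof (rule sum_mono)
    fix i assume "i \<in> {..<n}"
    then show "(cmod (fv p i))\<^sup>2 \<le> (cmod (fv v i))\<^sup>2"
      using power_mono[OF rnd_bounds(1)[OF N, of "Re (fv v i)"] abs_ge_zero, of 2]
        power_mono[OF rnd_bounds(1)[OF N, of "Im (fv v i)"] abs_ge_zero, of 2]
      unfolding cmod_power2 by (intro add_mono) (simp_all only: lessThan_iff p complex.sel power2_abs)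
  qed
  then show "norm p \<le> norm v" by (rule power2_le_imp_le) simp
  have "(norm (v - p))\<^sup>2 \<le> (\<Sum>i<n. 2 / N\<^sup>2)"
    unfolding norm_fspace[OF fspace_closed(3)[OF v pV]]
  proof (rule sum_mono)
    fix i assume i: "i \<in> {..<n}"
    have "(Re (fv (v - p) i))\<^sup>2 \<le> (1 / N)\<^sup>2" "(Im (fv (v - p) i))\<^sup>2 \<le> (1 / N)\<^sup>2"
      using power_mono[OF rnd_bounds(2)[OF N, of "Re (fv v i)"] abs_ge_zero, of 2]
        power_mono[OF rnd_bounds(2)[OF N, of "Im (fv v i)"] abs_ge_zero, of 2] i
      by (simp_all only: lessThan_iff minus_fvec.rep_eq p complex.sel minus_complex.sel power2_abs)
    then show "(cmod (fv (v - p) i))\<^sup>2 \<le> 2 / N\<^sup>2" unfolding cmod_power2 by (simp add: power_divide)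
  qed
  also have "\<dots> = (sqrt (2 * n) / N)\<^sup>2" by (simp add: power_divide)
  finally show "norm (v - p) \<le> sqrt (2 * n) / N" by (rule power2_le_imp_le) simp
qed

definition grid :: "nat \<Rightarrow> nat \<Rightarrow> fvec set" where
  "grid n N = (\<lambda>(ks, ls). lattice_pt n N ks ls) `
     ({ks. set ks \<subseteq> {- int N..int N} \<and> length ks = n} \<times> {ks. set ks \<subseteq> {- int N..int N} \<and> length ks = n})
     \<inter> {p. norm p \<le> 1}"

lemma grid_simps: "p \<in> grid n N \<Longrightarrow> p \<in> fspace n" "p \<in> grid n N \<Longrightarrow> norm p \<le> 1"
  by (auto simp: grid_def)

lemma finite_grid: "finite (grid n N)" and card_grid: "card (grid n N) \<le> (2 * N + 1) ^ (2 * n)"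
proof -
  let ?L = "{ks. set ks \<subseteq> {- int N..int N} \<and> length ks = n}"
  have fin: "finite ?L" by (rule finite_lists_length_eq) simp
  have "card ?L = card {- int N..int N} ^ n" by (rule card_lists_length_eq) simp
  also have "card {- int N..int N} = 2 * N + 1" by simp
  finally have c: "card (?L \<times> ?L) = (2 * N + 1) ^ (2 * n)"
    by (simp only: card_cartesian_product mult_2[of n] power_add)
  show f: "finite (grid n N)" unfolding grid_def using fin by (intro finite_Int) auto
  have "card (grid n N) \<le> card ((\<lambda>(ks, ls). lattice_pt n N ks ls) ` (?L \<times> ?L))"
    unfolding grid_def using fin by (intro card_mono finite_imageI) auto
  also have "\<dots> \<le> card (?L \<times> ?L)" using fin by (intro card_image_le) auto
  finally show "card (grid n N) \<le> (2 * N + 1) ^ (2 * n)" using c by simp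
qed

lemma grid_net:
  assumes v: "v \<in> fspace n" "norm v \<le> 1" and N: "N > 0"
  shows "\<exists>p\<in>grid n N. norm (v - p) \<le> sqrt (2 * n) / N"
proof -
  define ks ls where "ks = map (\<lambda>i. rnd N (Re (fv v i))) [0..<n]" and "ls = map (\<lambda>i. rnd N (Im (fv v i))) [0..<n]"
  have co: "cmod (fv v i) \<le> 1" if "i < n" for i
  proof -
    have "(cmod (fv v i))\<^sup>2 \<le> (\<Sum>i<n. (cmod (fv v i))\<^sup>2)" using that by (intro member_le_sum) auto
    also have "\<dots> = (norm v)\<^sup>2" by (rule norm_fspace[OF v(1), symmetric])
    also have "\<dots> \<le> 1" using v(2) by (simp add: power_le_one)
    finally show ?thesis by (simp add: abs_square_le_1)
  qed
  have rb: "rnd N t \<in> {- int N..int N}" if "\<bar>t\<bar> \<le> 1" for t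
  proof -
    have "\<bar>of_int (rnd N t) / N\<bar> \<le> 1" using rnd_bounds(1)[OF N, of t] that by linarith
    then have "\<bar>of_int (rnd N t)\<bar> \<le> real N" using N by (simp add: field_simps)
    then have "real_of_int \<bar>rnd N t\<bar> \<le> real_of_int (int N)" by simp
    then have "\<bar>rnd N t\<bar> \<le> int N" by (simp only: of_int_le_iff)
    then show ?thesis by auto
  qed
  have "rnd N (Re (fv v i)) \<in> {- int N..int N}" "rnd N (Im (fv v i)) \<in> {- int N..int N}" if "i < n" for i
    by (rule rb, rule order_trans[OF _ co[OF that]], rule abs_Re_le_cmod abs_Im_le_cmod)+
  then have sub: "set ks \<subseteq> {- int N..int N}" "set ls \<subseteq> {- int N..int N}"
    unfolding ks_def ls_def set_map set_upt by (auto simp del: atLeastAtMost_iff)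
  have len: "length ks = n" "length ls = n" by (simp_all add: ks_def ls_def)
  have "(\<lambda>(ks, ls). lattice_pt n N ks ls) (ks, ls) \<in> (\<lambda>(ks, ls). lattice_pt n N ks ls) `
     ({ks. set ks \<subseteq> {- int N..int N} \<and> length ks = n} \<times> {ks. set ks \<subseteq> {- int N..int N} \<and> length ks = n})"
    by (intro imageI SigmaI CollectI conjI sub len)
  moreover note la = lattice_approx[OF v(1) N, folded ks_def ls_def]
  ultimately have "lattice_pt n N ks ls \<in> grid n N"
    using order_trans[OF la(1) v(2)] unfolding grid_def by simp
  then show ?thesis using la(2) by (rule rev_bexI)
qed

lemma countable_dense_fspace:
  obtains D :: "fvec set" where "countable D" "D \<subseteq> fspace n" "D \<noteq> {}"
    "\<And>v e. v \<in> fspace n \<Longrightarrow> e > 0 \<Longrightarrow> \<exists>d\<in>D. norm (v - d) < e"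
proof
  let ?D = "range (\<lambda>(N, ks, ls). lattice_pt n N ks ls)"
  show "countable ?D" by simp
  show "?D \<subseteq> fspace n" "?D \<noteq> {}" by auto
  fix v e assume v: "v \<in> fspace n" and e: "e > (0::real)"
  obtain N where N: "sqrt (2 * n) / e < real N" using reals_Archimedean2 by blast
  have "0 \<le> sqrt (2 * n) / e" using e by simp
  with N have N0: "real N > 0" by linarith
  then have "N > 0" by simp
  note la = lattice_approx(2)[OF v this]
  have "sqrt (2 * n) / N < e" using N N0 e by (simp add: field_simps)
  with la have "norm (v - (\<lambda>(N, ks, ls). lattice_pt n N ks ls) (N, map (\<lambda>i. rnd N (Re (fv v i))) [0..<n],
      map (\<lambda>i. rnd N (Im (fv v i))) [0..<n])) < e" by simp
  then show "\<exists>d\<in>?D. norm (v - d) < e" by (rule bexI) (rule rangeI)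
qed

section \<open>From a net to the whole unit ball\<close>

text \<open>
  All quantities are Lipschitz in \<open>u\<close> and \<open>v\<close>, with constants that are powers of \<open>R\<close>. The net has to lie in the closed unit
  ball but its points may be shorter than \<open>1\<close>, whence the norms in the conditions at the points of the net.
\<close>

lemma regular_sample_from_net:
  fixes \<delta> :: real
  assumes m: "m > 0" and a: "\<And>j. a j \<in> fspace n" and x: "x \<in> fspace n" "norm x = 1"
    and cst: "B \<ge> 0" "\<rho> \<ge> 0" "0 < \<tau>" "\<tau> \<le> 1/10^8" "2 * B * \<rho> \<le> \<tau>" "B \<le> 2 * R"
    and norm_a: "\<And>j. j < m \<Longrightarrow> norm (a j) \<le> R" and x_inc: "\<And>j. j < m \<Longrightarrow> cmod (cip x (a j)) \<le> B"
    and net: "\<And>u. u \<in> fspace n \<Longrightarrow> norm u \<le> 1 \<Longrightarrow> \<exists>p\<in>S. norm (u - p) \<le> \<delta>"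
    and S: "\<And>p. p \<in> S \<Longrightarrow> p \<in> fspace n" "\<And>p. p \<in> S \<Longrightarrow> norm p \<le> 1"
    and excess: "\<And>p. p \<in> S \<Longrightarrow> (\<Sum>j<m. (max 0 (cmod (cip p (a j)) - B))\<^sup>2) \<le> D"
    and D: "sqrt D + sqrt m * (R * \<delta>) \<le> \<rho> * sqrt m"
    and lower: "\<And>p q. p \<in> S \<Longrightarrow> q \<in> S \<Longrightarrow>
      (\<Sum>j<m. (Re (cnj (cip p (a j)) * cip q (a j)))\<^sup>2)
        \<ge> m * (((norm p)\<^sup>2 * (norm q)\<^sup>2 + 3 * (Re (cip p q))\<^sup>2 - (Im (cip p q))\<^sup>2) / 2 - \<tau> / 2)"
    and upper: "\<And>p q. p \<in> S \<Longrightarrow> q \<in> S \<Longrightarrow>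
      (\<Sum>j<m. (min (cmod (cip p (a j))) B * min (cmod (cip q (a j))) B)\<^sup>2)
        \<le> m * ((norm p)\<^sup>2 * (norm q)\<^sup>2 + (cmod (cip p q))\<^sup>2 + \<tau> / 2)"
    and fine: "(32 * R ^ 4 + 10) * \<delta> \<le> \<tau> / 4"
  shows "regular_sample n m a x R B \<rho> \<tau>"
proof (rule regular_sample.intro)
  have R0: "R \<ge> 0" using order_trans[OF norm_ge_zero norm_a[OF m]] .
  obtain p0 where p0: "p0 \<in> S" "norm (0 - p0) \<le> \<delta>" using net[of 0] by auto
  have \<delta>0: "\<delta> \<ge> 0" using order_trans[OF norm_ge_zero p0(2)] .
  have cl: "cmod (cip u (a j)) \<le> R * t" if "j < m" "norm u \<le> t" for u j t
    using cmod_cip_le[of u "a j"] mult_mono[OF that(2) norm_a[OF that(1)]] norm_ge_zero[of u] that(2)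
    by (simp add: mult.commute)
  have split: "(32 * R ^ 4 + 10) * \<delta> = 32 * R ^ 4 * \<delta> + 10 * \<delta>" by (simp add: algebra_simps)
  have "0 \<le> R ^ 4 * \<delta>" using R0 \<delta>0 by simp
  then have \<delta>1: "10 * \<delta> \<le> \<tau> / 4" "32 * R ^ 4 * \<delta> \<le> \<tau> / 4" using fine \<delta>0 unfolding split by linarith+
  have \<delta>_1: "\<delta> \<le> 1" "2 * \<delta> \<le> 1" using \<delta>1(1) cst(4) by simp_all
  show "0 < m" "a j \<in> fspace n" "x \<in> fspace n" "norm x = 1" "0 \<le> B" "0 \<le> \<rho>" "0 < \<tau>" "\<tau> \<le> 1/10^8"
    "2 * B * \<rho> \<le> \<tau>" "B \<le> 2 * R" for j using m a x cst by auto
  show "j < m \<Longrightarrow> norm (a j) \<le> R" "j < m \<Longrightarrow> cmod (cip x (a j)) \<le> B" for j using norm_a x_inc by auto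
  show "(\<Sum>j<m. (max 0 (cmod (cip u (a j)) - B))\<^sup>2) \<le> \<rho>\<^sup>2 * m" if u: "u \<in> fspace n" "norm u \<le> 1" for u
  proof -
    obtain p where p: "p \<in> S" "norm (u - p) \<le> \<delta>" using net[OF u] by blast
    have "max 0 (cmod (cip u (a j)) - B) \<le> max 0 (cmod (cip p (a j)) - B) + R * \<delta>" if j: "j < m" for j
    proof -
      have "cmod (cip u (a j)) \<le> cmod (cip p (a j)) + cmod (cip (u - p) (a j))"
        using norm_triangle_ineq[of "cip p (a j)" "cip (u - p) (a j)"] by (simp add: cip_linear)
      also have "\<dots> \<le> cmod (cip p (a j)) + R * \<delta>" using cl[OF j p(2)] by simp
      finally have le: "cmod (cip u (a j)) \<le> cmod (cip p (a j)) + R * \<delta>" .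
      have gen: "s \<le> t + d \<Longrightarrow> 0 \<le> d \<Longrightarrow> max 0 (s - B) \<le> max 0 (t - B) + d" for s t d :: real by (simp add: max_def)
      show ?thesis by (rule gen[OF le]) (use R0 \<delta>0 in simp)
    qed
    then have "L2_set (\<lambda>j. max 0 (cmod (cip u (a j)) - B)) {..<m}
        \<le> L2_set (\<lambda>j. max 0 (cmod (cip p (a j)) - B) + R * \<delta>) {..<m}" by (intro L2_set_mono) auto
    also have "\<dots> \<le> L2_set (\<lambda>j. max 0 (cmod (cip p (a j)) - B)) {..<m} + L2_set (\<lambda>j. R * \<delta>) {..<m}"
      by (rule L2_set_triangle_ineq)
    also have "L2_set (\<lambda>j. max 0 (cmod (cip p (a j)) - B)) {..<m} \<le> sqrt D"
      unfolding L2_set_def by (intro real_sqrt_le_mono excess p)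
    also have "L2_set (\<lambda>j. R * \<delta>) {..<m} = sqrt m * (R * \<delta>)"
      using R0 \<delta>0 by (simp add: L2_set_constant)
    finally have "L2_set (\<lambda>j. max 0 (cmod (cip u (a j)) - B)) {..<m} \<le> \<rho> * sqrt m" using D by linarith
    then have "(L2_set (\<lambda>j. max 0 (cmod (cip u (a j)) - B)) {..<m})\<^sup>2 \<le> (\<rho> * sqrt m)\<^sup>2"
      by (intro power_mono) auto
    then show ?thesis by (simp add: L2_set_def sum_nonneg power_mult_distrib)
  qed
  have sq: "\<bar>s\<^sup>2 - t\<^sup>2\<bar> \<le> 2 * M * d" if "\<bar>s\<bar> \<le> M" "\<bar>t\<bar> \<le> M" "\<bar>s - t\<bar> \<le> d" for s t M d :: real
  proof -
    have "\<bar>s + t\<bar> * \<bar>s - t\<bar> \<le> (2 * M) * d" using that by (intro mult_mono) auto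
    then show ?thesis by (simp add: abs_mult[symmetric] power2_eq_square algebra_simps)
  qed
  have cc: "cmod (cip u v - cip p q) \<le> 2 * \<delta>"
    if "norm u = 1" "norm q \<le> 1" "norm (u - p) \<le> \<delta>" "norm (v - q) \<le> \<delta>" for u v p q
  proof -
    have "cmod (cip u v - cip p q) = cmod (cip u (v - q) + cip (u - p) q)" by (simp add: cip_linear)
    then have "cmod (cip u v - cip p q) \<le> norm u * norm (v - q) + norm (u - p) * norm q"
      using norm_triangle_ineq[of "cip u (v - q)" "cip (u - p) q"] cmod_cip_le[of u "v - q"] cmod_cip_le[of "u - p" q]
      by linarith
    also have "\<dots> \<le> 1 * \<delta> + \<delta> * 1" using that \<delta>0 by (intro add_mono mult_mono) auto
    finally show ?thesis by simp
  qed
  have c1: "cmod (cip p q) \<le> 1" if "norm p \<le> 1" "norm q \<le> 1" for p q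
    using cmod_cip_le[of p q] mult_mono[OF that] by simp
  show "re_avg m a u v \<ge> (1 + 3 * (Re (cip u v))\<^sup>2 - (Im (cip u v))\<^sup>2) / 2 - \<tau>"
    if uv: "u \<in> fspace n" "v \<in> fspace n" "norm u = 1" "norm v = 1" for u v
  proof -
    obtain p where p: "p \<in> S" "norm (u - p) \<le> \<delta>" using net[OF uv(1)] uv(3) by auto
    obtain q where q: "q \<in> S" "norm (v - q) \<le> \<delta>" using net[OF uv(2)] uv(4) by auto
    note np = S(2)[OF p(1)] and nq = S(2)[OF q(1)]
    let ?r = "\<lambda>u v j. Re (cnj (cip u (a j)) * cip v (a j))"
    have pt: "(?r u v j)\<^sup>2 \<ge> (?r p q j)\<^sup>2 - \<tau> / 4" if j: "j < m" for j
    proof -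
      have bd: "\<bar>?r u v j\<bar> \<le> R\<^sup>2" if "norm u \<le> 1" "norm v \<le> 1" for u v
      proof -
        have "\<bar>?r u v j\<bar> \<le> cmod (cip u (a j)) * cmod (cip v (a j))"
          using abs_Re_le_cmod[of "cnj (cip u (a j)) * cip v (a j)"] by (simp add: norm_mult)
        also have "\<dots> \<le> R * R" using cl[OF j that(1)] cl[OF j that(2)] R0 by (intro mult_mono) auto
        finally show ?thesis by (simp add: power2_eq_square)
      qed
      have "?r u v j - ?r p q j = Re (cnj (cip u (a j)) * cip (v - q) (a j)) + Re (cnj (cip (u - p) (a j)) * cip q (a j))"
        by (simp add: cip_linear algebra_simps)
      also have "\<bar>\<dots>\<bar> \<le> cmod (cip u (a j)) * cmod (cip (v - q) (a j)) + cmod (cip (u - p) (a j)) * cmod (cip q (a j))"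
        using abs_Re_le_cmod[of "cnj (cip u (a j)) * cip (v - q) (a j)"] abs_Re_le_cmod[of "cnj (cip (u - p) (a j)) * cip q (a j)"]
        by (simp add: norm_mult)
      also have "\<dots> \<le> R * (R * \<delta>) + (R * \<delta>) * R"
        using cl[OF j, of u 1] cl[OF j q(2)] cl[OF j p(2)] cl[OF j nq] uv R0 \<delta>0 by (intro add_mono mult_mono) auto
      finally have "\<bar>?r u v j - ?r p q j\<bar> \<le> 2 * R\<^sup>2 * \<delta>" by (simp add: power2_eq_square)
      then have "\<bar>(?r u v j)\<^sup>2 - (?r p q j)\<^sup>2\<bar> \<le> 2 * R\<^sup>2 * (2 * R\<^sup>2 * \<delta>)"
        using uv np nq by (intro sq bd) auto
      also have "\<dots> \<le> 32 * R ^ 4 * \<delta>" using \<open>0 \<le> R ^ 4 * \<delta>\<close> by (simp add: power2_eq_square power4_eq_xxxx mult_ac)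
      finally show ?thesis using abs_le_D2 \<delta>1(2) by fastforce
    qed
    have "(\<Sum>j<m. (?r p q j)\<^sup>2) - m * (\<tau> / 4) = (\<Sum>j<m. (?r p q j)\<^sup>2 - \<tau> / 4)" by (simp add: sum_subtractf)
    also have "\<dots> \<le> (\<Sum>j<m. (?r u v j)\<^sup>2)" using pt by (intro sum_mono) auto
    finally have s: "(\<Sum>j<m. (?r p q j)\<^sup>2) - m * (\<tau> / 4) \<le> m * re_avg m a u v" using m by (simp add: re_avg_def)
    define \<mu> where "\<mu> = ((norm p)\<^sup>2 * (norm q)\<^sup>2 + 3 * (Re (cip p q))\<^sup>2 - (Im (cip p q))\<^sup>2) / 2"
    have "m * (\<mu> - \<tau> / 2) - m * (\<tau> / 4) \<le> m * re_avg m a u v" using lower[OF p(1) q(1)] s unfolding \<mu>_def by linarith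
    then have "m * (\<mu> - \<tau> / 2 - \<tau> / 4) \<le> m * re_avg m a u v" by (simp add: algebra_simps)
    then have r1: "\<mu> - \<tau> / 2 - \<tau> / 4 \<le> re_avg m a u v" using m by simp
    have np1: "norm p \<ge> 1 - \<delta>" "norm q \<ge> 1 - \<delta>"
      using norm_triangle_ineq2[of u p] norm_triangle_ineq2[of v q] p q uv by auto
    have "1 - 4 * \<delta> \<le> ((1 - \<delta>) * (1 - \<delta>)) * ((1 - \<delta>) * (1 - \<delta>))"
    proof -
      have "1 - 2 * \<delta> \<le> (1 - \<delta>) * (1 - \<delta>)" by (simp add: algebra_simps)
      then have "(1 - 2 * \<delta>) * (1 - 2 * \<delta>) \<le> ((1 - \<delta>) * (1 - \<delta>)) * ((1 - \<delta>) * (1 - \<delta>))"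
        using \<delta>_1 by (intro mult_mono) simp_all
      moreover have "1 - 4 * \<delta> \<le> (1 - 2 * \<delta>) * (1 - 2 * \<delta>)" by (simp add: algebra_simps)
      ultimately show ?thesis by linarith
    qed
    also have "\<dots> \<le> (norm p)\<^sup>2 * (norm q)\<^sup>2"
      unfolding power2_eq_square by (intro mult_mono np1) (use \<delta>_1 in simp_all)
    finally have n1: "(norm p)\<^sup>2 * (norm q)\<^sup>2 \<ge> 1 - 4 * \<delta>" .
    have d: "cmod (cip u v - cip p q) \<le> 2 * \<delta>" using uv p q nq by (intro cc) auto
    have c: "cmod (cip u v) \<le> 1" "cmod (cip p q) \<le> 1" using c1 uv np nq by auto
    have reD: "\<bar>(Re (cip u v))\<^sup>2 - (Re (cip p q))\<^sup>2\<bar> \<le> 2 * 1 * (2 * \<delta>)"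
      using d c abs_Re_le_cmod[of "cip u v"] abs_Re_le_cmod[of "cip p q"] abs_Re_le_cmod[of "cip u v - cip p q"]
      by (intro sq) auto
    have imD: "\<bar>(Im (cip u v))\<^sup>2 - (Im (cip p q))\<^sup>2\<bar> \<le> 2 * 1 * (2 * \<delta>)"
      using d c abs_Im_le_cmod[of "cip u v"] abs_Im_le_cmod[of "cip p q"] abs_Im_le_cmod[of "cip u v - cip p q"]
      by (intro sq) auto
    have \<mu>_ge: "\<mu> \<ge> (1 + 3 * (Re (cip u v))\<^sup>2 - (Im (cip u v))\<^sup>2) / 2 - 10 * \<delta>"
    proof -
      have "(1 + 3 * r - i) / 2 - 10 * \<delta> \<le> (k + 3 * r' - i') / 2"
        if "1 - 4 * \<delta> \<le> k" "r - r' \<le> 2 * 1 * (2 * \<delta>)" "- (i - i') \<le> 2 * 1 * (2 * \<delta>)" for k r r' i i'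
        using that by (simp add: field_simps)
      from this[OF n1 abs_le_D1[OF reD] abs_le_D2[OF imD]] show ?thesis unfolding \<mu>_def .
    qed
    have gen: "k - 10 * \<delta> \<le> \<mu> \<Longrightarrow> 10 * \<delta> \<le> \<tau> / 4 \<Longrightarrow> \<mu> - \<tau> / 2 - \<tau> / 4 \<le> r \<Longrightarrow> k - \<tau> \<le> r" for k r
      by linarith
    show ?thesis by (rule gen[OF \<mu>_ge \<delta>1(1) r1])
  qed
  show "(\<Sum>j<m. (min (cmod (cip u (a j))) B * min (cmod (cip v (a j))) B)\<^sup>2) / m \<le> 1 + (cmod (cip u v))\<^sup>2 + \<tau>"
    if uv: "u \<in> fspace n" "v \<in> fspace n" "norm u = 1" "norm v = 1" for u v
  proof -
    obtain p where p: "p \<in> S" "norm (u - p) \<le> \<delta>" using net[OF uv(1)] uv(3) by auto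
    obtain q where q: "q \<in> S" "norm (v - q) \<le> \<delta>" using net[OF uv(2)] uv(4) by auto
    note np = S(2)[OF p(1)] and nq = S(2)[OF q(1)]
    define c where "c u j = min (cmod (cip u (a j))) B" for u j
    have pt: "(c u j * c v j)\<^sup>2 \<le> (c p j * c q j)\<^sup>2 + \<tau> / 4" if j: "j < m" for j
    proof -
      have minl: "\<bar>min s B - min t B\<bar> \<le> \<bar>s - t\<bar>" for s t :: real by (simp add: min_def)
      have lip: "\<bar>c u j - c p j\<bar> \<le> R * \<delta>" if "norm (u - p) \<le> \<delta>" for u p
      proof -
        have "\<bar>c u j - c p j\<bar> \<le> \<bar>cmod (cip u (a j)) - cmod (cip p (a j))\<bar>" unfolding c_def by (rule minl)
        also have "\<dots> \<le> cmod (cip u (a j) - cip p (a j))" by (rule norm_triangle_ineq3)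
        also have "\<dots> \<le> R * \<delta>" using cl[OF j that] by (simp add: cip_linear)
        finally show ?thesis .
      qed
      have cb: "\<bar>c u j\<bar> \<le> B" for u using cst(1) by (simp add: c_def min_def)
      have "c u j * c v j - c p j * c q j = c u j * (c v j - c q j) + (c u j - c p j) * c q j"
        by (simp add: algebra_simps)
      also have "\<bar>\<dots>\<bar> \<le> \<bar>c u j\<bar> * \<bar>c v j - c q j\<bar> + \<bar>c u j - c p j\<bar> * \<bar>c q j\<bar>"
        unfolding abs_mult[symmetric] by (rule abs_triangle_ineq)
      also have "\<dots> \<le> B * (R * \<delta>) + (R * \<delta>) * B"
        by (intro add_mono mult_mono lip[OF p(2)] lip[OF q(2)] cb) (use cst(1) R0 \<delta>0 in simp_all)
      also have "\<dots> = 2 * B * (R * \<delta>)" by simp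
      finally have l: "\<bar>c u j * c v j - c p j * c q j\<bar> \<le> 2 * B * (R * \<delta>)" .
      have bb: "\<bar>c u j * c v j\<bar> \<le> B * B" for u v unfolding abs_mult by (intro mult_mono cb) (use cst(1) in simp_all)
      have "\<bar>(c u j * c v j)\<^sup>2 - (c p j * c q j)\<^sup>2\<bar> \<le> 2 * (B * B) * (2 * B * (R * \<delta>))"
        by (rule sq[OF bb bb l])
      also have "\<dots> = 4 * (B * B * B) * (R * \<delta>)" by simp
      also have "\<dots> \<le> 4 * ((2 * R) * (2 * R) * (2 * R)) * (R * \<delta>)"
        by (intro mult_right_mono mult_left_mono mult_mono) (use cst(1,6) R0 \<delta>0 in simp_all)
      also have "\<dots> = 32 * R ^ 4 * \<delta>" by (simp add: power4_eq_xxxx)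
      finally show ?thesis using \<delta>1 by (simp add: abs_le_iff)
    qed
    have "(\<Sum>j<m. (c u j * c v j)\<^sup>2) \<le> (\<Sum>j<m. (c p j * c q j)\<^sup>2 + \<tau> / 4)" using pt by (intro sum_mono) auto
    also have "\<dots> = (\<Sum>j<m. (c p j * c q j)\<^sup>2) + m * (\<tau> / 4)" by (simp add: sum.distrib)
    also have "\<dots> \<le> m * ((norm p)\<^sup>2 * (norm q)\<^sup>2 + (cmod (cip p q))\<^sup>2 + \<tau> / 2) + m * (\<tau> / 4)"
      using upper[OF p(1) q(1)] unfolding c_def by (rule add_right_mono)
    also have "\<dots> = m * ((norm p)\<^sup>2 * (norm q)\<^sup>2 + (cmod (cip p q))\<^sup>2 + 3/4 * \<tau>)" by (simp add: algebra_simps)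
    also have "\<dots> \<le> m * (1 + ((cmod (cip u v))\<^sup>2 + 4 * \<delta>) + 3/4 * \<tau>)"
    proof -
      have d: "cmod (cip u v - cip p q) \<le> 2 * \<delta>" using uv p q nq by (intro cc) auto
      have c1': "cmod (cip u v) \<le> 1" "cmod (cip p q) \<le> 1" using c1 uv np nq by auto
      have "\<bar>(cmod (cip u v))\<^sup>2 - (cmod (cip p q))\<^sup>2\<bar> \<le> 2 * 1 * (2 * \<delta>)"
        using d c1' norm_triangle_ineq3[of "cip u v" "cip p q"] by (intro sq) auto
      moreover have "(norm p)\<^sup>2 * (norm q)\<^sup>2 \<le> 1 * 1" using np nq by (intro mult_mono) (auto simp: power_le_one)
      ultimately show ?thesis by (intro mult_left_mono) (auto simp: abs_le_iff)
    qed
    also have "\<dots> \<le> (1 + (cmod (cip u v))\<^sup>2 + \<tau>) * m"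
      unfolding mult.commute[of _ "real m"] using \<delta>1(1) \<delta>0 by (intro mult_left_mono) simp_all
    finally show ?thesis unfolding c_def by (rule mult_imp_div_pos_le[rotated]) (use m in simp)
  qed
qed

section \<open>Probabilities of the exceptional events\<close>

lemma sample_component_prob:
  assumes j: "j < m" and P: "{g \<in> space (std_complex_gaussian n). P g} \<in> sets (std_complex_gaussian n)"
  shows "{\<omega> \<in> space (gaussian_sample n m). P (\<omega> j)} \<in> sets (gaussian_sample n m)"
    and "measure (gaussian_sample n m) {\<omega> \<in> space (gaussian_sample n m). P (\<omega> j)}
      = measure (std_complex_gaussian n) {g \<in> space (std_complex_gaussian n). P g}"
proof -
  let ?G = "std_complex_gaussian n" and ?P = "gaussian_sample n m"
  interpret I: product_prob_space "\<lambda>_::nat. ?G" "{..<m}" by standard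
  have d: "distr ?P ?G (\<lambda>\<omega>. \<omega> j) = ?G"
    unfolding gaussian_sample_def using j by (intro I.PiM_component) simp
  have eq: "(\<lambda>\<omega>. \<omega> j) -` {g \<in> space ?G. P g} \<inter> space ?P = {\<omega> \<in> space ?P. P (\<omega> j)}"
    using measurable_space[OF measurable_sample_component[OF j, of n]] by auto
  show "{\<omega> \<in> space ?P. P (\<omega> j)} \<in> sets ?P"
    using measurable_sets[OF measurable_sample_component[OF j] P] unfolding eq .
  have "measure ?G {g \<in> space ?G. P g} = measure (distr ?P ?G (\<lambda>\<omega>. \<omega> j)) {g \<in> space ?G. P g}" by (simp only: d)
  also have "\<dots> = measure ?P {\<omega> \<in> space ?P. P (\<omega> j)}"
    unfolding eq[symmetric] using P by (intro measure_distr measurable_sample_component j)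
  finally show "measure ?P {\<omega> \<in> space ?P. P (\<omega> j)} = measure ?G {g \<in> space ?G. P g}" by simp
qed

lemma cip_tail:
  assumes u: "u \<in> fspace n" and B: "B \<ge> 0"
  shows "measure (std_complex_gaussian n) {g \<in> space (std_complex_gaussian n). B * norm u < cmod (cip u (mk_fv n g))}
    \<le> sqrt 2 * exp (- (B\<^sup>2 / 4))" (is "measure ?G ?A \<le> _")
proof (cases "u = 0")
  case True
  then show ?thesis by simp
next
  case False
  define u' where "u' = (1 / norm u) *\<^sub>R u"
  have u': "u' \<in> fspace n" "norm u' = 1" using u False by (simp_all add: u'_def)
  have "?A \<subseteq> {g \<in> space ?G. B\<^sup>2 / 4 \<le> (cmod (cip u' (mk_fv n g)))\<^sup>2 / 4}"
  proof safe
    fix g assume "B * norm u < cmod (cip u (mk_fv n g))"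
    then have "B \<le> cmod (cip u' (mk_fv n g))"
      using False by (simp add: u'_def cip_linear norm_divide field_simps)
    then show "B\<^sup>2 / 4 \<le> (cmod (cip u' (mk_fv n g)))\<^sup>2 / 4" using B by (intro divide_right_mono power_mono) auto
  qed
  then have "measure ?G ?A \<le> measure ?G {g \<in> space ?G. B\<^sup>2 / 4 \<le> (cmod (cip u' (mk_fv n g)))\<^sup>2 / 4}"
    by (intro scg.finite_measure_mono) measurable
  also have "\<dots> \<le> sqrt 2 * exp (- (B\<^sup>2 / 4))"
    using u' by (intro exp_markov prob_space_std_complex_gaussian exp_cip) auto
  finally show ?thesis .
qed

lemma norm_mk_fv: "(norm (mk_fv n g))\<^sup>2 = (\<Sum>i<n. (cmod (g i))\<^sup>2)"
  by (subst norm_fspace[of _ n]) auto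

lemma exp_std_complex_normal: "(\<integral>\<^sup>+ z. ennreal (exp ((cmod z)\<^sup>2 / 4)) \<partial>std_complex_normal) \<le> ennreal (sqrt 2)"
proof -
  interpret I: product_prob_space "\<lambda>_::nat. std_complex_normal" "{..<1::nat}" by standard
  have d: "distr (std_complex_gaussian 1) std_complex_normal (\<lambda>g. g 0) = std_complex_normal"
    unfolding std_complex_gaussian_def by (intro I.PiM_component) simp
  have [measurable]: "(\<lambda>g. g (0::nat)) \<in> measurable (std_complex_gaussian 1) std_complex_normal"
    unfolding std_complex_gaussian_def by (rule measurable_component_singleton) simp
  define u where "u = mk_fv 1 (\<lambda>_. 1)"
  have u: "u \<in> fspace 1" by (simp add: u_def)
  have "(norm u)\<^sup>2 = 1" by (simp add: u_def norm_mk_fv)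
  then have nu: "norm u \<le> 1" by (intro power2_le_imp_le[of "norm u" 1]) simp_all
  have "(\<integral>\<^sup>+ z. ennreal (exp ((cmod z)\<^sup>2 / 4)) \<partial>std_complex_normal)
      = (\<integral>\<^sup>+ z. ennreal (exp ((cmod z)\<^sup>2 / 4)) \<partial>distr (std_complex_gaussian 1) std_complex_normal (\<lambda>g. g 0))"
    by (simp only: d)
  also have "\<dots> = (\<integral>\<^sup>+ g. ennreal (exp ((cmod (g 0))\<^sup>2 / 4)) \<partial>std_complex_gaussian 1)"
    by (rule nn_integral_distr) measurable
  also have "\<dots> = (\<integral>\<^sup>+ g. ennreal (exp ((cmod (cip u (mk_fv 1 g)))\<^sup>2 / 4)) \<partial>std_complex_gaussian 1)"
    by (simp add: cip_mk_fv u_def)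
  also have "\<dots> \<le> ennreal (sqrt 2)" using u nu by (rule exp_cip)
  finally show ?thesis .
qed

lemma measurable_norm_mk_fv [measurable]: "(\<lambda>g. norm (mk_fv n g)) \<in> borel_measurable (std_complex_gaussian n)"
proof -
  have "norm (mk_fv n g) = sqrt (\<Sum>i<n. (cmod (g i))\<^sup>2)" for g
    by (simp add: norm_mk_fv[symmetric])
  then show ?thesis by simp
qed

lemma norm_tail:
  "measure (std_complex_gaussian n) {g \<in> space (std_complex_gaussian n). sqrt (18 * real n) < norm (mk_fv n g)}
    \<le> exp (- 1.5 * real n)" (is "measure ?G ?A \<le> _")
proof -
  have "(\<integral>\<^sup>+ g. ennreal (exp ((norm (mk_fv n g))\<^sup>2 / 4)) \<partial>?G)
      = (\<integral>\<^sup>+ g. (\<Prod>i<n. ennreal (exp ((cmod (g i))\<^sup>2 / 4))) \<partial>?G)"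
    by (simp add: norm_mk_fv exp_sum sum_divide_distrib prod_ennreal)
  also have "\<dots> = (\<Prod>i<n. \<integral>\<^sup>+ z. ennreal (exp ((cmod z)\<^sup>2 / 4)) \<partial>std_complex_normal)"
    unfolding std_complex_gaussian_def by (rule scn_prod.product_nn_integral_prod) auto
  also have "\<dots> \<le> (\<Prod>i<n. ennreal (sqrt 2))" by (intro prod_mono_ennreal exp_std_complex_normal)
  also have "\<dots> = ennreal (sqrt 2 ^ n)" by (simp add: ennreal_power)
  finally have e: "(\<integral>\<^sup>+ g. ennreal (exp ((norm (mk_fv n g))\<^sup>2 / 4)) \<partial>?G) \<le> ennreal (sqrt 2 ^ n)" .
  have "?A \<subseteq> {g \<in> space ?G. 18 * real n / 4 \<le> (norm (mk_fv n g))\<^sup>2 / 4}"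
  proof safe
    fix g assume "sqrt (18 * real n) < norm (mk_fv n g)"
    then have "(sqrt (18 * real n))\<^sup>2 \<le> (norm (mk_fv n g))\<^sup>2" by (intro power_mono) auto
    then show "18 * real n / 4 \<le> (norm (mk_fv n g))\<^sup>2 / 4" by simp
  qed
  then have "measure ?G ?A \<le> measure ?G {g \<in> space ?G. 18 * real n / 4 \<le> (norm (mk_fv n g))\<^sup>2 / 4}"
    by (intro scg.finite_measure_mono) measurable
  also have "\<dots> \<le> sqrt 2 ^ n * exp (- (18 * real n / 4))"
    by (intro exp_markov prob_space_std_complex_gaussian e) auto
  also have "sqrt 2 ^ n \<le> exp (3 * real n)"
  proof -
    have "sqrt 2 \<le> (3 :: real)" by (rule real_le_lsqrt) auto
    also have "3 \<le> exp (3 :: real)" using exp_ge_add_one_self[of "3 :: real"] by simp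
    finally have "sqrt 2 ^ n \<le> exp 3 ^ n" by (intro power_mono) auto
    then show ?thesis by (simp add: exp_of_nat_mult[symmetric] mult.commute)
  qed
  finally have "measure ?G ?A \<le> exp (3 * real n) * exp (- (18 * real n / 4))" by simp
  then show ?thesis by (simp add: exp_add[symmetric])
qed

text \<open>
  Above the level \<open>B\<close> one has \<open>(y - B)\<^sup>2 \<le> y\<^sup>2 - B\<^sup>2\<close>. So the exponential moment of a quarter of the squared excess is at most
  \<open>1 + sqrt 2 * exp (- (B\<^sup>2 / 4))\<close>, and its \<open>m\<close>-th power is bounded.
\<close>

lemma excess_tail:
  assumes p: "p \<in> fspace n" "norm p \<le> 1" and B: "B \<ge> 0" and Bm: "m * (sqrt 2 * exp (- (B\<^sup>2 / 4))) \<le> 1"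
  shows "measure (gaussian_sample n m) {\<omega> \<in> space (gaussian_sample n m).
      t \<le> (\<Sum>j<m. (max 0 (cmod (cip p (mk_fv n (\<omega> j))) - B))\<^sup>2)} \<le> exp (1 - t / 4)"
proof -
  let ?G = "std_complex_gaussian n"
  define X where "X g = cmod (cip p (mk_fv n g))" for g
  have [measurable]: "X \<in> borel_measurable ?G" unfolding X_def by measurable
  define c where "c = exp (- (B\<^sup>2 / 4))"
  have c: "c \<ge> 0" by (simp add: c_def)
  have pt: "exp ((max 0 (y - B))\<^sup>2 / 4) \<le> 1 + c * exp (y\<^sup>2 / 4)" if "y \<ge> 0" for y
  proof (cases "y \<le> B")
    case True
    then show ?thesis using c by (simp add: max_def)
  next
    case False
    have "0 \<le> B * (y - B)" using False B by simp
    moreover have "(y - B)\<^sup>2 = y\<^sup>2 - B\<^sup>2 - 2 * (B * (y - B))" by (simp add: power2_eq_square algebra_simps)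
    ultimately have "(y - B)\<^sup>2 / 4 \<le> y\<^sup>2 / 4 - B\<^sup>2 / 4" by linarith
    then have "exp ((y - B)\<^sup>2 / 4) \<le> c * exp (y\<^sup>2 / 4)" by (simp add: c_def exp_add[symmetric])
    moreover have "max 0 (y - B) = y - B" using False by simp
    ultimately show ?thesis by simp
  qed
  have "(\<integral>\<^sup>+ g. ennreal (exp ((max 0 (X g - B))\<^sup>2 / 4)) \<partial>?G) \<le> (\<integral>\<^sup>+ g. 1 + ennreal c * ennreal (exp ((X g)\<^sup>2 / 4)) \<partial>?G)"
  proof (rule nn_integral_mono)
    fix g
    have "ennreal (exp ((max 0 (X g - B))\<^sup>2 / 4)) \<le> ennreal (1 + c * exp ((X g)\<^sup>2 / 4))"
      by (intro ennreal_leI pt) (simp add: X_def)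
    also have "\<dots> = 1 + ennreal c * ennreal (exp ((X g)\<^sup>2 / 4))" using c by (simp add: ennreal_mult)
    finally show "ennreal (exp ((max 0 (X g - B))\<^sup>2 / 4)) \<le> 1 + ennreal c * ennreal (exp ((X g)\<^sup>2 / 4))" .
  qed
  also have "\<dots> = 1 + ennreal c * (\<integral>\<^sup>+ g. ennreal (exp ((X g)\<^sup>2 / 4)) \<partial>?G)"
    by (subst nn_integral_add) (auto simp: nn_integral_cmult scg.emeasure_space_1)
  also have "\<dots> \<le> 1 + ennreal c * ennreal (sqrt 2)"
    unfolding X_def by (intro add_left_mono mult_left_mono exp_cip p) simp
  also have "\<dots> = ennreal (1 + sqrt 2 * c)" using c by (simp add: ennreal_mult'[symmetric] mult.commute)
  finally have "(\<integral>\<^sup>+ g. ennreal (exp ((max 0 (X g - B))\<^sup>2 / 4)) \<partial>?G) \<le> ennreal (1 + sqrt 2 * c)" .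
  then have "measure (gaussian_sample n m) {\<omega> \<in> space (gaussian_sample n m). t / 4 \<le> (\<Sum>j<m. (max 0 (X (\<omega> j) - B))\<^sup>2 / 4)}
      \<le> (1 + sqrt 2 * c) ^ m * exp (- (t / 4))"
    using c by (intro chernoff_sample) auto
  also have "(1 + sqrt 2 * c) ^ m \<le> exp (sqrt 2 * c) ^ m"
    using c exp_ge_add_one_self[of "sqrt 2 * c"] by (intro power_mono) auto
  also have "\<dots> = exp (m * (sqrt 2 * c))" by (simp add: exp_of_nat_mult)
  also have "\<dots> \<le> exp 1" using Bm by (simp add: c_def)
  finally have "measure (gaussian_sample n m) {\<omega> \<in> space (gaussian_sample n m). t / 4 \<le> (\<Sum>j<m. (max 0 (X (\<omega> j) - B))\<^sup>2 / 4)}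
      \<le> exp 1 * exp (- (t / 4))" by simp
  also have "exp 1 * exp (- (t / 4)) = exp (1 - t / 4)" by (simp add: exp_add[symmetric])
  finally show ?thesis unfolding X_def sum_divide_distrib[symmetric] by simp
qed

text \<open>
  The rate is weakened by a factor \<open>b \<ge> 1\<close>, to agree with the rate in \<open>trunc_avg_tail\<close> when \<open>b = B ^ 4\<close>.
\<close>

lemma re_avg_tail:
  assumes p: "p \<in> fspace n" "norm p \<le> 1" and q: "q \<in> fspace n" "norm q \<le> 1"
    and \<tau>: "0 < \<tau>" and b: "b \<ge> (1 :: real)"
  defines "\<mu> \<equiv> ((norm p)\<^sup>2 * (norm q)\<^sup>2 + 3 * (Re (cip p q))\<^sup>2 - (Im (cip p q))\<^sup>2) / 2"
  shows "measure (gaussian_sample n m) {\<omega> \<in> space (gaussian_sample n m).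
      (\<Sum>j<m. (Re (cnj (cip p (mk_fv n (\<omega> j))) * cip q (mk_fv n (\<omega> j))))\<^sup>2) \<le> m * (\<mu> - \<tau> / 2)}
    \<le> exp (- (m * (\<tau>\<^sup>2 / (16 * 10^5 * b))))"
proof -
  let ?G = "std_complex_gaussian n"
  let ?f = "\<lambda>g. (Re (cnj (cip p (mk_fv n g)) * cip q (mk_fv n g)))\<^sup>2"
  define V s :: real where "V = 10^5" and "s = \<tau> / (4 * V)"
  have V: "V > 0" by (simp add: V_def)
  have le: "\<bar>?f g\<bar> \<le> (cmod (cip p (mk_fv n g)))\<^sup>2 * (cmod (cip q (mk_fv n g)))\<^sup>2" for g
  proof -
    have "\<bar>Re (cnj (cip p (mk_fv n g)) * cip q (mk_fv n g))\<bar> \<le> cmod (cip p (mk_fv n g)) * cmod (cip q (mk_fv n g))"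
      using abs_Re_le_cmod[of "cnj (cip p (mk_fv n g)) * cip q (mk_fv n g)"] by (simp add: norm_mult)
    then have "\<bar>Re (cnj (cip p (mk_fv n g)) * cip q (mk_fv n g))\<bar>\<^sup>2 \<le> (cmod (cip p (mk_fv n g)) * cmod (cip q (mk_fv n g)))\<^sup>2"
      by (rule power_mono) simp
    then show ?thesis by (simp add: power_mult_distrib)
  qed
  have [measurable]: "?f \<in> borel_measurable ?G" by measurable
  note m8 = cip_mixed_moment8[OF p q _ le]
  have "measure (gaussian_sample n m) {\<omega> \<in> space (gaussian_sample n m). (\<Sum>j<m. ?f (\<omega> j)) \<le> m * (\<mu> - \<tau> / 2)}
    \<le> exp (- (m * (s * (\<tau> / 2) - s\<^sup>2 * V)))"
    by (rule lower_deviation)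
      (use \<tau> V cip_mixed_moments(3,4)[OF p(1) q(1)] m8 in \<open>simp_all add: s_def \<mu>_def V_def\<close>)
  also have "\<dots> \<le> exp (- (m * (\<tau>\<^sup>2 / (16 * 10^5 * b))))"
  proof -
    have "s * (\<tau> / 2) - s\<^sup>2 * V = \<tau>\<^sup>2 / (16 * V)" using V by (simp add: s_def power2_eq_square field_simps)
    moreover have "\<tau>\<^sup>2 / (16 * V * b) \<le> \<tau>\<^sup>2 / (16 * V)"
      using b V by (intro divide_left_mono) simp_all
    ultimately have "m * (\<tau>\<^sup>2 / (16 * V * b)) \<le> m * (s * (\<tau> / 2) - s\<^sup>2 * V)" by (intro mult_left_mono) simp_all
    then show ?thesis unfolding V_def by simp
  qed
  finally show ?thesis .
qed

text \<open>
  The exponential inequality holds for parameters \<open>s \<le> B ^ (- 4)\<close>; as \<open>B\<close> is of order \<open>sqrt (ln m)\<close>, this costs two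
  logarithmic factors in the rate.
\<close>

lemma trunc_avg_tail:
  assumes p: "p \<in> fspace n" "norm p \<le> 1" and q: "q \<in> fspace n" "norm q \<le> 1"
    and \<tau>: "0 < \<tau>" "\<tau> \<le> 1" and B: "B \<ge> (1 :: real)"
  defines "\<mu> \<equiv> (norm p)\<^sup>2 * (norm q)\<^sup>2 + (cmod (cip p q))\<^sup>2"
  shows "measure (gaussian_sample n m) {\<omega> \<in> space (gaussian_sample n m).
      m * (\<mu> + \<tau> / 2) \<le> (\<Sum>j<m. (min (cmod (cip p (mk_fv n (\<omega> j)))) B * min (cmod (cip q (mk_fv n (\<omega> j)))) B)\<^sup>2)}
    \<le> exp (- (m * (\<tau>\<^sup>2 / (16 * 10^5 * B ^ 4))))"
proof -
  let ?G = "std_complex_gaussian n"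
  let ?f = "\<lambda>g. (min (cmod (cip p (mk_fv n g))) B * min (cmod (cip q (mk_fv n g))) B)\<^sup>2"
  define V where "V = (10^5 :: real)"
  define s where "s = \<tau> / (4 * V * B ^ 4)"
  have V: "V \<ge> 1" by (simp add: V_def)
  have B4: "B ^ 4 \<ge> 1" using B by (rule one_le_power)
  have min1: "0 \<le> min y B" "min y B \<le> y" "min y B \<le> B" if "y \<ge> 0" for y using that B by simp_all
  have le: "\<bar>?f g\<bar> \<le> (cmod (cip p (mk_fv n g)))\<^sup>2 * (cmod (cip q (mk_fv n g)))\<^sup>2" for g
  proof -
    have "0 \<le> min (cmod (cip p (mk_fv n g))) B" "0 \<le> min (cmod (cip q (mk_fv n g))) B" using B by simp_all
    then have "(min (cmod (cip p (mk_fv n g))) B)\<^sup>2 * (min (cmod (cip q (mk_fv n g))) B)\<^sup>2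
        \<le> (cmod (cip p (mk_fv n g)))\<^sup>2 * (cmod (cip q (mk_fv n g)))\<^sup>2"
      by (intro mult_mono power_mono) simp_all
    then show ?thesis by (simp only: abs_power2 abs_mult power_mult_distrib)
  qed
  have le4: "?f g \<le> B ^ 4" for g
  proof -
    have "min (cmod (cip p (mk_fv n g))) B * min (cmod (cip q (mk_fv n g))) B \<le> B * B"
      using B by (intro mult_mono min1) simp_all
    then have "?f g \<le> (B * B)\<^sup>2" using B by (intro power_mono mult_nonneg_nonneg min1) simp_all
    then show ?thesis by (simp add: power2_eq_square power4_eq_xxxx mult_ac)
  qed
  have [measurable]: "?f \<in> borel_measurable ?G" by measurable
  note m8 = cip_mixed_moment8[OF p q _ le]
  have if1: "integrable ?G ?f" using le4 by (intro scg.integrable_const_bound[where B = "B ^ 4"]) auto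
  have s: "0 < s" unfolding s_def using \<tau> V B4 by (intro divide_pos_pos mult_pos_pos) linarith+
  have sB: "s * B ^ 4 \<le> 1"
  proof -
    have "s * B ^ 4 = \<tau> / (4 * V)" using B V by (simp add: s_def)
    also have "\<dots> \<le> 1" using \<tau> V by (simp add: field_simps)
    finally show ?thesis .
  qed
  have mu: "(\<integral>g. ?f g \<partial>?G) \<le> \<mu>"
    unfolding \<mu>_def cip_mixed_moments(2)[OF p(1) q(1), symmetric]
    using le by (intro integral_mono if1 cip_mixed_moments(1) p q) (simp add: abs_le_iff)
  have "measure (gaussian_sample n m) {\<omega> \<in> space (gaussian_sample n m). m * (\<mu> + \<tau> / 2) \<le> (\<Sum>j<m. ?f (\<omega> j))}
    \<le> exp (- (m * (s * (\<tau> / 2) - s\<^sup>2 * V)))"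
    by (rule upper_deviation[OF _ _ le4 s sB mu]) (use m8 in \<open>simp_all add: V_def\<close>)
  also have "\<dots> \<le> exp (- (m * (\<tau>\<^sup>2 / (16 * V * B ^ 4))))"
  proof -
    have "s * V \<le> \<tau> / 4"
    proof -
      have "s * V = \<tau> / (4 * B ^ 4)" using V by (simp add: s_def)
      also have "\<dots> \<le> \<tau> / (4 * 1)" using \<tau> B4 B by (intro divide_left_mono) simp_all
      finally show ?thesis by simp
    qed
    then have "s * (\<tau> / 4) \<le> s * (\<tau> / 2 - s * V)" using s by (intro mult_left_mono) simp_all
    moreover have "s * (\<tau> / 4) = \<tau>\<^sup>2 / (16 * V * B ^ 4)" by (simp add: s_def power2_eq_square)
    moreover have "s * (\<tau> / 2 - s * V) = s * (\<tau> / 2) - s\<^sup>2 * V" by (simp add: power2_eq_square algebra_simps)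
    ultimately have "\<tau>\<^sup>2 / (16 * V * B ^ 4) \<le> s * (\<tau> / 2) - s\<^sup>2 * V" by (simp only:)
    then have "m * (\<tau>\<^sup>2 / (16 * V * B ^ 4)) \<le> m * (s * (\<tau> / 2) - s\<^sup>2 * V)" by (rule mult_left_mono) simp
    then show ?thesis by simp
  qed
  finally show ?thesis unfolding V_def .
qed


section \<open>Leave-one-out paths are incoherent with the sample left out\<close>

lemma measurable_norm_fvec:
  assumes "\<And>\<omega>. F \<omega> \<in> fspace n" and [measurable]: "\<And>i. i < n \<Longrightarrow> (\<lambda>\<omega>. fv (F \<omega>) i) \<in> borel_measurable M"
  shows "(\<lambda>\<omega>. norm (F \<omega>)) \<in> borel_measurable M"
proof -
  have "norm (F \<omega>) = sqrt (\<Sum>i<n. (cmod (fv (F \<omega>) i))\<^sup>2)" for \<omega>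
    using norm_fspace[OF assms(1)] by (metis norm_ge_zero real_sqrt_abs abs_of_nonneg)
  then show ?thesis by simp
qed

lemma measurable_cip_sample [measurable]:
  "j < m \<Longrightarrow> (\<lambda>\<omega>. cip u (mk_fv n (\<omega> j))) \<in> borel_measurable (gaussian_sample n m)"
  by (rule measurable_compose[OF measurable_sample_component measurable_cip_mk_fv])

lemma measurable_sample_entry [measurable]:
  assumes "j < m" "i < n" shows "(\<lambda>\<omega>. \<omega> j i) \<in> borel_measurable (gaussian_sample n m)"
proof -
  have "(\<lambda>g. g i) \<in> borel_measurable (std_complex_gaussian n)"
    unfolding std_complex_gaussian_def using assms(2) measurable_component_singleton[of i "{..<n}" "\<lambda>_. std_complex_normal"]
    by (simp add: measurable_cong_sets[OF refl sets_std_complex_normal])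
  from measurable_compose[OF measurable_sample_component[OF assms(1)] this] show ?thesis .
qed

lemma measurable_norm_sample_sum:
  assumes u: "u \<in> fspace n" and c: "\<And>j. j < m \<Longrightarrow> c j \<in> borel_measurable (gaussian_sample n m)"
  shows "(\<lambda>\<omega>. norm ((\<Sum>j\<in>{..<m} - {l}. cmul (c j \<omega>) (mk_fv n (\<omega> j))) - u)) \<in> borel_measurable (gaussian_sample n m)"
proof (rule measurable_norm_fvec[of _ n])
  fix i assume i: "i < n"
  have "(\<lambda>\<omega>. c j \<omega> * \<omega> j i) \<in> borel_measurable (gaussian_sample n m)" if "j \<in> {..<m} - {l}" for j
    using that c[of j] measurable_sample_entry[OF _ i, of j m] by (intro borel_measurable_times) auto
  then have "(\<lambda>\<omega>. (\<Sum>j\<in>{..<m} - {l}. c j \<omega> * \<omega> j i) - fv u i) \<in> borel_measurable (gaussian_sample n m)"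
    by (intro borel_measurable_diff borel_measurable_sum) auto
  moreover have "fv ((\<Sum>j\<in>{..<m} - {l}. cmul (c j \<omega>) (mk_fv n (\<omega> j))) - u) i = (\<Sum>j\<in>{..<m} - {l}. c j \<omega> * \<omega> j i) - fv u i" for \<omega>
    using i by (simp add: fv_sum mk_fv.rep_eq)
  ultimately show "(\<lambda>\<omega>. fv ((\<Sum>j\<in>{..<m} - {l}. cmul (c j \<omega>) (mk_fv n (\<omega> j))) - u) i) \<in> borel_measurable (gaussian_sample n m)"
    by (simp only:)
qed (use u in auto)

text \<open>
  For a fixed path the conditions are polynomial inequalities in the samples.
\<close>

lemma measurable_loo_path:
  assumes x: "x \<in> fspace n"
  shows "{\<omega> \<in> space (gaussian_sample n m). loo_path n m (\<lambda>j. mk_fv n (\<omega> j)) x l K \<eta> t} \<in> sets (gaussian_sample n m)"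
proof (cases "\<forall>k. t k \<in> fspace n")
  case False
  then have "{\<omega> \<in> space (gaussian_sample n m). loo_path n m (\<lambda>j. mk_fv n (\<omega> j)) x l K \<eta> t} = {}"
    by (auto simp: loo_path_def)
  then show ?thesis by (simp only: sets.empty_sets)
next
  case True
  let ?P = "gaussian_sample n m"
  have c: "(\<lambda>\<omega>. norm (weighted_cov (\<lambda>j. mk_fv n (\<omega> j)) ({..<m} - {l}) x v - r *\<^sub>R v)) \<in> borel_measurable ?P"
    if v: "v \<in> fspace n" for v r
    unfolding weighted_cov_def using v by (intro measurable_norm_sample_sum) (auto intro!: borel_measurable_times)
  have g: "(\<lambda>\<omega>. norm (gn_form (\<lambda>j. mk_fv n (\<omega> j)) ({..<m} - {l}) x h u - 0)) \<in> borel_measurable ?P" for h u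
    unfolding gn_form_def by (intro measurable_norm_sample_sum) (auto intro!: borel_measurable_times)
  define F where "F \<omega> = norm (weighted_cov (\<lambda>j. mk_fv n (\<omega> j)) ({..<m} - {l}) x (x + displ x (t 0))
     - (2 * real m * (norm (x + displ x (t 0)))\<^sup>2) *\<^sub>R (x + displ x (t 0)))" for \<omega>
  define G where "G k \<omega> = norm (gn_form (\<lambda>j. mk_fv n (\<omega> j)) ({..<m} - {l}) x (displ x (t k)) (t (Suc k)))" for k \<omega>
  have [measurable]: "F \<in> borel_measurable ?P" unfolding F_def using x True by (intro c) auto
  have [measurable]: "G k \<in> borel_measurable ?P" for k using g unfolding G_def by simp
  define p where "p \<longleftrightarrow> (\<forall>k. t k \<in> fspace n) \<and> norm (displ x (t 0)) \<le> 2/1000 \<and>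
    (\<forall>k<K. \<bar>Im (cip (t (Suc k)) (x + displ x (t k)))\<bar> \<le> \<eta>)"
  have "loo_path n m (\<lambda>j. mk_fv n (\<omega> j)) x l K \<eta> t \<longleftrightarrow> p \<and> F \<omega> \<le> \<eta> * real m \<and> (\<forall>k<K. G k \<omega> \<le> \<eta> * real m)" for \<omega>
    unfolding loo_path_def p_def F_def G_def by blast
  then show ?thesis by simp
qed

lemma loo_path_update:
  "loo_path n m (\<lambda>j. mk_fv n (fun_upd \<omega> l g j)) x l K \<eta> t \<longleftrightarrow> loo_path n m (\<lambda>j. mk_fv n (\<omega> j)) x l K \<eta> t"
proof -
  have "weighted_cov (\<lambda>j. mk_fv n (fun_upd \<omega> l g j)) ({..<m} - {l}) x v = weighted_cov (\<lambda>j. mk_fv n (\<omega> j)) ({..<m} - {l}) x v" for v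
    unfolding weighted_cov_def by (intro sum.cong) auto
  moreover have "gn_form (\<lambda>j. mk_fv n (fun_upd \<omega> l g j)) ({..<m} - {l}) x h v = gn_form (\<lambda>j. mk_fv n (\<omega> j)) ({..<m} - {l}) x h v" for h v
    unfolding gn_form_def by (intro sum.cong) auto
  ultimately show ?thesis unfolding loo_path_def by (simp only:)
qed

lemma loo_path_cong:
  assumes "loo_path n m a x l K \<eta> t" "\<And>k. k \<le> K \<Longrightarrow> t' k = t k" "\<And>k. t' k \<in> fspace n"
  shows "loo_path n m a x l K \<eta> t'"
  using assms(1) unfolding loo_path_def by (simp add: assms(2,3))

text \<open>
  If there is a path in \<open>D\<close> at all, the first one in an enumeration is independent of the sample \<open>l\<close>, and each
  of the \<open>2 (K + 1)\<close> inner products with it violates the bound with probability at most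
  \<open>sqrt 2 * exp (- (B\<^sup>2 / 4))\<close>. The path obtained need not be the given one.
\<close>

lemma incoherent_loo_path:
  assumes l: "l < m" and x: "x \<in> fspace n" and B: "B \<ge> 0" and D: "countable D" "D \<subseteq> fspace n" "D \<noteq> {}"
  obtains N where "N \<in> sets (gaussian_sample n m)"
    "measure (gaussian_sample n m) N \<le> 2 * (real K + 1) * (sqrt 2 * exp (- (B\<^sup>2 / 4)))"
    "\<And>\<omega> t. \<omega> \<in> space (gaussian_sample n m) - N \<Longrightarrow> (\<And>k. t k \<in> D) \<Longrightarrow>
       loo_path n m (\<lambda>j. mk_fv n (\<omega> j)) x l K \<eta> t \<Longrightarrow>
       \<exists>t'. loo_path n m (\<lambda>j. mk_fv n (\<omega> j)) x l K \<eta> t' \<and>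
         incoherent_along x (mk_fv n (\<omega> l)) B K t'"
proof -
  let ?P = "gaussian_sample n m" and ?G = "std_complex_gaussian n"
  define d where "d = from_nat_into D"
  have d: "d i \<in> D" for i using D(3) by (simp add: d_def from_nat_into)
  have d_surj: "\<exists>i. d i = v" if "v \<in> D" for v using from_nat_into_surj[OF D(1) that] by (simp add: d_def)
  \<comment> \<open>Only the first \<open>K + 1\<close> points of a path matter, so countably many paths suffice.\<close>
  define path where "path i k = d (let xs = (from_nat i :: nat list) in if k < length xs then xs ! k else 0)" for i k
  have pathV: "path i k \<in> fspace n" for i k using d D(2) by (auto simp: path_def)
  define S where "S i = {\<omega> \<in> space ?P. loo_path n m (\<lambda>j. mk_fv n (\<omega> j)) x l K \<eta> (path i)}" for i
  define bad where "bad u = {g \<in> space ?G. B * norm u < cmod (cip u (mk_fv n g))}" for u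
  have bad_sets [measurable]: "bad u \<in> sets ?G" for u unfolding bad_def by measurable
  define T where "T i = (\<Union>k\<in>{..K}. bad (path i k) \<union> bad (displ x (path i k)))" for i
  have T_sets: "T i \<in> sets ?G" for i unfolding T_def by measurable
  have T_small: "measure ?G (T i) \<le> 2 * (real K + 1) * (sqrt 2 * exp (- (B\<^sup>2 / 4)))" for i
  proof -
    have b: "measure ?G (bad u) \<le> sqrt 2 * exp (- (B\<^sup>2 / 4))" if "u \<in> fspace n" for u
      unfolding bad_def using that B by (rule cip_tail)
    have "measure ?G (T i) \<le> (\<Sum>k\<in>{..K}. measure ?G (bad (path i k) \<union> bad (displ x (path i k))))"
      unfolding T_def by (rule scg.finite_measure_subadditive_finite) auto
    also have "\<dots> \<le> (\<Sum>k\<in>{..K}. 2 * (sqrt 2 * exp (- (B\<^sup>2 / 4))))"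
    proof (rule sum_mono)
      fix k
      have "measure ?G (bad (path i k) \<union> bad (displ x (path i k))) \<le> measure ?G (bad (path i k)) + measure ?G (bad (displ x (path i k)))"
        by (rule measure_Un_le) auto
      then show "measure ?G (bad (path i k) \<union> bad (displ x (path i k))) \<le> 2 * (sqrt 2 * exp (- (B\<^sup>2 / 4)))"
        using b[OF pathV[of i k]] b[OF displ_fspace[OF pathV[of i k] x]] by linarith
    qed
    finally show ?thesis by (simp add: algebra_simps)
  qed
  have S_sets: "S i \<in> sets ?P" for i unfolding S_def by (rule measurable_loo_path[OF x])
  have S_inv: "fun_upd \<omega> l g \<in> S i \<longleftrightarrow> \<omega> \<in> S i" if "\<omega> \<in> space ?P" "g \<in> space ?G" for i \<omega> g
  proof -
    have "fun_upd \<omega> l g \<in> space ?P"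
      using that l by (auto simp: gaussian_sample_def space_PiM PiE_iff extensional_def)
    then show ?thesis using that by (simp only: S_def mem_Collect_eq loo_path_update)
  qed
  obtain N where N: "N \<in> sets ?P" "measure ?P N \<le> 2 * (real K + 1) * (sqrt 2 * exp (- (B\<^sup>2 / 4)))"
    "\<And>\<omega> i. \<omega> \<in> space ?P - N \<Longrightarrow> \<omega> \<in> S i \<Longrightarrow> \<exists>k. \<omega> \<in> S k \<and> \<omega> l \<notin> T k"
    using select_independent[where S = S and T = T, OF l S_sets T_sets S_inv T_small] by metis
  show thesis
  proof (rule that[OF N(1,2)])
    fix \<omega> t
    assume \<omega>: "\<omega> \<in> space ?P - N" and t: "\<And>k. t k \<in> D" and loo: "loo_path n m (\<lambda>j. mk_fv n (\<omega> j)) x l K \<eta> t"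
    obtain f where f: "\<And>k. d (f k) = t k" using d_surj[OF t] by metis
    define i where "i = to_nat (map f [0..<Suc K])"
    have "path i k = t k" if "k \<le> K" for k
      using that by (simp add: path_def i_def f Let_def nth_append del: upt_Suc)
    then have "loo_path n m (\<lambda>j. mk_fv n (\<omega> j)) x l K \<eta> (path i)"
      using pathV by (intro loo_path_cong[OF loo]) simp_all
    then have "\<omega> \<in> S i" using \<omega> by (simp add: S_def)
    then obtain k where k: "\<omega> \<in> S k" "\<omega> l \<notin> T k" using N(3)[OF \<omega>] by blast
    have "\<omega> l \<in> space ?G" using measurable_space[OF measurable_sample_component[OF l, of n]] \<omega> by auto
    then have good: "cmod (cip u (mk_fv n (\<omega> l))) \<le> B * norm u" if "\<omega> l \<notin> bad u" for u
      using that unfolding bad_def by simp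
    have "incoherent_along x (mk_fv n (\<omega> l)) B K (path k)"
      using k(2) unfolding T_def incoherent_along_def by (intro allI impI conjI good) blast+
    then show "\<exists>t'. loo_path n m (\<lambda>j. mk_fv n (\<omega> j)) x l K \<eta> t' \<and>
         incoherent_along x (mk_fv n (\<omega> l)) B K t'"
      using k(1) by (auto simp: S_def)
  qed
qed

section \<open>The good event\<close>

lemma sample_union_bound:
  assumes "finite I" and A: "\<And>i. i \<in> I \<Longrightarrow> A i \<in> sets (gaussian_sample n m)"
    and c: "\<And>i. i \<in> I \<Longrightarrow> measure (gaussian_sample n m) (A i) \<le> c" "c \<ge> 0" and k: "real (card I) \<le> k"
  shows "measure (gaussian_sample n m) (\<Union>i\<in>I. A i) \<le> k * c"
proof -
  have "measure (gaussian_sample n m) (\<Union>i\<in>I. A i) \<le> (\<Sum>i\<in>I. measure (gaussian_sample n m) (A i))"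
    using assms(1) A by (intro sample.finite_measure_subadditive_finite) auto
  also have "\<dots> \<le> (\<Sum>i\<in>I. c)" by (intro sum_mono c)
  also have "\<dots> \<le> k * c" using k c(2) by (simp add: mult_right_mono)
  finally show "measure (gaussian_sample n m) (\<Union>i\<in>I. A i) \<le> k * c" .
qed

text \<open>
  The choices are made such that \<open>exp (- (B\<^sup>2 / 4)) = 1 / m ^ 12\<close> and
  \<open>P (norm a\<^sub>j > R) \<le> exp (- 1.5 n)\<close>, and such that the total excess \<open>100 n ln m\<close>, a quarter of \<open>\<rho>\<^sup>2 m\<close>, has
  probability at most \<open>exp (1 - 25 n ln m)\<close> to be exceeded at a given point, which beats the number of lattice points. The
  factor \<open>10 ^ 30\<close> leaves room for \<open>\<tau>\<^sup>2 = 10 ^ (- 16)\<close> in the rate of the concentration inequalities.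
\<close>

locale large_sample =
  fixes n m :: nat and \<epsilon> :: real
  assumes n1: "n \<ge> 1" and m3: "m \<ge> 3" and eps: "0 < \<epsilon>" "\<epsilon> \<le> 1"
    and large: "10^30 * real n * ln (real m) ^ 3 \<le> \<epsilon>\<^sup>2 * real m" and ln_le: "ln (real m) \<le> 1.5 * real n"
begin

definition B :: real where "B = sqrt (48 * ln (real m))"
definition R :: real where "R = sqrt (18 * real n)"
definition \<rho> :: real where "\<rho> = sqrt (400 * real n * ln (real m) / real m)"
definition \<tau> :: real where "\<tau> = 1 / 10^8"
definition \<delta> :: real where "\<delta> = sqrt (2 * real n) / real (m ^ 4)"

lemma ln_ge_1: "ln (real m) \<ge> 1"
proof -
  have "exp 1 \<le> real m" using exp_le m3 by linarith
  then show ?thesis using m3 by (subst ln_ge_iff) auto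
qed

lemma n_ge_1: "real n \<ge> 1" and m_ge_3: "real m \<ge> 3"
  using n1 m3 by simp_all

lemma large':
  "10^30 * real n * ln (real m) ^ 3 \<le> real m" "10^30 * (real n * (ln (real m))\<^sup>2) \<le> \<epsilon>\<^sup>2 * real m"
  "10^30 * (real n * (ln (real m))\<^sup>2) \<le> real m" "10^30 * (real n * ln (real m)) \<le> real m"
  "10^30 * (ln (real m))\<^sup>2 \<le> real m" "10^30 * real n \<le> real m"
proof -
  let ?l = "ln (real m)"
  have e1: "\<epsilon>\<^sup>2 * real m \<le> 1 * real m" using eps by (intro mult_right_mono) (simp_all add: power_le_one)
  then show 1: "10^30 * real n * ?l ^ 3 \<le> real m" using large by linarith
  have scale: "10^30 * b \<le> z" if "b \<le> a" "10^30 * a \<le> z" for a b z :: real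
    using that by (intro order_trans[OF mult_left_mono[OF that(1)] that(2)]) simp
  have p: "?l\<^sup>2 \<le> ?l ^ 3" "?l \<le> ?l\<^sup>2"
    using power_increasing[OF _ ln_ge_1, of 2 3] power_increasing[OF _ ln_ge_1, of 1 2] by simp_all
  have "real n * ?l\<^sup>2 \<le> real n * ?l ^ 3" using p by (intro mult_left_mono) simp_all
  then show 2: "10^30 * (real n * ?l\<^sup>2) \<le> \<epsilon>\<^sup>2 * real m" by (rule scale) (use large in \<open>simp only: mult.assoc\<close>)
  show 3: "10^30 * (real n * ?l\<^sup>2) \<le> real m" using order_trans[OF 2 e1] by (simp only: mult_1_left)
  have "real n * ?l \<le> real n * ?l\<^sup>2" using p by (intro mult_left_mono) simp_all
  then show 4: "10^30 * (real n * ?l) \<le> real m" by (rule scale[OF _ 3])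
  have "1 * ?l\<^sup>2 \<le> real n * ?l\<^sup>2" using n_ge_1 by (intro mult_right_mono) simp_all
  then show "10^30 * ?l\<^sup>2 \<le> real m" by (intro scale[OF _ 3]) simp
  have "real n * 1 \<le> real n * ?l" using ln_ge_1 by (intro mult_left_mono) simp_all
  then show "10^30 * real n \<le> real m" by (intro scale[OF _ 4]) simp
qed

lemma n_less_m: "real n + 1 \<le> real m"
proof -
  have "2 * real n \<le> 10^30 * real n" by (intro mult_right_mono) simp_all
  then show ?thesis using order_trans[OF _ large'(6)] n_ge_1 by fastforce
qed

lemma B_sq: "B\<^sup>2 = 48 * ln (real m)" and B_4: "B ^ 4 = 2304 * (ln (real m))\<^sup>2" and B_ge_1: "B \<ge> 1"
proof -
  show 1: "B\<^sup>2 = 48 * ln (real m)" using ln_ge_1 by (simp add: B_def)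
  have "B ^ 4 = (B\<^sup>2)\<^sup>2" by simp
  then show "B ^ 4 = 2304 * (ln (real m))\<^sup>2" unfolding 1 by (simp add: power_mult_distrib)
  show "B \<ge> 1" unfolding B_def using ln_ge_1 by simp
qed

lemma R_sq: "R\<^sup>2 = 18 * real n" and R_ge_1: "R \<ge> 1"
  using n_ge_1 by (simp_all add: R_def)

lemma tau_bounds: "0 < \<tau>" "\<tau> \<le> 1 / 10^8" "\<tau> \<le> 1"
  by (simp_all add: \<tau>_def)

lemma B_rho: "0 \<le> \<rho>" "B * \<rho> \<le> \<epsilon> / 10^12" "2 * B * \<rho> \<le> \<tau>" "4 * B * \<rho> \<le> \<epsilon>"
proof -
  show "0 \<le> \<rho>" using ln_ge_1 by (simp add: \<rho>_def)
  have "(B * \<rho>)\<^sup>2 = 19200 * (real n * (ln (real m))\<^sup>2) / real m"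
    using ln_ge_1 unfolding power_mult_distrib B_sq \<rho>_def by (simp add: power2_eq_square)
  also have "\<dots> \<le> 19200 * (\<epsilon>\<^sup>2 * real m / 10^30) / real m"
    using large'(2) m_ge_3 by (intro divide_right_mono mult_left_mono) (simp_all add: field_simps)
  also have "\<dots> \<le> (\<epsilon> / 10^12)\<^sup>2" using m_ge_3 by (simp add: power_divide)
  finally show 1: "B * \<rho> \<le> \<epsilon> / 10^12" using eps by (intro power2_le_imp_le[of "B * \<rho>"]) simp_all
  show "2 * B * \<rho> \<le> \<tau>" using 1 eps by (simp add: \<tau>_def)
  show "4 * B * \<rho> \<le> \<epsilon>" using 1 eps by simp
qed

lemma B_le_2R: "B \<le> 2 * R"
proof (rule power2_le_imp_le)
  show "B\<^sup>2 \<le> (2 * R)\<^sup>2" unfolding power_mult_distrib B_sq R_sq using ln_le by simp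
qed (use R_ge_1 in simp)

lemma net_fine: "sqrt (100 * real n * ln (real m)) + sqrt (real m) * (R * \<delta>) \<le> \<rho> * sqrt (real m)"
  "(32 * R ^ 4 + 10) * \<delta> \<le> \<tau> / 4"
proof -
  have nm: "real n \<le> real m" using n_less_m by simp
  have m1: "real m \<ge> 1" "real m > 0" using m_ge_3 by simp_all
  have \<delta>le: "\<delta> \<le> 2 * real n / real m ^ 4"
  proof -
    have "sqrt (2 * real n) \<le> 2 * real n"
      using n_ge_1 by (intro real_le_lsqrt) (simp_all add: power2_eq_square)
    then show ?thesis unfolding \<delta>_def of_nat_power by (rule divide_right_mono) simp
  qed
  have \<delta>0: "\<delta> \<ge> 0" by (simp add: \<delta>_def)
  have n3: "real n ^ 3 \<le> real m ^ 3" using nm by (intro power_mono) simp_all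
  have "\<rho> * sqrt (real m) = sqrt (4 * (100 * real n * ln (real m)))"
    using m1 by (simp add: \<rho>_def real_sqrt_mult[symmetric])
  then have 1: "\<rho> * sqrt (real m) = 2 * sqrt (100 * real n * ln (real m))"
    by (simp add: real_sqrt_mult)
  have "1 * 1 \<le> real n * ln (real m)" using n_ge_1 ln_ge_1 by (intro mult_mono) simp_all
  then have 2: "10 \<le> sqrt (100 * real n * ln (real m))" by (intro real_le_rsqrt) simp
  have R18: "R \<le> 18 * real n"
    using R_sq R_ge_1 mult_left_mono[OF R_ge_1, of R] by (simp add: power2_eq_square)
  have "sqrt (real m) \<le> real m" using m1 by (intro real_le_lsqrt) (simp_all add: power2_eq_square)
  then have "sqrt (real m) * (R * \<delta>) \<le> real m * ((18 * real n) * (2 * real n / real m ^ 4))"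
    using R_ge_1 \<delta>0 m1 R18 \<delta>le by (intro mult_mono) simp_all
  also have "\<dots> = 36 * (real n / real m) * (real n / real m) / real m"
    using m1 by (simp add: power4_eq_xxxx)
  also have "\<dots> \<le> 36 * 1 * 1 / real m"
    using nm m1 by (intro divide_right_mono mult_mono) simp_all
  also have "\<dots> \<le> 1" using large'(6) n_ge_1 m1 by simp
  finally show "sqrt (100 * real n * ln (real m)) + sqrt (real m) * (R * \<delta>) \<le> \<rho> * sqrt (real m)"
    unfolding 1 using 2 by linarith
  have "R ^ 4 = (R\<^sup>2)\<^sup>2" by simp
  then have R4: "R ^ 4 = 324 * (real n)\<^sup>2" unfolding R_sq by (simp add: power_mult_distrib)
  have "1 \<le> (real n)\<^sup>2" using n_ge_1 by simp
  then have "(32 * R ^ 4 + 10) * \<delta> \<le> (10378 * (real n)\<^sup>2) * (2 * real n / real m ^ 4)"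
    unfolding R4 using \<delta>0 \<delta>le by (intro mult_mono) simp_all
  also have "\<dots> = 20756 * (real n ^ 3 / real m ^ 3) / real m"
    by (simp add: power4_eq_xxxx power3_eq_cube power2_eq_square)
  also have "\<dots> \<le> 20756 * 1 / real m"
    using n3 m1 by (intro divide_right_mono mult_left_mono) simp_all
  also have "\<dots> \<le> \<tau> / 4"
    using large'(6) n_ge_1 m1 by (simp add: \<tau>_def field_simps)
  finally show "(32 * R ^ 4 + 10) * \<delta> \<le> \<tau> / 4" .
qed

lemma path_parameters:
  "R / 2 ^ n \<le> B" "40 * B ^ 3 * R / real m \<le> 1/100"
  "R * (4 * (1 / real m) + 2 * (40 * B ^ 3 * R / real m)) \<le> B / 10^5" "B ^ 4 \<le> \<tau> * real m"
proof -
  let ?l = "ln (real m)"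
  have m1: "real m > 0" using m_ge_3 by simp
  have B3: "B ^ 3 = 48 * ?l * B" using B_sq by (simp add: power3_eq_cube power2_eq_square)
  have RR: "R * R = 18 * real n" using R_sq by (simp add: power2_eq_square)
  have "R\<^sup>2 \<le> (B * 2 ^ n)\<^sup>2"
  proof -
    have "real n \<le> 2 ^ n * 2 ^ n"
      using mult_mono[of "real n" "2 ^ n" 1 "2 ^ n :: real"] of_nat_less_two_power[of n, where 'a = real] by simp
    then have "18 * real n * 1 \<le> 48 * (2 ^ n * 2 ^ n) * ?l" using ln_ge_1 by (intro mult_mono) simp_all
    then show ?thesis unfolding power_mult_distrib R_sq B_sq by (simp add: power2_eq_square mult_ac)
  qed
  then have "R \<le> B * 2 ^ n" using B_ge_1 by (intro power2_le_imp_le[of R]) simp_all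
  then show "R / 2 ^ n \<le> B" by (simp add: field_simps)
  have "B ^ 3 * R \<le> (48 * ?l * (2 * R)) * R"
    unfolding B3 using B_le_2R ln_ge_1 R_ge_1 by (intro mult_right_mono mult_left_mono) simp_all
  also have "\<dots> = 96 * ?l * (R * R)" by simp
  also have "\<dots> = 1728 * (real n * ?l)" unfolding RR by simp
  finally have "40 * B ^ 3 * R \<le> 69120 * (real n * ?l)" by (simp add: mult.commute)
  also have "\<dots> \<le> 1/100 * real m" using large'(4) by simp
  finally show "40 * B ^ 3 * R / real m \<le> 1/100" using m1 by (simp add: field_simps)
  have "R * (4 * (1 / real m) + 2 * (40 * B ^ 3 * R / real m)) = (4 * R + 80 * B ^ 3 * (R * R)) / real m"
    using m1 by (simp add: field_simps)
  also have "\<dots> = (4 * R + 69120 * (real n * ?l) * B) / real m" unfolding RR B3 by simp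
  also have "\<dots> \<le> (72 * (real n * ?l) * B + 69120 * (real n * ?l) * B) / real m"
  proof (intro divide_right_mono add_right_mono)
    have "R * 1 \<le> R * R" using R_ge_1 by (intro mult_left_mono) simp_all
    then have "4 * R \<le> 72 * (real n * 1) * 1" unfolding RR by simp
    also have "\<dots> \<le> 72 * (real n * ?l) * B" using ln_ge_1 B_ge_1 by (intro mult_mono) simp_all
    finally show "4 * R \<le> 72 * (real n * ?l) * B" .
  qed simp
  also have "\<dots> = 69192 * (real n * ?l) * B / real m" by (simp add: algebra_simps)
  also have "\<dots> \<le> (real m / 10^5) * B / real m"
    using large'(4) B_ge_1 by (intro divide_right_mono mult_right_mono) simp_all
  also have "\<dots> = B / 10^5" using m1 by simp
  finally show "R * (4 * (1 / real m) + 2 * (40 * B ^ 3 * R / real m)) \<le> B / 10^5" .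
  show "B ^ 4 \<le> \<tau> * real m" unfolding B_4 \<tau>_def using large'(5) by simp
qed

text \<open>
  The numbers used in the union bounds for \<open>good_event\<close>; every contribution is at most \<open>1 / m ^ 8\<close>.
\<close>

lemma tail_parameters:
  "exp (- (B\<^sup>2 / 4)) = 1 / real m ^ 12"
  "real m * (sqrt 2 * (1 / real m ^ 12)) \<le> 1 / real m ^ 8"
  "real m * (2 * (real n + 1) * (sqrt 2 * (1 / real m ^ 12))) \<le> 1 / real m ^ 8"
  "exp (10 * (real n * ln (real m))) * exp (1 - 100 * real n * ln (real m) / 4) \<le> 1 / real m ^ 8"
  "(exp (10 * (real n * ln (real m))))\<^sup>2 * exp (- (real m * (\<tau>\<^sup>2 / (16 * 10^5 * B ^ 4)))) \<le> 1 / real m ^ 8"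
  "real ((2 * m ^ 4 + 1) ^ (2 * n)) \<le> exp (10 * (real n * ln (real m)))"
proof -
  let ?l = "ln (real m)"
  have m1: "real m > 0" "real m \<ge> 1" using m_ge_3 by simp_all
  have exp_l: "exp (real k * ?l) = real m ^ k" for k using m1 by (simp add: exp_of_nat_mult)
  have exp_ml: "exp (- (real k * ?l)) = 1 / real m ^ k" for k using exp_l[of k] by (simp add: exp_minus field_simps)
  show "exp (- (B\<^sup>2 / 4)) = 1 / real m ^ 12" using exp_ml[of 12] by (simp add: B_sq)
  note nm = n_less_m
  have s2: "sqrt 2 \<le> (2 :: real)" by (rule real_le_lsqrt) auto
  have "(2 * (real n + 1)) * sqrt 2 \<le> (2 * real m) * 2" using nm s2 by (intro mult_mono) simp_all
  then have "real m * ((2 * (real n + 1)) * sqrt 2) \<le> real m * ((2 * real m) * 2)" by (intro mult_left_mono) simp_all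
  also have "\<dots> \<le> real m ^ 4"
  proof -
    have "4 * (real m * real m) \<le> (real m * real m) * (real m * real m)"
      using m_ge_3 mult_mono[of 3 "real m" 3 "real m"] by (intro mult_right_mono) simp_all
    then show ?thesis by (simp add: power4_eq_xxxx mult_ac)
  qed
  finally have "real m * ((2 * (real n + 1)) * sqrt 2) / real m ^ 12 \<le> real m ^ 4 / real m ^ 12"
    by (rule divide_right_mono) simp
  moreover have "real m ^ 4 / real m ^ 12 = 1 / real m ^ 8"
  proof -
    have "real m ^ 12 = real m ^ 4 * real m ^ 8" by (simp add: power_add[symmetric])
    moreover have "x / (x * y) = 1 / y" if "x > 0" for x y :: real using that by simp
    ultimately show ?thesis using m1(1) by (simp only: zero_less_power)
  qed
  ultimately show 3: "real m * (2 * (real n + 1) * (sqrt 2 * (1 / real m ^ 12))) \<le> 1 / real m ^ 8"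
    by (simp add: mult.assoc)
  have "real m * (1 * (sqrt 2 * (1 / real m ^ 12))) \<le> real m * (2 * (real n + 1) * (sqrt 2 * (1 / real m ^ 12)))"
    by (intro mult_left_mono mult_right_mono) simp_all
  then show "real m * (sqrt 2 * (1 / real m ^ 12)) \<le> 1 / real m ^ 8" using 3 by simp
  have nl: "?l \<le> real n * ?l" using mult_right_mono[OF n_ge_1, of ?l] ln_ge_1 by simp
  have gen: "1 - 15 * y \<le> - (real 8 * l)" if "l \<le> y" "1 \<le> l" for y l :: real using that by simp
  have gen': "20 * y - z \<le> - (real 8 * l)" if "28 * y \<le> z" "l \<le> y" for y l z :: real using that by simp
  have "exp (10 * (real n * ?l)) * exp (1 - 100 * real n * ?l / 4) = exp (1 - 15 * (real n * ?l))"
    by (simp add: exp_add[symmetric])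
  also have "\<dots> \<le> exp (- (real 8 * ?l))" unfolding exp_le_cancel_iff using nl ln_ge_1 by (rule gen)
  finally show "exp (10 * (real n * ?l)) * exp (1 - 100 * real n * ?l / 4) \<le> 1 / real m ^ 8" unfolding exp_ml .
  have \<kappa>: "28 * (real n * ?l) \<le> real m * (\<tau>\<^sup>2 / (16 * 10^5 * B ^ 4))"
  proof -
    have "28 * (real n * ?l) * (16 * 10^5 * (2304 * ?l\<^sup>2)) = 103219200000 * (real n * ?l ^ 3)"
      by (simp add: power2_eq_square power3_eq_cube)
    also have "\<dots> \<le> real m * \<tau>\<^sup>2"
      using large'(1) ln_ge_1 n_ge_1 by (simp add: \<tau>_def power_divide)
    finally show ?thesis unfolding B_4 using ln_ge_1 by (simp add: field_simps)
  qed
  have "(exp (10 * (real n * ?l)))\<^sup>2 * exp (- (real m * (\<tau>\<^sup>2 / (16 * 10^5 * B ^ 4))))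
      = exp (20 * (real n * ?l) - real m * (\<tau>\<^sup>2 / (16 * 10^5 * B ^ 4)))"
    by (simp add: power2_eq_square exp_add[symmetric])
  also have "\<dots> \<le> exp (- (real 8 * ?l))" unfolding exp_le_cancel_iff using \<kappa> nl by (rule gen')
  finally show "(exp (10 * (real n * ?l)))\<^sup>2 * exp (- (real m * (\<tau>\<^sup>2 / (16 * 10^5 * B ^ 4)))) \<le> 1 / real m ^ 8" unfolding exp_ml .
  have "2 * m ^ 4 + 1 \<le> m ^ 5"
  proof -
    have "1 \<le> m ^ 4" using m3 by simp
    moreover have "3 * m ^ 4 \<le> m * m ^ 4" using m3 by (intro mult_right_mono) simp_all
    moreover have "m * m ^ 4 = m ^ 5" by (simp add: power_Suc[symmetric] del: power_Suc)
    ultimately show ?thesis by linarith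
  qed
  then have "(2 * m ^ 4 + 1) ^ (2 * n) \<le> (m ^ 5) ^ (2 * n)" by (rule power_mono) simp
  then have "real ((2 * m ^ 4 + 1) ^ (2 * n)) \<le> real ((m ^ 5) ^ (2 * n))" by (simp only: of_nat_le_iff)
  also have "\<dots> = real m ^ (10 * n)" by (simp add: power_mult[symmetric])
  also have "\<dots> = exp (10 * (real n * ?l))" using exp_l[of "10 * n"] by (simp add: mult.assoc)
  finally show "real ((2 * m ^ 4 + 1) ^ (2 * n)) \<le> exp (10 * (real n * ?l))" .
qed

text \<open>
  Six exceptional events are removed: a long sample vector, a sample coherent with \<open>x\<close>, the failure at some lattice point or pair
  of lattice points of one of the three conditions on averages, and, for some \<open>l\<close>, a coherent choice of the path without the sample \<open>l\<close>.
\<close>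

lemma good_event:
  assumes x: "x \<in> fspace n" "norm x = 1"
  obtains E where "E \<in> sets (gaussian_sample n m)"
    "measure (gaussian_sample n m) E \<ge> 1 - 5 * (1 / real m ^ 8) - real m * exp (- 1.5 * real n)"
    "\<And>\<omega>. \<omega> \<in> E \<Longrightarrow> regular_sample n m (\<lambda>j. mk_fv n (\<omega> j)) x R B \<rho> \<tau>"
    "\<And>\<omega> l. \<omega> \<in> E \<Longrightarrow> l < m \<Longrightarrow> \<exists>t. loo_path n m (\<lambda>j. mk_fv n (\<omega> j)) x l n (1 / real m) t \<and>
       incoherent_along x (mk_fv n (\<omega> l)) B n t"
proof -
  let ?P = "gaussian_sample n m" and ?G = "std_complex_gaussian n"
  define q where "q = 1 / real m ^ 8"
  define \<nu> where "\<nu> = exp (10 * (real n * ln (real m)))"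
  define b where "b = sqrt 2 * (1 / real m ^ 12)"
  note tp = tail_parameters[folded q_def \<nu>_def b_def]
  have q0: "q \<ge> 0" and \<nu>0: "\<nu> \<ge> 0" and b0: "b \<ge> 0" by (simp_all add: q_def \<nu>_def b_def)
  have B0: "B \<ge> 0" and m0: "m > 0" using B_ge_1 m3 by simp_all
  define S where "S = grid n (m ^ 4)"
  have S: "p \<in> fspace n" "norm p \<le> 1" if "p \<in> S" for p using that grid_simps by (auto simp: S_def)
  have S_fin: "finite S" unfolding S_def by (rule finite_grid)
  have S_card: "real (card S) \<le> \<nu>"
    using order_trans[OF of_nat_mono[OF card_grid[of n "m ^ 4"]] tp(6)] by (simp only: S_def)
  have SS_card: "real (card (S \<times> S)) \<le> \<nu>\<^sup>2"
    unfolding card_cartesian_product of_nat_mult power2_eq_square using S_card \<nu>0 by (intro mult_mono) simp_all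
  obtain D where D: "countable D" "D \<subseteq> fspace n" "D \<noteq> {}"
    "\<And>v e. v \<in> fspace n \<Longrightarrow> e > 0 \<Longrightarrow> \<exists>d\<in>D. norm (v - d) < e"
    using countable_dense_fspace[of n] by metis
  define N1 where "N1 = (\<Union>j\<in>{..<m}. {\<omega> \<in> space ?P. sqrt (18 * real n) < norm (mk_fv n (\<omega> j))})"
  have N1: "N1 \<in> sets ?P" "measure ?P N1 \<le> real m * exp (- 1.5 * real n)"
  proof -
    have c: "{\<omega> \<in> space ?P. sqrt (18 * real n) < norm (mk_fv n (\<omega> j))} \<in> sets ?P"
      "measure ?P {\<omega> \<in> space ?P. sqrt (18 * real n) < norm (mk_fv n (\<omega> j))} \<le> exp (- 1.5 * real n)" if j: "j < m" for j
    proof -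
      have "{g \<in> space ?G. sqrt (18 * real n) < norm (mk_fv n g)} \<in> sets ?G" by measurable
      from sample_component_prob[OF j this] norm_tail[of n]
      show "{\<omega> \<in> space ?P. sqrt (18 * real n) < norm (mk_fv n (\<omega> j))} \<in> sets ?P"
        "measure ?P {\<omega> \<in> space ?P. sqrt (18 * real n) < norm (mk_fv n (\<omega> j))} \<le> exp (- 1.5 * real n)" by simp_all
    qed
    show "N1 \<in> sets ?P" unfolding N1_def using c(1) by (intro sets.finite_UN) auto
    show "measure ?P N1 \<le> real m * exp (- 1.5 * real n)"
      unfolding N1_def by (rule sample_union_bound) (use c in auto)
  qed
  define N2 where "N2 = (\<Union>j\<in>{..<m}. {\<omega> \<in> space ?P. B < cmod (cip x (mk_fv n (\<omega> j)))})"
  have x_tail: "measure ?G {g \<in> space ?G. B < cmod (cip x (mk_fv n g))} \<le> b"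
    using cip_tail[OF x(1) B0] by (simp only: x(2) mult_1_right tp(1) b_def)
  have N2: "N2 \<in> sets ?P" "measure ?P N2 \<le> real m * b"
  proof -
    have c: "{\<omega> \<in> space ?P. B < cmod (cip x (mk_fv n (\<omega> j)))} \<in> sets ?P"
      "measure ?P {\<omega> \<in> space ?P. B < cmod (cip x (mk_fv n (\<omega> j)))} \<le> b" if j: "j < m" for j
    proof -
      have "{g \<in> space ?G. B < cmod (cip x (mk_fv n g))} \<in> sets ?G" by measurable
      from sample_component_prob[OF j this] x_tail
      show "{\<omega> \<in> space ?P. B < cmod (cip x (mk_fv n (\<omega> j)))} \<in> sets ?P"
        "measure ?P {\<omega> \<in> space ?P. B < cmod (cip x (mk_fv n (\<omega> j)))} \<le> b" by simp_all
    qed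
    show "N2 \<in> sets ?P" unfolding N2_def using c(1) by (intro sets.finite_UN) auto
    show "measure ?P N2 \<le> real m * b"
      unfolding N2_def by (rule sample_union_bound) (use c b0 in auto)
  qed
  define N3 where "N3 = (\<Union>p\<in>S. {\<omega> \<in> space ?P. 100 * real n * ln (real m) \<le> (\<Sum>j<m. (max 0 (cmod (cip p (mk_fv n (\<omega> j))) - B))\<^sup>2)})"
  have "q \<le> 1" unfolding q_def using m_ge_3 by simp
  then have Bm: "m * (sqrt 2 * exp (- (B\<^sup>2 / 4))) \<le> 1" using tp(1,2) by (simp add: b_def)
  have N3: "N3 \<in> sets ?P" "measure ?P N3 \<le> \<nu> * exp (1 - 100 * real n * ln (real m) / 4)"
  proof -
    have c: "{\<omega> \<in> space ?P. 100 * real n * ln (real m) \<le> (\<Sum>j<m. (max 0 (cmod (cip p (mk_fv n (\<omega> j))) - B))\<^sup>2)} \<in> sets ?P" for p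
      by measurable
    show "N3 \<in> sets ?P" unfolding N3_def using c S_fin by (intro sets.finite_UN) auto
    show "measure ?P N3 \<le> \<nu> * exp (1 - 100 * real n * ln (real m) / 4)"
      unfolding N3_def by (rule sample_union_bound) (use c S_fin S_card excess_tail[OF S B0 Bm, where t = "100 * real n * ln (real m)"] in auto)
  qed
  define N4 where "N4 = (\<Union>(p, q)\<in>S \<times> S. {\<omega> \<in> space ?P. (\<Sum>j<m. (Re (cnj (cip p (mk_fv n (\<omega> j))) * cip q (mk_fv n (\<omega> j))))\<^sup>2)
     \<le> m * (((norm p)\<^sup>2 * (norm q)\<^sup>2 + 3 * (Re (cip p q))\<^sup>2 - (Im (cip p q))\<^sup>2) / 2 - \<tau> / 2)})"
  define N5 where "N5 = (\<Union>(p, q)\<in>S \<times> S. {\<omega> \<in> space ?P. m * ((norm p)\<^sup>2 * (norm q)\<^sup>2 + (cmod (cip p q))\<^sup>2 + \<tau> / 2)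
     \<le> (\<Sum>j<m. (min (cmod (cip p (mk_fv n (\<omega> j)))) B * min (cmod (cip q (mk_fv n (\<omega> j)))) B)\<^sup>2)})"
  define \<kappa> where "\<kappa> = exp (- (real m * (\<tau>\<^sup>2 / (16 * 10^5 * B ^ 4))))"
  have N4: "N4 \<in> sets ?P" "measure ?P N4 \<le> \<nu>\<^sup>2 * \<kappa>"
  proof -
    define A where "A = (\<lambda>(p, q). {\<omega> \<in> space ?P. (\<Sum>j<m. (Re (cnj (cip p (mk_fv n (\<omega> j))) * cip q (mk_fv n (\<omega> j))))\<^sup>2)
     \<le> m * (((norm p)\<^sup>2 * (norm q)\<^sup>2 + 3 * (Re (cip p q))\<^sup>2 - (Im (cip p q))\<^sup>2) / 2 - \<tau> / 2)})"
    have A: "A i \<in> sets ?P" for i unfolding A_def by (cases i) simp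
    have c: "measure ?P (A i) \<le> \<kappa>" if "i \<in> S \<times> S" for i
      using that S tau_bounds one_le_power[OF B_ge_1, of 4] unfolding A_def \<kappa>_def by (cases i) (simp only: prod.case, rule re_avg_tail, auto)
    show "N4 \<in> sets ?P" unfolding N4_def A_def[symmetric] using S_fin A by (intro sets.finite_UN) auto
    show "measure ?P N4 \<le> \<nu>\<^sup>2 * \<kappa>"
      unfolding N4_def A_def[symmetric] by (rule sample_union_bound) (use S_fin SS_card A c in \<open>auto simp: \<kappa>_def\<close>)
  qed
  have N5: "N5 \<in> sets ?P" "measure ?P N5 \<le> \<nu>\<^sup>2 * \<kappa>"
  proof -
    define A where "A = (\<lambda>(p, q). {\<omega> \<in> space ?P. m * ((norm p)\<^sup>2 * (norm q)\<^sup>2 + (cmod (cip p q))\<^sup>2 + \<tau> / 2)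
     \<le> (\<Sum>j<m. (min (cmod (cip p (mk_fv n (\<omega> j)))) B * min (cmod (cip q (mk_fv n (\<omega> j)))) B)\<^sup>2)})"
    have A: "A i \<in> sets ?P" for i unfolding A_def by (cases i) simp
    have c: "measure ?P (A i) \<le> \<kappa>" if "i \<in> S \<times> S" for i
      using that S tau_bounds B_ge_1 unfolding A_def \<kappa>_def by (cases i) (simp only: prod.case, rule trunc_avg_tail, auto)
    show "N5 \<in> sets ?P" unfolding N5_def A_def[symmetric] using S_fin A by (intro sets.finite_UN) auto
    show "measure ?P N5 \<le> \<nu>\<^sup>2 * \<kappa>"
      unfolding N5_def A_def[symmetric] by (rule sample_union_bound) (use S_fin SS_card A c in \<open>auto simp: \<kappa>_def\<close>)
  qed
  have "\<exists>N\<in>sets ?P. measure ?P N \<le> 2 * (real n + 1) * b \<and> (\<forall>\<omega> t. \<omega> \<in> space ?P - N \<longrightarrow> (\<forall>k. t k \<in> D) \<longrightarrow>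
       loo_path n m (\<lambda>j. mk_fv n (\<omega> j)) x l n (1 / real m) t \<longrightarrow>
       (\<exists>t'. loo_path n m (\<lambda>j. mk_fv n (\<omega> j)) x l n (1 / real m) t' \<and>
         incoherent_along x (mk_fv n (\<omega> l)) B n t'))" if l: "l < m" for l
    using incoherent_loo_path[OF l x(1) B0 D(1-3), of n "1 / real m"] unfolding tp(1) b_def by metis
  then obtain N where N: "\<And>l. l < m \<Longrightarrow> N l \<in> sets ?P" "\<And>l. l < m \<Longrightarrow> measure ?P (N l) \<le> 2 * (real n + 1) * b"
    "\<And>l \<omega> t. l < m \<Longrightarrow> \<omega> \<in> space ?P - N l \<Longrightarrow> (\<And>k. t k \<in> D) \<Longrightarrow> loo_path n m (\<lambda>j. mk_fv n (\<omega> j)) x l n (1 / real m) t \<Longrightarrow>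
       (\<exists>t'. loo_path n m (\<lambda>j. mk_fv n (\<omega> j)) x l n (1 / real m) t' \<and>
         incoherent_along x (mk_fv n (\<omega> l)) B n t')"
    by metis
  define N6 where "N6 = (\<Union>l\<in>{..<m}. N l)"
  have N6: "N6 \<in> sets ?P" "measure ?P N6 \<le> real m * (2 * (real n + 1) * b)"
  proof -
    show "N6 \<in> sets ?P" unfolding N6_def using N(1) by (intro sets.finite_UN) auto
    show "measure ?P N6 \<le> real m * (2 * (real n + 1) * b)"
      unfolding N6_def by (rule sample_union_bound) (use N(1,2) b0 in auto)
  qed
  define E where "E = space ?P - (N1 \<union> (N2 \<union> (N3 \<union> (N4 \<union> (N5 \<union> N6)))))"
  note sets_N = N1(1) N2(1) N3(1) N4(1) N5(1) N6(1)
  have E_sets: "E \<in> sets ?P" unfolding E_def using sets_N by auto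
  have "measure ?P (N1 \<union> (N2 \<union> (N3 \<union> (N4 \<union> (N5 \<union> N6))))) \<le> real m * exp (- 1.5 * real n) + (q + (q + (q + (q + q))))"
    using sets_N N1(2) order_trans[OF N2(2) tp(2)] order_trans[OF N3(2) tp(4)] order_trans[OF N4(2) tp(5)[folded \<kappa>_def]]
      order_trans[OF N5(2) tp(5)[folded \<kappa>_def]] order_trans[OF N6(2) tp(3)]
    by (intro order_trans[OF measure_Un_le add_mono] sets.Un) assumption+
  then have E_meas: "measure ?P E \<ge> 1 - 5 * (1 / real m ^ 8) - real m * exp (- 1.5 * real n)"
    unfolding E_def using sets_N by (subst sample.prob_compl) (auto simp: q_def)
  have reg: "regular_sample n m (\<lambda>j. mk_fv n (\<omega> j)) x R B \<rho> \<tau>" if \<omega>: "\<omega> \<in> E" for \<omega>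
  proof (rule regular_sample_from_net)
    have sp: "\<omega> \<in> space ?P" using \<omega> by (simp add: E_def)
    show "norm (mk_fv n (\<omega> j)) \<le> R" if "j < m" for j
    proof -
      have "\<omega> \<notin> N1" using \<omega> by (simp add: E_def)
      then show ?thesis using that sp unfolding N1_def R_def by (simp add: not_less)
    qed
    show "cmod (cip x (mk_fv n (\<omega> j))) \<le> B" if "j < m" for j
    proof -
      have "\<omega> \<notin> N2" using \<omega> by (simp add: E_def)
      then show ?thesis using that sp unfolding N2_def by (simp add: not_less)
    qed
    show "\<exists>p\<in>S. norm (u - p) \<le> \<delta>" if "u \<in> fspace n" "norm u \<le> 1" for u
      using grid_net[OF that, of "m ^ 4"] m0 by (simp add: S_def \<delta>_def)
    show "(\<Sum>j<m. (max 0 (cmod (cip p (mk_fv n (\<omega> j))) - B))\<^sup>2) \<le> 100 * real n * ln (real m)" if "p \<in> S" for p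
    proof -
      have "\<omega> \<notin> N3" using \<omega> by (simp add: E_def)
      then have "\<not> 100 * real n * ln (real m) \<le> (\<Sum>j<m. (max 0 (cmod (cip p (mk_fv n (\<omega> j))) - B))\<^sup>2)"
        using that sp unfolding N3_def by blast
      then show ?thesis by (simp only: not_le less_imp_le)
    qed
    show "(\<Sum>j<m. (Re (cnj (cip p (mk_fv n (\<omega> j))) * cip q (mk_fv n (\<omega> j))))\<^sup>2)
        \<ge> m * (((norm p)\<^sup>2 * (norm q)\<^sup>2 + 3 * (Re (cip p q))\<^sup>2 - (Im (cip p q))\<^sup>2) / 2 - \<tau> / 2)" if "p \<in> S" "q \<in> S" for p q
    proof -
      have "\<omega> \<notin> N4" using \<omega> by (simp add: E_def)
      then have "\<not> (\<Sum>j<m. (Re (cnj (cip p (mk_fv n (\<omega> j))) * cip q (mk_fv n (\<omega> j))))\<^sup>2)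
        \<le> m * (((norm p)\<^sup>2 * (norm q)\<^sup>2 + 3 * (Re (cip p q))\<^sup>2 - (Im (cip p q))\<^sup>2) / 2 - \<tau> / 2)"
        using that sp unfolding N4_def by blast
      then show ?thesis by (simp only: not_le less_imp_le)
    qed
    show "(\<Sum>j<m. (min (cmod (cip p (mk_fv n (\<omega> j)))) B * min (cmod (cip q (mk_fv n (\<omega> j)))) B)\<^sup>2)
        \<le> m * ((norm p)\<^sup>2 * (norm q)\<^sup>2 + (cmod (cip p q))\<^sup>2 + \<tau> / 2)" if "p \<in> S" "q \<in> S" for p q
    proof -
      have "\<omega> \<notin> N5" using \<omega> by (simp add: E_def)
      then have "\<not> m * ((norm p)\<^sup>2 * (norm q)\<^sup>2 + (cmod (cip p q))\<^sup>2 + \<tau> / 2)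
        \<le> (\<Sum>j<m. (min (cmod (cip p (mk_fv n (\<omega> j)))) B * min (cmod (cip q (mk_fv n (\<omega> j)))) B)\<^sup>2)"
        using that sp unfolding N5_def by blast
      then show ?thesis by (simp only: not_le less_imp_le)
    qed
  qed (use m0 x B0 B_rho(1,3) tau_bounds B_le_2R net_fine S in \<open>simp_all only: mk_fv_fspace\<close>)
  show thesis
  proof (rule that[OF E_sets E_meas reg])
    fix \<omega> l assume \<omega>: "\<omega> \<in> E" and l: "l < m"
    interpret regular_sample n m "\<lambda>j. mk_fv n (\<omega> j)" x R B \<rho> \<tau> by (rule reg[OF \<omega>])
    have "1 / real m > 0" using m0 by simp
    then obtain t where t: "\<And>k. t k \<in> D" "loo_path n m (\<lambda>j. mk_fv n (\<omega> j)) x l n (1 / real m) t"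
      using loo_path_exists[OF D(4) D(2) l _ path_parameters(4)] by metis
    have "\<omega> \<in> space ?P - N l" using \<omega> l by (auto simp: E_def N6_def)
    then show "\<exists>t. loo_path n m (\<lambda>j. mk_fv n (\<omega> j)) x l n (1 / real m) t \<and>
       incoherent_along x (mk_fv n (\<omega> l)) B n t"
      using N(3)[OF l _ t] by blast
  qed
qed

end

section \<open>Reduction to a signal of unit norm\<close>

text \<open>
  The infimum is attained at the phase of the inner product.
\<close>

lemma phase_dist_attained:
  assumes x: "x \<in> carrier_vec n" "x \<noteq> 0\<^sub>v n" and z: "z \<in> carrier_vec n"
  defines "s \<equiv> l2norm x"
  defines "u \<equiv> (1 / s) *\<^sub>R to_fv x" and "w \<equiv> (1 / s) *\<^sub>R to_fv z"
  shows "s > 0" "norm u = 1" "l2norm (z - cis \<phi> \<cdot>\<^sub>v x) = s * norm (w - cmul (cis \<phi>) u)"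
    "phase_dist z x = s * norm (align u w - u)"
    "is_aligning_phase x z \<phi> \<Longrightarrow> norm (w - cmul (cis \<phi>) u) = norm (align u w - u)"
proof -
  have "s \<noteq> 0" using l2norm_eq_0[of x n] x by (auto simp: s_def)
  moreover have "s \<ge> 0" unfolding s_def norm_to_fv[symmetric] by simp
  ultimately show s: "s > 0" by simp
  show u1: "norm u = 1" using s by (simp add: u_def norm_to_fv s_def)
  have eq: "l2norm (z - cis \<phi> \<cdot>\<^sub>v x) = s * norm (w - cmul (cis \<phi>) u)" for \<phi>
  proof -
    have "to_fv (z - cis \<phi> \<cdot>\<^sub>v x) = to_fv z - cmul (cis \<phi>) (to_fv x)"
      using x z by (simp add: to_fv_simps(2)[of _ n] to_fv_simps(3))
    also have "\<dots> = s *\<^sub>R (w - cmul (cis \<phi>) u)"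
      using s by (simp add: u_def w_def scaleR_eq_cmul cmul_simps)
    finally show ?thesis unfolding norm_to_fv[symmetric] using s by simp
  qed
  then show "l2norm (z - cis \<phi> \<cdot>\<^sub>v x) = s * norm (w - cmul (cis \<phi>) u)" .
  have le: "s * norm (align u w - u) \<le> l2norm (z - cis \<phi> \<cdot>\<^sub>v x)" for \<phi>
    unfolding eq using s u1 by (intro mult_left_mono norm_align_diff_le) auto
  obtain \<psi> where \<psi>: "ph (cip w u) = cis \<psi>"
    using cmod_ph[of "cip w u"] by (metis Arg_def cis_Arg_unique norm_one sgn_div_norm rcis_cmod_Arg rcis_def mult_1_left of_real_1)
  have at: "l2norm (z - cis \<psi> \<cdot>\<^sub>v x) = s * norm (align u w - u)"
  proof -
    have "w - cmul (cis \<psi>) u = cmul (cis \<psi>) (align u w - u)"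
      using unalign[of w u] by (simp add: cmul_simps \<psi>)
    then show ?thesis unfolding eq by simp
  qed
  have "(INF \<phi>. l2norm (z - cis \<phi> \<cdot>\<^sub>v x)) = s * norm (align u w - u)"
    by (rule cInf_eq_minimum) (use le at in \<open>auto simp: image_iff intro: exI[of _ \<psi>]\<close>)
  then show "phase_dist z x = s * norm (align u w - u)" by (simp add: phase_dist_def)
  show "norm (w - cmul (cis \<phi>) u) = norm (align u w - u)" if "is_aligning_phase x z \<phi>"
  proof -
    have "\<not> l2norm (z - cis \<psi> \<cdot>\<^sub>v x) < l2norm (z - cis \<phi> \<cdot>\<^sub>v x)"
      using that by (simp add: is_aligning_phase_def is_arg_min_def)
    then have "l2norm (z - cis \<phi> \<cdot>\<^sub>v x) = s * norm (align u w - u)" using at le[of \<phi>] by simp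
    then show ?thesis using eq[of \<phi>] s by simp
  qed
qed

text \<open>
  At a minimiser \<open>Re (cnj c * cip w u)\<close> attains its upper bound \<open>cmod (cip w u)\<close>. This determines the phase \<open>c\<close> unless
  \<open>w\<close> and \<open>u\<close> are orthogonal, a case excluded by the distance being less than \<open>1\<close>.
\<close>

lemma minimiser_is_aligned:
  assumes u: "norm u = 1" and c: "cmod c = 1" and min: "norm (w - cmul c u) = norm (align u w - u)"
    and close: "norm (align u w - u) < 1"
  shows "w - cmul c u = cmul c (align u w - u)"
proof -
  let ?p = "cip w u"
  have "(norm (w - cmul c u))\<^sup>2 = (norm (align u w - u))\<^sup>2" using min by simp
  then have re: "Re (cnj c * ?p) = cmod ?p"
    using norm_align_diff_sq[OF u, of w] norm_diff_cmul_sq[OF u c, of w] by simp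
  have cc: "c * cnj c = 1" using mult_cnj_self[of c] c by simp
  have "(Re (cnj c * ?p))\<^sup>2 + (Im (cnj c * ?p))\<^sup>2 = (cmod ?p)\<^sup>2"
    using cmod_power2[of "cnj c * ?p"] c by (simp add: norm_mult)
  then have "Im (cnj c * ?p) = 0" unfolding re by simp
  with re have "cnj c * ?p = of_real (cmod ?p)" by (simp add: complex_eq_iff)
  then have "c * cnj c * ?p = c * of_real (cmod ?p)" by (simp add: mult.assoc)
  then have p: "?p = c * of_real (cmod ?p)" by (simp add: cc)
  have "?p \<noteq> 0"
  proof
    assume "?p = 0"
    then have "(norm (align u w - u))\<^sup>2 \<ge> 1" using norm_align_diff_sq[OF u, of w] by simp
    then show False using close by (simp add: abs_square_less_1 power_less_one_iff not_less[symmetric])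
  qed
  then have "ph ?p = c"
    using p ph_mult[OF c, of "of_real (cmod ?p)"] by (simp add: ph_def sgn_of_real)
  then show ?thesis using unalign[of w u] by (simp add: cmul_simps)
qed

lemma weighted_cov_scaleR_signal: "weighted_cov a J (r *\<^sub>R x) v = r\<^sup>2 *\<^sub>R weighted_cov a J x v"
proof -
  have "cmul (of_real ((cmod (cip (r *\<^sub>R x) b))\<^sup>2) * p) b = cmul (of_real (r\<^sup>2)) (cmul (of_real ((cmod (cip x b))\<^sup>2) * p) b)" for b p
    by (simp add: cip_linear cmul_simps norm_mult power_mult_distrib mult_ac)
  then show ?thesis unfolding weighted_cov_def scaleR_eq_cmul[of "r\<^sup>2"] cmul_sum by (intro sum.cong refl) (simp only:)
qed

lemma gn_relation_scaleR:
  assumes "gn_relation m a x z z'" shows "gn_relation m a (r *\<^sub>R x) (r *\<^sub>R z) (r *\<^sub>R z')"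
proof -
  have "cmul (of_real (2 * Re (cnj (cip (r *\<^sub>R z) b) * cip (r *\<^sub>R z - r *\<^sub>R z') b)
        - ((cmod (cip (r *\<^sub>R z) b))\<^sup>2 - (cmod (cip (r *\<^sub>R x) b))\<^sup>2)) * cip (r *\<^sub>R z) b) b
    = cmul (of_real (r ^ 3)) (cmul (of_real (2 * Re (cnj (cip z b) * cip (z - z') b)
        - ((cmod (cip z b))\<^sup>2 - (cmod (cip x b))\<^sup>2)) * cip z b) b)" for b
  proof -
    have "2 * Re (cnj (cip (r *\<^sub>R z) b) * cip (r *\<^sub>R z - r *\<^sub>R z') b)
        - ((cmod (cip (r *\<^sub>R z) b))\<^sup>2 - (cmod (cip (r *\<^sub>R x) b))\<^sup>2)
      = r\<^sup>2 * (2 * Re (cnj (cip z b) * cip (z - z') b) - ((cmod (cip z b))\<^sup>2 - (cmod (cip x b))\<^sup>2))"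
    proof -
      have "cip (r *\<^sub>R z) b = of_real r * cip z b" "cip (r *\<^sub>R z - r *\<^sub>R z') b = of_real r * cip (z - z') b"
        "cip (r *\<^sub>R x) b = of_real r * cip x b"
        by (simp_all add: cip_linear algebra_simps)
      then show ?thesis by (simp add: norm_mult power_mult_distrib power2_eq_square algebra_simps)
    qed
    then show ?thesis by (simp only:) (simp add: cip_linear cmul_simps power3_eq_cube power2_eq_square mult_ac)
  qed
  note scaled = this
  have "cip (r *\<^sub>R z - r *\<^sub>R z') (r *\<^sub>R z) = of_real (r * r) * cip (z - z') z"
    by (simp add: cip_linear algebra_simps)
  then have "Im (cip (r *\<^sub>R z - r *\<^sub>R z') (r *\<^sub>R z)) = 0"
    using assms by (simp add: gn_relation_def)
  then show ?thesis
    using assms unfolding gn_relation_def scaled cmul_sum[symmetric] by (simp only: cmul_simps simp_thms)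
qed

text \<open>
  The method commutes with scaling the signal and the iterates by the same factor. The matrices of the method occur
  only here; afterwards a run is described by an eigenvalue equation and by \<open>gn_relation\<close>.
\<close>

lemma gauss_newton_run_normalised:
  fixes x :: "complex vec"
  assumes a: "\<And>j. a j \<in> carrier_vec n" and x: "x \<in> carrier_vec n" "x \<noteq> 0\<^sub>v n" and m: "m > 0"
    and run: "gauss_newton_run n m a (\<lambda>j. (cmod (x \<bullet>c a j))\<^sup>2) z"
  defines "b \<equiv> \<lambda>j. to_fv (a j)" and "s \<equiv> l2norm x"
  defines "u \<equiv> (1 / s) *\<^sub>R to_fv x" and "w \<equiv> \<lambda>k. (1 / s) *\<^sub>R to_fv (z k)"
  shows "z k \<in> carrier_vec n"
    and "weighted_cov b {..<m} u (w 0) = (2 * real m * (norm (w 0))\<^sup>2) *\<^sub>R w 0"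
    and "2 * real m * (norm (w 0))\<^sup>2 \<ge> inner (weighted_cov b {..<m} u u) u"
    and "(\<And>v. v \<in> fspace n \<Longrightarrow> (\<And>j. j < m \<Longrightarrow> Re (cnj (cip (w k) (b j)) * cip v (b j)) = 0)
        \<Longrightarrow> \<exists>t. v = cmul (\<i> * of_real t) (w k)) \<Longrightarrow> gn_relation m b u (w k) (w (Suc k))"
proof -
  note pd = phase_dist_attained[OF x x(1), folded s_def, folded u_def]
  have s: "s > 0" by (rule pd)
  have init: "spectral_init (spectral_mat n m a (\<lambda>j. (cmod (x \<bullet>c a j))\<^sup>2)) (z 0)"
    and stp: "\<And>k. z (Suc k) = z k - vec_first (pseudoinverse (gn_mat n m a (z k)) *\<^sub>v gn_residual m a (\<lambda>j. (cmod (x \<bullet>c a j))\<^sup>2) (z k)) n"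
    using run by (simp_all add: gauss_newton_run_def)
  note spec = spectral_init_eigen[OF a x m init]
  show zV: "z k \<in> carrier_vec n" for k
  proof (cases k)
    case 0
    then show ?thesis using spec(1) by (simp only:)
  next
    case (Suc i)
    show ?thesis unfolding Suc stp[of i] by (rule carrier_vecI) simp
  qed
  have nw: "(norm (w 0))\<^sup>2 = (norm (to_fv (z 0)))\<^sup>2 / s\<^sup>2" by (simp add: w_def power_mult_distrib power_divide)
  show "weighted_cov b {..<m} u (w 0) = (2 * real m * (norm (w 0))\<^sup>2) *\<^sub>R w 0"
    unfolding nw u_def weighted_cov_scaleR_signal unfolding w_def b_def scaleR_eq_cmul[of "1 / s" "to_fv (z 0)"] weighted_cov_linear spec(2)
    by (simp add: scaleR_eq_cmul cmul_simps power_divide mult_ac)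
  have "inner (weighted_cov b {..<m} u u) u = inner (weighted_cov b {..<m} (to_fv x) (to_fv x)) (to_fv x) / s ^ 4"
    unfolding u_def weighted_cov_scaleR_signal unfolding scaleR_eq_cmul[of "1 / s" "to_fv x"] weighted_cov_linear
    unfolding scaleR_eq_cmul[symmetric] by (simp add: power2_eq_square power4_eq_xxxx power_divide)
  also have "\<dots> \<le> (2 * real m * (norm (to_fv (z 0)))\<^sup>2 * (norm (to_fv x))\<^sup>2) / s ^ 4"
    using spec(3) unfolding b_def by (intro divide_right_mono) simp_all
  also have "\<dots> = 2 * real m * (norm (w 0))\<^sup>2"
    unfolding nw norm_to_fv s_def[symmetric] using s by (simp add: power2_eq_square power4_eq_xxxx)
  finally show "2 * real m * (norm (w 0))\<^sup>2 \<ge> inner (weighted_cov b {..<m} u u) u" .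
  show "gn_relation m b u (w k) (w (Suc k))"
    if ker: "\<And>v. v \<in> fspace n \<Longrightarrow> (\<And>j. j < m \<Longrightarrow> Re (cnj (cip (w k) (b j)) * cip v (b j)) = 0)
        \<Longrightarrow> \<exists>t. v = cmul (\<i> * of_real t) (w k)"
  proof -
    have wz: "cip (w k) v = of_real (1 / s) * cip (to_fv (z k)) v" for v by (simp add: w_def cip_linear)
    have ker': "\<exists>t. v = cmul (\<i> * of_real t) (to_fv (z k))"
      if v: "v \<in> fspace n" and 0: "\<And>j. j < m \<Longrightarrow> Re (cnj (cip (to_fv (z k)) (to_fv (a j))) * cip v (to_fv (a j))) = 0" for v
    proof -
      have ker0: "Re (cnj (cip (w k) (b j)) * cip v (b j)) = 0" if "j < m" for j
      proof -
        have "cnj (cip (w k) (b j)) * cip v (b j) = of_real (1 / s) * (cnj (cip (to_fv (z k)) (b j)) * cip v (b j))"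
          by (simp add: wz)
        moreover have "Re (of_real r * p) = r * Re p" for r p by simp
        ultimately have "Re (cnj (cip (w k) (b j)) * cip v (b j)) = 1 / s * Re (cnj (cip (to_fv (z k)) (b j)) * cip v (b j))"
          by (simp only:)
        then show ?thesis using 0[OF that] by (simp add: b_def del: times_complex.sel)
      qed
      from ker[OF v ker0] obtain t where "v = cmul (\<i> * of_real t) (w k)" by blast
      then have "v = cmul (\<i> * of_real (t / s)) (to_fv (z k))" by (simp add: w_def scaleR_eq_cmul cmul_simps)
      then show ?thesis by blast
    qed
    \<comment> \<open>If \<open>z k\<close> vanished, every vector would lie in the kernel, and the nonzero vector \<open>u\<close> would be a multiple of \<open>0\<close>.\<close>
    have "z k \<noteq> 0\<^sub>v n"
    proof
      assume z0: "z k = 0\<^sub>v n"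
      have "to_fv (z k) = 0" unfolding z0 by (simp add: fvec_eq_iff fv_to_fv[of _ n])
      moreover from this ker'[of u] have "\<exists>t. u = cmul (\<i> * of_real t) (to_fv (z k))"
        using x by (simp add: u_def)
      ultimately have "u = 0" by (simp add: cmul_simps)
      then show False using pd(2) by simp
    qed
    note ne = gn_update_normal_equations[where a = a and n = n and m = m, OF a x(1) zV this m, OF ker']
    define G where "G = to_fv (vec_first (pseudoinverse (gn_mat n m a (z k)) *\<^sub>v gn_residual m a (\<lambda>j. (cmod (x \<bullet>c a j))\<^sup>2) (z k)) n)"
    have "to_fv (z (Suc k)) = to_fv (z k) - G"
      unfolding stp G_def using zV by (intro to_fv_simps(2)[of _ n]) auto
    then have G: "to_fv (z k) - to_fv (z (Suc k)) = G" by simp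
    have "gn_relation m b (to_fv x) (to_fv (z k)) (to_fv (z (Suc k)))"
      unfolding gn_relation_def G b_def using ne unfolding G_def[symmetric] by (rule conjI)
    then show ?thesis unfolding u_def w_def by (rule gn_relation_scaleR)
  qed
qed

lemma (in large_sample) run_bounds:
  fixes x :: "complex vec" and \<omega> :: "nat \<Rightarrow> nat \<Rightarrow> complex"
  defines "s \<equiv> l2norm x" and "a \<equiv> sample_vec n \<omega>"
  defines "u \<equiv> (1 / s) *\<^sub>R to_fv x"
  assumes x: "x \<in> carrier_vec n" "x \<noteq> 0\<^sub>v n"
    and reg: "regular_sample n m (\<lambda>j. mk_fv n (\<omega> j)) u R B \<rho> \<tau>"
    and loo: "\<And>l. l < m \<Longrightarrow> \<exists>t. loo_path n m (\<lambda>j. mk_fv n (\<omega> j)) u l n (1 / real m) t \<and>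
       incoherent_along u (mk_fv n (\<omega> l)) B n t"
    and run: "gauss_newton_run n m a (\<lambda>j. (cmod (x \<bullet>c a j))\<^sup>2) z"
  shows "phase_dist (z 0) x \<le> 1/1000 * s"
    and "phase_dist (z (Suc k)) x \<le> 2 / s * (phase_dist (z k) x)\<^sup>2 + \<epsilon> * phase_dist (z k) x"
    and "is_aligning_phase x (z k) \<phi> \<Longrightarrow> j < m \<Longrightarrow> cmod ((z k - cis \<phi> \<cdot>\<^sub>v x) \<bullet>c a j) \<le> B * s"
proof -
  note eps_ge = B_rho(4)
  interpret regular_sample n m "\<lambda>j. mk_fv n (\<omega> j)" u R B \<rho> \<tau> by (rule reg)
  define w where "w k = (1 / s) *\<^sub>R to_fv (z k)" for k
  define H where "H k = align u (w k) - u" for k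
  have aV: "a j \<in> carrier_vec n" for j by (simp add: a_def sample_vec_def)
  have m0: "m > 0" using m3 by simp
  have b: "to_fv (a j) = mk_fv n (\<omega> j)" for j by (simp add: a_def to_fv_sample_vec)
  note nr = gauss_newton_run_normalised[OF aV x m0 run, folded s_def, folded u_def w_def, unfolded b]
  note pd = phase_dist_attained[OF x nr(1), folded s_def, folded u_def w_def, folded H_def]
  have s: "s > 0" by (rule pd(1))
  have wV: "w k \<in> fspace n" for k unfolding w_def using nr(1)[of k] by auto
  have R0: "R > 0" using R_ge_1 by simp
  note ic = iterates_converge[where z = w and K = n and \<eta> = "1 / real m" and \<epsilon> = \<epsilon>, folded H_def,
      OF wV nr(2,3) _ _ R0 path_parameters(1) path_parameters(2)[folded sample_err_def]
      path_parameters(3)[folded sample_err_def] eps_ge]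
  have H1: "norm (H k) \<le> 1/1000" for k by (rule ic(1)) (fact nr(4), fact loo)
  have H2: "norm (H (Suc k)) \<le> 2 * (norm (H k))\<^sup>2 + \<epsilon> * norm (H k)" for k by (rule ic(2)) (fact nr(4), fact loo)
  have H3: "cmod (cip (H k) (mk_fv n (\<omega> j))) \<le> B" if "j < m" for j k by (rule ic(3)[OF _ _ that]) (fact nr(4), fact loo)
  have pd_H: "phase_dist (z k) x = s * norm (H k)" for k by (rule pd(4))
  show "phase_dist (z 0) x \<le> 1/1000 * s" unfolding pd_H using H1[of 0] s by simp
  have "s * norm (H (Suc k)) \<le> s * (2 * (norm (H k))\<^sup>2 + \<epsilon> * norm (H k))" using H2 s by (intro mult_left_mono) auto
  also have "\<dots> = 2 / s * (s * norm (H k))\<^sup>2 + \<epsilon> * (s * norm (H k))"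
    using s by (simp add: power2_eq_square algebra_simps)
  finally show "phase_dist (z (Suc k)) x \<le> 2 / s * (phase_dist (z k) x)\<^sup>2 + \<epsilon> * phase_dist (z k) x"
    unfolding pd_H .
  show "cmod ((z k - cis \<phi> \<cdot>\<^sub>v x) \<bullet>c a j) \<le> B * s" if \<phi>: "is_aligning_phase x (z k) \<phi>" and j: "j < m"
  proof -
    have "norm (align u (w k) - u) < 1" using H1[of k] by (simp add: H_def)
    then have al: "w k - cmul (cis \<phi>) u = cmul (cis \<phi>) (H k)"
      unfolding H_def using pd(2) pd(5)[OF \<phi>] by (intro minimiser_is_aligned) (auto simp: H_def)
    have "to_fv (z k - cis \<phi> \<cdot>\<^sub>v x) = to_fv (z k) - cmul (cis \<phi>) (to_fv x)"
      using x nr(1) by (simp add: to_fv_simps(2)[of _ n] to_fv_simps(3))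
    also have "\<dots> = s *\<^sub>R (w k - cmul (cis \<phi>) u)"
      using s by (simp add: u_def w_def scaleR_eq_cmul cmul_simps)
    finally have v: "to_fv (z k - cis \<phi> \<cdot>\<^sub>v x) = s *\<^sub>R cmul (cis \<phi>) (H k)" unfolding al .
    have "(z k - cis \<phi> \<cdot>\<^sub>v x) \<bullet>c a j = cip (to_fv (z k - cis \<phi> \<cdot>\<^sub>v x)) (to_fv (a j))"
      using x nr(1) aV by (intro cip_to_fv[symmetric, of _ n]) auto
    then have "cmod ((z k - cis \<phi> \<cdot>\<^sub>v x) \<bullet>c a j) = s * cmod (cip (H k) (mk_fv n (\<omega> j)))"
      unfolding v using s by (simp add: b cip_linear norm_mult)
    also have "\<dots> \<le> s * B" using H3[OF j] s by (intro mult_left_mono) auto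
    finally show ?thesis by (simp add: mult.commute)
  qed
qed


section \<open>The sample size\<close>

lemma log_cube_bound:
  fixes L :: real
  assumes "L \<ge> exp 600" shows "(ln L + 4) ^ 3 \<le> sqrt L"
proof -
  define y where "y = ln L / 2"
  have L0: "L > 0" using assms exp_gt_zero[of "600 :: real"] by linarith
  have y: "y \<ge> 300" using assms L0 by (simp add: y_def ln_ge_iff)
  have "(ln L + 4) ^ 3 \<le> (3 * y) ^ 3" using y by (intro power_mono) (simp_all add: y_def)
  also have "\<dots> = 27 * y ^ 3" by (simp add: power_mult_distrib)
  also have "\<dots> \<le> (y / 5) ^ 2 / 125 * y ^ 3"
  proof (rule mult_right_mono)
    have "60 ^ 2 \<le> (y / 5) ^ 2" using y by (intro power_mono) simp_all
    then show "27 \<le> (y / 5) ^ 2 / 125" by simp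
  qed (use y in simp)
  also have "\<dots> = (y / 5) ^ 5" by (simp add: power_divide power_add[symmetric] numeral_eq_Suc)
  also have "\<dots> \<le> (1 + y / real 5) ^ 5" using y by (intro power_mono) simp_all
  also have "\<dots> \<le> exp y" using y by (intro exp_ge_one_plus_x_over_n_power_n) simp_all
  also have "exp y = sqrt L"
  proof -
    have "sqrt L = exp (ln (sqrt L))" using L0 by simp
    then show ?thesis using L0 by (simp add: y_def ln_sqrt)
  qed
  finally show ?thesis .
qed

text \<open>
  With \<open>q = p exp r\<close> this is \<open>(1 + r / ln p) ^ 3 \<le> (exp (r / 3)) ^ 3\<close>.
\<close>

lemma ln_cube_over_id_antimono:
  fixes p q :: real
  assumes p: "exp 3 \<le> p" and pq: "p \<le> q"
  shows "p * (ln q) ^ 3 \<le> q * (ln p) ^ 3"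
proof -
  have p0: "p > 0" using p exp_gt_zero[of "3 :: real"] by linarith
  have l3: "ln p \<ge> 3" using p p0 by (simp add: ln_ge_iff)
  define r where "r = ln (q / p)"
  have r: "r \<ge> 0" "ln q = ln p + r" "q = p * exp r"
    using p0 pq by (simp_all add: r_def ln_div[symmetric]) (simp add: ln_div)
  have "r \<le> r / 3 * ln p" using r(1) l3 mult_left_mono[of 3 "ln p" "r / 3"] by simp
  then have "ln q \<le> ln p * (1 + r / 3)" using r by (simp add: algebra_simps)
  also have "\<dots> \<le> ln p * exp (r / 3)" using l3 by (intro mult_left_mono exp_ge_add_one_self) simp
  finally have "(ln q) ^ 3 \<le> (ln p * exp (r / 3)) ^ 3" using l3 r by (intro power_mono) simp_all
  also have "\<dots> = (ln p) ^ 3 * exp r" by (simp add: power_mult_distrib exp_of_nat_mult[symmetric])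
  finally have "p * (ln q) ^ 3 \<le> p * ((ln p) ^ 3 * exp r)" using p0 by (intro mult_left_mono) simp_all
  then show ?thesis using r(3) by (simp add: mult_ac)
qed

text \<open>
  The hypothesis is a lower bound for \<open>m\<close> in terms of \<open>ln n\<close>, the conclusion one in terms of \<open>ln m\<close>. By monotonicity it suffices
  to consider the smallest \<open>m\<close> allowed, of which the logarithm is at most \<open>(ln L + 4) * ln n\<close> for
  \<open>L = exp 600 * \<epsilon> powr (-4)\<close>. The surplus \<open>\<epsilon> powr (-2)\<close> in the hypothesis pays for the power of \<open>ln L\<close>.
\<close>

lemma sample_size_condition:
  fixes \<epsilon> :: real
  assumes n: "n \<ge> 3" and eps: "0 < \<epsilon>" "\<epsilon> \<le> 1"
    and m: "real m \<ge> exp 600 * \<epsilon> powr (-4) * real n * (ln (real n)) ^ 3"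
  shows "10^30 * real n * ln (real m) ^ 3 \<le> \<epsilon>\<^sup>2 * real m"
proof -
  define L q l where "L = exp 600 * \<epsilon> powr (-4)" and "q = exp 300 / \<epsilon>\<^sup>2" and "l = ln (real n)"
  have n1: "real n \<ge> 3" using n by simp
  have "exp 1 \<le> real n" using exp_le n1 by linarith
  then have l1: "l \<ge> 1" unfolding l_def using n1 by (subst ln_ge_iff) auto
  have q0: "q > 0" using eps by (simp add: q_def)
  have Lq: "L = q\<^sup>2"
    using eps by (simp add: L_def q_def power_divide powr_neg_numeral exp_of_nat_mult[symmetric] exp_double[symmetric])
  have L600: "L \<ge> exp 600"
  proof -
    have "\<epsilon> powr (-4) \<ge> 1" using eps by (simp add: powr_neg_numeral power_le_one)
    then show ?thesis by (simp add: L_def)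
  qed
  then have L1: "L \<ge> 1" using order_trans[OF one_le_exp_iff[THEN iffD2, of 600]] by simp
  have sq: "sqrt L = q" unfolding Lq using q0 by simp
  define p where "p = L * real n * l ^ 3"
  have l31: "l ^ 3 \<ge> 1" using l1 by (rule one_le_power)
  have pL: "L \<le> p"
  proof -
    have "L * 1 * 1 \<le> L * real n * l ^ 3" using L1 n1 l31 by (intro mult_mono) simp_all
    then show ?thesis by (simp add: p_def)
  qed
  have p0: "p > 0" using pL L1 by simp
  have e3: "exp 3 \<le> p" using order_trans[OF _ order_trans[OF L600 pL], of "exp 3"] by simp
  have pm: "p \<le> real m" using m by (simp add: p_def L_def l_def)
  have lp: "ln p \<le> (ln L + 4) * l"
  proof -
    have "ln p = ln L + l + 3 * ln l"
      using L1 n1 l1 by (simp add: p_def ln_mult ln_realpow l_def)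
    also have "\<dots> \<le> ln L + l + 3 * l" using ln_le_minus_one[of l] l1 by simp
    also have "\<dots> \<le> ln L * l + 4 * l" using mult_left_mono[OF l1, of "ln L"] L1 by simp
    finally show ?thesis by (simp add: algebra_simps)
  qed
  have "0 \<le> ln p" using order_trans[OF L1 pL] by simp
  then have "(ln p) ^ 3 \<le> ((ln L + 4) * l) ^ 3" using lp by (intro power_mono)
  also have "\<dots> \<le> q * l ^ 3"
    unfolding power_mult_distrib using log_cube_bound[OF L600] l1 by (intro mult_right_mono) (simp_all add: sq)
  finally have "q * real n * (ln p) ^ 3 \<le> q * real n * (q * l ^ 3)" using q0 by (intro mult_left_mono) simp_all
  also have "\<dots> = p" by (simp add: p_def Lq power2_eq_square)
  finally have 1: "q * real n * (ln p) ^ 3 \<le> p" .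
  have "p * (ln (real m)) ^ 3 \<le> real m * (ln p) ^ 3" using e3 pm by (rule ln_cube_over_id_antimono)
  then have "p * (q * real n * (ln (real m)) ^ 3) \<le> real m * (q * real n * (ln p) ^ 3)"
    using mult_left_mono[of "p * (ln (real m)) ^ 3" "real m * (ln p) ^ 3" "q * real n"] q0 by (simp add: mult_ac)
  also have "\<dots> \<le> real m * p" using 1 by (rule mult_left_mono) simp
  finally have "p * (q * real n * (ln (real m)) ^ 3) \<le> p * real m" by (simp add: mult.commute)
  then have 2: "q * real n * (ln (real m)) ^ 3 \<le> real m" using p0 by simp
  have "(10 :: real)^30 \<le> exp 10 ^ 30"
    using exp_ge_add_one_self[of "10 :: real"] by (intro power_mono) simp_all
  also have "\<dots> = exp 300" by (simp add: exp_of_nat_mult[symmetric])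
  also have "\<dots> = \<epsilon>\<^sup>2 * q" using eps by (simp add: q_def)
  finally have "10^30 * (real n * ln (real m) ^ 3) \<le> (\<epsilon>\<^sup>2 * q) * (real n * ln (real m) ^ 3)"
  proof (rule mult_right_mono)
    have "1 \<le> real m" using order_trans[OF order_trans[OF L1 pL] pm] .
    then show "0 \<le> real n * ln (real m) ^ 3" by simp
  qed
  also have "\<dots> = \<epsilon>\<^sup>2 * (q * real n * (ln (real m)) ^ 3)" by simp
  also have "\<dots> \<le> \<epsilon>\<^sup>2 * real m" using 2 by (intro mult_left_mono) simp_all
  finally show ?thesis by (simp only: mult.assoc)
qed


section \<open>Convergence with high probability\<close>

lemma convergence_event:
  fixes \<epsilon> :: real and n m :: nat and x :: "complex vec"
  assumes eps: "0 < \<epsilon>" "\<epsilon> \<le> 1" and x: "x \<in> carrier_vec n" "x \<noteq> 0\<^sub>v n" and m1: "m \<ge> 1"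
    and size: "real m \<ge> exp 600 * \<epsilon> powr (-4) * real n * (ln (real n)) ^ 3"
  shows "\<exists>E \<in> sets (gaussian_sample n m).
      measure (gaussian_sample n m) E \<ge> 1 - 256 * real m powr (-8) - exp 3 * real m * exp (- 1.5 * real n) \<and>
      (\<forall>\<omega>\<in>E. \<forall>z. let a = sample_vec n \<omega>; y = (\<lambda>j. (cmod (x \<bullet>c a j))\<^sup>2) in
         gauss_newton_run n m a y z \<longrightarrow>
         phase_dist (z 0) x \<le> 1/1000 * l2norm x \<and>
         (\<forall>k. phase_dist (z (Suc k)) x \<le> 2 / l2norm x * (phase_dist (z k) x)\<^sup>2 + \<epsilon> * phase_dist (z k) x \<and>
            (\<forall>\<phi>. is_aligning_phase x (z k) \<phi> \<longrightarrow>
               (MAX j\<in>{..<m}. cmod ((z k - cis \<phi> \<cdot>\<^sub>v x) \<bullet>c a j)) \<le> sqrt 48 * sqrt (ln (real m)) * l2norm x)))"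
proof (cases "m \<ge> 3 \<and> n \<ge> 3 \<and> ln (real m) \<le> 1.5 * real n")
  case False
  \<comment> \<open>Here the lower bound on the probability is not positive; the constants \<open>256 = 2 ^ 8\<close> and \<open>exp 3\<close> are
    chosen for \<open>m \<le> 2\<close> and for \<open>n \<le> 2\<close>, respectively.\<close>
  have p8: "real m powr (-8) = 1 / real m ^ 8" using m1 by (simp add: powr_neg_numeral)
  have nn: "0 \<le> 256 * real m powr (-8)" "0 \<le> exp 3 * real m * exp (- 1.5 * real n)" by simp_all
  consider "m \<le> 2" | "n \<le> 2" | "ln (real m) \<ge> 1.5 * real n" using False by linarith
  then have "1 \<le> 256 * real m powr (-8) + exp 3 * real m * exp (- 1.5 * real n)"
  proof cases
    case 1
    then have "real m ^ 8 \<le> 2 ^ 8" by (intro power_mono) simp_all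
    then have "1 \<le> 256 * real m powr (-8)" unfolding p8 using m1 by (simp add: field_simps)
    then show ?thesis using nn(2) by linarith
  next
    case 2
    have "exp 3 * 1 * exp (- 3) \<le> exp 3 * real m * exp (- 1.5 * real n)"
      using m1 2 by (intro mult_mono) simp_all
    then have "1 \<le> exp 3 * real m * exp (- 1.5 * real n)" by (simp add: exp_minus)
    then show ?thesis using nn(1) by linarith
  next
    case 3
    have "exp (1.5 * real n) \<le> real m"
      using 3 m1 by (subst (asm) ln_ge_iff) simp_all
    then have "1 * exp (1.5 * real n) * exp (- 1.5 * real n) \<le> exp 3 * real m * exp (- 1.5 * real n)"
      by (intro mult_right_mono mult_mono) simp_all
    then have "1 \<le> exp 3 * real m * exp (- 1.5 * real n)" by (simp add: exp_add[symmetric])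
    then show ?thesis using nn(1) by linarith
  qed
  then show ?thesis by (intro bexI[of _ "{}"]) simp_all
next
  case True
  then interpret large_sample n m \<epsilon>
    using eps sample_size_condition[OF _ eps size] by unfold_locales simp_all
  define u where "u = (1 / l2norm x) *\<^sub>R to_fv x"
  have u: "u \<in> fspace n" "norm u = 1" using phase_dist_attained(2)[OF x x(1)] x by (auto simp: u_def)
  obtain E where E: "E \<in> sets (gaussian_sample n m)"
    "measure (gaussian_sample n m) E \<ge> 1 - 5 * (1 / real m ^ 8) - real m * exp (- 1.5 * real n)"
    "\<And>\<omega>. \<omega> \<in> E \<Longrightarrow> regular_sample n m (\<lambda>j. mk_fv n (\<omega> j)) u R B \<rho> \<tau>"
    "\<And>\<omega> l. \<omega> \<in> E \<Longrightarrow> l < m \<Longrightarrow> \<exists>t. loo_path n m (\<lambda>j. mk_fv n (\<omega> j)) u l n (1 / real m) t \<and>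
       incoherent_along u (mk_fv n (\<omega> l)) B n t"
    using good_event[OF u] by blast
  have prob: "measure (gaussian_sample n m) E \<ge> 1 - 256 * real m powr (-8) - exp 3 * real m * exp (- 1.5 * real n)"
  proof -
    have "5 * (1 / real m ^ 8) \<le> 256 * real m powr (-8)" using m1 by (simp add: powr_neg_numeral divide_right_mono)
    moreover have "1 * (real m * exp (- 1.5 * real n)) \<le> exp 3 * (real m * exp (- 1.5 * real n))"
      by (intro mult_right_mono) simp_all
    ultimately show ?thesis using E(2) by (simp add: mult.assoc)
  qed
  have bounds: "phase_dist (z 0) x \<le> 1/1000 * l2norm x \<and>
       (\<forall>k. phase_dist (z (Suc k)) x \<le> 2 / l2norm x * (phase_dist (z k) x)\<^sup>2 + \<epsilon> * phase_dist (z k) x \<and>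
          (\<forall>\<phi>. is_aligning_phase x (z k) \<phi> \<longrightarrow>
             (MAX j\<in>{..<m}. cmod ((z k - cis \<phi> \<cdot>\<^sub>v x) \<bullet>c sample_vec n \<omega> j)) \<le> sqrt 48 * sqrt (ln (real m)) * l2norm x))"
    if \<omega>: "\<omega> \<in> E" and run: "gauss_newton_run n m (sample_vec n \<omega>) (\<lambda>j. (cmod (x \<bullet>c sample_vec n \<omega> j))\<^sup>2) z" for \<omega> z
  proof -
    note loo = E(4)[OF \<omega>, unfolded u_def] and rb = run_bounds[OF x E(3)[OF \<omega>, unfolded u_def] _ run]
    have "(MAX j\<in>{..<m}. cmod ((z k - cis \<phi> \<cdot>\<^sub>v x) \<bullet>c sample_vec n \<omega> j)) \<le> sqrt 48 * sqrt (ln (real m)) * l2norm x"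
      if \<phi>: "is_aligning_phase x (z k) \<phi>" for k \<phi>
    proof (rule Max.boundedI)
      show "finite ((\<lambda>j. cmod ((z k - cis \<phi> \<cdot>\<^sub>v x) \<bullet>c sample_vec n \<omega> j)) ` {..<m})" by simp
      show "(\<lambda>j. cmod ((z k - cis \<phi> \<cdot>\<^sub>v x) \<bullet>c sample_vec n \<omega> j)) ` {..<m} \<noteq> {}" using m1 by (auto simp: lessThan_empty_iff)
      fix y assume "y \<in> (\<lambda>j. cmod ((z k - cis \<phi> \<cdot>\<^sub>v x) \<bullet>c sample_vec n \<omega> j)) ` {..<m}"
      then obtain j where j: "j < m" "y = cmod ((z k - cis \<phi> \<cdot>\<^sub>v x) \<bullet>c sample_vec n \<omega> j)" by blast
      show "y \<le> sqrt 48 * sqrt (ln (real m)) * l2norm x"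
        unfolding j(2) B_def[unfolded real_sqrt_mult, symmetric]
        by (rule rb(3)[OF _ \<phi> j(1)]) (fact loo)
    qed
    moreover have "phase_dist (z 0) x \<le> 1/1000 * l2norm x"
      "phase_dist (z (Suc k)) x \<le> 2 / l2norm x * (phase_dist (z k) x)\<^sup>2 + \<epsilon> * phase_dist (z k) x" for k
      by (rule rb(1), fact loo) (rule rb(2), fact loo)
    ultimately show ?thesis by blast
  qed
  show ?thesis
    unfolding Let_def by (intro bexI[of _ E] conjI prob ballI allI impI E(1) bounds)
qed

theorem theorem3p1:
  "\<exists>(\<delta>::real) (C\<^sub>0::real) (C\<^sub>1::real) (K\<^sub>1::real) (K\<^sub>2::real) (\<eta>::real).
     0 < \<delta> \<and> \<delta> \<le> 0.01 \<and> 0 < C\<^sub>0 \<and> 0 < C\<^sub>1 \<and> 0 < K\<^sub>1 \<and> 0 < K\<^sub>2 \<and> 0 < \<eta> \<and>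
     (\<forall>\<epsilon>\<^sub>0::real. 0 < \<epsilon>\<^sub>0 \<and> \<epsilon>\<^sub>0 \<le> \<eta> \<longrightarrow>
       (\<forall>(n::nat) (m::nat) (x::complex vec).
          x \<in> carrier_vec n \<and> x \<noteq> 0\<^sub>v n \<and> m \<ge> 1 \<and>
          real m \<ge> C\<^sub>0 * \<epsilon>\<^sub>0 powr (-4) * real n * (ln (real n)) ^ 3 \<longrightarrow>
          (\<exists>E \<in> sets (gaussian_sample n m).
             measure (gaussian_sample n m) E
               \<ge> 1 - K\<^sub>1 * real m powr (-8) - K\<^sub>2 * real m * exp (- 1.5 * real n) \<and>
             (\<forall>\<omega>\<in>E. \<forall>z. let a = sample_vec n \<omega>; y = (\<lambda>j. (cmod (x \<bullet>c a j))\<^sup>2) in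
                gauss_newton_run n m a y z \<longrightarrow>
                phase_dist (z 0) x \<le> \<delta> * l2norm x \<and>
                (\<forall>k.
                   phase_dist (z (Suc k)) x
                     \<le> 2 / l2norm x * (phase_dist (z k) x)\<^sup>2 + \<epsilon>\<^sub>0 * phase_dist (z k) x \<and>
                   (\<forall>\<phi>. is_aligning_phase x (z k) \<phi> \<longrightarrow>
                      (MAX j\<in>{..<m}. cmod ((z k - cis \<phi> \<cdot>\<^sub>v x) \<bullet>c a j))
                        \<le> C\<^sub>1 * sqrt (ln (real m)) * l2norm x))))))"
  by (rule exI[of _ "1/1000"], rule exI[of _ "exp 600"], rule exI[of _ "sqrt 48"], rule exI[of _ "256"],
      rule exI[of _ "exp 3"], rule exI[of _ "1"], intro conjI allI impI;
      (elim conjE, rule convergence_event; assumption | simp))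

end
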